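(* Let $d\in\mathbb N$ and $k\in\{0,\ldots,d-1\}$ be such that either (i) both $d$ and $d-k$ are even, or (ii) $d$ is odd. Then $$ C_{d,k}=\frac{d^2+1}{d!}(d+1)^{\frac{d^2-d}{d+1}}\binom d{k+1}\Gamma\Big(\frac{d^2+1}{d+1}\Big)\Big(\frac{\sqrt\pi\,\Gamma(\frac{d+1}{2})}{\Gamma(\frac{d+2}{2})}\Big)^{k+\frac2{d+1}}\operatorname{Res}_{x=0}\left[\frac{\big(\int_0^x(\sin y)^{d}dy\big)^{d-k-1}}{(\sin x)^{d^2+2}}\right]. $$
   Context: Let $U_1,U_2,\ldots$ be i.i.d. uniform points in the unit ball $\mathbb B^d\subset\mathbb R^d$ and $K_{n,d}=\mathrm{conv}(U_1,\ldots,U_n)$. $f_k(P)$ denotes the number of $k$-dimensional faces of a polytope $P$. The constant $C_{d,k}$ is defined as the limit $C_{d,k}=\lim_{n\to\infty}\mathbb E f_k(K_{n,d})/n^{\frac{d-1}{d+1}}$ (which exists, by a result of Reitzner; it is the constant in the asymptotics of $\mathbb Ef_k$ of random polytopes in smooth convex bodies, normalised by the ball). $\operatorname{Res}_{x=0}$ is the coefficient of $x^{-1}$ in the Laurent expansion at $0$. *)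

theory Defs
  imports "HOL-Analysis.Analysis" "HOL-Complex_Analysis.Complex_Analysis"
begin

definition num_faces :: "nat \<Rightarrow> ('a::euclidean_space) set \<Rightarrow> nat" where
  "num_faces k P = card {F. F face_of P \<and> aff_dim F = int k}"

definition unif_ball :: "('a::euclidean_space) measure" where
  "unif_ball = uniform_measure lborel (ball 0 1)"

definition expected_faces :: "('a::euclidean_space) itself \<Rightarrow> nat \<Rightarrow> nat \<Rightarrow> real" where
  "expected_faces _ k n =
     integral\<^sup>L (PiM {..<n} (\<lambda>_. (unif_ball :: ('a::euclidean_space) measure)))
       (\<lambda>U. real (num_faces k (convex hull (U ` {..<n}))))"

definition res_fun :: "nat \<Rightarrow> nat \<Rightarrow> complex \<Rightarrow> complex" where
  "res_fun d k x = (contour_integral (linepath 0 x) (\<lambda>y. sin y ^ d)) ^ (d - k - 1)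
                    / (sin x) ^ (d\<^sup>2 + 2)"

end

theory Submission
  imports Defs "HOL-Probability.Infinite_Product_Measure"
begin

text \<open>
  Lift a point \<open>x\<close> to \<open>(x, 1)\<close>. A set \<open>F\<close> of \<open>k + 1\<close> sample points spans a face iff some affine
  functional vanishes on \<open>F\<close> and is positive at all other points. Shrinking the set of coordinates on which
  the functionals may depend from size \<open>m\<close> to size \<open>m - 2\<close>, the change of this indicator is a sum over the
  \<open>m\<close>-sets \<open>G \<supseteq> F\<close> whose hyperplane has all other points on one side; the identity is proved by
  flipping the signs of the lifted points one at a time.

  A Blaschke-Petkantschin type disintegration shows that the distance of that hyperplane from the centre is
  independent of events about \<open>G\<close> invariant under homotheties. With \<open>g x = (\<integral> y=0..x. sin y ^ d)\<close> the
  probability that \<open>F\<close> spans a face is therefore a combination of the integrals of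
  \<open>sin x ^ (d * m) * (g x / g pi) ^ (n - m)\<close> over \<open>[0, pi]\<close>, whose unknown coefficients do not depend on \<open>n\<close>.
  For \<open>n \<le> d\<close> the probability is \<open>1\<close>, and this triangular system determines the coefficients.
  A residue identity, proved by differentiating under a contour integral, exhibits the solution; the parity
  condition removes the residues of the wrong parity.

  As \<open>n\<close> grows only the term \<open>m = d\<close> survives, and Laplace's method evaluates it.
\<close>

section \<open>Counting facets in general position\<close>

text \<open>Coordinates are dropped in pairs because the argument is planar. Let \<open>U'\<close>
  have codimension 2 in \<open>U\<close>, and let C be the cone of functionals in \<open>U\<close>
  that vanish on F and are positive elsewhere. If C is nonempty and misses \<open>U'\<close>, its
  image in the quotient plane is a wedge with two boundary rays, and in general position each comes
  from one extreme ray of C, that is, from one hyperplane. If C meets \<open>U'\<close>, the image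
  is the whole plane and has no boundary. The extreme ray with zero set G lies over the boundary iff
  no functional in \<open>U'\<close> vanishes on F and is positive on the rest of G. This condition
  concerns the points of G alone, ignores the removed coordinates and is homothety invariant; hence
  it is independent of the height, and its probability does not involve n. These probabilities are
  never computed directly: small samples, in which every subset spans a face, supply enough
  equations. The chain visits only indices with the parity of d, whereas the residue identity sums
  over all indices; this mismatch is where the hypothesis on d and k enters.\<close>

definition pos_sol :: "'v::euclidean_space set \<Rightarrow> ('i \<Rightarrow> 'v) \<Rightarrow> 'i set \<Rightarrow> 'i set \<Rightarrow> bool" where
  "pos_sol U z F S \<longleftrightarrow> (\<exists>u\<in>U. (\<forall>i\<in>F. u \<bullet> z i = 0) \<and> (\<forall>i\<in>S. u \<bullet> z i > 0))"

definition kern :: "'v::euclidean_space set \<Rightarrow> ('i \<Rightarrow> 'v) \<Rightarrow> 'i set \<Rightarrow> 'v set" where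
  "kern U z B = {u\<in>U. \<forall>i\<in>B. u \<bullet> z i = 0}"

text \<open>The case \<open>B = {}\<close> forces \<open>r\<close> to be \<open>dim U\<close>, so
  \<open>r\<close> is not a free parameter.\<close>

definition generic :: "'v::euclidean_space set \<Rightarrow> ('i \<Rightarrow> 'v) \<Rightarrow> 'i set \<Rightarrow> nat \<Rightarrow> bool" where
  "generic U z S r \<longleftrightarrow> (\<forall>B\<subseteq>S. card B \<le> r \<longrightarrow> dim (kern U z B) = r - card B)"

lemma subspace_kern: "subspace U \<Longrightarrow> subspace (kern U z B)"
  unfolding kern_def by (auto simp: subspace_def inner_add_left)

lemma kern_kern: "kern (kern U z A) z B = kern U z (A \<union> B)"
  unfolding kern_def by auto

lemma kern_empty [simp]: "kern U z {} = U"
  unfolding kern_def by auto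

lemma kern_mono: "U' \<subseteq> U \<Longrightarrow> kern U' z B \<subseteq> kern U z B"
  unfolding kern_def by auto

lemma pos_sol_kern: "pos_sol (kern U z A) z F S = pos_sol U z (A \<union> F) S"
  unfolding kern_def pos_sol_def by auto

lemma pos_sol_kern': "pos_sol (kern U z F) z {} S = pos_sol U z F S"
  unfolding pos_sol_kern by simp

lemma pos_sol_cong:
  assumes "\<And>i. i \<in> F \<Longrightarrow> z i = z' i \<or> z i = - z' i" "\<And>i. i \<in> S \<Longrightarrow> z i = z' i"
  shows "pos_sol U z F S = pos_sol U z' F S"
proof -
  have "(\<forall>i\<in>F. u \<bullet> z i = 0) = (\<forall>i\<in>F. u \<bullet> z' i = 0)" for u
    using assms(1) by (metis inner_minus_right neg_equal_0_iff_equal)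
  thus ?thesis unfolding pos_sol_def using assms(2) by simp
qed

lemma kern_cong:
  assumes "\<And>i. i \<in> B \<Longrightarrow> z i = z' i \<or> z i = - z' i"
  shows "kern U z B = kern U z' B"
proof -
  have "(\<forall>i\<in>B. u \<bullet> z i = 0) = (\<forall>i\<in>B. u \<bullet> z' i = 0)" for u
    using assms(1) by (metis inner_minus_right neg_equal_0_iff_equal)
  thus ?thesis unfolding kern_def by simp
qed

lemma generic_subset: "generic U z S r \<Longrightarrow> T \<subseteq> S \<Longrightarrow> generic U z T r"
  unfolding generic_def by blast

lemma generic_cong:
  assumes "\<And>i. i \<in> S \<Longrightarrow> z i = z' i \<or> z i = - z' i"
  shows "generic U z S r = generic U z' S r"
proof -
  have "kern U z B = kern U z' B" if "B \<subseteq> S" for B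
    using that assms by (intro kern_cong) auto
  thus ?thesis unfolding generic_def by simp
qed

lemma generic_kern:
  assumes "generic U z (S \<union> F) r" "finite F" "finite S" "S \<inter> F = {}" "card F \<le> r"
  shows "generic (kern U z F) z S (r - card F)"
  unfolding generic_def
proof (intro allI impI)
  fix B assume B: "B \<subseteq> S" "card B \<le> r - card F"
  have c: "card (F \<union> B) = card F + card B"
    using B assms by (intro card_Un_disjoint) (auto dest: finite_subset)
  have "card (F \<union> B) \<le> r" using B assms(5) c by simp
  moreover have "F \<union> B \<subseteq> S \<union> F" using B by auto
  ultimately have "dim (kern U z (F \<union> B)) = r - card (F \<union> B)"
    using assms(1) unfolding generic_def by blast
  thus "dim (kern (kern U z F) z B) = r - card F - card B"
    using c by (simp add: kern_kern)
qed

lemma generic_ex_nonzero: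
  assumes "generic U z S r" "B \<subseteq> S" "finite S" "p \<in> S" "p \<notin> B" "card B < r"
  shows "\<exists>u\<in>kern U z B. u \<bullet> z p \<noteq> 0"
proof (rule ccontr)
  assume "\<not> ?thesis"
  hence "kern U z (insert p B) = kern U z B" unfolding kern_def by auto
  moreover have "finite B" using assms finite_subset by auto
  moreover have "dim (kern U z B) = r - card B" "dim (kern U z (insert p B)) = r - card (insert p B)"
    using assms \<open>finite B\<close> unfolding generic_def by auto
  ultimately show False using assms(5,6) by simp
qed

lemma pos_perturb:
  fixes z :: "'i \<Rightarrow> 'v::euclidean_space"
  assumes "finite S" "\<And>i. i \<in> S \<Longrightarrow> u \<bullet> z i > 0"
  shows "\<exists>e>0. \<forall>i\<in>S. (u + e *\<^sub>R v) \<bullet> z i > 0"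
proof -
  have "eventually (\<lambda>e. \<forall>i\<in>S. (u + e *\<^sub>R v) \<bullet> z i > 0) (at_right 0)"
  proof (rule eventually_ball_finite[OF assms(1)], rule ballI)
    fix i assume "i \<in> S"
    have "((\<lambda>e. (u + e *\<^sub>R v) \<bullet> z i) \<longlongrightarrow> (u + 0 *\<^sub>R v) \<bullet> z i) (at_right 0)"
      by (intro tendsto_intros)
    thus "eventually (\<lambda>e. (u + e *\<^sub>R v) \<bullet> z i > 0) (at_right 0)"
      using assms(2)[OF \<open>i \<in> S\<close>] by (intro order_tendstoD(1)) auto
  qed
  moreover have "eventually (\<lambda>e::real. e > 0) (at_right 0)"
    by (simp add: eventually_at_right_less)
  ultimately have "eventually (\<lambda>e. e > 0 \<and> (\<forall>i\<in>S. (u + e *\<^sub>R v) \<bullet> z i > 0)) (at_right 0)"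
    by eventually_elim auto
  thus ?thesis using eventually_happens by fastforce
qed

text \<open>A solution that vanishes at \<open>p\<close> can be tilted towards \<open>u0\<close> or
  its negative; finitely many strict inequalities survive a small tilt.\<close>

lemma pos_sol_insert_perturb:
  fixes z :: "'i \<Rightarrow> 'v::euclidean_space"
  assumes "subspace U" "finite S" "pos_sol (kern U z {p}) z {} S" "u0 \<in> U" "u0 \<bullet> z p \<noteq> 0"
  shows "pos_sol U z {} (insert p S)"
proof -
  obtain u where u: "u \<in> U" "u \<bullet> z p = 0" "\<And>i. i \<in> S \<Longrightarrow> u \<bullet> z i > 0"
    using assms(3) unfolding pos_sol_def kern_def by auto
  define v where "v = sgn (u0 \<bullet> z p) *\<^sub>R u0"
  have v: "v \<in> U" "v \<bullet> z p > 0"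
    using assms unfolding v_def by (auto simp: subspace_scale sgn_if mult_less_0_iff)
  obtain e where e: "e > 0" "\<forall>i\<in>S. (u + e *\<^sub>R v) \<bullet> z i > 0"
    using pos_perturb[of S u z v, OF assms(2)] u(3) by blast
  have "u + e *\<^sub>R v \<in> U" using u v assms(1) by (simp add: subspace_add subspace_scale)
  moreover have "(u + e *\<^sub>R v) \<bullet> z p > 0" using u v e by (simp add: inner_add_left)
  ultimately show ?thesis using e unfolding pos_sol_def by auto
qed

text \<open>Deletion and restriction for hyperplane arrangements. The hyperplane of functionals
  vanishing at \<open>z p\<close> either cuts the cone belonging to \<open>S\<close>, and then both
  signs at \<open>p\<close> are realised, or leaves the cone on one side, and then exactly one sign
  is.\<close>

lemma pos_sol_flip_sum:
  fixes z :: "'i \<Rightarrow> 'v::euclidean_space"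
  assumes "subspace U" "finite S" "p \<notin> S" "u0 \<in> U" "u0 \<bullet> z p \<noteq> 0"
  shows "of_bool (pos_sol U z {} (insert p S)) + of_bool (pos_sol U (z(p := - z p)) {} (insert p S))
       = (of_bool (pos_sol U z {} S) + of_bool (pos_sol (kern U z {p}) z {} S) :: int)"
proof -
  let ?z = "z(p := - z p)"
  have S': "pos_sol U ?z {} S = pos_sol U z {} S"
    using assms(3) by (intro pos_sol_cong) auto
  have K': "pos_sol (kern U ?z {p}) ?z {} S = pos_sol (kern U z {p}) z {} S"
  proof -
    have "kern U ?z {p} = kern U z {p}" by (intro kern_cong) auto
    thus ?thesis using assms(3) by (metis (no_types, lifting) empty_iff fun_upd_other pos_sol_cong)
  qed
  have sub: "pos_sol U z {} S" if "pos_sol U z {} (insert p S) \<or> pos_sol U ?z {} (insert p S) \<or> pos_sol (kern U z {p}) z {} S"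
    using that S' unfolding pos_sol_def kern_def by auto
  show ?thesis
  proof (cases "pos_sol U z {} S")
    case False
    with sub show ?thesis by auto
  next
    case True
    show ?thesis
    proof (cases "pos_sol (kern U z {p}) z {} S")
      case T2: True
      have "pos_sol U z {} (insert p S)"
        using pos_sol_insert_perturb[OF assms(1,2) T2 assms(4,5)] .
      moreover have "pos_sol U ?z {} (insert p S)"
        using pos_sol_insert_perturb[OF assms(1,2) _ assms(4), of ?z p] T2 K' assms(5) by simp
      ultimately show ?thesis using True T2 by simp
    next
      case F2: False
      obtain u where u: "u \<in> U" "\<And>i. i \<in> S \<Longrightarrow> u \<bullet> z i > 0" using True unfolding pos_sol_def by auto
      have "u \<bullet> z p \<noteq> 0" using F2 u unfolding pos_sol_def kern_def by auto
      hence "pos_sol U z {} (insert p S) \<or> pos_sol U ?z {} (insert p S)"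
      proof (cases "u \<bullet> z p > 0")
        case True thus ?thesis using u unfolding pos_sol_def by auto
      next
        case False
        hence "u \<bullet> ?z p > 0" using \<open>u \<bullet> z p \<noteq> 0\<close> by simp
        moreover have "u \<bullet> ?z i > 0" if "i \<in> S" for i using u(2)[OF that] that assms(3) by (cases "i = p") auto
        ultimately have "pos_sol U ?z {} (insert p S)" using u(1) unfolding pos_sol_def by blast
        thus ?thesis ..
      qed
      moreover have "\<not> (pos_sol U z {} (insert p S) \<and> pos_sol U ?z {} (insert p S))"
      proof
        assume a: "pos_sol U z {} (insert p S) \<and> pos_sol U ?z {} (insert p S)"
        obtain u where u: "u \<in> U" "\<And>i. i \<in> S \<Longrightarrow> u \<bullet> z i > 0" "u \<bullet> z p > 0"
          using a unfolding pos_sol_def by auto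
        obtain v where v: "v \<in> U" "\<And>i. i \<in> S \<Longrightarrow> v \<bullet> ?z i > 0" "v \<bullet> z p < 0"
          using a unfolding pos_sol_def by auto
        have v2: "v \<bullet> z i > 0" if "i \<in> S" for i using v(2)[OF that] that assms(3) by (cases "i = p") auto
        \<comment> \<open>Up to scaling, \<open>w\<close> is the point where the segment from
          \<open>u\<close> to \<open>v\<close> crosses the hyperplane of functionals vanishing at
          \<open>z p\<close>.\<close>
        define w where "w = (- (v \<bullet> z p)) *\<^sub>R u + (u \<bullet> z p) *\<^sub>R v"
        have "w \<in> U" unfolding w_def using u v assms(1) by (intro subspace_add subspace_scale) auto
        moreover have "w \<bullet> z p = 0" unfolding w_def by (simp add: inner_add_left inner_diff_left)
        moreover have "w \<bullet> z i > 0" if "i \<in> S" for i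
        proof -
          have "w \<bullet> z i = (- (v \<bullet> z p)) * (u \<bullet> z i) + (u \<bullet> z p) * (v \<bullet> z i)"
            unfolding w_def by (simp add: inner_add_left inner_diff_left)
          also have "\<dots> > 0" using u v v2 that by (intro add_pos_pos mult_pos_pos) auto
          finally show ?thesis .
        qed
        ultimately show False using F2 unfolding pos_sol_def kern_def by auto
      qed
      ultimately show ?thesis using True F2 by auto
    qed
  qed
qed

text \<open>Solve first among the functionals that vanish at one point, where one dimension and one
  condition fewer remain, then tilt the solution to be positive at that point too.\<close>

lemma generic_pos_sol:
  fixes z :: "'i \<Rightarrow> 'v::euclidean_space"
  assumes "subspace U" "finite S" "generic U z S r" "card S \<le> r"
  shows "pos_sol U z {} S"
  using assms(2,1,3,4)
proof (induction S arbitrary: U r rule: finite_induct)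
  case empty
  thus ?case unfolding pos_sol_def by (metis empty_iff subspace_0)
next
  case (insert p S)
  have "\<exists>u\<in>kern U z {}. u \<bullet> z p \<noteq> 0"
    using insert by (intro generic_ex_nonzero[of U z "insert p S" r]) auto
  then obtain u0 where u0: "u0 \<in> U" "u0 \<bullet> z p \<noteq> 0" by auto
  have "pos_sol (kern U z {p}) z {} S"
  proof (rule insert.IH)
    show "subspace (kern U z {p})" using insert by (simp add: subspace_kern)
    show "generic (kern U z {p}) z S (r - 1)"
      using generic_kern[of U z S "{p}" r] insert by simp
    show "card S \<le> r - 1" using insert by simp
  qed
  thus ?case by (rule pos_sol_insert_perturb[where U = U and z = z and S = S and p = p, OF insert.prems(1) insert.hyps(1) _ u0])
qed

text \<open>Finitely many proper subspaces do not cover \<open>U\<close>; a functional is repaired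
  point by point with small perturbations.\<close>

lemma ex_all_nonzero:
  fixes z :: "'i \<Rightarrow> 'v::euclidean_space"
  assumes "subspace U" "finite S" "\<And>i. i \<in> S \<Longrightarrow> \<exists>u\<in>U. u \<bullet> z i \<noteq> 0"
  shows "\<exists>u\<in>U. \<forall>i\<in>S. u \<bullet> z i \<noteq> 0"
  using assms(2,3)
proof (induction S rule: finite_induct)
  case empty
  have "0 \<in> U" using assms(1) by (rule subspace_0)
  thus ?case by blast
next
  case (insert p S)
  obtain u where u: "u \<in> U" "\<forall>i\<in>S. u \<bullet> z i \<noteq> 0" using insert by auto
  obtain v where v: "v \<in> U" "v \<bullet> z p \<noteq> 0" using insert by auto
  show ?case
  proof (cases "u \<bullet> z p = 0")
    case False thus ?thesis using u by auto
  next
    case True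
    \<comment> \<open>Multiplying each point by the sign of its value turns being nonzero into being
      positive, so that \<open>pos_perturb\<close> applies.\<close>
    define y where "y = (\<lambda>i. sgn (u \<bullet> z i) *\<^sub>R z i)"
    have "\<And>i. i \<in> S \<Longrightarrow> u \<bullet> y i > 0" using u unfolding y_def by (auto simp: sgn_if mult_less_0_iff)
    then obtain e where e: "e > 0" "\<forall>i\<in>S. (u + e *\<^sub>R v) \<bullet> y i > 0"
      using pos_perturb[of S u y v, OF insert(1)] by blast
    have "(u + e *\<^sub>R v) \<bullet> z i \<noteq> 0" if "i \<in> insert p S" for i
    proof (cases "i = p")
      case True thus ?thesis using v e \<open>u \<bullet> z p = 0\<close> by (simp add: inner_add_left)
    next
      case False thus ?thesis using e that unfolding y_def by auto
    qed
    moreover have "u + e *\<^sub>R v \<in> U" using u v assms(1) by (simp add: subspace_add subspace_scale)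
    ultimately show ?thesis by blast
  qed
qed

text \<open>For \<open>m = dim U - 1\<close> generic points \<open>B\<close> the functionals in
  \<open>U\<close> vanishing on \<open>B\<close> form a line. The second factor counts the
  orientations of that line that are positive on \<open>S - B\<close>: at most one if
  \<open>B \<noteq> S\<close>, and both if \<open>B = S\<close>.\<close>

definition facet_count :: "'v::euclidean_space set \<Rightarrow> 'v set \<Rightarrow> ('i \<Rightarrow> 'v) \<Rightarrow> 'i set \<Rightarrow> nat \<Rightarrow> int" where
  "facet_count U U' z S m = (\<Sum>B | B \<subseteq> S \<and> card B = m.
     of_bool (\<not> pos_sol U' z {} B) * (of_bool (pos_sol U z B (S - B)) + of_bool (B = S)))"

text \<open>The factor 2 is the number of boundary rays of a planar wedge.\<close>

definition defect :: "'v::euclidean_space set \<Rightarrow> 'v set \<Rightarrow> ('i \<Rightarrow> 'v) \<Rightarrow> 'i set \<Rightarrow> nat \<Rightarrow> int" where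
  "defect U U' z S m = 2 * of_bool (pos_sol U z {} S) - 2 * of_bool (pos_sol U' z {} S) - facet_count U U' z S m"

lemma subsets_insert_card:
  assumes "finite S" "p \<notin> S"
  shows "{B. B \<subseteq> insert p S \<and> card B = Suc m} = {B. B \<subseteq> S \<and> card B = Suc m} \<union> insert p ` {B. B \<subseteq> S \<and> card B = m}"
proof (intro equalityI subsetI)
  fix B assume B: "B \<in> {B. B \<subseteq> insert p S \<and> card B = Suc m}"
  show "B \<in> {B. B \<subseteq> S \<and> card B = Suc m} \<union> insert p ` {B. B \<subseteq> S \<and> card B = m}"
  proof (cases "p \<in> B")
    case True
    have "finite B" using B assms finite_subset by fastforce
    hence "card (B - {p}) = m" using True B by simp
    moreover have "insert p (B - {p}) = B" using True by auto
    moreover have "B - {p} \<subseteq> S" using B by auto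
    ultimately have "B \<in> insert p ` {B. B \<subseteq> S \<and> card B = m}"
      by (metis (mono_tags, lifting) image_eqI mem_Collect_eq)
    thus ?thesis ..
  next
    case False thus ?thesis using B by auto
  qed
next
  fix B assume B: "B \<in> {B. B \<subseteq> S \<and> card B = Suc m} \<union> insert p ` {B. B \<subseteq> S \<and> card B = m}"
  moreover have "card (insert p C) = Suc (card C)" if "C \<subseteq> S" for C
    using that assms by (meson card_insert_disjoint finite_subset subsetD)
  ultimately show "B \<in> {B. B \<subseteq> insert p S \<and> card B = Suc m}" by auto
qed

lemma sum_subsets_insert:
  fixes f :: "'i set \<Rightarrow> int"
  assumes "finite S" "p \<notin> S"
  shows "(\<Sum>B | B \<subseteq> insert p S \<and> card B = Suc m. f B)
       = (\<Sum>B | B \<subseteq> S \<and> card B = Suc m. f B) + (\<Sum>B | B \<subseteq> S \<and> card B = m. f (insert p B))"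
proof -
  have fin: "finite {B. B \<subseteq> S \<and> card B = j}" for j using assms by simp
  have inj: "inj_on (insert p) {B. B \<subseteq> S \<and> card B = m}"
    using assms(2) by (intro inj_onI) (metis (no_types, lifting) Diff_insert_absorb mem_Collect_eq subset_eq)
  show ?thesis
    unfolding subsets_insert_card[OF assms]
    using fin assms by (subst sum.union_disjoint) (auto simp: sum.reindex[OF inj])
qed

text \<open>The subsets of \<open>insert p S\<close> split by membership of \<open>p\<close>. For
  \<open>B\<close> without \<open>p\<close> the flip acts on the sign condition at \<open>p\<close>;
  for \<open>B\<close> containing \<open>p\<close> it acts only on the test in
  \<open>U'\<close>.\<close>

lemma facet_count_flip:
  fixes z :: "'i \<Rightarrow> 'v::euclidean_space"
  assumes U: "subspace U" and fin: "finite S" and p: "p \<notin> S"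
    and gen: "generic U z (insert p S) (Suc (Suc m))"
  shows "facet_count U U' z (insert p S) (Suc m) + facet_count U U' (z(p := - z p)) (insert p S) (Suc m)
       = facet_count U U' z S (Suc m)
       + (\<Sum>B | B \<subseteq> S \<and> card B = m.
            (of_bool (\<not> pos_sol U' z {} (insert p B)) + of_bool (\<not> pos_sol U' (z(p := - z p)) {} (insert p B)))
            * (of_bool (pos_sol (kern U z {p}) z B (S - B)) + of_bool (B = S)))"
proof -
  let ?z = "z(p := - z p)"
  define T where "T = (\<lambda>z B. of_bool (\<not> pos_sol U' z {} B) *
     (of_bool (pos_sol U z B (insert p S - B)) + of_bool (B = insert p S)) :: int)"
  have 1: "T z B + T ?z B = of_bool (\<not> pos_sol U' z {} B) * (of_bool (pos_sol U z B (S - B)) + of_bool (B = S))"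
    if B: "B \<subseteq> S" "card B = Suc m" for B
  proof -
    have finB: "finite B" using B fin finite_subset by auto
    have pB: "p \<notin> B" using B p by auto
    have e1: "pos_sol U' ?z {} B = pos_sol U' z {} B"
      using pB by (intro pos_sol_cong) auto
    have e2: "insert p S - B = insert p (S - B)" using pB by auto
    have e3: "B \<noteq> insert p S" using pB by auto
    let ?W = "kern U z B"
    have W: "kern U ?z B = ?W" using pB by (intro kern_cong) auto
    have sW: "subspace ?W" using U by (rule subspace_kern)
    obtain w where w: "w \<in> ?W" "w \<bullet> z p \<noteq> 0"
      using generic_ex_nonzero[OF gen, of B p] B pB fin by auto
    have "pos_sol U z B (insert p (S - B)) = pos_sol ?W z {} (insert p (S - B))"
         "pos_sol U ?z B (insert p (S - B)) = pos_sol ?W ?z {} (insert p (S - B))"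
         "pos_sol U z B (S - B) = pos_sol ?W z {} (S - B)"
      using W pos_sol_kern'[of U z B] pos_sol_kern'[of U ?z B] by metis+
    moreover have "of_bool (pos_sol ?W z {} (insert p (S - B))) + of_bool (pos_sol ?W ?z {} (insert p (S - B)))
       = (of_bool (pos_sol ?W z {} (S - B)) + of_bool (pos_sol (kern ?W z {p}) z {} (S - B)) :: int)"
      using fin p pB by (intro pos_sol_flip_sum[of "kern U z B" "S - B" p w z, OF sW _ _ w]) auto
    \<comment> \<open>\<open>B\<close> together with \<open>p\<close> uses up all
      \<open>m + 2\<close> dimensions, so only the zero functional survives, and it is positive on
      \<open>S - B\<close> only if that set is empty. This is the source of the summand
      \<open>B = S\<close>.\<close>
    moreover have "pos_sol (kern ?W z {p}) z {} (S - B) = (B = S)"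
    proof -
      have "dim (kern U z (insert p B)) = Suc (Suc m) - card (insert p B)"
        using gen[unfolded generic_def, rule_format, of "insert p B"] B finB pB by auto
      hence "dim (kern ?W z {p}) = 0" using B pB finB by (simp add: kern_kern)
      hence k: "kern ?W z {p} = {0}"
        using subspace_0[OF subspace_kern[OF sW]] dim_eq_0 by blast
      show ?thesis unfolding k pos_sol_def using B by auto
    qed
    ultimately show ?thesis unfolding T_def e1 e2 using e3
      by (simp add: distrib_left flip: distrib_left)
  qed
  have 2: "T z (insert p B) + T ?z (insert p B) = (of_bool (\<not> pos_sol U' z {} (insert p B)) + of_bool (\<not> pos_sol U' ?z {} (insert p B)))
            * (of_bool (pos_sol (kern U z {p}) z B (S - B)) + of_bool (B = S))"
    if B: "B \<subseteq> S" "card B = m" for B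
  proof -
    have pB: "p \<notin> B" using B p by auto
    have e1: "insert p S - insert p B = S - B" using p by auto
    have e2: "(insert p B = insert p S) = (B = S)" using p pB by auto
    have "pos_sol U z (insert p B) (S - B) = pos_sol (kern U z {p}) z B (S - B)"
      by (simp add: pos_sol_kern)
    moreover have "pos_sol U ?z (insert p B) (S - B) = pos_sol U z (insert p B) (S - B)"
      using p by (intro pos_sol_cong) auto
    ultimately show ?thesis unfolding T_def e1 e2 by (simp add: distrib_right)
  qed
  have "facet_count U U' z (insert p S) (Suc m) + facet_count U U' ?z (insert p S) (Suc m)
     = (\<Sum>B | B \<subseteq> insert p S \<and> card B = Suc m. T z B + T ?z B)"
    unfolding facet_count_def T_def by (simp add: sum.distrib)
  also have "\<dots> = (\<Sum>B | B \<subseteq> S \<and> card B = Suc m. T z B + T ?z B)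
     + (\<Sum>B | B \<subseteq> S \<and> card B = m. T z (insert p B) + T ?z (insert p B))"
    by (rule sum_subsets_insert[OF fin p])
  also have "(\<Sum>B | B \<subseteq> S \<and> card B = Suc m. T z B + T ?z B) = facet_count U U' z S (Suc m)"
    unfolding facet_count_def by (rule sum.cong[OF refl], rule 1) auto
  also have "(\<Sum>B | B \<subseteq> S \<and> card B = m. T z (insert p B) + T ?z (insert p B))
    = (\<Sum>B | B \<subseteq> S \<and> card B = m.
            (of_bool (\<not> pos_sol U' z {} (insert p B)) + of_bool (\<not> pos_sol U' ?z {} (insert p B)))
            * (of_bool (pos_sol (kern U z {p}) z B (S - B)) + of_bool (B = S)))"
    by (rule sum.cong[OF refl], rule 2) auto
  finally show ?thesis .
qed

text \<open>The defect inherits deletion and restriction: the two signs at \<open>p\<close> add up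
  to the system without \<open>p\<close> and the system restricted to functionals vanishing at
  \<open>p\<close>, in which both dimensions and the subset size drop by one.\<close>

lemma defect_flip:
  fixes z :: "'i \<Rightarrow> 'v::euclidean_space"
  assumes U: "subspace U" and U': "subspace U'" and fin: "finite S" and p: "p \<notin> S"
    and gen: "generic U z (insert p S) (r + 3)" and gen': "generic U' z (insert p S) (r + 1)"
  shows "defect U U' z (insert p S) (r + 2) + defect U U' (z(p := - z p)) (insert p S) (r + 2)
       = defect U U' z S (r + 2) + defect (kern U z {p}) (kern U' z {p}) z S (r + 1)"
proof -
  let ?z = "z(p := - z p)"
  obtain u where u: "u \<in> U" "u \<bullet> z p \<noteq> 0"
    using generic_ex_nonzero[OF gen, of "{}" p] fin by auto
  obtain u' where u': "u' \<in> U'" "u' \<bullet> z p \<noteq> 0"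
    using generic_ex_nonzero[OF gen', of "{}" p] fin by auto
  note a = pos_sol_flip_sum[of U S p u z, OF U fin p u]
  note b = pos_sol_flip_sum[of U' S p u' z, OF U' fin p u']
  \<comment> \<open>\<open>B\<close> has \<open>r + 1 = dim U'\<close> points and is therefore
    solvable in \<open>U'\<close>. The flip identity then reads one plus the restricted indicator,
    and taking complements leaves one minus it.\<close>
  have c: "(of_bool (\<not> pos_sol U' z {} (insert p B)) + of_bool (\<not> pos_sol U' ?z {} (insert p B)) :: int)
      = of_bool (\<not> pos_sol (kern U' z {p}) z {} B)" if B: "B \<subseteq> S" "card B = r + 1" for B
  proof -
    have finB: "finite B" and pB: "p \<notin> B" using B p fin finite_subset by auto
    have "pos_sol U' z {} B"
      using B finB by (intro generic_pos_sol[OF U' finB generic_subset[OF gen']]) auto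
    with pos_sol_flip_sum[of U' B p u' z, OF U' finB pB u'] show ?thesis
      unfolding of_bool_def by (simp split: if_splits)
  qed
  have d: "facet_count U U' z (insert p S) (r + 2) + facet_count U U' ?z (insert p S) (r + 2)
     = facet_count U U' z S (r + 2) + facet_count (kern U z {p}) (kern U' z {p}) z S (r + 1)"
    using facet_count_flip[where U = U and U' = U' and m = "r+1", OF U fin p] gen
    unfolding facet_count_def[of "kern U z {p}"] by (simp add: c numeral_3_eq_3)
  show ?thesis unfolding defect_def using a b d by simp
qed

text \<open>The bottom case, where \<open>U'\<close> is zero and cannot be restricted further. Twice
  the restricted solvability term arises from solvability in \<open>U\<close>, and twice from the
  facet \<open>{p}\<close>, counted under both signs; the two cancel.\<close>

lemma defect_flip_2:
  fixes z :: "'i \<Rightarrow> 'v::euclidean_space"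
  assumes U: "subspace U" and fin: "finite S" and p: "p \<notin> S" and "S \<noteq> {}"
    and gen: "generic U z (insert p S) 2"
  shows "defect U {0} z (insert p S) 1 + defect U {0} (z(p := - z p)) (insert p S) 1 = defect U {0} z S 1"
proof -
  let ?z = "z(p := - z p)"
  obtain u where u: "u \<in> U" "u \<bullet> z p \<noteq> 0"
    using generic_ex_nonzero[OF gen, of "{}" p] fin by auto
  note a = pos_sol_flip_sum[of U S p u z, OF U fin p u]
  have z0: "\<not> pos_sol {0} y {} B" if "B \<noteq> {}" for y and B :: "'i set"
    using that unfolding pos_sol_def by auto
  have s: "{B. B \<subseteq> S \<and> card B = 0} = {{}}"
    using fin by (auto simp: card_eq_0_iff dest: finite_subset)
  have d: "facet_count U {0} z (insert p S) 1 + facet_count U {0} ?z (insert p S) 1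
     = facet_count U {0} z S 1 + 2 * of_bool (pos_sol (kern U z {p}) z {} S)"
    using facet_count_flip[where U = U and U' = "{0}" and m = 0, OF U fin p] gen \<open>S \<noteq> {}\<close>
    by (simp add: s z0 numeral_2_eq_2)
  show ?thesis unfolding defect_def using a d \<open>S \<noteq> {}\<close> by (simp add: z0)
qed

definition flip :: "'i set \<Rightarrow> ('i \<Rightarrow> 'v::euclidean_space) \<Rightarrow> 'i \<Rightarrow> 'v" where
  "flip T z = (\<lambda>i. if i \<in> T then - z i else z i)"

lemma flip_insert: "p \<notin> T \<Longrightarrow> flip (insert p T) z = (flip T z)(p := - flip T z p)"
  unfolding flip_def by auto

lemma generic_flip: "generic U (flip T z) S r = generic U z S r"
  by (intro generic_cong) (auto simp: flip_def)

text \<open>Once the defect changes sign under every flip, it suffices that it vanishes for one choice of signs.\<close>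

lemma defect_zero_flip:
  assumes "finite S" "T \<subseteq> S"
    and "\<And>T p. T \<subseteq> S \<Longrightarrow> p \<in> S \<Longrightarrow> defect U U' (flip T z) S m + defect U U' ((flip T z)(p := - flip T z p)) S m = 0"
    and "defect U U' (flip T z) S m = 0"
  shows "defect U U' z S m = 0"
proof -
  have "finite T" using assms(1,2) finite_subset by auto
  hence "T \<subseteq> S \<Longrightarrow> \<bar>defect U U' (flip T z) S m\<bar> = \<bar>defect U U' z S m\<bar>"
  proof (induction T rule: finite_induct)
    case empty thus ?case by (simp add: flip_def)
  next
    case (insert p T)
    have T: "T \<subseteq> S" "p \<in> S" using insert.prems by auto
    show ?case unfolding flip_insert[OF insert(2)] using insert.IH[OF T(1)] assms(3)[OF T] by linarith
  qed
  thus ?thesis using assms by simp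
qed

text \<open>By induction over subsets of \<open>S\<close>, deletion and restriction make the defect
  change sign under flips, so one convenient choice of signs decides. For \<open>r > 0\<close> all
  points are made positive for one functional in \<open>U'\<close>, which solves both systems and
  excludes every facet. For \<open>r = 0\<close> and at least three points the signs are chosen so
  that nothing is solvable at all.\<close>

lemma defect_zero:
  fixes z :: "'i \<Rightarrow> 'v::euclidean_space"
  assumes "finite S" "subspace U" "subspace U'" "U' \<subseteq> U"
    and "generic U z S (r + 2)" "generic U' z S r"
  shows "defect U U' z S (r + 1) = 0"
  using assms
proof (induction S arbitrary: U U' z r rule: finite_psubset_induct)
  case (psubset S)
  note fin = psubset(1) and U = psubset.prems(1) and U' = psubset.prems(2) and UU = psubset.prems(3)
    and gen = psubset.prems(4) and gen' = psubset.prems(5)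
  have zU: "0 \<in> U" "0 \<in> U'" using U U' by (auto dest: subspace_0)
  show ?case
  proof (cases "S = {}")
    case True
    have "{B::'i set. B = {} \<and> card B = r + 1} = {}" by auto
    thus ?thesis using True zU by (auto simp: defect_def facet_count_def pos_sol_def)
  next
    case ne: False
    show ?thesis
    proof (cases r)
      case (Suc q)
      have sub: "subspace (kern U (flip T z) {p})" "subspace (kern U' (flip T z) {p})" for T p
        using U U' by (auto intro: subspace_kern)
      have fl: "defect U U' (flip T z) S (r + 1) + defect U U' ((flip T z)(p := - flip T z p)) S (r + 1) = 0"
        if T: "T \<subseteq> S" and p: "p \<in> S" for T p
      proof -
        let ?S = "S - {p}" and ?z = "flip T z"
        have S: "insert p ?S = S" using p by auto
        have g: "generic U ?z S (q + 3)" "generic U' ?z S (q + 1)"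
          using gen gen' Suc by (simp_all add: generic_flip numeral_3_eq_3 numeral_2_eq_2)
        have gk: "generic (kern U ?z {p}) ?z ?S (q + 2)" "generic (kern U' ?z {p}) ?z ?S q"
          using generic_kern[of U ?z ?S "{p}" "q+3"] generic_kern[of U' ?z ?S "{p}" "q+1"] fin g S by auto
        have "defect U U' ?z ?S (Suc q + 1) = 0"
          by (rule psubset.IH[OF _ U U' UU]) (use p g in \<open>auto intro: generic_subset simp: numeral_3_eq_3\<close>)
        moreover have "defect (kern U ?z {p}) (kern U' ?z {p}) ?z ?S (q + 1) = 0"
          by (rule psubset.IH[OF _ sub kern_mono[OF UU] gk]) (use p in auto)
        moreover note defect_flip[OF U U', of ?S p ?z q] g S fin
        ultimately show ?thesis using Suc by simp
      qed
      have "\<exists>u\<in>U'. u \<bullet> z i \<noteq> 0" if "i \<in> S" for i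
        using generic_ex_nonzero[OF gen', of "{}" i] fin that Suc by auto
      then obtain u where u: "u \<in> U'" "\<forall>i\<in>S. u \<bullet> z i \<noteq> 0"
        using ex_all_nonzero[OF U' fin, of z] by blast
      define T where "T = {i\<in>S. u \<bullet> z i < 0}"
      have up: "u \<bullet> flip T z i > 0" if "i \<in> S" for i
        using u that unfolding flip_def T_def by (auto simp: not_less order_less_le)
      have "pos_sol U' (flip T z) {} B" if "B \<subseteq> S" for B
        using up u that unfolding pos_sol_def by auto
      moreover have "pos_sol U (flip T z) {} S" using up u UU unfolding pos_sol_def by auto
      ultimately have "defect U U' (flip T z) S (r + 1) = 0"
        unfolding defect_def facet_count_def by (simp add: sum.neutral)
      thus ?thesis using defect_zero_flip[OF fin, of T U U' z "r+1"] fl unfolding T_def by blast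
    next
      case 0
      have "dim U' = 0" using gen'[unfolded generic_def, rule_format, of "{}"] 0 by simp
      hence U'0: "U' = {0}" using zU dim_eq_0 by blast
      have z0: "\<not> pos_sol {0} y {} B" if "B \<noteq> {}" for y and B :: "'i set"
        using that unfolding pos_sol_def by auto
      have gen2: "generic U z S 2" using gen 0 by (simp add: numeral_2_eq_2)
      have kern0: "u = 0" if "u \<in> U" "p \<in> S" "q \<in> S" "p \<noteq> q" "u \<bullet> z p = 0" "u \<bullet> z q = 0" for u p q
      proof -
        have "dim (kern U z {p, q}) = 0" using gen2[unfolded generic_def, rule_format, of "{p,q}"] that by simp
        moreover have "u \<in> kern U z {p, q}" using that unfolding kern_def by auto
        ultimately show ?thesis using dim_eq_0 by blast
      qed
      have dir: "\<exists>w\<in>U. w \<bullet> z p = 0 \<and> w \<bullet> z q > 0" if "p \<in> S" "q \<in> S" "p \<noteq> q" for p q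
      proof -
        have "\<exists>w\<in>kern U z {p}. w \<bullet> z q \<noteq> 0"
          using fin that by (intro generic_ex_nonzero[OF gen2]) auto
        then obtain w where w: "w \<in> kern U z {p}" "w \<bullet> z q \<noteq> 0" by blast
        have "sgn (w \<bullet> z q) *\<^sub>R w \<in> U" "(sgn (w \<bullet> z q) *\<^sub>R w) \<bullet> z p = 0" "(sgn (w \<bullet> z q) *\<^sub>R w) \<bullet> z q > 0"
          using w U by (auto simp: kern_def subspace_scale sgn_if mult_less_0_iff)
        thus ?thesis by blast
      qed
      consider "card S = 1" | "card S = 2" | "card S \<ge> 3"
        using ne fin card_gt_0_iff[of S] by linarith
      hence "defect U {0} z S 1 = 0"
      proof cases
        case 1
        then obtain p where p: "S = {p}" by (auto simp: card_Suc_eq)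
        have "pos_sol U z {} S" using 1 gen2 fin by (intro generic_pos_sol[OF U fin gen2]) auto
        moreover have "{B. B \<subseteq> {p} \<and> card B = 1} = {{p}}" by (auto simp: card_1_singleton_iff)
        moreover have "pos_sol U z {p} {}" using zU unfolding pos_sol_def by (intro bexI[of _ 0]) auto
        ultimately show ?thesis unfolding defect_def facet_count_def p by (simp add: z0)
      next
        case 2
        then obtain p q where pq: "S = {p, q}" "p \<noteq> q" by (meson card_2_iff)
        have "pos_sol U z {} S" using 2 fin by (intro generic_pos_sol[OF U fin gen2]) auto
        moreover have "{B. B \<subseteq> {p, q} \<and> card B = 1} = {{p}, {q}}" by (auto simp: card_1_singleton_iff)
        moreover have "pos_sol U z {p} ({p, q} - {p})" "pos_sol U z {q} ({p, q} - {q})"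
          using dir[of p q] dir[of q p] pq unfolding pos_sol_def by auto
        ultimately show ?thesis using pq unfolding defect_def facet_count_def pq by (auto simp: z0)
      next
        case 3
        obtain p A where A: "p \<in> S" "A = S - {p}" using ne by auto
        have "card A \<ge> 2" using A 3 fin by simp
        then obtain q where q: "q \<in> A" by (metis card.empty not_numeral_le_zero ex_in_conv)
        have "card (A - {q}) \<ge> 1" using q A fin \<open>card A \<ge> 2\<close> by simp
        then obtain s where s: "s \<in> A - {q}" by (metis card.empty not_one_le_zero ex_in_conv)
        have pqs: "p \<in> S" "q \<in> S" "s \<in> S" "p \<noteq> q" "p \<noteq> s" "q \<noteq> s" using A q s by auto
        obtain w1 where w1: "w1 \<in> U" "w1 \<bullet> z p = 0" "w1 \<bullet> z s < 0"
        proof -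
          obtain w where "w \<in> U" "w \<bullet> z p = 0" "w \<bullet> z s > 0" using dir[of p s] pqs by auto
          thus ?thesis using U that[of "- w"] by (simp add: subspace_neg)
        qed
        obtain w2 where w2: "w2 \<in> U" "w2 \<bullet> z q = 0" "w2 \<bullet> z s < 0"
        proof -
          obtain w where "w \<in> U" "w \<bullet> z q = 0" "w \<bullet> z s > 0" using dir[of q s] pqs by auto
          thus ?thesis using U that[of "- w"] by (simp add: subspace_neg)
        qed
        have n1: "w1 \<bullet> z q \<noteq> 0" using kern0[of w1 p q] w1 pqs by auto
        have n2: "w2 \<bullet> z p \<noteq> 0" using kern0[of w2 p q] w2 pqs by auto
        \<comment> \<open>In the plane \<open>U\<close> the functionals \<open>w1\<close> and
          \<open>w2\<close> form a basis adapted to \<open>p\<close> and \<open>q\<close>. The flips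
          make both coefficients of any solution positive, while both basis elements are negative at
          \<open>s\<close>.\<close>
        define T where "T = {i. (i = p \<and> w2 \<bullet> z p < 0) \<or> (i = q \<and> w1 \<bullet> z q < 0)}"
        have no: "\<not> pos_sol U (flip T z) {} S"
        proof
          assume "pos_sol U (flip T z) {} S"
          then obtain u where u: "u \<in> U" "\<And>i. i \<in> S \<Longrightarrow> u \<bullet> flip T z i > 0" unfolding pos_sol_def by auto
          define a where "a = (u \<bullet> z q) / (w1 \<bullet> z q)"
          define b where "b = (u \<bullet> z p) / (w2 \<bullet> z p)"
          have ab: "a > 0" "b > 0"
            using u(2)[of p] u(2)[of q] pqs n1 n2 unfolding a_def b_def flip_def T_def
            by (auto simp: zero_less_divide_iff zero_le_divide_iff not_less order_less_le split: if_splits)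
          have "u - a *\<^sub>R w1 - b *\<^sub>R w2 = 0"
          proof (rule kern0[of _ p q])
            show "u - a *\<^sub>R w1 - b *\<^sub>R w2 \<in> U" using u w1 w2 U by (intro subspace_diff subspace_scale) auto
          qed (use pqs n1 n2 w1 w2 in \<open>auto simp: a_def b_def inner_diff_left\<close>)
          hence "u = a *\<^sub>R w1 + b *\<^sub>R w2" by (simp add: algebra_simps)
          hence "u \<bullet> z s = a * (w1 \<bullet> z s) + b * (w2 \<bullet> z s)" by (simp add: inner_add_left)
          moreover have "a * (w1 \<bullet> z s) < 0" "b * (w2 \<bullet> z s) < 0" using ab w1 w2 by (auto simp: mult_less_0_iff)
          moreover have "u \<bullet> z s > 0" using u(2)[of s] pqs unfolding flip_def T_def by auto
          ultimately show False by linarith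
        qed
        \<comment> \<open>A facet could be tilted to a solution, so excluding solutions also
          excludes facets.\<close>
        have nf: "\<not> pos_sol U (flip T z) B (S - B)" if B: "B \<subseteq> S" "card B = 1" for B
        proof
          assume a: "pos_sol U (flip T z) B (S - B)"
          obtain b where b: "B = {b}" using B by (auto simp: card_Suc_eq)
          have bS: "b \<in> S" "insert b (S - B) = S" using B b by auto
          have "generic U (flip T z) S 2" using gen2 by (simp add: generic_flip)
          then obtain u0 where u0: "u0 \<in> U" "u0 \<bullet> flip T z b \<noteq> 0"
            using generic_ex_nonzero[of U "flip T z" S 2 "{}" b] fin bS by auto
          have "pos_sol (kern U (flip T z) {b}) (flip T z) {} (S - B)"
            using a b by (simp add: pos_sol_kern)
          from pos_sol_insert_perturb[OF U _ this u0] have "pos_sol U (flip T z) {} S" using fin bS by simp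
          thus False using no by simp
        qed
        have "B \<noteq> S" if "card B = 1" for B using that 3 by auto
        hence "facet_count U {0} (flip T z) S 1 = 0" unfolding facet_count_def by (intro sum.neutral) (auto simp: nf)
        hence "defect U {0} (flip T z) S 1 = 0" using no z0[OF ne] unfolding defect_def by simp
        moreover have "T \<subseteq> S" unfolding T_def using pqs by auto
        moreover have "defect U {0} (flip T z) S 1 + defect U {0} ((flip T z)(p := - flip T z p)) S 1 = 0"
          if T: "T \<subseteq> S" and p: "p \<in> S" for T p
        proof -
          let ?S = "S - {p}" and ?z = "flip T z"
          have S: "insert p ?S = S" using p by auto
          have "card ?S \<ge> 2" using 3 p fin by simp
          hence "?S \<noteq> {}" by (metis card.empty not_numeral_le_zero)
          have g: "generic U ?z S 2" using gen2 by (simp add: generic_flip)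
          have g0: "generic {0} ?z S 0" using gen' 0 U'0 by (simp add: generic_flip)
          have "defect U {0} ?z ?S (0 + 1) = 0"
            by (rule psubset.IH[OF _ U]) (use p g g0 zU in \<open>auto intro: generic_subset simp: numeral_2_eq_2\<close>)
          moreover note defect_flip_2[OF U, of ?S p ?z] g S fin \<open>?S \<noteq> {}\<close>
          ultimately show ?thesis by simp
        qed
        ultimately show ?thesis using defect_zero_flip[OF fin, of T U "{0}" z 1] by blast
      qed
      thus ?thesis using 0 U'0 by simp
    qed
  qed
qed

section \<open>Disintegration along graphs of affine functions\<close>

abbreviation lebP :: "'i set \<Rightarrow> ('i \<Rightarrow> real) measure" where
  "lebP I \<equiv> PiM I (\<lambda>_. lborel)"

interpretation lp: product_sigma_finite "\<lambda>_. lborel :: real measure"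
  by standard

lemma nn_integral_lebP_affine:
  fixes f :: "('i \<Rightarrow> real) \<Rightarrow> ennreal"
  assumes "finite I" "f \<in> borel_measurable (lebP I)" "r > 0"
  shows "(\<integral>\<^sup>+x. f x \<partial>lebP I) = ennreal (r ^ card I) * (\<integral>\<^sup>+v. f (\<lambda>i\<in>I. c i + r * v i) \<partial>lebP I)"
  using assms(1,2)
proof (induction I arbitrary: f rule: finite_induct)
  case empty
  show ?case by (simp add: lp.nn_integral_empty restrict_def space_PiM_empty)
next
  case (insert i I)
  note [measurable] = insert.prems
  have m0: "(\<lambda>(x, y). x(i := c i + r * y)) \<in> lebP I \<Otimes>\<^sub>M lborel \<rightarrow>\<^sub>M lebP (insert i I)"
  proof -
    have "(\<lambda>(x, y). (x, c i + r * y)) \<in> lebP I \<Otimes>\<^sub>M lborel \<rightarrow>\<^sub>M lebP I \<Otimes>\<^sub>M lborel" by measurable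
    from measurable_comp[OF this measurable_add_dim, of i] show ?thesis by (simp add: comp_def case_prod_unfold)
  qed
  have m1[measurable]: "(\<lambda>(x, y). f (x(i := c i + r * y))) \<in> borel_measurable (lebP I \<Otimes>\<^sub>M lborel)"
    using measurable_comp[OF m0 insert.prems] by (simp add: comp_def case_prod_unfold)
  define F where "F = (\<lambda>x. \<integral>\<^sup>+y. f (x(i := c i + r * y)) \<partial>lborel)"
  have [measurable]: "F \<in> borel_measurable (lebP I)" unfolding F_def by measurable
  have up: "(\<lambda>y. f (x(i := y))) \<in> borel_measurable borel" if "x \<in> space (lebP I)" for x
    using measurable_comp[OF measurable_component_update[OF that insert(2)] insert.prems]
    by (simp add: comp_def)
  have "(\<integral>\<^sup>+x. f x \<partial>lebP (insert i I)) = (\<integral>\<^sup>+x. (\<integral>\<^sup>+y. f (x(i := y)) \<partial>lborel) \<partial>lebP I)"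
    using insert by (intro lp.product_nn_integral_insert) auto
  also have "\<dots> = (\<integral>\<^sup>+x. ennreal r * F x \<partial>lebP I)"
    unfolding F_def using \<open>r > 0\<close> by (intro nn_integral_cong, subst nn_integral_real_affine[where c = r and t = "c i"]) (auto intro: up)
  also have "\<dots> = ennreal r * (\<integral>\<^sup>+x. F x \<partial>lebP I)"
    by (rule nn_integral_cmult) measurable
  also have "(\<integral>\<^sup>+x. F x \<partial>lebP I) = ennreal (r ^ card I) * (\<integral>\<^sup>+v. F (\<lambda>i\<in>I. c i + r * v i) \<partial>lebP I)"
    by (rule insert.IH) measurable
  also have "(\<integral>\<^sup>+v. F (\<lambda>i\<in>I. c i + r * v i) \<partial>lebP I) = (\<integral>\<^sup>+x. (\<integral>\<^sup>+y. f (\<lambda>j\<in>insert i I. c j + r * (x(i := y)) j) \<partial>lborel) \<partial>lebP I)"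
  proof -
    have "(\<lambda>j\<in>insert i I. c j + r * (x(i := y)) j) = (\<lambda>j\<in>I. c j + r * x j)(i := c i + r * y)" for x y
      using insert(2) by (auto simp: fun_eq_iff restrict_def)
    thus ?thesis unfolding F_def by simp
  qed
  also have "\<dots> = (\<integral>\<^sup>+v. f (\<lambda>i\<in>insert i I. c i + r * v i) \<partial>lebP (insert i I))"
    using insert by (intro lp.product_nn_integral_insert[symmetric]) measurable
  finally have "(\<integral>\<^sup>+x. f x \<partial>lebP (insert i I)) = ennreal r * ennreal (r ^ card I) *
      (\<integral>\<^sup>+v. f (\<lambda>i\<in>insert i I. c i + r * v i) \<partial>lebP (insert i I))"
    by (simp only: mult.assoc)
  moreover have "ennreal r * ennreal (r ^ card I) = ennreal (r ^ card (insert i I))"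
    using insert(1,2) \<open>r > 0\<close> by (simp flip: ennreal_mult)
  ultimately show ?case by (simp only:)
qed

text \<open>Gaussian elimination: a pivot reduces the substitution to a one-dimensional one and the Schur complement.\<close>

lemma nn_integral_lebP_linear:
  fixes A :: "'i \<Rightarrow> 'j \<Rightarrow> real"
  assumes "finite J" "finite I" "card I = card J"
    and "\<And>a. (\<And>i. i \<in> I \<Longrightarrow> (\<Sum>j\<in>J. A i j * a j) = 0) \<Longrightarrow> (\<forall>j\<in>J. a j = 0)"
  shows "\<exists>\<delta>>0. \<forall>f\<in>borel_measurable (lebP I).
     (\<integral>\<^sup>+a. f (\<lambda>i\<in>I. \<Sum>j\<in>J. A i j * a j) \<partial>lebP J) = ennreal \<delta> * (\<integral>\<^sup>+x. f x \<partial>lebP I)"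
  using assms
proof (induction J arbitrary: I A rule: finite_induct)
  case empty
  hence "I = {}" by simp
  thus ?case by (intro exI[of _ 1]) (auto simp: lp.nn_integral_empty restrict_def space_PiM_empty)
next
  case (insert j0 J)
  note finJ = insert.hyps(1) and j0 = insert.hyps(2) and finI = insert.prems(1)
  obtain i0 where i0: "i0 \<in> I" "A i0 j0 \<noteq> 0"
  proof (rule ccontr)
    assume "\<not> thesis"
    hence z: "A i j0 = 0" if "i \<in> I" for i using that \<open>\<And>i0. \<lbrakk>i0 \<in> I; A i0 j0 \<noteq> 0\<rbrakk> \<Longrightarrow> thesis\<close> by blast
    have "(\<Sum>j\<in>insert j0 J. A i j * (if j = j0 then 1 else 0)) = 0" if "i \<in> I" for i
      using z[OF that] by (intro sum.neutral) auto
    from insert.prems(3)[OF this] show False by auto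
  qed
  define \<alpha> where "\<alpha> = A i0 j0"
  have \<alpha>: "\<alpha> \<noteq> 0" using i0 unfolding \<alpha>_def by simp
  define I' where "I' = I - {i0}"
  have I: "I = insert i0 I'" "i0 \<notin> I'" and finI': "finite I'" using i0 finI unfolding I'_def by auto
  define A' where "A' = (\<lambda>i j. A i j - A i j0 * A i0 j / \<alpha>)"
  have A'sum: "(\<Sum>j\<in>J. A' i j * a j) = (\<Sum>j\<in>J. A i j * a j) - A i j0 / \<alpha> * (\<Sum>j\<in>J. A i0 j * a j)" for i a
    unfolding A'_def by (simp add: sum_subtractf sum_distrib_left left_diff_distrib mult.assoc)
  have "\<exists>\<delta>>0. \<forall>f\<in>borel_measurable (lebP I').
     (\<integral>\<^sup>+a. f (\<lambda>i\<in>I'. \<Sum>j\<in>J. A' i j * a j) \<partial>lebP J) = ennreal \<delta> * (\<integral>\<^sup>+x. f x \<partial>lebP I')"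
  proof (rule insert.IH[OF finI'])
    show "card I' = card J" using insert I finI' by simp
    fix a assume a: "\<And>i. i \<in> I' \<Longrightarrow> (\<Sum>j\<in>J. A' i j * a j) = 0"
    \<comment> \<open>\<open>s\<close> is the pivot variable solved from the pivot equation; with it
      a null vector of the Schur complement extends to one of \<open>A\<close>.\<close>
    define s where "s = - (\<Sum>j\<in>J. A i0 j * a j) / \<alpha>"
    have e: "(\<Sum>j\<in>insert j0 J. A i j * (a(j0 := s)) j) = A i j0 * s + (\<Sum>j\<in>J. A i j * a j)" for i
    proof -
      have "(\<Sum>j\<in>J. A i j * (a(j0 := s)) j) = (\<Sum>j\<in>J. A i j * a j)"
        using j0 by (intro sum.cong) auto
      thus ?thesis using finJ j0 by simp
    qed
    have "(\<Sum>j\<in>insert j0 J. A i j * (a(j0 := s)) j) = 0" if "i \<in> I" for i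
    proof (cases "i = i0")
      case True thus ?thesis unfolding e using \<alpha> by (simp add: s_def flip: \<alpha>_def)
    next
      case False
      hence "i \<in> I'" using that I by auto
      from a[OF this] show ?thesis unfolding e by (simp add: A'sum s_def)
    qed
    from insert.prems(3)[OF this] show "\<forall>j\<in>J. a j = 0" using j0 by (metis fun_upd_other insertCI)
  qed
  then obtain \<delta>' where \<delta>': "\<delta>' > 0" "\<And>f. f \<in> borel_measurable (lebP I') \<Longrightarrow>
     (\<integral>\<^sup>+a. f (\<lambda>i\<in>I'. \<Sum>j\<in>J. A' i j * a j) \<partial>lebP J) = ennreal \<delta>' * (\<integral>\<^sup>+x. f x \<partial>lebP I')" by blast
  show ?case
  proof (intro exI[of _ "\<delta>' / \<bar>\<alpha>\<bar>"] conjI ballI)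
    show "\<delta>' / \<bar>\<alpha>\<bar> > 0" using \<delta>' \<alpha> by simp
    fix f :: "('i \<Rightarrow> real) \<Rightarrow> ennreal" assume f[measurable]: "f \<in> borel_measurable (lebP I)"
    \<comment> \<open>\<open>G a t\<close> is the image point whose pivot coordinate equals
      \<open>t\<close>; the pivot variable enters only through \<open>t\<close>.\<close>
    define G where "G = (\<lambda>a t. (\<lambda>i\<in>I. if i = i0 then t else (\<Sum>j\<in>J. A' i j * a j) + A i j0 / \<alpha> * t))"
    have G[measurable]: "(\<lambda>(a, t). G a t) \<in> lebP J \<Otimes>\<^sub>M lborel \<rightarrow>\<^sub>M lebP I"
      unfolding G_def case_prod_unfold by measurable
    have fG[measurable]: "(\<lambda>(a, t). f (G a t)) \<in> borel_measurable (lebP J \<Otimes>\<^sub>M lborel)"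
      using measurable_comp[OF G f] by (simp add: comp_def case_prod_unfold)
    have fG2[measurable]: "(\<lambda>t. f (G a t)) \<in> borel_measurable borel" if "a \<in> space (lebP J)" for a
      using measurable_Pair2[OF fG that] by simp
    have Ga: "(\<lambda>i\<in>I. \<Sum>j\<in>insert j0 J. A i j * (a(j0 := s)) j) = G a ((\<Sum>j\<in>J. A i0 j * a j) + \<alpha> * s)" for a s
    proof -
      have e: "(\<Sum>j\<in>insert j0 J. A i j * (a(j0 := s)) j) = A i j0 * s + (\<Sum>j\<in>J. A i j * a j)" for i
      proof -
        have "(\<Sum>j\<in>J. A i j * (a(j0 := s)) j) = (\<Sum>j\<in>J. A i j * a j)"
          using j0 by (intro sum.cong) auto
        thus ?thesis using finJ j0 by simp
      qed
      show ?thesis unfolding e G_def A'sum using \<alpha> by (auto simp: fun_eq_iff restrict_def field_simps \<alpha>_def)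
    qed
    have "(\<integral>\<^sup>+a. f (\<lambda>i\<in>I. \<Sum>j\<in>insert j0 J. A i j * a j) \<partial>lebP (insert j0 J))
       = (\<integral>\<^sup>+a. (\<integral>\<^sup>+s. f (\<lambda>i\<in>I. \<Sum>j\<in>insert j0 J. A i j * (a(j0 := s)) j) \<partial>lborel) \<partial>lebP J)"
    proof (rule lp.product_nn_integral_insert[OF finJ j0])
      have "(\<lambda>a. \<lambda>i\<in>I. \<Sum>j\<in>insert j0 J. A i j * a j) \<in> lebP (insert j0 J) \<rightarrow>\<^sub>M lebP I" by measurable
      from measurable_comp[OF this f] show "(\<lambda>a. f (\<lambda>i\<in>I. \<Sum>j\<in>insert j0 J. A i j * a j)) \<in> borel_measurable (lebP (insert j0 J))"
        by (simp add: comp_def)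
    qed
    also have "\<dots> = (\<integral>\<^sup>+a. (\<integral>\<^sup>+s. f (G a ((\<Sum>j\<in>J. A i0 j * a j) + \<alpha> * s)) \<partial>lborel) \<partial>lebP J)"
      unfolding Ga ..
    also have "\<dots> = (\<integral>\<^sup>+a. ennreal (1 / \<bar>\<alpha>\<bar>) * (\<integral>\<^sup>+t. f (G a t) \<partial>lborel) \<partial>lebP J)"
    proof (rule nn_integral_cong)
      fix a assume "a \<in> space (lebP J)"
      from nn_integral_real_affine[OF fG2[OF this] \<alpha>, of "\<Sum>j\<in>J. A i0 j * a j"]
      show "(\<integral>\<^sup>+s. f (G a ((\<Sum>j\<in>J. A i0 j * a j) + \<alpha> * s)) \<partial>lborel) = ennreal (1 / \<bar>\<alpha>\<bar>) * (\<integral>\<^sup>+t. f (G a t) \<partial>lborel)"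
        using \<alpha> by (simp add: mult.assoc[symmetric] flip: ennreal_mult)
    qed
    also have "\<dots> = ennreal (1 / \<bar>\<alpha>\<bar>) * (\<integral>\<^sup>+a. (\<integral>\<^sup>+t. f (G a t) \<partial>lborel) \<partial>lebP J)"
      by (rule nn_integral_cmult) measurable
    also have "(\<integral>\<^sup>+a. (\<integral>\<^sup>+t. f (G a t) \<partial>lborel) \<partial>lebP J) = (\<integral>\<^sup>+t. (\<integral>\<^sup>+a. f (G a t) \<partial>lebP J) \<partial>lborel)"
    proof -
      interpret J: finite_product_sigma_finite "\<lambda>_. lborel :: real measure" J by standard (rule finJ)
      interpret pair_sigma_finite "lebP J" "lborel :: real measure" by standard
      show ?thesis using Fubini'[OF fG] by simp
    qed
    also have "\<dots> = (\<integral>\<^sup>+t. ennreal \<delta>' * (\<integral>\<^sup>+x. f (x(i0 := t)) \<partial>lebP I') \<partial>lborel)"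
    proof (rule nn_integral_cong)
      fix t :: real
      have m: "(\<lambda>x. f (x(i0 := t))) \<in> borel_measurable (lebP I')"
        using measurable_comp[OF measurable_comp[OF _ measurable_add_dim] f[unfolded I(1)], of "\<lambda>x. (x, t)" "lebP I'"]
        by (simp add: comp_def)
      define H where "H = (\<lambda>x. f ((\<lambda>i\<in>I'. A i j0 / \<alpha> * t + 1 * x i)(i0 := t)))"
      have "(\<lambda>x. \<lambda>i\<in>I'. A i j0 / \<alpha> * t + 1 * x i) \<in> lebP I' \<rightarrow>\<^sub>M lebP I'" by measurable
      from measurable_comp[OF this m] have H: "H \<in> borel_measurable (lebP I')" unfolding H_def by (simp add: comp_def)
      have "G a t = (\<lambda>i\<in>I'. A i j0 / \<alpha> * t + 1 * (\<lambda>i\<in>I'. \<Sum>j\<in>J. A' i j * a j) i)(i0 := t)" for a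
        unfolding G_def I(1) using I(2) by (auto simp: fun_eq_iff restrict_def)
      hence "(\<integral>\<^sup>+a. f (G a t) \<partial>lebP J) = (\<integral>\<^sup>+a. H (\<lambda>i\<in>I'. \<Sum>j\<in>J. A' i j * a j) \<partial>lebP J)"
        unfolding H_def by simp
      also have "\<dots> = ennreal \<delta>' * (\<integral>\<^sup>+x. H x \<partial>lebP I')" by (rule \<delta>'(2)[OF H])
      also have "(\<integral>\<^sup>+x. H x \<partial>lebP I') = (\<integral>\<^sup>+x. f (x(i0 := t)) \<partial>lebP I')"
        using nn_integral_lebP_affine[OF finI' m, of 1 "\<lambda>i. A i j0 / \<alpha> * t"] unfolding H_def by simp
      finally show "(\<integral>\<^sup>+a. f (G a t) \<partial>lebP J) = ennreal \<delta>' * (\<integral>\<^sup>+x. f (x(i0 := t)) \<partial>lebP I')" .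
    qed
    also have "\<dots> = ennreal \<delta>' * (\<integral>\<^sup>+t. (\<integral>\<^sup>+x. f (x(i0 := t)) \<partial>lebP I') \<partial>lborel)"
    proof (rule nn_integral_cmult)
      have "(\<lambda>(t, x). (x, t)) \<in> lborel \<Otimes>\<^sub>M lebP I' \<rightarrow>\<^sub>M lebP I' \<Otimes>\<^sub>M (lborel :: real measure)" by measurable
      from measurable_comp[OF measurable_comp[OF this measurable_add_dim] f[unfolded I(1)]]
      have [measurable]: "(\<lambda>(t, x). f (x(i0 := t))) \<in> borel_measurable (lborel \<Otimes>\<^sub>M lebP I')"
        by (simp add: comp_def case_prod_unfold)
      interpret I': finite_product_sigma_finite "\<lambda>_. lborel :: real measure" I' by standard (rule finI')
      show "(\<lambda>t. \<integral>\<^sup>+x. f (x(i0 := t)) \<partial>lebP I') \<in> borel_measurable lborel" by measurable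
    qed
    also have "(\<integral>\<^sup>+t. (\<integral>\<^sup>+x. f (x(i0 := t)) \<partial>lebP I') \<partial>lborel) = (\<integral>\<^sup>+x. f x \<partial>lebP I)"
      unfolding I(1) using I(2) finI' f[unfolded I(1)] by (intro lp.product_nn_integral_insert_rev[symmetric]) auto
    also have "ennreal (1 / \<bar>\<alpha>\<bar>) * (ennreal \<delta>' * (\<integral>\<^sup>+x. f x \<partial>lebP I)) = ennreal (\<delta>' / \<bar>\<alpha>\<bar>) * (\<integral>\<^sup>+x. f x \<partial>lebP I)"
      using \<delta>'(1) by (simp add: mult.assoc[symmetric] flip: ennreal_mult)
    finally show "(\<integral>\<^sup>+a. f (\<lambda>i\<in>I. \<Sum>j\<in>insert j0 J. A i j * a j) \<partial>lebP (insert j0 J))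
        = ennreal (\<delta>' / \<bar>\<alpha>\<bar>) * (\<integral>\<^sup>+x. f x \<partial>lebP I)" .
  qed
qed

section \<open>Points on the graph of an affine function\<close>

definition graph_val :: "'n set \<Rightarrow> 'n \<Rightarrow> (nat \<times> 'n \<Rightarrow> real) \<Rightarrow> ('n \<Rightarrow> real) \<Rightarrow> nat \<Rightarrow> real" where
  "graph_val A t y a i = (\<Sum>j\<in>A - {t}. y (i, j) * a j) + a t"

definition graph_map :: "nat set \<Rightarrow> 'n set \<Rightarrow> 'n \<Rightarrow> (nat \<times> 'n \<Rightarrow> real) \<Rightarrow> ('n \<Rightarrow> real) \<Rightarrow> nat \<times> 'n \<Rightarrow> real" where
  "graph_map P A t y a = (\<lambda>p\<in>P \<times> {t}. graph_val A t y a (fst p))"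

lemma nn_integral_graph:
  fixes A :: "'n set"
  assumes P: "finite P" and A: "finite A" "t \<in> A" "card P = card A"
    and inj: "\<And>a. (\<And>i. i \<in> P \<Longrightarrow> graph_val A t y a i = 0) \<Longrightarrow> (\<forall>j\<in>A. a j = 0)"
  shows "\<exists>\<delta>>0. \<forall>f\<in>borel_measurable (lebP (P \<times> {t})).
     (\<integral>\<^sup>+a. f (graph_map P A t y a) \<partial>lebP A) = ennreal \<delta> * (\<integral>\<^sup>+x. f x \<partial>lebP (P \<times> {t}))"
proof -
  define C where "C = (\<lambda>(p :: nat \<times> 'n) j. if j = t then 1 else y (fst p, j))"
  have C: "(\<Sum>j\<in>A. C p j * a j) = graph_val A t y a (fst p)" for p a
  proof -
    have "(\<Sum>j\<in>A. C p j * a j) = C p t * a t + (\<Sum>j\<in>A-{t}. C p j * a j)"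
      using A by (simp add: sum.remove)
    also have "(\<Sum>j\<in>A-{t}. C p j * a j) = (\<Sum>j\<in>A-{t}. y (fst p, j) * a j)"
      by (intro sum.cong) (auto simp: C_def)
    finally show ?thesis unfolding graph_val_def C_def by simp
  qed
  have "\<exists>\<delta>>0. \<forall>f\<in>borel_measurable (lebP (P \<times> {t})).
     (\<integral>\<^sup>+a. f (\<lambda>p\<in>P \<times> {t}. \<Sum>j\<in>A. C p j * a j) \<partial>lebP A) = ennreal \<delta> * (\<integral>\<^sup>+x. f x \<partial>lebP (P \<times> {t}))"
  proof (rule nn_integral_lebP_linear)
    fix a assume "\<And>p. p \<in> P \<times> {t} \<Longrightarrow> (\<Sum>j\<in>A. C p j * a j) = 0"
    hence "graph_val A t y a i = 0" if "i \<in> P" for i using that C[of "(i, t)" a] by force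
    thus "\<forall>j\<in>A. a j = 0" by (rule inj)
  qed (use P A in auto)
  thus ?thesis unfolding C graph_map_def .
qed

text \<open>The preimage volume of the unit cube is the reciprocal absolute determinant of the
  linear map from coefficients to values at the points. In this form measurability in
  \<open>y\<close> follows from iterated integration.\<close>

definition box_vol :: "nat set \<Rightarrow> 'n set \<Rightarrow> 'n \<Rightarrow> (nat \<times> 'n \<Rightarrow> real) \<Rightarrow> ennreal" where
  "box_vol P A t y = (\<integral>\<^sup>+a. indicator (\<Pi>\<^sub>E p\<in>P \<times> {t}. {0..1}) (graph_map P A t y a) \<partial>lebP A)"

lemma measurable_graph_map:
  fixes A :: "'n::finite set"
  assumes "finite P" "t \<in> A"
  shows "(\<lambda>(y, a). graph_map P A t y a) \<in> lebP (P \<times> (UNIV - {t})) \<Otimes>\<^sub>M lebP A \<rightarrow>\<^sub>M lebP (P \<times> {t})"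
  unfolding graph_map_def graph_val_def case_prod_unfold
proof (rule measurable_restrict)
  fix p assume p: "p \<in> P \<times> {t}"
  have a: "(\<lambda>x. fst x (fst p, j)) \<in> borel_measurable (lebP (P \<times> (UNIV - {t})) \<Otimes>\<^sub>M lebP A)" if "j \<in> A - {t}" for j
  proof -
    have "(\<lambda>y. y (fst p, j)) \<in> borel_measurable (lebP (P \<times> (UNIV - {t})))"
      using p that by (subst measurable_lborel1[symmetric], intro measurable_component_singleton) auto
    from measurable_compose[OF measurable_fst this] show ?thesis .
  qed
  have b: "(\<lambda>x. snd x j) \<in> borel_measurable (lebP (P \<times> (UNIV - {t})) \<Otimes>\<^sub>M lebP A)" if "j \<in> A" for j
  proof -
    have "(\<lambda>y. y j) \<in> borel_measurable (lebP A)"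
      using that by (subst measurable_lborel1[symmetric], intro measurable_component_singleton) auto
    from measurable_compose[OF measurable_snd this] show ?thesis .
  qed
  have "(\<lambda>x. (\<Sum>j\<in>A - {t}. fst x (fst p, j) * snd x j) + snd x t)
         \<in> borel_measurable (lebP (P \<times> (UNIV - {t})) \<Otimes>\<^sub>M lebP A)"
    using assms(2) by (intro borel_measurable_add borel_measurable_sum borel_measurable_times a b) auto
  thus "(\<lambda>x. (\<Sum>j\<in>A - {t}. fst x (fst p, j) * snd x j) + snd x t)
         \<in> lebP (P \<times> (UNIV - {t})) \<Otimes>\<^sub>M lebP A \<rightarrow>\<^sub>M lborel" by simp
qed

lemma box_meas: "finite P \<Longrightarrow> (\<Pi>\<^sub>E p\<in>P \<times> {t}. {0..1::real}) \<in> sets (lebP (P \<times> {t}))"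
  by (intro sets_PiM_I_finite) auto

lemma box_emeasure: "finite P \<Longrightarrow> emeasure (lebP (P \<times> {t})) (\<Pi>\<^sub>E p\<in>P \<times> {t}. {0..1::real}) = 1"
  by (subst lp.emeasure_PiM) auto

lemma box_vol_measurable:
  fixes A :: "'n::finite set"
  assumes "finite P" "t \<in> A"
  shows "box_vol P A t \<in> borel_measurable (lebP (P \<times> (UNIV - {t})))"
proof -
  have "(indicator (\<Pi>\<^sub>E p\<in>P \<times> {t}. {0..1}) :: _ \<Rightarrow> ennreal) \<in> borel_measurable (lebP (P \<times> {t}))"
    using box_meas[OF assms(1)] by (rule borel_measurable_indicator)
  from measurable_comp[OF measurable_graph_map[OF assms] this]
  have [measurable]: "(\<lambda>(y, a). indicator (\<Pi>\<^sub>E p\<in>P \<times> {t}. {0..1}) (graph_map P A t y a) :: ennreal)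
     \<in> borel_measurable (lebP (P \<times> (UNIV - {t})) \<Otimes>\<^sub>M lebP A)"
    by (simp add: comp_def case_prod_unfold)
  interpret A: finite_product_sigma_finite "\<lambda>_. lborel :: real measure" A by standard auto
  show ?thesis unfolding box_vol_def by measurable
qed

text \<open>Testing the substitution on the unit cube identifies its constant, so that the Jacobian
  becomes an explicit function of \<open>y\<close>.\<close>

lemma nn_integral_graph':
  fixes A :: "'n::finite set"
  assumes P: "finite P" and A: "t \<in> A" "card P = card A"
    and inj: "\<And>a. (\<And>i. i \<in> P \<Longrightarrow> graph_val A t y a i = 0) \<Longrightarrow> (\<forall>j\<in>A. a j = 0)"
    and f: "f \<in> borel_measurable (lebP (P \<times> {t}))"
  shows "(\<integral>\<^sup>+x. f x \<partial>lebP (P \<times> {t})) = inverse (box_vol P A t y) * (\<integral>\<^sup>+a. f (graph_map P A t y a) \<partial>lebP A)"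
proof -
  obtain \<delta> where \<delta>: "\<delta> > 0" "\<And>f. f \<in> borel_measurable (lebP (P \<times> {t})) \<Longrightarrow>
     (\<integral>\<^sup>+a. f (graph_map P A t y a) \<partial>lebP A) = ennreal \<delta> * (\<integral>\<^sup>+x. f x \<partial>lebP (P \<times> {t}))"
    using nn_integral_graph[where y = y, OF P finite A inj] by blast
  have "box_vol P A t y = ennreal \<delta>"
    unfolding box_vol_def using box_meas[OF P, of t] box_emeasure[OF P, of t] by (subst \<delta>(2)) auto
  moreover have "inverse (ennreal \<delta>) * (ennreal \<delta> * X) = X" for X
    using \<delta>(1) by (simp add: mult.assoc[symmetric] inverse_ennreal flip: ennreal_mult)
  ultimately show ?thesis using \<delta>(2)[OF f] by simp
qed

lemma lebP_insert_swap:
  fixes A :: "'n::finite set"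
  assumes "t \<in> A" "f \<in> borel_measurable (lebP A)"
  shows "(\<integral>\<^sup>+a. f a \<partial>lebP A) = (\<integral>\<^sup>+a. (\<integral>\<^sup>+b. f (a(t := b)) \<partial>lborel) \<partial>lebP (A - {t}))"
proof -
  have "insert t (A - {t}) = A" using assms by auto
  thus ?thesis using lp.product_nn_integral_insert[of "A - {t}" t f] assms by simp
qed

text \<open>The determinant is translation invariant and homogeneous of degree
  \<open>card A - 1\<close> in the points: every slope contributes one degree, the constant term
  none.\<close>

lemma box_vol_scale:
  fixes A :: "'n::finite set" and c :: "'n \<Rightarrow> real"
  assumes P: "finite P" and t: "t \<in> A" and r: "r > 0"
  shows "box_vol P A t y = ennreal (r ^ (card A - 1)) * box_vol P A t (\<lambda>p\<in>P \<times> (UNIV - {t}). c (snd p) + r * y p)"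
proof -
  let ?y = "\<lambda>p\<in>P \<times> (UNIV - {t}). c (snd p) + r * y p"
  define Q where "Q = (\<lambda>a b. indicator {z::nat\<Rightarrow>real. \<forall>i\<in>P. z i \<in> {0..1}} (\<lambda>i. (\<Sum>j\<in>A - {t}. y (i, j) * a j) + b) :: ennreal)"
  have ind: "indicator (\<Pi>\<^sub>E p\<in>P \<times> {t}. {0..1}) (graph_map P A t w a) = (indicator {z::nat\<Rightarrow>real. \<forall>i\<in>P. z i \<in> {0..1}} (graph_val A t w a) :: ennreal)" for w a
    unfolding graph_map_def by (auto simp: indicator_def PiE_iff)
  have gmeas: "(\<lambda>a. indicator {z::nat\<Rightarrow>real. \<forall>i\<in>P. z i \<in> {0..1}} (graph_val A t w a) :: ennreal) \<in> borel_measurable (lebP A)" for w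
  proof -
    have [measurable]: "(\<lambda>a. a j) \<in> borel_measurable (lebP A)" if "j \<in> A" for j
      using that by (subst measurable_lborel1[symmetric], intro measurable_component_singleton) auto
    have g: "(\<lambda>a. graph_val A t w a i) \<in> borel_measurable (lebP A)" for i
      unfolding graph_val_def using t by (intro borel_measurable_add borel_measurable_sum borel_measurable_times) auto
    have "{a \<in> space (lebP A). \<forall>i\<in>P. graph_val A t w a i \<in> {0..1}} \<in> sets (lebP A)"
      using P g by (intro sets.sets_Collect_finite_All pred_sets2[of "{0..1}" borel]) auto
    from borel_measurable_indicator[OF this]
    have "(\<lambda>a. indicator {a \<in> space (lebP A). \<forall>i\<in>P. graph_val A t w a i \<in> {0..1}} a :: ennreal) \<in> borel_measurable (lebP A)" .
    thus ?thesis by (rule measurable_cong[THEN iffD1, rotated]) (auto simp: indicator_def)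
  qed
  have bv: "box_vol P A t w = (\<integral>\<^sup>+a. (\<integral>\<^sup>+b. indicator {z::nat\<Rightarrow>real. \<forall>i\<in>P. z i \<in> {0..1}} (\<lambda>i. (\<Sum>j\<in>A - {t}. w (i, j) * a j) + b) \<partial>lborel) \<partial>lebP (A - {t}))" for w
  proof -
    have "graph_val A t w (a(t := b)) = (\<lambda>i. (\<Sum>j\<in>A - {t}. w (i, j) * a j) + b)" for a b
      by (rule ext) (simp add: graph_val_def)
    thus ?thesis unfolding box_vol_def ind using lebP_insert_swap[OF t gmeas, of w] by simp
  qed
  have jm: "(\<lambda>(a, b). Q a b) \<in> borel_measurable (lebP (A - {t}) \<Otimes>\<^sub>M lborel)"
  proof -
    have a: "(\<lambda>(a, b). a(t := b)) \<in> lebP (A - {t}) \<Otimes>\<^sub>M lborel \<rightarrow>\<^sub>M lebP A"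
      using measurable_add_dim[of t "A - {t}" "\<lambda>_. lborel :: real measure"] t by (simp add: insert_absorb)
    from measurable_comp[OF a gmeas[of y]] show ?thesis
      unfolding Q_def by (simp add: comp_def case_prod_unfold graph_val_def)
  qed
  have Qr: "(\<lambda>a. \<integral>\<^sup>+b. Q a b \<partial>lborel) \<in> borel_measurable (lebP (A - {t}))"
    using jm by measurable
  have Qb: "Q a \<in> borel_measurable borel" if "a \<in> space (lebP (A - {t}))" for a
    using measurable_Pair2[OF jm that] by simp
  have "box_vol P A t y = (\<integral>\<^sup>+a. (\<integral>\<^sup>+b. Q a b \<partial>lborel) \<partial>lebP (A - {t}))"
    unfolding bv Q_def ..
  also have "\<dots> = ennreal (r ^ card (A - {t})) * (\<integral>\<^sup>+a. (\<integral>\<^sup>+b. Q (\<lambda>j\<in>A - {t}. 0 + r * a j) b \<partial>lborel) \<partial>lebP (A - {t}))"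
    using nn_integral_lebP_affine[OF _ Qr r, of "\<lambda>_. 0"] by simp
  \<comment> \<open>Translating the points by \<open>c\<close> adds a constant to all values, which
    is absorbed in the constant term \<open>b\<close>.\<close>
  also have "(\<integral>\<^sup>+a. (\<integral>\<^sup>+b. Q (\<lambda>j\<in>A - {t}. 0 + r * a j) b \<partial>lborel) \<partial>lebP (A - {t}))
     = (\<integral>\<^sup>+a. (\<integral>\<^sup>+b. Q (\<lambda>j\<in>A - {t}. 0 + r * a j) ((\<Sum>j\<in>A - {t}. c j * a j) + 1 * b) \<partial>lborel) \<partial>lebP (A - {t}))"
  proof (rule nn_integral_cong)
    fix a assume a: "a \<in> space (lebP (A - {t}))"
    have "(\<lambda>j\<in>A - {t}. 0 + r * a j) \<in> space (lebP (A - {t}))" by (simp add: space_PiM)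
    from nn_integral_real_affine[OF Qb[OF this], of 1 "\<Sum>j\<in>A - {t}. c j * a j"]
    show "(\<integral>\<^sup>+b. Q (\<lambda>j\<in>A - {t}. 0 + r * a j) b \<partial>lborel) = (\<integral>\<^sup>+b. Q (\<lambda>j\<in>A - {t}. 0 + r * a j) ((\<Sum>j\<in>A - {t}. c j * a j) + 1 * b) \<partial>lborel)"
      by simp
  qed
  also have "\<dots> = box_vol P A t ?y"
  proof -
    have "Q (\<lambda>j\<in>A - {t}. 0 + r * a j) ((\<Sum>j\<in>A - {t}. c j * a j) + 1 * b)
       = indicator {z::nat\<Rightarrow>real. \<forall>i\<in>P. z i \<in> {0..1}} (\<lambda>i. (\<Sum>j\<in>A - {t}. ?y (i, j) * a j) + b)" for a b
    proof -
      have "(\<Sum>j\<in>A - {t}. y (i, j) * (\<lambda>j\<in>A - {t}. 0 + r * a j) j) + ((\<Sum>j\<in>A - {t}. c j * a j) + 1 * b)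
          = (\<Sum>j\<in>A - {t}. ?y (i, j) * a j) + b" if "i \<in> P" for i
      proof -
        have "(\<Sum>j\<in>A - {t}. ?y (i, j) * a j) = (\<Sum>j\<in>A - {t}. y (i, j) * (\<lambda>j\<in>A - {t}. 0 + r * a j) j + c j * a j)"
          using that by (intro sum.cong) (auto simp: algebra_simps)
        thus ?thesis by (simp add: sum.distrib)
      qed
      hence "(\<forall>i\<in>P. (\<Sum>j\<in>A - {t}. y (i, j) * (\<lambda>j\<in>A - {t}. 0 + r * a j) j) + ((\<Sum>j\<in>A - {t}. c j * a j) + 1 * b) \<in> {0..1})
          = (\<forall>i\<in>P. (\<Sum>j\<in>A - {t}. ?y (i, j) * a j) + b \<in> {0..1})"
        by (intro ball_cong refl) (simp only:)
      thus ?thesis unfolding Q_def indicator_def mem_Collect_eq by (simp only:)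
    qed
    thus ?thesis unfolding bv by simp
  qed
  finally show ?thesis using t by simp
qed

definition unit_balls :: "nat set \<Rightarrow> (nat \<times> 'n::finite \<Rightarrow> real) \<Rightarrow> ennreal" where
  "unit_balls P x = (\<Prod>i\<in>P. indicator {..1} (\<Sum>j\<in>UNIV. (x (i, j))\<^sup>2))"

text \<open>
  \<^term>\<open>y\<close> carries the coordinates other than \<^term>\<open>t\<close> of the points, and the points lie on the
  graph of the affine function with coefficients \<^term>\<open>a\<close>. Centring at the foot of the
  perpendicular from the origin turns the section of the ball into a ball of radius
  \<open>sqrt (1 - h\<^sup>2)\<close>, up to the metric of the graph.
\<close>

lemma section_identity:
  fixes A :: "'n::finite set" and a :: "'n \<Rightarrow> real" and b :: real
  assumes t: "t \<in> A"
  defines "s \<equiv> 1 + (\<Sum>j\<in>A - {t}. (a j)\<^sup>2)"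
  assumes c: "c = (\<lambda>j. if j \<in> A - {t} then - b * a j / s else 0)"
  shows "(\<Sum>j\<in>UNIV - {t}. (c j + r * v j)\<^sup>2) + ((\<Sum>j\<in>A - {t}. (c j + r * v j) * a j) + b)\<^sup>2
       = b\<^sup>2 / s + r\<^sup>2 * ((\<Sum>j\<in>UNIV - {t}. (v j)\<^sup>2) + (\<Sum>j\<in>A - {t}. v j * a j)\<^sup>2)"
proof -
  define S where "S = (\<Sum>j\<in>A - {t}. (a j)\<^sup>2)"
  define V where "V = (\<Sum>j\<in>A - {t}. v j * a j)"
  have s: "s = 1 + S" "s > 0" unfolding s_def S_def by (simp_all add: add_pos_nonneg sum_nonneg)
  have sub: "(\<Sum>j\<in>UNIV - {t}. c j * f j) = (\<Sum>j\<in>A - {t}. c j * f j)" for f :: "'n \<Rightarrow> real"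
    by (rule sum.mono_neutral_right) (auto simp: c)
  have 1: "(\<Sum>j\<in>UNIV - {t}. (c j)\<^sup>2) = b\<^sup>2 * S / s\<^sup>2"
  proof -
    have "(\<Sum>j\<in>UNIV - {t}. (c j)\<^sup>2) = (\<Sum>j\<in>A - {t}. b\<^sup>2 / s\<^sup>2 * (a j)\<^sup>2)"
      using sub[of c] by (simp add: power2_eq_square) (intro sum.cong, auto simp: c)
    also have "\<dots> = b\<^sup>2 / s\<^sup>2 * S" by (simp only: S_def sum_distrib_left)
    finally show ?thesis by simp
  qed
  have 2: "(\<Sum>j\<in>UNIV - {t}. c j * v j) = - b * V / s"
  proof -
    have "(\<Sum>j\<in>UNIV - {t}. c j * v j) = (\<Sum>j\<in>A - {t}. (- b / s) * (v j * a j))"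
      unfolding sub by (intro sum.cong) (auto simp: c)
    also have "\<dots> = (- b / s) * V" by (simp only: V_def sum_distrib_left)
    finally show ?thesis by simp
  qed
  have 3: "(\<Sum>j\<in>A - {t}. (c j + r * v j) * a j) + b = b / s + r * V"
  proof -
    have "(\<Sum>j\<in>A - {t}. (c j + r * v j) * a j) = (\<Sum>j\<in>A - {t}. (- b / s) * (a j)\<^sup>2 + r * (v j * a j))"
      by (intro sum.cong) (auto simp: c algebra_simps power2_eq_square)
    also have "\<dots> = (- b / s) * S + r * V" by (simp only: S_def V_def sum.distrib sum_distrib_left)
    finally show ?thesis using s by (simp add: field_simps)
  qed
  have 4: "(\<Sum>j\<in>UNIV - {t}. (c j + r * v j)\<^sup>2) = b\<^sup>2 * S / s\<^sup>2 + 2 * r * (- b * V / s) + r\<^sup>2 * (\<Sum>j\<in>UNIV - {t}. (v j)\<^sup>2)"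
  proof -
    have "(\<Sum>j\<in>UNIV - {t}. (c j + r * v j)\<^sup>2) = (\<Sum>j\<in>UNIV - {t}. (c j)\<^sup>2 + 2 * r * (c j * v j) + r\<^sup>2 * (v j)\<^sup>2)"
      by (intro sum.cong) (auto simp: power2_eq_square algebra_simps)
    also have "\<dots> = (\<Sum>j\<in>UNIV - {t}. (c j)\<^sup>2) + 2 * r * (\<Sum>j\<in>UNIV - {t}. c j * v j) + r\<^sup>2 * (\<Sum>j\<in>UNIV - {t}. (v j)\<^sup>2)"
      by (simp only: sum.distrib sum_distrib_left)
    finally show ?thesis unfolding 1 2 .
  qed
  have 5: "b\<^sup>2 * S / s\<^sup>2 + (b / s)\<^sup>2 = b\<^sup>2 / s"
  proof -
    have "b\<^sup>2 * S / s\<^sup>2 + (b / s)\<^sup>2 = b\<^sup>2 * (1 + S) / s\<^sup>2"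
      by (simp add: power_divide distrib_left add_divide_distrib)
    thus ?thesis using s(2) unfolding s(1)[symmetric] by (simp add: power2_eq_square)
  qed
  show ?thesis unfolding 3 4 V_def[symmetric] using 5 by (simp add: power2_eq_square algebra_simps)
qed

text \<open>What remains of a hyperplane section after it has been centred and rescaled: a quantity
  that depends on the slopes alone. The inverse of \<open>box_vol\<close> is the Jacobian.\<close>

definition sec_measure :: "nat set \<Rightarrow> 'n::finite set \<Rightarrow> 'n \<Rightarrow> (nat \<times> 'n \<Rightarrow> real) set \<Rightarrow> ('n \<Rightarrow> real) \<Rightarrow> ennreal" where
  "sec_measure P A t E a = (\<integral>\<^sup>+v. indicator E v * inverse (box_vol P A t v) *
      (\<Prod>i\<in>P. indicator {..1} ((\<Sum>j\<in>UNIV - {t}. (v (i, j))\<^sup>2) + (\<Sum>j\<in>A - {t}. v (i, j) * a j)\<^sup>2))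
      \<partial>lebP (P \<times> (UNIV - {t})))"

text \<open>The square root is the Jacobian of passing from the constant term to the signed distance
  from the origin.\<close>

definition sec_const :: "nat set \<Rightarrow> 'n::finite set \<Rightarrow> 'n \<Rightarrow> (nat \<times> 'n \<Rightarrow> real) set \<Rightarrow> ennreal" where
  "sec_const P A t E = (\<integral>\<^sup>+a. ennreal (sqrt (1 + (\<Sum>j\<in>A - {t}. (a j)\<^sup>2))) * sec_measure P A t E a \<partial>lebP (A - {t}))"

text \<open>Up to normalisation the density of the signed distance of the spanned hyperplane;
  \<open>sqrt (1 - h\<^sup>2)\<close> is the radius of the section.\<close>

definition height_weight :: "nat \<Rightarrow> real \<Rightarrow> ennreal" where
  "height_weight m h = indicator {-1<..<1} h * ennreal (sqrt (1 - h\<^sup>2) ^ m)"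

lemma measurable_lebP_component: "p \<in> I \<Longrightarrow> (\<lambda>y. y p) \<in> borel_measurable (lebP I)"
  by (subst measurable_lborel1[symmetric], intro measurable_component_singleton) auto

lemma measurable_prod_indicator:
  assumes "\<And>i. i \<in> P \<Longrightarrow> q i \<in> borel_measurable M"
  shows "(\<lambda>x. \<Prod>i\<in>P. indicator {..1::real} (q i x) :: ennreal) \<in> borel_measurable M"
proof (rule borel_measurable_prod_ennreal)
  fix i assume "i \<in> P"
  have "(indicator {..1::real} :: real \<Rightarrow> ennreal) \<in> borel_measurable borel" by measurable
  from measurable_compose[OF assms[OF \<open>i \<in> P\<close>] this]
  show "(\<lambda>x. indicator {..1::real} (q i x) :: ennreal) \<in> borel_measurable M" .
qed

text \<open>The section is centred and rescaled by its radius. The exponent collects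
  \<open>card P * (CARD('n) - 1)\<close> from the coordinates and \<open>card A - 1\<close> from the
  determinant. If the height exceeds 1 in absolute value the hyperplane misses the ball; at height 1
  the radius is 0 and the rescaling breaks down, hence the assumption on \<open>b\<close>.\<close>

lemma section_integral:
  fixes A :: "'n::finite set" and \<alpha> :: "'n \<Rightarrow> real"
  assumes P: "finite P" "P \<noteq> {}" and t: "t \<in> A" and card: "card P = card A"
    and E: "E \<in> sets (lebP (P \<times> (UNIV - {t})))"
    and inv: "\<And>y c r. y \<in> space (lebP (P \<times> (UNIV - {t}))) \<Longrightarrow> r > 0 \<Longrightarrow>
       (\<lambda>p\<in>P \<times> (UNIV - {t}). c (snd p) + r * y p) \<in> E \<longleftrightarrow> y \<in> E"
    and s: "s = sqrt (1 + (\<Sum>j\<in>A - {t}. (\<alpha> j)\<^sup>2))" and b: "\<bar>b / s\<bar> \<noteq> 1"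
  shows "(\<integral>\<^sup>+y. indicator E y * inverse (box_vol P A t y) *
      (\<Prod>i\<in>P. indicator {..1} ((\<Sum>j\<in>UNIV - {t}. (y (i, j))\<^sup>2) + (graph_val A t y (\<alpha>(t := b)) i)\<^sup>2))
      \<partial>lebP (P \<times> (UNIV - {t}))) = height_weight (card P * CARD('n) - 1) (b / s) * sec_measure P A t E \<alpha>"
proof -
  define Y where "Y = P \<times> (UNIV - {t} :: 'n set)"
  have finY: "finite Y" unfolding Y_def using P by auto
  have s2: "s\<^sup>2 = 1 + (\<Sum>j\<in>A - {t}. (\<alpha> j)\<^sup>2)" "s > 0"
    unfolding s by (simp_all add: add_pos_nonneg sum_nonneg)
  \<comment> \<open>\<open>c\<close> is the foot of the perpendicular from the origin to the
    hyperplane, without its coordinate \<open>t\<close>.\<close>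
  define c where "c = (\<lambda>j. if j \<in> A - {t} then - b * \<alpha> j / s\<^sup>2 else 0)"
  have id: "(\<Sum>j\<in>UNIV - {t}. (c j + r * v j)\<^sup>2) + ((\<Sum>j\<in>A - {t}. (c j + r * v j) * \<alpha> j) + b)\<^sup>2
       = (b / s)\<^sup>2 + r\<^sup>2 * ((\<Sum>j\<in>UNIV - {t}. (v j)\<^sup>2) + (\<Sum>j\<in>A - {t}. v j * \<alpha> j)\<^sup>2)" for r v
    using section_identity[OF t, of c b \<alpha> r v] unfolding c_def s2(1)[symmetric] by (simp add: power_divide)
  define U where "U = (\<lambda>y::nat\<times>'n\<Rightarrow>real. (\<Prod>i\<in>P. indicator {..1} ((\<Sum>j\<in>UNIV - {t}. (y (i, j))\<^sup>2) + (graph_val A t y (\<alpha>(t := b)) i)\<^sup>2)) :: ennreal)"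
  define f where "f = (\<lambda>y. indicator E y * inverse (box_vol P A t y) * U y)"
  have [measurable]: "(\<lambda>y. y p) \<in> borel_measurable (lebP Y)" if "p \<in> Y" for p
    using that by (rule measurable_lebP_component)
  have [measurable]: "U \<in> borel_measurable (lebP Y)"
    unfolding U_def graph_val_def
  by (intro measurable_prod_indicator borel_measurable_add borel_measurable_sum borel_measurable_power borel_measurable_times
      measurable_lebP_component borel_measurable_const) (auto simp: Y_def)
  have [measurable]: "E \<in> sets (lebP Y)" "box_vol P A t \<in> borel_measurable (lebP Y)"
    using E box_vol_measurable[OF P(1) t] unfolding Y_def by auto
  have f[measurable]: "f \<in> borel_measurable (lebP Y)" unfolding f_def by measurable
  show ?thesis
  proof (cases "\<bar>b / s\<bar> < 1")
    case True
    define r where "r = sqrt (1 - (b / s)\<^sup>2)"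
    have "(b / s)\<^sup>2 < 1" using True by (simp add: abs_square_less_1)
    hence r: "r > 0" "r\<^sup>2 = 1 - (b / s)\<^sup>2" unfolding r_def by auto
    let ?g = "\<lambda>v. \<lambda>p\<in>Y. c (snd p) + r * v p"
    define V where "V = (\<lambda>v::nat\<times>'n\<Rightarrow>real. (\<Prod>i\<in>P. indicator {..1} ((\<Sum>j\<in>UNIV - {t}. (v (i, j))\<^sup>2) + (\<Sum>j\<in>A - {t}. v (i, j) * \<alpha> j)\<^sup>2)) :: ennreal)"
    have [measurable]: "V \<in> borel_measurable (lebP Y)"
      unfolding V_def
    by (intro measurable_prod_indicator borel_measurable_add borel_measurable_sum borel_measurable_power borel_measurable_times
        measurable_lebP_component borel_measurable_const) (auto simp: Y_def)
    have UV: "U (?g v) = V v" for v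
    proof -
      have "indicator {..1} ((\<Sum>j\<in>UNIV - {t}. (?g v (i, j))\<^sup>2) + (graph_val A t (?g v) (\<alpha>(t := b)) i)\<^sup>2)
          = (indicator {..1} ((\<Sum>j\<in>UNIV - {t}. (v (i, j))\<^sup>2) + (\<Sum>j\<in>A - {t}. v (i, j) * \<alpha> j)\<^sup>2) :: ennreal)"
        if i: "i \<in> P" for i
      proof -
        have g: "graph_val A t (?g v) (\<alpha>(t := b)) i = (\<Sum>j\<in>A - {t}. (c j + r * v (i, j)) * \<alpha> j) + b"
          unfolding graph_val_def using i by (simp add: Y_def)
        have "(\<Sum>j\<in>UNIV - {t}. (?g v (i, j))\<^sup>2) = (\<Sum>j\<in>UNIV - {t}. (c j + r * v (i, j))\<^sup>2)"
          using i by (intro sum.cong) (auto simp: Y_def)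
        hence "(\<Sum>j\<in>UNIV - {t}. (?g v (i, j))\<^sup>2) + (graph_val A t (?g v) (\<alpha>(t := b)) i)\<^sup>2
           = 1 + r\<^sup>2 * ((\<Sum>j\<in>UNIV - {t}. (v (i, j))\<^sup>2) + (\<Sum>j\<in>A - {t}. v (i, j) * \<alpha> j)\<^sup>2 - 1)"
        proof -
          assume sq: "(\<Sum>j\<in>UNIV - {t}. (?g v (i, j))\<^sup>2) = (\<Sum>j\<in>UNIV - {t}. (c j + r * v (i, j))\<^sup>2)"
          have "(b / s)\<^sup>2 = 1 - r\<^sup>2" using r(2) by simp
          thus ?thesis unfolding g sq id[of r "\<lambda>j. v (i, j)"] by (simp add: algebra_simps)
        qed
        moreover have "1 + r\<^sup>2 * (q - 1) \<le> 1 \<longleftrightarrow> q \<le> 1" for q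
        proof -
          have "1 + x * (q - 1) \<le> 1 \<longleftrightarrow> q \<le> 1" if "x > 0" for x :: real
            using that by (simp add: mult_le_0_iff)
          thus ?thesis using r(1) by simp
        qed
        ultimately show ?thesis by (simp add: indicator_def)
      qed
      thus ?thesis unfolding U_def V_def by (intro prod.cong) auto
    qed
    have D: "inverse (box_vol P A t (?g v)) = ennreal (r ^ (card A - 1)) * inverse (box_vol P A t v)" for v
    proof -
      let ?x = "ennreal (r ^ (card A - 1))"
      have x: "?x \<noteq> 0" "?x \<noteq> top" using r by auto
      have "box_vol P A t v = ?x * box_vol P A t (?g v)"
        using box_vol_scale[OF P(1) t r(1), of v c] unfolding Y_def .
      hence "inverse (box_vol P A t v) = inverse ?x * inverse (box_vol P A t (?g v))"
        using x by (metis ennreal_inverse_mult' less_top not_gr_zero)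
      moreover have "?x * inverse ?x = 1" using r by (simp add: inverse_ennreal flip: ennreal_mult)
      ultimately show ?thesis by (simp add: mult.assoc[symmetric])
    qed
    have fg: "f (?g v) = ennreal (r ^ (card A - 1)) * (indicator E v * inverse (box_vol P A t v) * V v)"
      if "v \<in> space (lebP Y)" for v
    proof -
      have "indicator E (?g v) = (indicator E v :: ennreal)"
        using inv[of v r c] that r unfolding Y_def indicator_def by simp
      thus ?thesis unfolding f_def UV D by (simp add: mult_ac)
    qed
    have "(\<integral>\<^sup>+y. f y \<partial>lebP Y) = ennreal (r ^ card Y) * (\<integral>\<^sup>+v. f (?g v) \<partial>lebP Y)"
      by (rule nn_integral_lebP_affine[OF finY f r(1)])
    also have "(\<integral>\<^sup>+v. f (?g v) \<partial>lebP Y) = (\<integral>\<^sup>+v. ennreal (r ^ (card A - 1)) * (indicator E v * inverse (box_vol P A t v) * V v) \<partial>lebP Y)"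
      by (intro nn_integral_cong fg)
    also have "\<dots> = ennreal (r ^ (card A - 1)) * sec_measure P A t E \<alpha>"
    proof -
      have "sec_measure P A t E \<alpha> = (\<integral>\<^sup>+v. indicator E v * inverse (box_vol P A t v) * V v \<partial>lebP Y)"
        unfolding sec_measure_def V_def Y_def ..
      thus ?thesis by (simp only:) (rule nn_integral_cmult, measurable)
    qed
    also have "ennreal (r ^ card Y) * (ennreal (r ^ (card A - 1)) * sec_measure P A t E \<alpha>)
       = ennreal (r ^ (card P * CARD('n) - 1)) * sec_measure P A t E \<alpha>"
    proof -
      have "card Y = card P * (CARD('n) - 1)" unfolding Y_def by (simp add: card_cartesian_product)
      moreover have "CARD('n) > 0" "card P > 0" using P by (auto simp: card_gt_0_iff)
      ultimately have "card Y + (card A - 1) = card P * CARD('n) - 1"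
        using card by (cases "CARD('n)"; cases "card P") auto
      thus ?thesis using r by (simp add: mult.assoc[symmetric] flip: ennreal_mult power_add)
    qed
    moreover have "height_weight (card P * CARD('n) - 1) (b / s) = ennreal (r ^ (card P * CARD('n) - 1))"
      using True unfolding height_weight_def r_def abs_less_iff by (simp add: indicator_def)
    ultimately show ?thesis unfolding f_def U_def Y_def by simp
  next
    case False
    hence gt: "(b / s)\<^sup>2 > 1" using b
      by (metis abs_square_less_1 abs_square_eq_1 linorder_neqE_linordered_idom)
    obtain i where i: "i \<in> P" using P by auto
    have "U y = 0" for y
    proof -
      \<comment> \<open>The section identity with radius 1, applied to \<open>y - c\<close>, bounds
        the squared norm below by the squared distance of the hyperplane.\<close>
      have "(\<Sum>j\<in>UNIV - {t}. (y (i, j))\<^sup>2) + (graph_val A t y (\<alpha>(t := b)) i)\<^sup>2 \<ge> (b / s)\<^sup>2"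
      proof -
        have "graph_val A t y (\<alpha>(t := b)) i = (\<Sum>j\<in>A - {t}. (c j + 1 * (y (i, j) - c j)) * \<alpha> j) + b"
          unfolding graph_val_def by simp
        moreover have "(\<Sum>j\<in>UNIV - {t}. (y (i, j))\<^sup>2) = (\<Sum>j\<in>UNIV - {t}. (c j + 1 * (y (i, j) - c j))\<^sup>2)" by simp
        ultimately have "(\<Sum>j\<in>UNIV - {t}. (y (i, j))\<^sup>2) + (graph_val A t y (\<alpha>(t := b)) i)\<^sup>2
          = (b / s)\<^sup>2 + 1\<^sup>2 * ((\<Sum>j\<in>UNIV - {t}. (y (i, j) - c j)\<^sup>2) + (\<Sum>j\<in>A - {t}. (y (i, j) - c j) * \<alpha> j)\<^sup>2)"
          using id[of 1 "\<lambda>j. y (i, j) - c j"] by (simp only:)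
        thus ?thesis by (simp add: sum_nonneg)
      qed
      hence "indicator {..1} ((\<Sum>j\<in>UNIV - {t}. (y (i, j))\<^sup>2) + (graph_val A t y (\<alpha>(t := b)) i)\<^sup>2) = (0::ennreal)"
        using gt by (simp add: indicator_def)
      thus ?thesis unfolding U_def using P i by (intro prod_zero) auto
    qed
    moreover have "height_weight (card P * CARD('n) - 1) (b / s) = 0"
      using False unfolding height_weight_def abs_less_iff by (auto simp: indicator_def)
    moreover from calculation(1) have "(\<integral>\<^sup>+y. f y \<partial>lebP Y) = 0" unfolding f_def by simp
    ultimately show ?thesis unfolding f_def U_def Y_def by simp
  qed
qed

lemma unit_balls_merge:
  fixes y :: "nat \<times> 'n::finite \<Rightarrow> real"
  shows "unit_balls P (merge (P \<times> (UNIV - {t})) (P \<times> {t}) (y, graph_map P A t y a))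
    = (\<Prod>i\<in>P. indicator {..1} ((\<Sum>j\<in>UNIV - {t}. (y (i, j))\<^sup>2) + (graph_val A t y a i)\<^sup>2))"
  unfolding unit_balls_def
proof (intro prod.cong refl)
  fix i assume i: "i \<in> P"
  let ?m = "merge (P \<times> (UNIV - {t})) (P \<times> {t}) (y, graph_map P A t y a)"
  have "(\<Sum>j\<in>UNIV. (?m (i, j))\<^sup>2) = (?m (i, t))\<^sup>2 + (\<Sum>j\<in>UNIV - {t}. (?m (i, j))\<^sup>2)"
    by (simp add: sum.remove)
  also have "(\<Sum>j\<in>UNIV - {t}. (?m (i, j))\<^sup>2) = (\<Sum>j\<in>UNIV - {t}. (y (i, j))\<^sup>2)"
    using i by (intro sum.cong) (auto simp: merge_def)
  also have "?m (i, t) = graph_val A t y a i" using i by (simp add: merge_def graph_map_def)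
  finally show "indicator {..1} (\<Sum>j\<in>UNIV. (?m (i, j))\<^sup>2)
     = (indicator {..1} ((\<Sum>j\<in>UNIV - {t}. (y (i, j))\<^sup>2) + (graph_val A t y a i)\<^sup>2) :: ennreal)"
    by (simp add: add.commute)
qed

text \<open>Replace the coordinates \<open>t\<close> of the points by the coefficients of the affine
  function through them, then its constant term by the height. Now the integrand separates:
  \<open>E\<close> depends on the shape of the configuration in the other coordinates,
  \<open>F\<close> on the height. All independence statements below come from this product
  form.\<close>

theorem graph_disintegration:
  fixes A :: "'n::finite set" and \<gamma> :: "real \<Rightarrow> ennreal"
  assumes P: "finite P" "P \<noteq> {}" and t: "t \<in> A" and card: "card P = card A"
    and E: "E \<in> sets (lebP (P \<times> (UNIV - {t})))"
    and inj: "\<And>y a. y \<in> E \<Longrightarrow> (\<And>i. i \<in> P \<Longrightarrow> graph_val A t y a i = 0) \<Longrightarrow> (\<forall>j\<in>A. a j = 0)"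
    and inv: "\<And>y c r. y \<in> space (lebP (P \<times> (UNIV - {t}))) \<Longrightarrow> r > 0 \<Longrightarrow>
       (\<lambda>p\<in>P \<times> (UNIV - {t}). c (snd p) + r * y p) \<in> E \<longleftrightarrow> y \<in> E"
    and \<gamma>[measurable]: "\<gamma> \<in> borel_measurable borel" and F: "F \<in> borel_measurable (lebP (P \<times> UNIV))"
    and F\<gamma>: "\<And>y a. y \<in> E \<Longrightarrow> a \<in> space (lebP A) \<Longrightarrow>
       F (merge (P \<times> (UNIV - {t})) (P \<times> {t}) (y, graph_map P A t y a)) = \<gamma> (a t / sqrt (1 + (\<Sum>j\<in>A - {t}. (a j)\<^sup>2)))"
  shows "(\<integral>\<^sup>+x. indicator E (restrict x (P \<times> (UNIV - {t}))) * F x * unit_balls P x \<partial>lebP (P \<times> UNIV))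
    = (\<integral>\<^sup>+h. \<gamma> h * height_weight (card P * CARD('n) - 1) h \<partial>lborel) * sec_const P A t E"
proof -
  define Y where "Y = P \<times> (UNIV - {t} :: 'n set)"
  define T where "T = P \<times> {t}"
  have YT: "Y \<inter> T = {}" "Y \<union> T = P \<times> UNIV" "finite Y" "finite T" unfolding Y_def T_def using P by auto
  interpret Yf: finite_product_sigma_finite "\<lambda>_. lborel :: real measure" Y by standard fact
  interpret Af: finite_product_sigma_finite "\<lambda>_. lborel :: real measure" A by standard simp
  interpret Bf: finite_product_sigma_finite "\<lambda>_. lborel :: real measure" "A - {t}" by standard simp
  interpret YA: pair_sigma_finite "lebP Y" "lebP A" by standard
  note E' [measurable] = E[folded Y_def]
  note F' [measurable] = F[folded YT(2)]
  have um: "unit_balls P \<in> borel_measurable (lebP (Y \<union> T))"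
    unfolding unit_balls_def
  by (intro measurable_prod_indicator borel_measurable_sum borel_measurable_power measurable_lebP_component) (auto simp: YT(2))
  note um[measurable]
  define h where "h = (\<lambda>a. a t / sqrt (1 + (\<Sum>j\<in>A - {t}. (a j)\<^sup>2)))"
  define U where "U = (\<lambda>y (a::'n\<Rightarrow>real). (\<Prod>i\<in>P. indicator {..1} ((\<Sum>j\<in>UNIV - {t}. (y (i, j))\<^sup>2) + (graph_val A t y a i)\<^sup>2)) :: ennreal)"
  define K where "K = (\<lambda>y a. indicator E y * inverse (box_vol P A t y) * U y a * \<gamma> (h a))"
  have hm[measurable]: "h \<in> borel_measurable (lebP A)"
    unfolding h_def using t
    by (intro borel_measurable_divide measurable_compose[OF _ borel_measurable_sqrt] borel_measurable_add borel_measurable_sum borel_measurable_power measurable_lebP_component borel_measurable_const) auto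
  have [measurable]: "box_vol P A t \<in> borel_measurable (lebP Y)"
    using box_vol_measurable[OF P(1) t] unfolding Y_def by auto
  have Um: "(\<lambda>z. U (fst z) (snd z)) \<in> borel_measurable (lebP Y \<Otimes>\<^sub>M lebP A)"
    unfolding U_def graph_val_def
  by (intro measurable_prod_indicator borel_measurable_add borel_measurable_sum borel_measurable_power borel_measurable_times
      measurable_compose[OF measurable_fst measurable_lebP_component] measurable_compose[OF measurable_snd measurable_lebP_component])
    (use t in \<open>auto simp: Y_def\<close>)
  have Km[measurable]: "(\<lambda>(y, a). K y a) \<in> borel_measurable (lebP Y \<Otimes>\<^sub>M lebP A)"
    unfolding K_def case_prod_unfold using Um by measurable
  have KmA: "(\<lambda>a. \<integral>\<^sup>+y. K y a \<partial>lebP Y) \<in> borel_measurable (lebP A)"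
    using Km by measurable
  have restr: "restrict (merge Y T (y, z)) Y = y" if "y \<in> space (lebP Y)" for y z
    using that YT(1) by (auto simp: space_PiM merge_def restrict_def PiE_def extensional_def fun_eq_iff)
  have "(\<integral>\<^sup>+x. indicator E (restrict x Y) * F x * unit_balls P x \<partial>lebP (P \<times> UNIV))
      = (\<integral>\<^sup>+y. (\<integral>\<^sup>+z. indicator E (restrict (merge Y T (y, z)) Y) * F (merge Y T (y, z)) * unit_balls P (merge Y T (y, z)) \<partial>lebP T) \<partial>lebP Y)"
  proof -
    have "(\<lambda>x. indicator E (restrict x Y) * F x * unit_balls P x) \<in> borel_measurable (lebP (Y \<union> T))"
      by measurable
    from lp.product_nn_integral_fold[OF YT(1,3,4) this] show ?thesis unfolding YT(2) .
  qed
  also have "\<dots> = (\<integral>\<^sup>+y. (\<integral>\<^sup>+a. K y a \<partial>lebP A) \<partial>lebP Y)"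
  proof (rule nn_integral_cong)
    fix y assume y: "y \<in> space (lebP Y)"
    show "(\<integral>\<^sup>+z. indicator E (restrict (merge Y T (y, z)) Y) * F (merge Y T (y, z)) * unit_balls P (merge Y T (y, z)) \<partial>lebP T) = (\<integral>\<^sup>+a. K y a \<partial>lebP A)"
    proof (cases "y \<in> E")
      case False thus ?thesis unfolding restr[OF y] K_def by simp
    next
      case True
      have mz: "merge Y T \<in> lebP Y \<Otimes>\<^sub>M lebP T \<rightarrow>\<^sub>M lebP (Y \<union> T)" by (rule measurable_merge)
      have mz': "(\<lambda>z. merge Y T (y, z)) \<in> lebP T \<rightarrow>\<^sub>M lebP (Y \<union> T)" by (rule measurable_Pair2[OF mz y])
      have fm: "(\<lambda>z. F (merge Y T (y, z)) * unit_balls P (merge Y T (y, z))) \<in> borel_measurable (lebP T)"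
        using measurable_compose[OF mz' F'] measurable_compose[OF mz' um] by (rule borel_measurable_times_ennreal)
      \<comment> \<open>On \<open>E\<close> the affine function through the points is unique, so its
        coefficients may serve as variables, with Jacobian
        \<open>inverse (box_vol P A t y)\<close>.\<close>
      have "(\<integral>\<^sup>+z. F (merge Y T (y, z)) * unit_balls P (merge Y T (y, z)) \<partial>lebP T)
          = inverse (box_vol P A t y) * (\<integral>\<^sup>+a. F (merge Y T (y, graph_map P A t y a)) * unit_balls P (merge Y T (y, graph_map P A t y a)) \<partial>lebP A)"
        unfolding T_def
        by (rule nn_integral_graph'[OF P(1) t card _ fm[unfolded T_def]]) (rule inj[OF True])
      also have "(\<integral>\<^sup>+a. F (merge Y T (y, graph_map P A t y a)) * unit_balls P (merge Y T (y, graph_map P A t y a)) \<partial>lebP A)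
          = (\<integral>\<^sup>+a. U y a * \<gamma> (h a) \<partial>lebP A)"
        by (intro nn_integral_cong) (simp add: F\<gamma>[OF True, unfolded Y_def[symmetric] T_def[symmetric]] unit_balls_merge[of P t y A, folded Y_def T_def] U_def h_def mult.commute)
      also have "inverse (box_vol P A t y) * \<dots> = (\<integral>\<^sup>+a. inverse (box_vol P A t y) * (U y a * \<gamma> (h a)) \<partial>lebP A)"
      proof (rule nn_integral_cmult[symmetric])
        have "(\<lambda>a. U y a) \<in> borel_measurable (lebP A)" using measurable_Pair2[OF Um y] by simp
        thus "(\<lambda>a. U y a * \<gamma> (h a)) \<in> borel_measurable (lebP A)" by measurable
      qed
      finally show ?thesis unfolding restr[OF y] K_def using True by (simp add: mult.assoc)
    qed
  qed
  also have "\<dots> = (\<integral>\<^sup>+a. (\<integral>\<^sup>+y. K y a \<partial>lebP Y) \<partial>lebP A)"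
    using YA.Fubini'[OF Km] by simp
  also have "\<dots> = (\<integral>\<^sup>+a. (\<integral>\<^sup>+b. (\<integral>\<^sup>+y. K y (a(t := b)) \<partial>lebP Y) \<partial>lborel) \<partial>lebP (A - {t}))"
    by (rule lebP_insert_swap[OF t KmA])
  also have "\<dots> = (\<integral>\<^sup>+a. (\<integral>\<^sup>+h. \<gamma> h * height_weight (card P * CARD('n) - 1) h \<partial>lborel) *
        (ennreal (sqrt (1 + (\<Sum>j\<in>A - {t}. (a j)\<^sup>2))) * sec_measure P A t E a) \<partial>lebP (A - {t}))"
  proof (rule nn_integral_cong)
    fix a :: "'n \<Rightarrow> real"
    define s where "s = sqrt (1 + (\<Sum>j\<in>A - {t}. (a j)\<^sup>2))"
    have s: "s > 0" unfolding s_def by (simp add: add_pos_nonneg sum_nonneg)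
    let ?W = "height_weight (card P * CARD('n) - 1)"
    have Wm[measurable]: "?W \<in> borel_measurable borel" unfolding height_weight_def by measurable
    have hs: "h (a(t := b)) = b / s" for b unfolding h_def s_def by simp
    have Kb: "(\<integral>\<^sup>+y. K y (a(t := b)) \<partial>lebP Y) = \<gamma> (b / s) * (?W (b / s) * sec_measure P A t E a)" if "\<bar>b / s\<bar> \<noteq> 1" for b
    proof -
      have "(\<integral>\<^sup>+y. K y (a(t := b)) \<partial>lebP Y) = (\<integral>\<^sup>+y. (indicator E y * inverse (box_vol P A t y) * U y (a(t := b))) * \<gamma> (b / s) \<partial>lebP Y)"
        unfolding K_def hs ..
      also have "\<dots> = (\<integral>\<^sup>+y. (indicator E y * inverse (box_vol P A t y) * U y (a(t := b))) \<partial>lebP Y) * \<gamma> (b / s)"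
      proof (rule nn_integral_multc)
        have "(\<lambda>y. U y (a(t := b))) \<in> borel_measurable (lebP Y)"
          unfolding U_def graph_val_def
        by (intro measurable_prod_indicator borel_measurable_add borel_measurable_sum borel_measurable_power borel_measurable_times
            measurable_lebP_component borel_measurable_const) (auto simp: Y_def)
        thus "(\<lambda>y. indicator E y * inverse (box_vol P A t y) * U y (a(t := b))) \<in> borel_measurable (lebP Y)"
          by measurable
      qed
      also have "(\<integral>\<^sup>+y. (indicator E y * inverse (box_vol P A t y) * U y (a(t := b))) \<partial>lebP Y) = ?W (b / s) * sec_measure P A t E a"
        unfolding U_def Y_def by (rule section_integral[OF P t card E inv s_def that])
      also have "\<dots> * \<gamma> (b / s) = \<gamma> (b / s) * (?W (b / s) * sec_measure P A t E a)" by (rule mult.commute)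
      finally show ?thesis .
    qed
    have "(\<integral>\<^sup>+b. (\<integral>\<^sup>+y. K y (a(t := b)) \<partial>lebP Y) \<partial>lborel) = (\<integral>\<^sup>+b. \<gamma> (b / s) * (?W (b / s) * sec_measure P A t E a) \<partial>lborel)"
    proof (rule nn_integral_cong_AE)
      \<comment> \<open>The two tangent positions excluded in \<open>section_integral\<close> form a
        null set.\<close>
      have "AE b in lborel. b \<noteq> s \<and> b \<noteq> - s" using AE_lborel_singleton[of s] AE_lborel_singleton[of "- s"] by eventually_elim auto
      thus "AE b in lborel. (\<integral>\<^sup>+y. K y (a(t := b)) \<partial>lebP Y) = \<gamma> (b / s) * (?W (b / s) * sec_measure P A t E a)"
      proof eventually_elim
        case (elim b)
        hence "\<bar>b / s\<bar> \<noteq> 1" using s by (auto simp: abs_if field_simps split: if_splits)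
        thus ?case by (rule Kb)
      qed
    qed
    also have "\<dots> = (\<integral>\<^sup>+b. (\<gamma> (b / s) * ?W (b / s)) * sec_measure P A t E a \<partial>lborel)" by (simp add: mult.assoc)
    also have "\<dots> = (\<integral>\<^sup>+b. \<gamma> (b / s) * ?W (b / s) \<partial>lborel) * sec_measure P A t E a"
      by (rule nn_integral_multc) measurable
    also have "(\<integral>\<^sup>+b. \<gamma> (b / s) * ?W (b / s) \<partial>lborel) = ennreal s * (\<integral>\<^sup>+h. \<gamma> h * ?W h \<partial>lborel)"
    proof -
      have "(\<integral>\<^sup>+b. \<gamma> (b / s) * ?W (b / s) \<partial>lborel) = ennreal \<bar>s\<bar> * (\<integral>\<^sup>+h. \<gamma> ((0 + s * h) / s) * ?W ((0 + s * h) / s) \<partial>lborel)"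
        by (rule nn_integral_real_affine) (measurable, use s in simp)
      thus ?thesis using s by simp
    qed
    finally show "(\<integral>\<^sup>+b. (\<integral>\<^sup>+y. K y (a(t := b)) \<partial>lebP Y) \<partial>lborel) = (\<integral>\<^sup>+h. \<gamma> h * ?W h \<partial>lborel) *
        (ennreal (sqrt (1 + (\<Sum>j\<in>A - {t}. (a j)\<^sup>2))) * sec_measure P A t E a)"
      unfolding s_def by (simp only: mult_ac)
  qed
  also have "\<dots> = (\<integral>\<^sup>+h. \<gamma> h * height_weight (card P * CARD('n) - 1) h \<partial>lborel) * sec_const P A t E"
    unfolding sec_const_def
  proof (rule nn_integral_cmult)
    have m: "(\<lambda>z. indicator E (snd z) * inverse (box_vol P A t (snd z)) *
      (\<Prod>i\<in>P. indicator {..1} ((\<Sum>j\<in>UNIV - {t}. (snd z (i, j))\<^sup>2) + (\<Sum>j\<in>A - {t}. snd z (i, j) * fst z j)\<^sup>2)) :: ennreal)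
      \<in> borel_measurable (lebP (A - {t}) \<Otimes>\<^sub>M lebP Y)" (is "(\<lambda>z. _ z * _ z * ?V z) \<in> _")
    proof -
      have "?V \<in> borel_measurable (lebP (A - {t}) \<Otimes>\<^sub>M lebP Y)"
      by (intro measurable_prod_indicator borel_measurable_add borel_measurable_sum borel_measurable_power borel_measurable_times
          measurable_compose[OF measurable_fst measurable_lebP_component] measurable_compose[OF measurable_snd measurable_lebP_component])
        (auto simp: Y_def)
      thus ?thesis by measurable
    qed
    have "sec_measure P A t E \<in> borel_measurable (lebP (A - {t}))"
      unfolding sec_measure_def Y_def[symmetric] using m
      by (intro Yf.borel_measurable_nn_integral) (simp add: case_prod_unfold)
    moreover have "(\<lambda>a. sqrt (1 + (\<Sum>j\<in>A - {t}. (a j)\<^sup>2))) \<in> borel_measurable (lebP (A - {t}))"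
      by (intro measurable_compose[OF _ borel_measurable_sqrt] borel_measurable_add borel_measurable_sum borel_measurable_power measurable_lebP_component borel_measurable_const) auto
    ultimately show "(\<lambda>a. ennreal (sqrt (1 + (\<Sum>j\<in>A - {t}. (a j)\<^sup>2))) * sec_measure P A t E a) \<in> borel_measurable (lebP (A - {t}))"
      by measurable
  qed
  finally show ?thesis unfolding Y_def .
qed

section \<open>Lifted sample points\<close>

text \<open>Turns solvability into a countable condition, for measurability. \<open>k\<close> bounds
  the functional and keeps the strict inequalities uniformly away from 0, \<open>l\<close> relaxes
  the equations; the bound provides the compactness that recovers an exact solution.\<close>

lemma pos_sol_iff_countable:
  fixes z :: "'i \<Rightarrow> 'v::euclidean_space"
  assumes U: "closed U" and D: "D \<subseteq> U" "U \<subseteq> closure D" and fin: "finite F" "finite S"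
  shows "pos_sol U z F S \<longleftrightarrow> (\<exists>k::nat. \<forall>l::nat. \<exists>v\<in>D. norm v \<le> real k \<and>
     (\<forall>i\<in>F. \<bar>v \<bullet> z i\<bar> \<le> 1 / (real l + 1)) \<and> (\<forall>i\<in>S. v \<bullet> z i \<ge> 1 / (real k + 1)))"
proof
  assume "pos_sol U z F S"
  then obtain u where u: "u \<in> U" "\<forall>i\<in>F. u \<bullet> z i = 0" "\<forall>i\<in>S. u \<bullet> z i > 0"
    unfolding pos_sol_def by auto
  have "eventually (\<lambda>k::nat. norm u < real k) sequentially"
    using filterlim_at_top_dense[THEN iffD1, OF filterlim_real_sequentially] by blast
  moreover have "eventually (\<lambda>k::nat. \<forall>i\<in>S. 1 / (real k + 1) < u \<bullet> z i) sequentially"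
  proof (rule eventually_ball_finite[OF fin(2)], rule ballI)
    fix i assume "i \<in> S"
    have "(\<lambda>k::nat. 1 / (real k + 1)) \<longlonglongrightarrow> 0"
      using LIMSEQ_inverse_real_of_nat by (simp add: inverse_eq_divide add.commute)
    thus "eventually (\<lambda>k::nat. 1 / (real k + 1) < u \<bullet> z i) sequentially"
      using u(3) \<open>i \<in> S\<close> by (intro order_tendstoD) auto
  qed
  ultimately have "eventually (\<lambda>k::nat. norm u < real k \<and> (\<forall>i\<in>S. 1 / (real k + 1) < u \<bullet> z i)) sequentially"
    by eventually_elim auto
  then obtain k :: nat where k: "norm u < real k" "\<forall>i\<in>S. 1 / (real k + 1) < u \<bullet> z i"
    using eventually_happens[of _ sequentially] by auto
  show "\<exists>k::nat. \<forall>l::nat. \<exists>v\<in>D. norm v \<le> real k \<and>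
     (\<forall>i\<in>F. \<bar>v \<bullet> z i\<bar> \<le> 1 / (real l + 1)) \<and> (\<forall>i\<in>S. v \<bullet> z i \<ge> 1 / (real k + 1))"
  proof (intro exI[of _ k] allI)
    fix l :: nat
    let ?O = "{v. norm v < real k} \<inter> (\<Inter>i\<in>F. {v. \<bar>v \<bullet> z i\<bar> < 1 / (real l + 1)}) \<inter> (\<Inter>i\<in>S. {v. 1 / (real k + 1) < v \<bullet> z i})"
    have o: "open {v. \<bar>v \<bullet> y\<bar> < c}" "open {v. c < v \<bullet> y}" "open {v. norm v < c}" for y :: 'v and c
      by (rule open_Collect_less; intro continuous_intros)+
    have "open ?O"
      using fin by (intro open_Int open_INT ballI o)
    moreover have "u \<in> ?O" using u k by auto
    moreover have "u \<in> closure D" using u D by auto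
    ultimately have "?O \<inter> D \<noteq> {}" using open_Int_closure_eq_empty[of ?O D] by blast
    then obtain v where "v \<in> ?O" "v \<in> D" by blast
    thus "\<exists>v\<in>D. norm v \<le> real k \<and>
     (\<forall>i\<in>F. \<bar>v \<bullet> z i\<bar> \<le> 1 / (real l + 1)) \<and> (\<forall>i\<in>S. v \<bullet> z i \<ge> 1 / (real k + 1))"
      by (intro bexI[of _ v]) (auto intro: less_imp_le)
  qed
next
  assume "\<exists>k::nat. \<forall>l::nat. \<exists>v\<in>D. norm v \<le> real k \<and>
     (\<forall>i\<in>F. \<bar>v \<bullet> z i\<bar> \<le> 1 / (real l + 1)) \<and> (\<forall>i\<in>S. v \<bullet> z i \<ge> 1 / (real k + 1))"
  then obtain k :: nat and v :: "nat \<Rightarrow> 'v" where v: "\<And>l. v l \<in> D" "\<And>l. norm (v l) \<le> real k"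
    "\<And>l i. i \<in> F \<Longrightarrow> \<bar>v l \<bullet> z i\<bar> \<le> 1 / (real l + 1)" "\<And>l i. i \<in> S \<Longrightarrow> v l \<bullet> z i \<ge> 1 / (real k + 1)"
    by metis
  have "bounded (range v)" using v(2) by (auto simp: bounded_iff)
  then obtain u r where r: "strict_mono (r :: nat \<Rightarrow> nat)" "(v \<circ> r) \<longlonglongrightarrow> u"
    using bounded_imp_convergent_subsequence[of v] by auto
  have lim: "(\<lambda>l. v (r l) \<bullet> z i) \<longlonglongrightarrow> u \<bullet> z i" for i
    using r(2) by (intro tendsto_intros) (simp add: o_def)
  have "u \<in> U"
    by (rule closed_sequentially[OF U _ r(2)]) (use v(1) D(1) in auto)
  moreover have "u \<bullet> z i = 0" if "i \<in> F" for i
  proof -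
    have "(\<lambda>l. 1 / (real l + 1)) \<longlonglongrightarrow> 0"
      using LIMSEQ_inverse_real_of_nat by (simp add: inverse_eq_divide add.commute)
    hence "(\<lambda>l. 1 / (real (r l) + 1)) \<longlonglongrightarrow> 0"
      using LIMSEQ_subseq_LIMSEQ[OF _ r(1)] by (auto simp: o_def)
    hence "(\<lambda>l. v (r l) \<bullet> z i) \<longlonglongrightarrow> 0"
      by (rule Lim_null_comparison[rotated]) (use v(3)[OF that] in auto)
    thus ?thesis using lim LIMSEQ_unique by blast
  qed
  moreover have "u \<bullet> z i > 0" if "i \<in> S" for i
  proof -
    have "u \<bullet> z i \<ge> 1 / (real k + 1)"
      by (rule LIMSEQ_le_const[OF lim]) (use v(4)[OF that] in auto)
    moreover have "1 / (real k + 1) > 0" by simp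
    ultimately show ?thesis by linarith
  qed
  ultimately show "pos_sol U z F S" unfolding pos_sol_def by auto
qed

lemma pos_sol_measurable:
  fixes z :: "'w \<Rightarrow> 'i \<Rightarrow> 'v::euclidean_space"
  assumes U: "closed U" and fin: "finite F" "finite S"
    and [measurable]: "\<And>i. i \<in> F \<union> S \<Longrightarrow> (\<lambda>w. z w i) \<in> borel_measurable M"
  shows "Measurable.pred M (\<lambda>w. pos_sol U (z w) F S)"
proof -
  obtain D where D: "countable D" "D \<subseteq> U" "U \<subseteq> closure D"
    using separable[of U] by blast
  have z[measurable]: "(\<lambda>w. v \<bullet> z w i) \<in> borel_measurable M" if "i \<in> F \<union> S" for i v
    using assms(4)[OF that] by measurable
  have 1: "Measurable.pred M (\<lambda>w. \<forall>i\<in>F. \<bar>v \<bullet> z w i\<bar> \<le> c)" for v c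
    unfolding pred_def
  proof (intro sets.sets_Collect_finite_All fin)
    fix i assume "i \<in> F"
    hence "(\<lambda>w. v \<bullet> z w i) \<in> borel_measurable M" by (intro z) auto
    thus "{w \<in> space M. \<bar>v \<bullet> z w i\<bar> \<le> c} \<in> sets M" by measurable
  qed
  have 2: "Measurable.pred M (\<lambda>w. \<forall>i\<in>S. v \<bullet> z w i \<ge> c)" for v c
    unfolding pred_def
  proof (intro sets.sets_Collect_finite_All fin)
    fix i assume "i \<in> S"
    hence "(\<lambda>w. v \<bullet> z w i) \<in> borel_measurable M" by (intro z) auto
    thus "{w \<in> space M. c \<le> v \<bullet> z w i} \<in> sets M" by measurable
  qed
  have "Measurable.pred M (\<lambda>w. \<exists>k::nat. \<forall>l::nat. \<exists>v\<in>D. norm v \<le> real k \<and>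
     (\<forall>i\<in>F. \<bar>v \<bullet> z w i\<bar> \<le> 1 / (real l + 1)) \<and> (\<forall>i\<in>S. v \<bullet> z w i \<ge> 1 / (real k + 1)))"
  proof (intro pred_intros_countable)
    fix k l :: nat
    have c: "Measurable.pred M (\<lambda>w. norm v \<le> real k \<and>
     (\<forall>i\<in>F. \<bar>v \<bullet> z w i\<bar> \<le> 1 / (real l + 1)) \<and> (\<forall>i\<in>S. v \<bullet> z w i \<ge> 1 / (real k + 1)))" for v
    proof (cases "norm v \<le> real k")
      case True
      note [measurable] = 1 2
      show ?thesis using True by measurable
    qed simp
    show "Measurable.pred M (\<lambda>w. \<exists>v\<in>D. norm v \<le> real k \<and>
     (\<forall>i\<in>F. \<bar>v \<bullet> z w i\<bar> \<le> 1 / (real l + 1)) \<and> (\<forall>i\<in>S. v \<bullet> z w i \<ge> 1 / (real k + 1)))"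
      unfolding pred_def
    proof (rule sets.sets_Collect_countable_Ex'[OF _ D(1)])
      fix v
      show "{w \<in> space M. norm v \<le> real k \<and> (\<forall>i\<in>F. \<bar>v \<bullet> z w i\<bar> \<le> 1 / (real l + 1)) \<and>
          (\<forall>i\<in>S. 1 / (real k + 1) \<le> v \<bullet> z w i)} \<in> sets M"
        using c[of v] unfolding pred_def .
    qed
  qed
  thus ?thesis using pos_sol_iff_countable[OF U D(2,3) fin] by simp
qed

section \<open>Affine functionals on lifted points, and general position\<close>

definition hat :: "real^'n \<Rightarrow> (real^'n) \<times> real" where "hat x = (x, 1)"

text \<open>The affine functionals that read only the coordinates in \<open>A\<close>; the real
  component is the constant term, hence the dimension \<open>card A + 1\<close>.\<close>

definition affs :: "'n set \<Rightarrow> ((real^'n) \<times> real) set" where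
  "affs A = {v. \<forall>j. j \<notin> A \<longrightarrow> fst v $ j = 0}"

lemma affs_Times: "affs A = {x. \<forall>j. j \<notin> A \<longrightarrow> x $ j = 0} \<times> UNIV"
  unfolding affs_def by auto

lemma subspace_affs: "subspace (affs A)"
  unfolding affs_def by (auto simp: subspace_def)

lemma closed_affs: "closed (affs (A :: 'n::finite set))"
  using subspace_affs closed_subspace by blast

lemma dim_affs: "dim (affs (A :: 'n::finite set)) = card A + 1"
proof -
  have s: "subspace {x :: real^'n. \<forall>j. j \<notin> A \<longrightarrow> x $ j = 0}" by (auto simp: subspace_def)
  have "dim (affs A) = dim {x :: real^'n. \<forall>j. j \<notin> A \<longrightarrow> x $ j = 0} + dim (UNIV :: real set)"
    unfolding affs_Times by (intro dim_Times s subspace_UNIV)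
  moreover have "{x :: real^'n. \<forall>j. j \<notin> A \<longrightarrow> x $ j = 0} = {x. \<forall>i\<in>Basis. i \<notin> (\<lambda>j. axis j 1) ` A \<longrightarrow> x \<bullet> i = 0}"
    by (auto simp: Basis_vec_def inner_axis axis_eq_axis)
  moreover have "dim {x :: real^'n. \<forall>i\<in>Basis. i \<notin> (\<lambda>j. axis j 1) ` A \<longrightarrow> x \<bullet> i = 0} = card ((\<lambda>j. axis j 1 :: real^'n) ` A)"
    by (intro dim_substandard) (auto simp: Basis_vec_def)
  moreover have "card ((\<lambda>j. axis j 1 :: real^'n) ` A) = card A"
    by (intro card_image) (auto simp: inj_on_def axis_eq_axis)
  ultimately show ?thesis by simp
qed

lemma affs_mono: "A \<subseteq> B \<Longrightarrow> affs A \<subseteq> affs B"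
  unfolding affs_def by auto

lemma hat_measurable [measurable]: "hat \<in> borel_measurable borel"
  unfolding hat_def by (intro borel_measurable_Pair) auto

lemma sets_unif_ball [measurable_cong, simp]: "sets (unif_ball :: 'a::euclidean_space measure) = sets borel"
  unfolding unif_ball_def by simp

lemma space_unif_ball [simp]: "space (unif_ball :: 'a::euclidean_space measure) = UNIV"
  unfolding unif_ball_def by simp

lemma prob_space_unif_ball: "prob_space (unif_ball :: 'a::euclidean_space measure)"
  unfolding unif_ball_def
proof (rule prob_space_uniform_measure)
  show "emeasure lborel (ball (0::'a) 1) \<noteq> 0"
  proof -
    have "emeasure lborel (ball (0::'a) 1) = ennreal (measure lborel (ball (0::'a) 1))"
      using emeasure_lborel_ball_finite[of "0::'a" 1] by (intro emeasure_eq_ennreal_measure) auto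
    thus ?thesis using content_ball_pos[of 1 "0::'a"] by simp
  qed
  show "emeasure lborel (ball (0::'a) 1) \<noteq> \<infinity>"
    using emeasure_lborel_ball_finite[of "0::'a" 1] by auto
qed

text \<open>A further condition costs exactly one dimension as soon as some functional in the kernel
  violates it. The violation is expressed by \<open>pos_sol\<close> because that predicate is known
  to be measurable.\<close>

lemma dim_kern_insert:
  fixes z :: "'i \<Rightarrow> 'v::euclidean_space"
  assumes U: "subspace U" and p: "pos_sol U z B {p}"
  shows "dim (kern U z (insert p B)) = dim (kern U z B) - 1"
proof -
  let ?K = "kern U z B" and ?T = "{x. z p \<bullet> x = 0}"
  obtain u where u: "u \<in> ?K" "u \<bullet> z p > 0" using p unfolding pos_sol_def kern_def by auto
  have K: "subspace ?K" using U by (rule subspace_kern)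
  have e: "kern U z (insert p B) = ?K \<inter> ?T" unfolding kern_def by (auto simp: inner_commute)
  have zp: "z p \<noteq> 0" using u by auto
  have "dim {x + y |x y. x \<in> ?K \<and> y \<in> ?T} + dim (?K \<inter> ?T) = dim ?K + dim ?T"
    by (intro dim_sums_Int K subspace_hyperplane)
  moreover have "dim ?T = DIM('v) - 1" using zp by (rule dim_hyperplane)
  moreover have "dim {x + y |x y. x \<in> ?K \<and> y \<in> ?T} \<le> DIM('v)" by (rule dim_subset_UNIV)
  moreover have "dim (?K \<inter> ?T) < dim ?K"
  proof (rule dim_psubset)
    have "span (?K \<inter> ?T) = ?K \<inter> ?T" "span ?K = ?K"
      by (intro span_eq_iff[THEN iffD2] subspace_inter K subspace_hyperplane)+
    note sp = this
    have "u \<notin> ?T" using u by (auto simp: inner_commute)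
    thus "span (?K \<inter> ?T) \<subset> span ?K" unfolding sp using u by auto
  qed
  moreover have "DIM('v) > 0" by simp
  ultimately show ?thesis unfolding e by linarith
qed

lemma unif_ball_hyperplane_null:
  fixes u :: "(real^'n::finite) \<times> real"
  assumes "u \<noteq> 0"
  shows "emeasure unif_ball {x. u \<bullet> hat x = 0} = 0"
proof -
  have "{x. u \<bullet> hat x = 0} \<in> null_sets lborel"
  proof (cases "fst u = 0")
    case True
    hence "snd u \<noteq> 0" using assms by (simp add: prod_eq_iff)
    hence "{x. u \<bullet> hat x = 0} = {}" using True by (auto simp: hat_def inner_prod_def)
    thus ?thesis by simp
  next
    case False
    have e: "{x. u \<bullet> hat x = 0} = {x. fst u \<bullet> x = - snd u}"
      by (auto simp: hat_def inner_prod_def)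
    have "negligible {x. fst u \<bullet> x = - snd u}" using False by (intro negligible_hyperplane) auto
    moreover have "{x. fst u \<bullet> x = - snd u} \<in> sets borel" using closed_hyperplane by (rule borel_closed)
    ultimately show ?thesis unfolding e negligible_iff_null_sets
      by (simp add: null_sets_completion_iff)
  qed
  hence n: "{x. u \<bullet> hat x = 0} \<in> null_sets lborel" .
  hence "{x. u \<bullet> hat x = 0} \<in> sets lborel" by (rule null_setsD2)
  moreover have "emeasure lborel (ball 0 1 \<inter> {x. u \<bullet> hat x = 0}) = 0"
    using null_sets_subset[OF n] \<open>_ \<in> sets lborel\<close> by (metis Int_lower2 borel_open null_setsD1 open_ball sets.Int sets_lborel)
  ultimately show ?thesis unfolding unif_ball_def by (subst emeasure_uniform_measure) auto
qed

abbreviation ballM :: "'i set \<Rightarrow> ('i \<Rightarrow> real^'n::finite) measure" where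
  "ballM I \<equiv> PiM I (\<lambda>_. unif_ball)"

lemma ballM_component [measurable]: "i \<in> I \<Longrightarrow> (\<lambda>X. X i) \<in> borel_measurable (ballM I)"
  using measurable_component_singleton[of i I "\<lambda>_. unif_ball"] by (simp cong: measurable_cong_sets)

interpretation ub: product_sigma_finite "\<lambda>_. unif_ball :: (real^'n::finite) measure"
  unfolding product_sigma_finite_def using prob_space_imp_sigma_finite[OF prob_space_unif_ball] by simp

lemma prob_space_ballM: "prob_space (ballM I)"
  by (intro prob_space_PiM prob_space_unif_ball)

lemma pos_sol_hat_measurable:
  assumes "finite F" "finite S" "F \<union> S \<subseteq> I"
  shows "Measurable.pred (ballM I) (\<lambda>X. pos_sol (affs A) (\<lambda>i. hat (X i :: real^'n::finite)) F S)"
  using assms by (intro pos_sol_measurable closed_affs measurable_compose[OF ballM_component hat_measurable]) auto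

text \<open>Points are added one at a time. Given the others, the kernel still contains a nonzero
  functional, and a random point almost surely avoids its zero set.\<close>

lemma AE_dim_kern:
  fixes A :: "'n::finite set"
  assumes "finite I" "B \<subseteq> I" "card B \<le> card A + 1"
  shows "AE X in ballM I. dim (kern (affs A) (\<lambda>i. hat (X i)) B) = card A + 1 - card B"
proof -
  have "finite B" using assms finite_subset by auto
  thus ?thesis using assms
  proof (induction B arbitrary: I rule: finite_induct)
    case empty
    show ?case by (simp add: dim_affs)
  next
    case (insert p B)
    let ?I = "I - {p}"
    have pI: "p \<in> I" "insert p ?I = I" "p \<notin> ?I" "finite ?I" and BI: "B \<subseteq> ?I" using insert by auto
    let ?P = "\<lambda>X. pos_sol (affs A) (\<lambda>i. hat (X i)) B {p}"
    have m[measurable]: "Measurable.pred (ballM I) ?P"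
      using insert by (intro pos_sol_hat_measurable) auto
    have IH0: "AE X in ballM ?I. dim (kern (affs A) (\<lambda>i. hat (X i)) B) = card A + 1 - card B"
      using insert by (intro insert.IH) auto
    have IH: "AE X in ballM I. dim (kern (affs A) (\<lambda>i. hat (X i)) B) = card A + 1 - card B"
      using insert by (intro insert.IH) auto
    have "(\<integral>\<^sup>+X. indicator {X. \<not> ?P X} X \<partial>ballM I)
        = (\<integral>\<^sup>+X. (\<integral>\<^sup>+x. indicator {X. \<not> ?P X} (X(p := x)) \<partial>unif_ball) \<partial>ballM ?I)"
    proof -
      have "(\<lambda>X. indicator {X. \<not> ?P X} X :: ennreal) \<in> borel_measurable (ballM (insert p ?I))"
        unfolding pI(2) by measurable
      from ub.product_nn_integral_insert[OF pI(4,3) this] show ?thesis unfolding pI(2) .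
    qed
    also have "\<dots> = (\<integral>\<^sup>+(X :: _ \<Rightarrow> real^'n). 0 \<partial>ballM ?I)"
    proof (rule nn_integral_cong_AE)
      show "AE X in ballM ?I. (\<integral>\<^sup>+x. indicator {X. \<not> ?P X} (X(p := x)) \<partial>unif_ball) = 0"
        using IH0
      proof eventually_elim
      case (elim X)
      have "dim (kern (affs A) (\<lambda>i. hat (X i)) B) > 0" using elim insert by simp
      then obtain u where u: "u \<in> kern (affs A) (\<lambda>i. hat (X i)) B" "u \<noteq> 0"
        by (metis dim_eq_0 less_irrefl subsetI singletonI)
      have "?P (X(p := x))" if ne: "u \<bullet> hat x \<noteq> 0" for x
      proof -
        let ?u = "sgn (u \<bullet> hat x) *\<^sub>R u"
        have "?u \<in> affs A" using u subspace_affs[of A] unfolding kern_def by (simp add: subspace_scale)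
        moreover have "?u \<bullet> hat ((X(p := x)) i) = 0" if "i \<in> B" for i
          using u that insert(2) unfolding kern_def by auto
        moreover have "?u \<bullet> hat ((X(p := x)) p) > 0" using ne by (simp add: sgn_if mult_less_0_iff)
        ultimately show ?thesis unfolding pos_sol_def by blast
      qed
      hence "(\<integral>\<^sup>+x. indicator {X. \<not> ?P X} (X(p := x)) \<partial>unif_ball) \<le> (\<integral>\<^sup>+x. indicator {x. u \<bullet> hat x = 0} x \<partial>unif_ball)"
        by (intro nn_integral_mono) (auto simp: indicator_def)
      also have "\<dots> = emeasure unif_ball {x. u \<bullet> hat x = 0}"
        by (rule nn_integral_indicator) measurable
      also have "\<dots> = 0" using u by (intro unif_ball_hyperplane_null)
      finally show ?case by simp
      qed
    qed
    finally have "(\<integral>\<^sup>+X. indicator {X. \<not> ?P X} X \<partial>ballM I) = 0" by simp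
    hence "AE X in ballM I. indicator {X. \<not> ?P X} X = (0::ennreal)"
      by (subst (asm) nn_integral_0_iff_AE) auto
    with IH show ?case
    proof eventually_elim
      case (elim X)
      have "?P X" using elim(2) by (auto simp: indicator_def split: if_splits)
      from dim_kern_insert[OF subspace_affs this] elim(1) show ?case using insert(1,2) by simp
    qed
  qed
qed

lemma AE_generic:
  assumes "finite I"
  shows "AE X in ballM I. \<forall>A :: 'n::finite set. generic (affs A) (\<lambda>i. hat (X i)) I (card A + 1)"
proof -
  have "AE X in ballM I. \<forall>A\<in>(UNIV :: 'n set set). \<forall>B\<in>{B. B \<subseteq> I \<and> card B \<le> card A + 1}. dim (kern (affs A) (\<lambda>i. hat (X i)) B) = card A + 1 - card B"
  proof (intro AE_finite_allI)
    fix A :: "'n set" and B assume "B \<in> {B. B \<subseteq> I \<and> card B \<le> card A + 1}"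
    thus "AE X in ballM I. dim (kern (affs A) (\<lambda>i. hat (X i)) B) = card A + 1 - card B"
      by (intro AE_dim_kern[OF assms]) auto
  qed (use assms in auto)
  thus ?thesis by eventually_elim (auto simp: generic_def)
qed

section \<open>Passing between random vectors and real coordinates\<close>

definition vecs :: "nat set \<Rightarrow> (nat \<times> 'n::finite \<Rightarrow> real) \<Rightarrow> nat \<Rightarrow> real^'n" where
  "vecs P x = (\<lambda>i\<in>P. \<chi> j. x (i, j))"

lemma measurable_vec_lambda:
  assumes "\<And>j. (\<lambda>x. g x j) \<in> borel_measurable M"
  shows "(\<lambda>x. \<chi> j. g x j :: real^'n::finite) \<in> borel_measurable M"
proof (subst borel_measurable_euclidean_space, rule ballI)
  fix b :: "real^'n" assume "b \<in> Basis"
  then obtain j where b: "b = axis j 1" by (auto simp: Basis_vec_def)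
  show "(\<lambda>x. (\<chi> j. g x j) \<bullet> b) \<in> borel_measurable M"
    unfolding b inner_axis using assms by simp
qed

lemma distr_lebP_vec:
  "distr (lebP ({p :: nat} \<times> UNIV)) borel (\<lambda>y. (\<chi> j. y (p, j)) :: real^'n::finite) = lborel"
proof (rule lborel_eqI[symmetric])
  let ?f = "\<lambda>y. (\<chi> j. y (p, j)) :: real^'n"
  have m: "?f \<in> lebP ({p} \<times> UNIV) \<rightarrow>\<^sub>M borel"
    by (intro measurable_vec_lambda measurable_lebP_component) auto
  fix l u :: "real^'n" assume lu: "\<And>b. b \<in> Basis \<Longrightarrow> l \<bullet> b \<le> u \<bullet> b"
  have lu': "l $ j \<le> u $ j" for j
    using lu[of "axis j 1"] by (auto simp: Basis_vec_def inner_axis)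
  have pre: "?f -` box l u \<inter> space (lebP ({p} \<times> UNIV)) = (\<Pi>\<^sub>E q\<in>{p} \<times> UNIV. {l $ snd q<..<u $ snd q})"
    by (auto simp: space_PiM mem_box_cart PiE_iff)
  have "emeasure (distr (lebP ({p} \<times> UNIV)) borel ?f) (box l u) = (\<Prod>q\<in>{p} \<times> (UNIV :: 'n set). ennreal (u $ snd q - l $ snd q))"
  proof -
    have "emeasure (distr (lebP ({p} \<times> UNIV)) borel ?f) (box l u) = emeasure (lebP ({p} \<times> UNIV)) (\<Pi>\<^sub>E q\<in>{p} \<times> UNIV. {l $ snd q<..<u $ snd q})"
      using emeasure_distr[OF m, of "box l u"] unfolding pre by simp
    also have "\<dots> = (\<Prod>q\<in>{p} \<times> (UNIV :: 'n set). emeasure lborel {l $ snd q<..<u $ snd q})"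
      by (rule lp.emeasure_PiM) auto
    finally show ?thesis using lu' by simp
  qed
  also have "\<dots> = (\<Prod>j\<in>(UNIV :: 'n set). ennreal (u $ j - l $ j))"
    by (rule prod.reindex_bij_witness[of _ "\<lambda>j. (p, j)" snd]) auto
  also have "\<dots> = ennreal (\<Prod>j\<in>(UNIV :: 'n set). u $ j - l $ j)"
    using lu' by (intro prod_ennreal) simp
  also have "(\<Prod>j\<in>(UNIV :: 'n set). u $ j - l $ j) = (\<Prod>b\<in>Basis. (u - l) \<bullet> b)"
  proof -
    have "(\<Prod>b\<in>Basis. (u - l) \<bullet> b) = (\<Prod>b\<in>range (\<lambda>j::'n. axis j 1). (u - l) \<bullet> b)"
      by (rule prod.cong) (auto simp: Basis_vec_def)
    also have "\<dots> = (\<Prod>j\<in>UNIV. (u - l) \<bullet> axis j 1)"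
      by (subst prod.reindex) (auto simp: inj_on_def axis_eq_axis)
    finally show ?thesis by (simp add: inner_axis)
  qed
  finally show "emeasure (distr (lebP ({p} \<times> UNIV)) borel ?f) (box l u) = (\<Prod>b\<in>Basis. (u - l) \<bullet> b)" .
qed simp

lemma vecs_measurable: "vecs P \<in> lebP (P \<times> UNIV) \<rightarrow>\<^sub>M PiM P (\<lambda>_. lborel :: (real^'n::finite) measure)"
  unfolding vecs_def
proof (rule measurable_restrict)
  fix i assume "i \<in> P"
  hence "(\<lambda>x. \<chi> j. x (i, j)) \<in> borel_measurable (lebP (P \<times> (UNIV :: 'n set)))"
    by (intro measurable_vec_lambda measurable_lebP_component) auto
  thus "(\<lambda>x. \<chi> j. x (i, j)) \<in> lebP (P \<times> (UNIV :: 'n set)) \<rightarrow>\<^sub>M lborel"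
    by (subst measurable_cong_sets[OF refl sets_lborel])
qed

lemma nn_integral_vecs_prod:
  fixes g :: "nat \<Rightarrow> real^'n::finite \<Rightarrow> ennreal"
  assumes "finite P" "\<And>i. i \<in> P \<Longrightarrow> g i \<in> borel_measurable borel"
  shows "(\<integral>\<^sup>+x. (\<Prod>i\<in>P. g i (\<chi> j. x (i, j))) \<partial>lebP (P \<times> UNIV)) = (\<Prod>i\<in>P. \<integral>\<^sup>+v. g i v \<partial>lborel)"
  using assms
proof (induction P rule: finite_induct)
  case empty
  show ?case by (simp add: lp.nn_integral_empty space_PiM_empty)
next
  case (insert p P)
  let ?I = "P \<times> (UNIV :: 'n set)" and ?J = "{p} \<times> (UNIV :: 'n set)"
  have IJ: "?I \<inter> ?J = {}" "?I \<union> ?J = insert p P \<times> UNIV" "finite ?I" "finite ?J" using insert by auto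
  have gm: "(\<lambda>x. g i (\<chi> j. x (i, j))) \<in> borel_measurable (lebP K)" if "i \<in> insert p P" "{i} \<times> UNIV \<subseteq> K" for i K
  proof -
    have "(\<lambda>x. x (i, j)) \<in> borel_measurable (lebP K)" for j
      using that by (intro measurable_lebP_component) auto
    hence "(\<lambda>x. \<chi> j. x (i, j)) \<in> lebP K \<rightarrow>\<^sub>M borel" by (rule measurable_vec_lambda)
    from measurable_compose[OF this insert.prems[OF that(1)]] show ?thesis .
  qed
  have pm: "(\<lambda>x. \<Prod>i\<in>Q. g i (\<chi> j. x (i, j))) \<in> borel_measurable (lebP K)" if "Q \<subseteq> insert p P" "Q \<times> UNIV \<subseteq> K" for Q K
    using that by (intro borel_measurable_prod_ennreal gm) auto
  have "(\<integral>\<^sup>+x. (\<Prod>i\<in>insert p P. g i (\<chi> j. x (i, j))) \<partial>lebP (insert p P \<times> UNIV))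
     = (\<integral>\<^sup>+x. (\<integral>\<^sup>+y. (\<Prod>i\<in>insert p P. g i (\<chi> j. merge ?I ?J (x, y) (i, j))) \<partial>lebP ?J) \<partial>lebP ?I)"
    using lp.product_nn_integral_fold[OF IJ(1,3,4) pm[of "insert p P"]] IJ(2) by simp
  also have "\<dots> = (\<integral>\<^sup>+x. (\<integral>\<^sup>+y. (\<Prod>i\<in>P. g i (\<chi> j. x (i, j))) * g p (\<chi> j. y (p, j)) \<partial>lebP ?J) \<partial>lebP ?I)"
  proof (intro nn_integral_cong)
    fix x y :: "nat \<times> 'n \<Rightarrow> real"
    have "(\<chi> j. merge ?I ?J (x, y) (p, j)) = (\<chi> j. y (p, j))" using insert(2) by (simp add: merge_def)
    moreover have "(\<Prod>i\<in>P. g i (\<chi> j. merge ?I ?J (x, y) (i, j))) = (\<Prod>i\<in>P. g i (\<chi> j. x (i, j)))"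
      by (intro prod.cong) (auto simp: merge_def)
    ultimately show "(\<Prod>i\<in>insert p P. g i (\<chi> j. merge ?I ?J (x, y) (i, j))) = (\<Prod>i\<in>P. g i (\<chi> j. x (i, j))) * g p (\<chi> j. y (p, j))"
      using insert(1,2) by (simp add: mult.commute)
  qed
  also have "\<dots> = (\<integral>\<^sup>+x. (\<Prod>i\<in>P. g i (\<chi> j. x (i, j))) * (\<integral>\<^sup>+y. g p (\<chi> j. y (p, j)) \<partial>lebP ?J) \<partial>lebP ?I)"
    by (intro nn_integral_cong nn_integral_cmult gm) auto
  also have "\<dots> = (\<integral>\<^sup>+x. (\<Prod>i\<in>P. g i (\<chi> j. x (i, j))) \<partial>lebP ?I) * (\<integral>\<^sup>+y. g p (\<chi> j. y (p, j)) \<partial>lebP ?J)"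
    by (intro nn_integral_multc pm) auto
  also have "(\<integral>\<^sup>+y. g p (\<chi> j. y (p, j)) \<partial>lebP ?J) = (\<integral>\<^sup>+v. g p v \<partial>lborel)"
  proof -
    have "(\<lambda>y. \<chi> j. y (p, j)) \<in> lebP ?J \<rightarrow>\<^sub>M (borel :: (real^'n) measure)"
      by (intro measurable_vec_lambda measurable_lebP_component) auto
    from nn_integral_distr[OF this, of "g p"] insert.prems[of p] show ?thesis
      unfolding distr_lebP_vec by simp
  qed
  finally show ?case using insert by (simp add: mult.commute)
qed

lemma distr_vecs:
  assumes P: "finite P"
  shows "distr (lebP (P \<times> UNIV)) (PiM P (\<lambda>_. lborel)) (vecs P) = PiM P (\<lambda>_. lborel :: (real^'n::finite) measure)"
proof -
  interpret L: product_sigma_finite "\<lambda>_::nat. lborel :: (real^'n) measure" by standard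
  show ?thesis
  proof (rule L.PiM_eqI[OF P])
    fix A :: "nat \<Rightarrow> (real^'n) set" assume A: "\<And>i. i \<in> P \<Longrightarrow> A i \<in> sets lborel"
    have Am: "Pi\<^sub>E P A \<in> sets (PiM P (\<lambda>_. lborel))" using P A by (intro sets_PiM_I_finite) auto
    have "emeasure (distr (lebP (P \<times> UNIV)) (PiM P (\<lambda>_. lborel)) (vecs P)) (Pi\<^sub>E P A)
      = (\<integral>\<^sup>+x. indicator (Pi\<^sub>E P A) x \<partial>distr (lebP (P \<times> UNIV)) (PiM P (\<lambda>_. lborel)) (vecs P))"
      using Am by simp
    also have "\<dots> = (\<integral>\<^sup>+x. indicator (Pi\<^sub>E P A) (vecs P x) \<partial>lebP (P \<times> UNIV))"
      using Am by (intro nn_integral_distr vecs_measurable) auto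
    also have "\<dots> = (\<integral>\<^sup>+x. (\<Prod>i\<in>P. indicator (A i) (\<chi> j. x (i, j))) \<partial>lebP (P \<times> UNIV))"
    proof (intro nn_integral_cong)
      fix x
      show "indicator (Pi\<^sub>E P A) (vecs P x) = ((\<Prod>i\<in>P. indicator (A i) (\<chi> j. x (i, j))) :: ennreal)"
      proof (cases "\<forall>i\<in>P. (\<chi> j. x (i, j)) \<in> A i")
        case True thus ?thesis by (auto simp: vecs_def indicator_def PiE_iff)
      next
        case False
        then obtain i where "i \<in> P" "(\<chi> j. x (i, j)) \<notin> A i" by auto
        moreover from this have "vecs P x \<notin> Pi\<^sub>E P A" by (auto simp: vecs_def PiE_iff)
        ultimately show ?thesis using P by (auto simp: prod_zero_iff[OF P] indicator_def)
      qed
    qed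
    also have "\<dots> = (\<Prod>i\<in>P. \<integral>\<^sup>+v. indicator (A i) v \<partial>lborel)"
      using A by (intro nn_integral_vecs_prod[OF P]) auto
    also have "\<dots> = (\<Prod>i\<in>P. emeasure lborel (A i))"
      using A by (intro prod.cong) auto
    finally show "emeasure (distr (lebP (P \<times> UNIV)) (PiM P (\<lambda>_. lborel)) (vecs P)) (Pi\<^sub>E P A) = (\<Prod>i\<in>P. emeasure lborel (A i))" .
  qed simp
qed

text \<open>The closed ball replaces the open one because \<open>unit_balls\<close> tests a weak
  inequality; the sphere is a null set.\<close>

lemma unif_ball_density:
  "unif_ball = density lborel (\<lambda>x::real^'n::finite. indicator (cball 0 1) x * inverse (emeasure lborel (ball (0::real^'n) 1)))"
proof (rule measure_eqI)
  fix A :: "(real^'n) set" assume "A \<in> sets unif_ball"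
  hence A[measurable]: "A \<in> sets borel" by simp
  have "emeasure unif_ball A = emeasure lborel (ball 0 1 \<inter> A) / emeasure lborel (ball (0::real^'n) 1)"
    unfolding unif_ball_def by (subst emeasure_uniform_measure) auto
  also have "emeasure lborel (ball 0 1 \<inter> A) = emeasure lborel (cball 0 1 \<inter> A)"
  proof (rule emeasure_eq_AE)
    have "sphere (0::real^'n) 1 \<in> null_sets lborel"
      using negligible_sphere[of "0::real^'n" 1] by (simp add: null_sets_completion_iff negligible_iff_null_sets)
    hence "AE x in lborel. x \<notin> sphere (0::real^'n) 1" by (rule AE_not_in)
    thus "AE x in lborel. (x \<in> ball 0 1 \<inter> A) = (x \<in> cball 0 1 \<inter> A)"
      by eventually_elim auto
  qed auto
  also have "emeasure lborel (cball 0 1 \<inter> A) / emeasure lborel (ball (0::real^'n) 1)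
     = (\<integral>\<^sup>+x. inverse (emeasure lborel (ball (0::real^'n) 1)) * indicator (cball 0 1 \<inter> A) x \<partial>lborel)"
    by (subst nn_integral_cmult_indicator) (auto simp: divide_ennreal_def mult.commute)
  also have "\<dots> = (\<integral>\<^sup>+x. (indicator (cball 0 1) x * inverse (emeasure lborel (ball (0::real^'n) 1))) * indicator A x \<partial>lborel)"
    by (intro nn_integral_cong) (auto simp: indicator_def)
  also have "\<dots> = emeasure (density lborel (\<lambda>x. indicator (cball 0 1) x * inverse (emeasure lborel (ball (0::real^'n) 1)))) A"
  proof (rule emeasure_density[symmetric])
    show "(\<lambda>x. indicator (cball 0 1) x * inverse (emeasure lborel (ball (0::real^'n) 1))) \<in> borel_measurable lborel"
      by (intro borel_measurable_times_ennreal borel_measurable_indicator borel_measurable_const) simp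
    show "A \<in> sets lborel" by simp
  qed
  finally show "emeasure unif_ball A = emeasure (density lborel (\<lambda>x. indicator (cball 0 1) x * inverse (emeasure lborel (ball (0::real^'n) 1)))) A" .
qed simp

definition ball_norm :: "'n::finite itself \<Rightarrow> ennreal" where
  "ball_norm _ = inverse (emeasure lborel (ball (0::real^'n) 1))"

lemma ballM_density:
  assumes P: "finite P"
  shows "ballM P = density (PiM P (\<lambda>_. lborel)) (\<lambda>x. \<Prod>i\<in>P. indicator (cball 0 1) (x i :: real^'n::finite) * ball_norm TYPE('n))"
proof -
  interpret L: product_sigma_finite "\<lambda>_::'a. lborel :: (real^'n) measure" by standard
  let ?g = "\<lambda>v::real^'n. indicator (cball 0 1) v * ball_norm TYPE('n)"
  have gm: "(\<lambda>x. \<Prod>i\<in>P. ?g (x i)) \<in> borel_measurable (PiM P (\<lambda>_. lborel))"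
  proof (rule borel_measurable_prod_ennreal)
    fix i assume "i \<in> P"
    have "?g \<in> borel_measurable lborel"
      by (intro borel_measurable_times_ennreal borel_measurable_indicator borel_measurable_const) auto
    from measurable_compose[OF measurable_component_singleton[OF \<open>i \<in> P\<close>] this]
    show "(\<lambda>x. ?g (x i)) \<in> borel_measurable (PiM P (\<lambda>_. lborel))" .
  qed
  show ?thesis
  proof (rule ub.PiM_eqI[OF P, symmetric])
    show "sets (density (PiM P (\<lambda>_. lborel)) (\<lambda>x. \<Prod>i\<in>P. ?g (x i))) = sets (ballM P)"
      by (simp cong: sets_PiM_cong)
    fix A :: "'a \<Rightarrow> (real^'n) set" assume A: "\<And>i. i \<in> P \<Longrightarrow> A i \<in> sets unif_ball"
    hence A'[measurable]: "\<And>i. i \<in> P \<Longrightarrow> A i \<in> sets borel" by simp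
    have Am: "Pi\<^sub>E P A \<in> sets (PiM P (\<lambda>_. lborel))" using P A by (intro sets_PiM_I_finite) auto
    have "emeasure (density (PiM P (\<lambda>_. lborel)) (\<lambda>x. \<Prod>i\<in>P. ?g (x i))) (Pi\<^sub>E P A)
       = (\<integral>\<^sup>+x. (\<Prod>i\<in>P. ?g (x i)) * indicator (Pi\<^sub>E P A) x \<partial>PiM P (\<lambda>_. lborel))"
      by (rule emeasure_density[OF gm Am])
    also have "\<dots> = (\<integral>\<^sup>+x. (\<Prod>i\<in>P. ?g (x i) * indicator (A i) (x i)) \<partial>PiM P (\<lambda>_. lborel))"
    proof (rule nn_integral_cong)
      fix x :: "'a \<Rightarrow> real^'n" assume "x \<in> space (PiM P (\<lambda>_. lborel))"
      hence "indicator (Pi\<^sub>E P A) x = (\<Prod>i\<in>P. indicator (A i) (x i) :: ennreal)"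
        using P by (cases "\<forall>i\<in>P. x i \<in> A i") (auto simp: indicator_def space_PiM PiE_iff prod_zero_iff)
      thus "(\<Prod>i\<in>P. ?g (x i)) * indicator (Pi\<^sub>E P A) x = (\<Prod>i\<in>P. ?g (x i) * indicator (A i) (x i))"
        by (simp add: prod.distrib)
    qed
    also have "\<dots> = (\<Prod>i\<in>P. \<integral>\<^sup>+v. ?g v * indicator (A i) v \<partial>lborel)"
      using A' by (intro L.product_nn_integral_prod P borel_measurable_times_ennreal borel_measurable_indicator borel_measurable_const) auto
    also have "\<dots> = (\<Prod>i\<in>P. emeasure unif_ball (A i))"
    proof (rule prod.cong[OF refl])
      fix i assume "i \<in> P"
      from A'[OF this] show "(\<integral>\<^sup>+v. ?g v * indicator (A i) v \<partial>lborel) = emeasure unif_ball (A i)"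
        unfolding unif_ball_density ball_norm_def
        by (subst emeasure_density) (auto intro!: borel_measurable_times_ennreal borel_measurable_indicator)
    qed
    finally show "emeasure (density (PiM P (\<lambda>_. lborel)) (\<lambda>x. \<Prod>i\<in>P. ?g (x i))) (Pi\<^sub>E P A) = (\<Prod>i\<in>P. emeasure unif_ball (A i))" .
  qed
qed

lemma nn_integral_ballM_coords:
  assumes P: "finite P" and f: "f \<in> borel_measurable (ballM P)"
  shows "(\<integral>\<^sup>+X. f X \<partial>ballM P) = ball_norm TYPE('n) ^ card P * (\<integral>\<^sup>+x. f (vecs P x :: nat \<Rightarrow> real^'n::finite) * unit_balls P x \<partial>lebP (P \<times> UNIV))"
proof -
  let ?g = "\<lambda>v::real^'n. indicator (cball 0 1) v * ball_norm TYPE('n)"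
  have f': "f \<in> borel_measurable (PiM P (\<lambda>_. lborel))"
  proof -
    have "sets (PiM P (\<lambda>_. lborel)) = sets (ballM P :: (nat \<Rightarrow> real^'n) measure)" by (intro sets_PiM_cong) auto
    thus ?thesis using f measurable_cong_sets by blast
  qed
  have gm: "(\<lambda>x. \<Prod>i\<in>P. ?g (x i)) \<in> borel_measurable (PiM P (\<lambda>_. lborel))"
  proof (rule borel_measurable_prod_ennreal)
    fix i assume "i \<in> P"
    have "?g \<in> borel_measurable lborel"
      by (intro borel_measurable_times_ennreal borel_measurable_indicator borel_measurable_const) auto
    from measurable_compose[OF measurable_component_singleton[OF \<open>i \<in> P\<close>] this]
    show "(\<lambda>x. ?g (x i)) \<in> borel_measurable (PiM P (\<lambda>_. lborel))" .
  qed
  have u: "(\<Prod>i\<in>P. ?g (vecs P x i)) = ball_norm TYPE('n) ^ card P * unit_balls P x" for x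
  proof -
    have "(\<Prod>i\<in>P. ?g (vecs P x i)) = (\<Prod>i\<in>P. indicator {..1} (\<Sum>j\<in>UNIV. (x (i, j))\<^sup>2) * ball_norm TYPE('n))"
    proof (rule prod.cong[OF refl])
      fix i assume "i \<in> P"
      have "norm (\<chi> j. x (i, j)) \<le> 1 \<longleftrightarrow> (\<Sum>j\<in>UNIV. (x (i, j))\<^sup>2) \<le> 1"
        by (simp add: norm_vec_def L2_set_def)
      thus "?g (vecs P x i) = indicator {..1} (\<Sum>j\<in>UNIV. (x (i, j))\<^sup>2) * ball_norm TYPE('n)"
        using \<open>i \<in> P\<close> by (simp add: vecs_def indicator_def)
    qed
    thus ?thesis unfolding unit_balls_def by (simp add: prod.distrib mult.commute)
  qed
  have um: "unit_balls P \<in> borel_measurable (lebP (P \<times> UNIV))"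
    unfolding unit_balls_def by (intro measurable_prod_indicator borel_measurable_sum borel_measurable_power measurable_lebP_component) auto
  have fv: "(\<lambda>x. f (vecs P x)) \<in> borel_measurable (lebP (P \<times> UNIV))"
    by (rule measurable_compose[OF vecs_measurable f'])
  have "(\<integral>\<^sup>+X. f X \<partial>ballM P) = (\<integral>\<^sup>+X. (\<Prod>i\<in>P. ?g (X i)) * f X \<partial>PiM P (\<lambda>_. lborel))"
    unfolding ballM_density[OF P] by (rule nn_integral_density[OF gm f'])
  also have "\<dots> = (\<integral>\<^sup>+x. (\<Prod>i\<in>P. ?g (vecs P x i)) * f (vecs P x) \<partial>lebP (P \<times> UNIV))"
    by (subst distr_vecs[OF P, symmetric], rule nn_integral_distr[OF vecs_measurable]) (use gm f' in simp)
  also have "\<dots> = (\<integral>\<^sup>+x. ball_norm TYPE('n) ^ card P * (f (vecs P x) * unit_balls P x) \<partial>lebP (P \<times> UNIV))"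
    unfolding u by (simp add: mult_ac)
  also have "\<dots> = ball_norm TYPE('n) ^ card P * (\<integral>\<^sup>+x. f (vecs P x) * unit_balls P x \<partial>lebP (P \<times> UNIV))"
    by (intro nn_integral_cmult borel_measurable_times_ennreal fv um)
  finally show ?thesis .
qed

section \<open>Independence of the height of a spanned hyperplane\<close>

lemma hat_inner: "v \<bullet> hat x = fst v \<bullet> x + snd v"
  by (simp add: hat_def inner_prod_def)

text \<open>A single \<open>C\<close> serves all integrands, so that it can be eliminated by
  comparison with the constant function 1. Assumption \<open>dep\<close> allows the coordinates
  \<open>t\<close> to be integrated out, \<open>inv\<close> allows sections to be rescaled, and
  \<open>gen\<close> makes the affine function through the points unique.\<close>

lemma ballM_disintegration:
  fixes A :: "'n::finite set" and \<gamma> :: "real \<Rightarrow> ennreal" and Ev :: "(nat \<Rightarrow> real^'n) \<Rightarrow> bool"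
  assumes P: "finite P" "P \<noteq> {}" and t: "t \<in> A" and card: "card P = card A"
    and Evm: "Measurable.pred (ballM P) Ev"
    and dep: "\<And>X Y. (\<And>i j. i \<in> P \<Longrightarrow> j \<noteq> t \<Longrightarrow> X i $ j = Y i $ j) \<Longrightarrow> Ev X = Ev Y"
    and inv: "\<And>X c r. r > 0 \<Longrightarrow> Ev (\<lambda>i. c + r *\<^sub>R X i) = Ev X"
    and gen: "\<And>X v. Ev X \<Longrightarrow> v \<in> affs (A - {t}) \<Longrightarrow> (\<And>i. i \<in> P \<Longrightarrow> v \<bullet> hat (X i) = 0) \<Longrightarrow> v = 0"
  shows "\<exists>C. \<forall>G \<gamma>. G \<in> borel_measurable (ballM P) \<longrightarrow> \<gamma> \<in> borel_measurable borel \<longrightarrow>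
     (\<forall>X a b. Ev X \<longrightarrow> (\<forall>j. j \<notin> A - {t} \<longrightarrow> a $ j = 0) \<longrightarrow> (\<forall>i\<in>P. X i $ t = a \<bullet> X i + b) \<longrightarrow>
        G X = \<gamma> (b / sqrt (1 + (norm a)\<^sup>2))) \<longrightarrow>
     (\<integral>\<^sup>+X. of_bool (Ev X) * G X \<partial>ballM P) = (\<integral>\<^sup>+h. \<gamma> h * height_weight (card P * CARD('n) - 1) h \<partial>lborel) * C"
proof -
  define Y where "Y = P \<times> (UNIV - {t} :: 'n set)"
  \<comment> \<open>The coordinate \<open>t\<close> is filled with 0, which \<open>dep\<close> makes
    harmless.\<close>
  define pts where "pts = (\<lambda>y. \<lambda>i\<in>P. (\<chi> j. if j = t then 0 else y (i, j)) :: real^'n)"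
  define E where "E = {y \<in> space (lebP Y). Ev (pts y)}"
  have ptsm: "pts \<in> lebP Y \<rightarrow>\<^sub>M ballM P"
    unfolding pts_def
  proof (rule measurable_restrict)
    fix i assume i: "i \<in> P"
    have "(\<lambda>y. if j = t then 0 else y (i, j)) \<in> borel_measurable (lebP Y)" for j
      using i by (cases "j = t") (auto simp: Y_def intro!: measurable_lebP_component)
    hence "(\<lambda>y. (\<chi> j. if j = t then 0 else y (i, j)) :: real^'n) \<in> borel_measurable (lebP Y)"
      by (rule measurable_vec_lambda)
    thus "(\<lambda>y. (\<chi> j. if j = t then 0 else y (i, j)) :: real^'n) \<in> lebP Y \<rightarrow>\<^sub>M unif_ball"
      by (subst measurable_cong_sets[OF refl sets_unif_ball])
  qed
  have Em: "E \<in> sets (lebP Y)"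
    unfolding E_def using measurable_compose[OF ptsm Evm] by (simp add: pred_def)
  have inj: "\<forall>j\<in>A. a j = 0" if y: "y \<in> E" and z: "\<And>i. i \<in> P \<Longrightarrow> graph_val A t y a i = 0" for y a
  proof -
    define v where "v = ((\<chi> j. if j \<in> A - {t} then a j else 0) :: real^'n, a t)"
    have "v = 0"
    proof (rule gen)
      show "Ev (pts y)" using y unfolding E_def by simp
      show "v \<in> affs (A - {t})" unfolding v_def affs_def by simp
      fix i assume i: "i \<in> P"
      have "(\<Sum>j\<in>UNIV. (if j \<in> A - {t} then a j else 0) * (if j = t then 0 else y (i, j))) = (\<Sum>j\<in>A - {t}. y (i, j) * a j)"
        by (rule sum.mono_neutral_cong_right) auto
      hence "v \<bullet> hat (pts y i) = graph_val A t y a i"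
        unfolding hat_inner v_def pts_def graph_val_def using i by (simp add: inner_vec_def)
      thus "v \<bullet> hat (pts y i) = 0" using z[OF i] by simp
    qed
    hence 1: "(\<chi> j. if j \<in> A - {t} then a j else 0) = (0 :: real^'n)" "a t = 0" unfolding v_def by (auto simp: prod_eq_iff)
    have "a j = 0" if "j \<in> A" for j
      using 1(2) that arg_cong[OF 1(1), of "\<lambda>x. x $ j"] by (cases "j = t") auto
    thus ?thesis by blast
  qed
  have invE: "(\<lambda>p\<in>Y. c (snd p) + r * y p) \<in> E \<longleftrightarrow> y \<in> E" if y: "y \<in> space (lebP Y)" and r: "r > 0" for y c r
  proof -
    have "Ev (pts (\<lambda>p\<in>Y. c (snd p) + r * y p)) = Ev (\<lambda>i. (\<chi> j. c j) + r *\<^sub>R pts y i)"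
      by (rule dep) (auto simp: pts_def Y_def)
    also have "\<dots> = Ev (pts y)" by (rule inv[OF r])
    finally show ?thesis using y unfolding E_def by (simp add: space_PiM)
  qed
  define C where "C = ball_norm TYPE('n) ^ card P * sec_const P A t E"
  show ?thesis
  proof (intro exI[of _ C] allI impI)
    fix G :: "(nat \<Rightarrow> real^'n) \<Rightarrow> ennreal" and \<gamma> :: "real \<Rightarrow> ennreal"
    assume G: "G \<in> borel_measurable (ballM P)" and \<gamma>: "\<gamma> \<in> borel_measurable borel"
      and G\<gamma>: "\<forall>X a b. Ev X \<longrightarrow> (\<forall>j. j \<notin> A - {t} \<longrightarrow> a $ j = 0) \<longrightarrow> (\<forall>i\<in>P. X i $ t = a \<bullet> X i + b) \<longrightarrow>
        G X = \<gamma> (b / sqrt (1 + (norm a)\<^sup>2))"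
    have vm: "vecs P \<in> lebP (P \<times> UNIV) \<rightarrow>\<^sub>M (ballM P :: (nat \<Rightarrow> real^'n) measure)"
    proof -
      have "sets (PiM P (\<lambda>_. lborel)) = sets (ballM P :: (nat \<Rightarrow> real^'n) measure)" by (intro sets_PiM_cong) auto
      thus ?thesis using vecs_measurable[of P] measurable_cong_sets[OF refl] by blast
    qed
    have EvX: "Ev (vecs P x) \<longleftrightarrow> restrict x Y \<in> E" if "x \<in> space (lebP (P \<times> UNIV))" for x
    proof -
      have "Ev (vecs P x) = Ev (pts (restrict x Y))"
        by (rule dep) (auto simp: pts_def vecs_def Y_def)
      thus ?thesis unfolding E_def by (simp add: space_PiM)
    qed
    have em: "(\<lambda>X. of_bool (Ev X) :: ennreal) \<in> borel_measurable (ballM P)"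
      using Evm by measurable
    have "(\<integral>\<^sup>+X. of_bool (Ev X) * G X \<partial>ballM P) = ball_norm TYPE('n) ^ card P *
        (\<integral>\<^sup>+x. (of_bool (Ev (vecs P x)) * G (vecs P x)) * unit_balls P x \<partial>lebP (P \<times> UNIV))"
      using em G by (intro nn_integral_ballM_coords[OF P(1)] borel_measurable_times_ennreal)
    also have "(\<integral>\<^sup>+x. (of_bool (Ev (vecs P x)) * G (vecs P x)) * unit_balls P x \<partial>lebP (P \<times> UNIV))
       = (\<integral>\<^sup>+x. indicator E (restrict x Y) * G (vecs P x) * unit_balls P x \<partial>lebP (P \<times> UNIV))"
      by (intro nn_integral_cong) (simp add: EvX indicator_def)
    also have "\<dots> = (\<integral>\<^sup>+h. \<gamma> h * height_weight (card P * CARD('n) - 1) h \<partial>lborel) * sec_const P A t E"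
      unfolding Y_def
    proof (rule graph_disintegration[OF P t card Em[unfolded Y_def] inj invE[unfolded Y_def] \<gamma>])
      show "(\<lambda>x. G (vecs P x)) \<in> borel_measurable (lebP (P \<times> UNIV))" by (rule measurable_compose[OF vm G])
      fix y a assume y: "y \<in> E" and a: "a \<in> space (lebP A)"
      let ?x = "merge (P \<times> (UNIV - {t})) (P \<times> {t}) (y, graph_map P A t y a)"
      define a' where "a' = ((\<chi> j. if j \<in> A - {t} then a j else 0) :: real^'n)"
      have xs: "vecs P ?x i $ j = (if j = t then graph_val A t y a i else y (i, j))" if "i \<in> P" for i j
        using that by (simp add: vecs_def merge_def graph_map_def)
      have "Ev (vecs P ?x) = Ev (pts y)"
        by (rule dep) (auto simp: pts_def xs)
      hence ev: "Ev (vecs P ?x)" using y unfolding E_def by simp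
      have eq: "vecs P ?x i $ t = a' \<bullet> vecs P ?x i + a t" if i: "i \<in> P" for i
      proof -
        have "(\<Sum>j\<in>UNIV. a' $ j * vecs P ?x i $ j) = (\<Sum>j\<in>A - {t}. y (i, j) * a j)"
          by (rule sum.mono_neutral_cong_right) (auto simp: a'_def xs[OF i])
        thus ?thesis using xs[OF i, of t] by (simp add: inner_vec_def graph_val_def)
      qed
      have nrm: "(norm a')\<^sup>2 = (\<Sum>j\<in>A - {t}. (a j)\<^sup>2)"
      proof -
        have "(norm a')\<^sup>2 = (\<Sum>j\<in>UNIV. a' $ j * a' $ j)" by (simp add: power2_norm_eq_inner inner_vec_def)
        also have "\<dots> = (\<Sum>j\<in>A - {t}. (a j)\<^sup>2)"
          by (rule sum.mono_neutral_cong_right) (auto simp: a'_def power2_eq_square)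
        finally show ?thesis .
      qed
      have a0: "a' $ j = 0" if "j \<notin> A - {t}" for j using that by (auto simp: a'_def)
      show "G (vecs P ?x) = \<gamma> (a t / sqrt (1 + (\<Sum>j\<in>A - {t}. (a j)\<^sup>2)))"
        using G\<gamma>[rule_format, OF ev a0 eq] unfolding nrm .
    qed
    finally show "(\<integral>\<^sup>+X. of_bool (Ev X) * G X \<partial>ballM P) = (\<integral>\<^sup>+h. \<gamma> h * height_weight (card P * CARD('n) - 1) h \<partial>lborel) * C"
      unfolding C_def by (simp only: mult_ac)
  qed
qed

text \<open>The substitution \<open>h = - cos \<phi>\<close> turns the radius of the section into
  \<open>sin \<phi>\<close>, and the differential adds one more power. The minus sign makes the
  height increase with the angle.\<close>

lemma height_weight_substitution:
  fixes g :: "real \<Rightarrow> real"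
  assumes g[measurable]: "g \<in> borel_measurable borel" and g0: "\<And>h. g h \<ge> 0"
  shows "(\<integral>\<^sup>+h. ennreal (g h) * height_weight m h \<partial>lborel)
       = (\<integral>\<^sup>+\<phi>. ennreal (g (- cos \<phi>) * sin \<phi> ^ Suc m * indicator {0..pi} \<phi>) \<partial>lborel)"
proof -
  let ?f = "\<lambda>h. g h * sqrt (1 - h\<^sup>2) ^ m"
  have "(\<integral>\<^sup>+h. ennreal (g h) * height_weight m h \<partial>lborel) = (\<integral>\<^sup>+h. ennreal (?f h * indicator {- cos 0..- cos pi} h) \<partial>lborel)"
  proof (rule nn_integral_cong_AE)
    have "AE h in lborel. h \<noteq> (1::real) \<and> h \<noteq> -1" using AE_lborel_singleton[of "1::real"] AE_lborel_singleton[of "-1::real"] by eventually_elim auto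
    thus "AE h in lborel. ennreal (g h) * height_weight m h = ennreal (?f h * indicator {- cos 0..- cos pi} h)"
    proof eventually_elim
      case (elim h)
      show ?case
      proof (cases "-1 < h \<and> h < 1")
        case True
        thus ?thesis using g0[of h] by (simp add: height_weight_def indicator_def ennreal_mult')
      next
        case False
        thus ?thesis using elim by (auto simp: height_weight_def indicator_def)
      qed
    qed
  qed
  also have "\<dots> = (\<integral>\<^sup>+\<phi>. ennreal (?f (- cos \<phi>) * sin \<phi> * indicator {0..pi} \<phi>) \<partial>lborel)"
  proof (rule nn_integral_substitution)
    show "set_borel_measurable borel {- cos 0..- cos pi} ?f" unfolding set_borel_measurable_def by measurable
    show "((\<lambda>x. - cos x) has_real_derivative sin x) (at x)" for x :: real
      by (auto intro!: derivative_eq_intros)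
    show "continuous_on {0..pi} sin" by (intro continuous_intros)
  qed (auto intro: sin_ge_zero)
  also have "\<dots> = (\<integral>\<^sup>+\<phi>. ennreal (g (- cos \<phi>) * sin \<phi> ^ Suc m * indicator {0..pi} \<phi>) \<partial>lborel)"
  proof (intro nn_integral_cong)
    fix \<phi> :: real
    have "sqrt (1 - (- cos \<phi>)\<^sup>2) = sin \<phi>" if "\<phi> \<in> {0..pi}"
      using that sin_ge_zero[of \<phi>] by (simp add: sin_squared_eq[symmetric])
    thus "ennreal (?f (- cos \<phi>) * sin \<phi> * indicator {0..pi} \<phi>) = ennreal (g (- cos \<phi>) * sin \<phi> ^ Suc m * indicator {0..pi} \<phi>)"
      by (cases "\<phi> \<in> {0..pi}") (auto simp: mult_ac)
  qed
  finally show ?thesis .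
qed

definition wallis :: "nat \<Rightarrow> real" where
  "wallis a = integral {0..pi} (\<lambda>x. sin x ^ a)"

definition sin_int :: "nat \<Rightarrow> real \<Rightarrow> real" where
  "sin_int d x = integral {0..x} (\<lambda>y. sin y ^ d)"

lemma nn_integral_cont_pi:
  assumes "continuous_on {0..pi} f" "\<And>x. x \<in> {0..pi} \<Longrightarrow> f x \<ge> 0"
  shows "(\<integral>\<^sup>+x. ennreal (f x * indicator {0..pi} x) \<partial>lborel) = ennreal (integral {0..pi} f)"
proof -
  have i: "set_integrable lborel {0..pi} f"
    by (rule borel_integrable_atLeastAtMost') fact
  have "(\<integral>\<^sup>+x. ennreal (f x * indicator {0..pi} x) \<partial>lborel) = (\<integral>\<^sup>+x. ennreal (indicator {0..pi} x *\<^sub>R f x) \<partial>lborel)"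
    by (simp add: mult.commute)
  also have "\<dots> = ennreal (\<integral>x. indicator {0..pi} x *\<^sub>R f x \<partial>lborel)"
    using i assms(2) unfolding set_integrable_def by (intro nn_integral_eq_integral) (auto simp: indicator_def)
  also have "(\<integral>x. indicator {0..pi} x *\<^sub>R f x \<partial>lborel) = integral {0..pi} f"
    using set_borel_integral_eq_integral(2)[OF i] unfolding set_lebesgue_integral_def .
  finally show ?thesis .
qed

lemma sin_pow_nonneg: "x \<in> {0..pi} \<Longrightarrow> 0 \<le> sin x ^ a"
  by (intro zero_le_power sin_ge_zero) auto

lemma wallis_pos: "wallis a > 0"
proof -
  have "wallis a \<ge> 0" unfolding wallis_def
    by (intro integral_nonneg integrable_continuous_interval continuous_intros sin_pow_nonneg)
  moreover have "wallis a \<noteq> 0"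
  proof
    assume "wallis a = 0"
    moreover have "continuous_on {0..pi} (\<lambda>x. sin x ^ a)" by (intro continuous_intros)
    ultimately have "\<forall>x\<in>{0..pi}. sin x ^ a = 0"
      unfolding wallis_def using integral_eq_0_iff[of 0 pi "\<lambda>x. sin x ^ a"] sin_pow_nonneg[of _ a] by simp
    from bspec[OF this, of "pi / 2"] show False by simp
  qed
  ultimately show ?thesis by simp
qed

lemma height_weight_total: "(\<integral>\<^sup>+h. height_weight m h \<partial>lborel) = ennreal (wallis (Suc m))"
proof -
  have "(\<integral>\<^sup>+h. height_weight m h \<partial>lborel) = (\<integral>\<^sup>+\<phi>. ennreal (sin \<phi> ^ Suc m * indicator {0..pi} \<phi>) \<partial>lborel)"
    using height_weight_substitution[of "\<lambda>_. 1" m] by simp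
  also have "\<dots> = ennreal (wallis (Suc m))"
    unfolding wallis_def by (intro nn_integral_cont_pi continuous_intros sin_pow_nonneg)
  finally show ?thesis .
qed

text \<open>The height is independent of the event: comparison with the constant function 1 removes
  the constant of \<open>ballM_disintegration\<close>. The normalising factor stays on the left to
  avoid division in \<open>ennreal\<close>.\<close>

corollary ballM_factor:
  fixes A :: "'n::finite set" and \<gamma> :: "real \<Rightarrow> ennreal" and Ev :: "(nat \<Rightarrow> real^'n) \<Rightarrow> bool"
  assumes P: "finite P" "P \<noteq> {}" and t: "t \<in> A" and card: "card P = card A"
    and Evm: "Measurable.pred (ballM P) Ev"
    and dep: "\<And>X Y. (\<And>i j. i \<in> P \<Longrightarrow> j \<noteq> t \<Longrightarrow> X i $ j = Y i $ j) \<Longrightarrow> Ev X = Ev Y"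
    and inv: "\<And>X c r. r > 0 \<Longrightarrow> Ev (\<lambda>i. c + r *\<^sub>R X i) = Ev X"
    and gen: "\<And>X v. Ev X \<Longrightarrow> v \<in> affs (A - {t}) \<Longrightarrow> (\<And>i. i \<in> P \<Longrightarrow> v \<bullet> hat (X i) = 0) \<Longrightarrow> v = 0"
    and G: "G \<in> borel_measurable (ballM P)" and \<gamma>: "\<gamma> \<in> borel_measurable borel"
    and G\<gamma>: "\<And>X a b. Ev X \<Longrightarrow> (\<And>j. j \<notin> A - {t} \<Longrightarrow> a $ j = 0) \<Longrightarrow> (\<And>i. i \<in> P \<Longrightarrow> X i $ t = a \<bullet> X i + b) \<Longrightarrow>
        G X = \<gamma> (b / sqrt (1 + (norm a)\<^sup>2))"
  shows "(\<integral>\<^sup>+X. of_bool (Ev X) * G X \<partial>ballM P) * ennreal (wallis (card P * CARD('n)))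
     = (\<integral>\<^sup>+h. \<gamma> h * height_weight (card P * CARD('n) - 1) h \<partial>lborel) * emeasure (ballM P) {X \<in> space (ballM P). Ev X}"
proof -
  obtain C where C0: "\<forall>G \<gamma>. G \<in> borel_measurable (ballM P) \<longrightarrow> \<gamma> \<in> borel_measurable borel \<longrightarrow>
     (\<forall>X a b. Ev X \<longrightarrow> (\<forall>j. j \<notin> A - {t} \<longrightarrow> a $ j = 0) \<longrightarrow> (\<forall>i\<in>P. X i $ t = a \<bullet> X i + b) \<longrightarrow>
        G X = \<gamma> (b / sqrt (1 + (norm a)\<^sup>2))) \<longrightarrow>
     (\<integral>\<^sup>+X. of_bool (Ev X) * G X \<partial>ballM P) = (\<integral>\<^sup>+h. \<gamma> h * height_weight (card P * CARD('n) - 1) h \<partial>lborel) * C"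
    using ballM_disintegration[OF P t card Evm dep inv gen] by (rule exE)
  note C = C0[rule_format]
  have pos: "card P * CARD('n) > 0" using P by (simp add: card_gt_0_iff)
  have "emeasure (ballM P) {X \<in> space (ballM P). Ev X} = (\<integral>\<^sup>+X. indicator {X \<in> space (ballM P). Ev X} X \<partial>ballM P)"
    using Evm unfolding pred_def by (rule nn_integral_indicator[symmetric])
  also have "\<dots> = (\<integral>\<^sup>+X. of_bool (Ev X) \<partial>ballM P)"
    by (intro nn_integral_cong) (simp add: indicator_def)
  also have "\<dots> = (\<integral>\<^sup>+X. of_bool (Ev X) * 1 \<partial>ballM P)" by (simp only: mult_1_right)
  also have "\<dots> = (\<integral>\<^sup>+h. 1 * height_weight (card P * CARD('n) - 1) h \<partial>lborel) * C"
    by (rule C) auto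
  also have "(\<integral>\<^sup>+h. 1 * height_weight (card P * CARD('n) - 1) h \<partial>lborel) = ennreal (wallis (card P * CARD('n)))"
    using height_weight_total[of "card P * CARD('n) - 1"] pos by simp
  finally have 1: "emeasure (ballM P) {X \<in> space (ballM P). Ev X} = ennreal (wallis (card P * CARD('n))) * C" .
  have 2: "(\<integral>\<^sup>+X. of_bool (Ev X) * G X \<partial>ballM P) = (\<integral>\<^sup>+h. \<gamma> h * height_weight (card P * CARD('n) - 1) h \<partial>lborel) * C"
  proof (rule C[OF G \<gamma>])
    fix X a b assume "Ev X" "\<And>j. j \<notin> A - {t} \<Longrightarrow> a $ j = 0" "\<And>i. i \<in> P \<Longrightarrow> X i $ t = a \<bullet> X i + b"
    thus "G X = \<gamma> (b / sqrt (1 + (norm a)\<^sup>2))" by (rule G\<gamma>)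
  qed
  show ?thesis unfolding 1 2 by (simp only: mult.assoc mult.commute[of C])
qed

section \<open>A residue identity\<close>

definition csin_int :: "nat \<Rightarrow> complex \<Rightarrow> complex" where
  "csin_int d x = contour_integral (linepath 0 x) (\<lambda>y. sin y ^ d)"

lemma csin_int_deriv: "(csin_int d has_field_derivative sin x ^ d) (at x)"
proof -
  obtain g :: "complex \<Rightarrow> complex" where g: "\<And>x. (g has_field_derivative sin x ^ d) (at x)"
  proof (rule holomorphic_convex_primitive'[of UNIV "\<lambda>y::complex. sin y ^ d"])
    show "(\<lambda>y::complex. sin y ^ d) holomorphic_on UNIV" by (intro holomorphic_intros)
  qed auto
  have "csin_int d x = g x - g 0" for x
    unfolding csin_int_def
    using contour_integral_primitive[of UNIV g "\<lambda>y. sin y ^ d" "linepath 0 x"] g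
    by (auto intro!: contour_integral_unique)
  hence "csin_int d = (\<lambda>x. g x - g 0)" by auto
  thus ?thesis using g by (auto intro!: derivative_eq_intros)
qed

lemma csin_int_0 [simp]: "csin_int d 0 = 0"
  unfolding csin_int_def by simp

lemma csin_int_deriv' [derivative_intros]:
  "(f has_field_derivative f') (at x within S) \<Longrightarrow>
   ((\<lambda>x. csin_int d (f x)) has_field_derivative sin (f x) ^ d * f') (at x within S)"
  using DERIV_chain2[OF csin_int_deriv] by blast

lemma csin_int_holomorphic [holomorphic_intros]:
  "f holomorphic_on S \<Longrightarrow> (\<lambda>x. csin_int d (f x)) holomorphic_on S"
proof -
  assume f: "f holomorphic_on S"
  have "csin_int d holomorphic_on UNIV"
    using csin_int_deriv by (auto simp: holomorphic_on_def field_differentiable_def has_field_derivative_at_within)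
  from holomorphic_on_compose[OF f holomorphic_on_subset[OF this]] show ?thesis by (simp add: o_def)
qed

lemma csin_int_continuous [continuous_intros]:
  "continuous_on S f \<Longrightarrow> continuous_on S (\<lambda>x. csin_int d (f x))"
proof -
  assume f: "continuous_on S f"
  have "continuous_on UNIV (csin_int d)"
    using csin_int_deriv DERIV_isCont continuous_at_imp_continuous_on by blast
  from continuous_on_compose2[OF this f] show ?thesis by simp
qed

lemma constant_if_deriv_0:
  fixes f :: "complex \<Rightarrow> complex"
  assumes "\<And>x. (f has_field_derivative 0) (at x)"
  shows "f x = f y"
proof -
  have "\<exists>c. \<forall>x\<in>UNIV. f x = c"
    by (rule has_field_derivative_zero_constant) (use assms in auto)
  thus ?thesis by auto
qed

lemma csin_int_minus: "csin_int d (- x) = (-1) ^ (d + 1) * csin_int d x"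
proof -
  define f where "f = (\<lambda>x. csin_int d (- x) - (-1) ^ (d + 1) * csin_int d x)"
  have "(f has_field_derivative 0) (at x)" for x
    unfolding f_def by (rule derivative_eq_intros refl csin_int_deriv | simp add: power_minus')+
  from constant_if_deriv_0[of f x 0, OF this] have "f x = 0" unfolding f_def by simp
  thus ?thesis unfolding f_def by (simp only: right_minus_eq)
qed

lemma csin_int_reflect: "csin_int d (of_real pi - x) + csin_int d x = csin_int d (of_real pi)"
proof -
  define f where "f = (\<lambda>x. csin_int d (of_real pi - x) + csin_int d x)"
  have "sin (of_real pi - x) = sin x" for x :: complex
    by (simp add: sin_diff flip: sin_of_real cos_of_real)
  hence "(f has_field_derivative 0) (at x)" for x
    unfolding f_def by (auto intro!: derivative_eq_intros)
  from constant_if_deriv_0[of f x 0, OF this] show ?thesis unfolding f_def by simp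
qed

lemma csin_int_of_real:
  assumes "x \<ge> 0"
  shows "csin_int d (of_real x) = of_real (integral {0..x} (\<lambda>y. sin y ^ d))"
proof -
  have "((\<lambda>y. sin (complex_of_real y) ^ d) has_integral csin_int d (of_real x) - csin_int d (of_real 0)) {0..x}"
  proof (rule fundamental_theorem_of_calculus[OF assms])
    fix y assume "y \<in> {0..x}"
    show "((\<lambda>y. csin_int d (complex_of_real y)) has_vector_derivative sin (complex_of_real y) ^ d) (at y within {0..x})"
      by (rule has_vector_derivative_real_field[OF csin_int_deriv])
  qed
  hence "integral {0..x} (\<lambda>y. complex_of_real (sin y ^ d)) = csin_int d (of_real x)"
    by (simp add: integral_unique sin_of_real)
  moreover have "((\<lambda>y. complex_of_real (sin y ^ d)) has_integral of_real (integral {0..x} (\<lambda>y. sin y ^ d))) {0..x}"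
    by (intro has_integral_of_real integrable_integral integrable_continuous_interval continuous_intros)
  ultimately show ?thesis using integral_unique by metis
qed

lemma sin_nz_ball: "x \<noteq> 0 \<Longrightarrow> norm x < pi \<Longrightarrow> sin (x :: complex) \<noteq> 0"
proof
  assume x: "x \<noteq> 0" "norm x < pi" "sin x = 0"
  then obtain n :: int where n: "x = of_real (of_int n * pi)"
    by (auto simp: sin_eq_0)
  hence "norm x = \<bar>real_of_int n\<bar> * pi" by (simp add: abs_mult norm_mult)
  moreover have "n \<noteq> 0" using x n by auto
  hence "\<bar>real_of_int n\<bar> \<ge> 1" by linarith
  ultimately show False using x(2) by (simp add: mult_le_cancel_right1 not_le[symmetric])
qed

text \<open>The half-turn maps the circle to itself, traversed in the same direction from the
  opposite point, but changes the sign of the contour element.\<close>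

lemma residue_even:
  assumes r: "r > 0" and f: "f holomorphic_on ball 0 r - {0}" and even: "\<And>x. f (- x) = f x"
  shows "residue f 0 = 0"
proof -
  let ?e = "r / 2"
  have c: "(f has_contour_integral 2 * pi * \<i> * residue f 0) (circlepath 0 ?e)"
    using r f by (intro base_residue[of "ball 0 r"]) auto
  have neg: "uminus \<circ> circlepath 0 ?e = circlepath 0 (- ?e)"
    by (auto simp: fun_eq_iff circlepath_def part_circlepath_def linepath_def)
  have "contour_integral (circlepath 0 (- ?e)) f = - contour_integral (circlepath 0 ?e) (\<lambda>x. f (- x))"
    using contour_integral_negatepath[of "circlepath 0 ?e" f] neg by simp
  also have "\<dots> = - contour_integral (circlepath 0 ?e) f" by (simp add: even)
  finally have 1: "contour_integral (circlepath 0 (- ?e)) f = - contour_integral (circlepath 0 ?e) f" .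
  have "circlepath 0 (- ?e) = shiftpath (1/2) (circlepath 0 ?e)"
  proof (rule ext)
    fix x
    show "circlepath 0 (- ?e) x = shiftpath (1/2) (circlepath 0 ?e) x"
      unfolding circlepath_minus shiftpath_def
      using circlepath_add1[of 0 ?e "x - 1/2"] by (simp add: add.commute)
  qed
  hence "contour_integral (circlepath 0 (- ?e)) f = contour_integral (circlepath 0 ?e) f"
    by (simp add: contour_integral_shiftpath)
  with 1 have "contour_integral (circlepath 0 ?e) f = 0" by simp
  with contour_integral_unique[OF c] show ?thesis by simp
qed

section \<open>Contour integrals with moving poles\<close>

lemma residue_over_sin:
  assumes "open S" "z \<in> S" "f holomorphic_on S"
  shows "residue (\<lambda>w. f w / sin (w - z)) z = f z"
proof -
  obtain r where r: "r > 0" "ball z r \<subseteq> S" using assms open_contains_ball by blast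
  define q where "q = min r 1"
  have q: "q > 0" "ball z q \<subseteq> S" "q \<le> 1" using r unfolding q_def by auto
  have nz: "sin (w - z) \<noteq> 0" if "w \<in> ball z q - {z}" for w
  proof (rule sin_nz_ball)
    have "norm (w - z) < q" using that by (simp add: dist_norm norm_minus_commute)
    thus "norm (w - z) < pi" using q pi_gt3 by simp
  qed (use that in auto)
  show ?thesis
  proof (rule residue_simple'[of "ball z q"])
    show "(\<lambda>w. f w / sin (w - z)) holomorphic_on ball z q - {z}"
      using nz by (intro holomorphic_intros holomorphic_on_subset[OF assms(3)]) (use q in auto)
    have "isCont f z" using assms by (meson holomorphic_on_imp_continuous_on continuous_on_eq_continuous_at)
    hence "(f \<longlongrightarrow> f z) (at z)" by (simp add: isCont_def)
    moreover have "((\<lambda>w. (w - z) / sin (w - z)) \<longlongrightarrow> 1) (at z)"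
    proof -
      have "(sin has_field_derivative cos 0) (at (0::complex))" by (rule DERIV_sin)
      hence "((\<lambda>h. sin h / h) \<longlongrightarrow> (1::complex)) (at 0)" by (simp add: DERIV_def)
      hence "((\<lambda>h. inverse (sin h / h)) \<longlongrightarrow> inverse (1::complex)) (at 0)" by (intro tendsto_intros) auto
      hence "((\<lambda>h. h / sin h) \<longlongrightarrow> (1::complex)) (at 0)" by simp
      thus ?thesis by (intro LIM_offset_zero_cancel[of _ z]) simp
    qed
    ultimately have "((\<lambda>w. f w * ((w - z) / sin (w - z))) \<longlongrightarrow> f z * 1) (at z)" by (rule tendsto_mult)
    thus "((\<lambda>w. f w / sin (w - z) * (w - z)) \<longlongrightarrow> f z) (at z)" by (simp add: mult.commute)
  qed (use q in auto)
qed

text \<open>The choice is dictated by the values at the zeros of \<open>sin (x + \<phi>)\<close>.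
  With \<open>t = sin \<phi> / sin x\<close>, the point \<open>x = - \<phi>\<close> gives
  \<open>t = -1\<close>, and the base of the \<open>N\<close>-th power vanishes because
  \<open>csin_int d\<close> has parity \<open>d + 1\<close>; the point
  \<open>x = pi - \<phi>\<close> gives \<open>t = 1\<close> and the base
  \<open>csin_int d pi\<close>. These values become the right-hand side of
  \<open>residue_identity\<close>.\<close>

definition Psi :: "nat \<Rightarrow> nat \<Rightarrow> nat \<Rightarrow> complex \<Rightarrow> complex \<Rightarrow> complex" where
  "Psi d e N x \<phi> = (sin \<phi> / sin x) ^ (e + 1) * (csin_int d \<phi> + csin_int d x * (sin \<phi> / sin x) ^ d) ^ N"

text \<open>The derivative of \<open>Psi\<close> in \<open>t\<close>, expanded binomially so that
  every summand carries a single power of \<open>csin_int d x\<close> and integrates to one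
  residue.\<close>

definition Psi_t :: "nat \<Rightarrow> nat \<Rightarrow> nat \<Rightarrow> complex \<Rightarrow> complex \<Rightarrow> complex" where
  "Psi_t d e N x \<phi> = (\<Sum>i\<le>N. of_nat (N choose i) * of_nat (e + d * i + 1) * csin_int d \<phi> ^ (N - i) * csin_int d x ^ i * (sin \<phi> / sin x) ^ (e + d * i))"

text \<open>Both derivatives below are derivatives of the summands of \<^term>\<open>Psi\<close>. Their difference involves
  only the derivative in \<open>t = sin \<phi> / sin x\<close>, as \<open>t ^ d * sin x ^ d = sin \<phi> ^ d\<close>.\<close>

definition Psi_phi :: "nat \<Rightarrow> nat \<Rightarrow> nat \<Rightarrow> complex \<Rightarrow> complex \<Rightarrow> complex" where
  "Psi_phi d e N x \<phi> = Psi_t d e N x \<phi> * (cos \<phi> / sin x)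
     + (sin \<phi> / sin x) ^ (e + 1) * (of_nat N * (csin_int d \<phi> + csin_int d x * (sin \<phi> / sin x) ^ d) ^ (N - 1) * sin \<phi> ^ d)"

definition Psi_x :: "nat \<Rightarrow> nat \<Rightarrow> nat \<Rightarrow> complex \<Rightarrow> complex \<Rightarrow> complex" where
  "Psi_x d e N x \<phi> = Psi_t d e N x \<phi> * (- sin \<phi> * cos x / (sin x)\<^sup>2)
     + (sin \<phi> / sin x) ^ (e + 1) * (of_nat N * (csin_int d \<phi> + csin_int d x * (sin \<phi> / sin x) ^ d) ^ (N - 1) * sin \<phi> ^ d)"

text \<open>Treats the ratio of sines and the two primitives as separate arguments, so that one
  chain rule yields both partial derivatives of \<open>Psi\<close>.\<close>

definition Psi_poly :: "nat \<Rightarrow> nat \<Rightarrow> nat \<Rightarrow> complex \<Rightarrow> complex \<Rightarrow> complex \<Rightarrow> complex" where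
  "Psi_poly d e N a b t = t ^ (e + 1) * (a + b * t ^ d) ^ N"

lemma Psi_poly_deriv_t:
  "(Psi_poly d e N a b has_field_derivative (\<Sum>i\<le>N. of_nat (N choose i) * of_nat (e + d * i + 1) * a ^ (N - i) * b ^ i * t ^ (e + d * i))) (at t)"
proof -
  have "Psi_poly d e N a b = (\<lambda>t. \<Sum>i\<le>N. of_nat (N choose i) * a ^ (N - i) * b ^ i * t ^ (e + d * i + 1))"
    unfolding Psi_poly_def
    by (rule ext, subst add.commute, subst binomial_ring) (auto simp: sum_distrib_left power_mult_distrib power_add power_mult intro!: sum.cong)
  moreover have "((\<lambda>t. c * t ^ (n + 1)) has_field_derivative of_nat (n + 1) * c * t ^ n) (at t)" for c :: complex and n
    using DERIV_cmult[OF DERIV_power[OF DERIV_ident, of "Suc n"], of c t UNIV] by (simp del: power_Suc of_nat_Suc add: mult_ac)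
  hence "((\<lambda>t. \<Sum>i\<le>N. (of_nat (N choose i) * a ^ (N - i) * b ^ i) * t ^ (e + d * i + 1)) has_field_derivative
     (\<Sum>i\<le>N. of_nat (e + d * i + 1) * (of_nat (N choose i) * a ^ (N - i) * b ^ i) * t ^ (e + d * i))) (at t)"
    by (intro DERIV_sum)
  ultimately show ?thesis by (simp only: mult_ac)
qed

lemma Psi_poly_deriv:
  assumes a: "(a has_field_derivative a') (at x)" and b: "(b has_field_derivative b') (at x)" and t: "(t has_field_derivative t') (at x)"
  shows "((\<lambda>x. Psi_poly d e N (a x) (b x) (t x)) has_field_derivative
     (\<Sum>i\<le>N. of_nat (N choose i) * of_nat (e + d * i + 1) * a x ^ (N - i) * b x ^ i * t x ^ (e + d * i)) * t'
     + t x ^ (e + 1) * (of_nat N * (a x + b x * t x ^ d) ^ (N - 1) * (a' + b' * t x ^ d))) (at x)"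
proof -
  let ?T = "of_nat (e + 1) * t x ^ e * (a x + b x * t x ^ d) ^ N + t x ^ (e + 1) * (of_nat N * (a x + b x * t x ^ d) ^ (N - 1) * (b x * (of_nat d * t x ^ (d - 1))))"
  have "(Psi_poly d e N (a x) (b x) has_field_derivative ?T) (at (t x))"
    unfolding Psi_poly_def by (rule derivative_eq_intros refl | simp)+
  \<comment> \<open>Both expressions are derivatives in \<open>t\<close> of the same polynomial, so
    the expanded form may replace the one that the product rule produces.\<close>
  from DERIV_unique[OF this Psi_poly_deriv_t]
  have T: "(\<Sum>i\<le>N. of_nat (N choose i) * of_nat (e + d * i + 1) * a x ^ (N - i) * b x ^ i * t x ^ (e + d * i)) = ?T" by simp
  show ?thesis
    unfolding T Psi_poly_def by (rule derivative_eq_intros a b t refl | simp add: algebra_simps)+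
qed

lemma Psi_deriv_phi:
  assumes "sin x \<noteq> 0"
  shows "((\<lambda>\<phi>. Psi d e N x \<phi>) has_field_derivative Psi_phi d e N x \<phi>) (at \<phi>)"
proof -
  have t: "((\<lambda>\<phi>. sin \<phi> / sin x) has_field_derivative cos \<phi> / sin x) (at \<phi>)"
    using assms by (auto intro!: derivative_eq_intros)
  have b: "((\<lambda>\<phi>. csin_int d x) has_field_derivative 0) (at \<phi>)" by simp
  show ?thesis
    using Psi_poly_deriv[OF csin_int_deriv[of d \<phi>] b t, of d e N]
    unfolding Psi_def Psi_phi_def Psi_t_def Psi_poly_def by simp
qed

lemma Psi_deriv_x:
  assumes "sin x \<noteq> 0"
  shows "((\<lambda>x. Psi d e N x \<phi>) has_field_derivative Psi_x d e N x \<phi>) (at x)"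
proof -
  have t: "((\<lambda>x. sin \<phi> / sin x) has_field_derivative - sin \<phi> * cos x / (sin x)\<^sup>2) (at x)"
    using assms by (auto intro!: derivative_eq_intros simp: power2_eq_square)
  have a: "((\<lambda>x. csin_int d \<phi>) has_field_derivative 0) (at x)" by simp
  have "sin x ^ d * (sin \<phi> / sin x) ^ d = sin \<phi> ^ d" using assms by (simp add: power_divide)
  thus ?thesis
    using Psi_poly_deriv[OF a csin_int_deriv[of d x] t, of d e N]
    unfolding Psi_def Psi_x_def Psi_t_def Psi_poly_def by simp
qed

definition Psi_kernel :: "nat \<Rightarrow> nat \<Rightarrow> nat \<Rightarrow> complex \<Rightarrow> complex \<Rightarrow> complex" where
  "Psi_kernel d e N x \<phi> = Psi d e N x \<phi> / sin (x + \<phi>)"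

definition Psi_kernel_x :: "nat \<Rightarrow> nat \<Rightarrow> nat \<Rightarrow> complex \<Rightarrow> complex \<Rightarrow> complex" where
  "Psi_kernel_x d e N x \<phi> = Psi_x d e N x \<phi> / sin (x + \<phi>) - Psi d e N x \<phi> * cos (x + \<phi>) / (sin (x + \<phi>))\<^sup>2"

lemma Psi_kernel_deriv_x:
  assumes "sin x \<noteq> 0" "sin (x + \<phi>) \<noteq> 0"
  shows "((\<lambda>x. Psi_kernel d e N x \<phi>) has_field_derivative Psi_kernel_x d e N x \<phi>) (at x)"
  unfolding Psi_kernel_def Psi_kernel_x_def using assms
  by (auto intro!: derivative_eq_intros Psi_deriv_x simp: field_simps power2_eq_square)

text \<open>The denominator is symmetric in \<open>x\<close> and \<phi>, so the partial derivatives
  of the kernel differ only through those of \<open>Psi\<close>, and there the addition theorem for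
  the sine cancels the denominator. Along a closed curve in \<open>x\<close> the derivative in
  \<open>x\<close> integrates to 0, and only the residues remain.\<close>

lemma Psi_kernel_deriv_phi:
  assumes "sin x \<noteq> 0" "sin (x + \<phi>) \<noteq> 0"
  shows "((\<lambda>\<phi>. Psi_kernel d e N x \<phi>) has_field_derivative Psi_kernel_x d e N x \<phi> + Psi_t d e N x \<phi> / (sin x)\<^sup>2) (at \<phi>)"
proof -
  have "((\<lambda>\<phi>. Psi_kernel d e N x \<phi>) has_field_derivative Psi_phi d e N x \<phi> / sin (x + \<phi>) - Psi d e N x \<phi> * cos (x + \<phi>) / (sin (x + \<phi>))\<^sup>2) (at \<phi>)"
    unfolding Psi_kernel_def using assms
    by (auto intro!: derivative_eq_intros Psi_deriv_phi simp: field_simps power2_eq_square)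
  moreover have "Psi_phi d e N x \<phi> - Psi_x d e N x \<phi> = Psi_t d e N x \<phi> * (sin (x + \<phi>) / (sin x)\<^sup>2)"
    unfolding Psi_phi_def Psi_x_def sin_add using assms(1)
    by (simp add: field_simps power2_eq_square)
  hence "Psi_phi d e N x \<phi> / sin (x + \<phi>) = Psi_x d e N x \<phi> / sin (x + \<phi>) + Psi_t d e N x \<phi> / (sin x)\<^sup>2"
    using assms by (simp add: field_simps)
  ultimately show ?thesis unfolding Psi_kernel_x_def by (simp add: algebra_simps)
qed

lemma Psi_t_continuous:
  fixes f g :: "'a::t2_space \<Rightarrow> complex"
  assumes "continuous_on S f" "continuous_on S g" "\<And>s. s \<in> S \<Longrightarrow> sin (f s) \<noteq> 0"
  shows "continuous_on S (\<lambda>s. Psi_t d e N (f s) (g s))"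
  unfolding Psi_t_def using assms by (intro continuous_intros) auto

lemma Psi_continuous:
  fixes f g :: "'a::t2_space \<Rightarrow> complex"
  assumes "continuous_on S f" "continuous_on S g" "\<And>s. s \<in> S \<Longrightarrow> sin (f s) \<noteq> 0"
  shows "continuous_on S (\<lambda>s. Psi d e N (f s) (g s))"
  unfolding Psi_def using assms by (intro continuous_intros) auto

lemma Psi_kernel_continuous:
  fixes f g :: "'a::t2_space \<Rightarrow> complex"
  assumes "continuous_on S f" "continuous_on S g" "\<And>s. s \<in> S \<Longrightarrow> sin (f s) \<noteq> 0" "\<And>s. s \<in> S \<Longrightarrow> sin (f s + g s) \<noteq> 0"
  shows "continuous_on S (\<lambda>s. Psi_kernel d e N (f s) (g s))"
  unfolding Psi_kernel_def using assms by (intro continuous_intros Psi_continuous) auto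

lemma Psi_kernel_x_continuous:
  fixes f g :: "'a::t2_space \<Rightarrow> complex"
  assumes "continuous_on S f" "continuous_on S g" "\<And>s. s \<in> S \<Longrightarrow> sin (f s) \<noteq> 0" "\<And>s. s \<in> S \<Longrightarrow> sin (f s + g s) \<noteq> 0"
  shows "continuous_on S (\<lambda>s. Psi_kernel_x d e N (f s) (g s))"
  unfolding Psi_kernel_x_def Psi_x_def using assms by (intro continuous_intros Psi_continuous Psi_t_continuous) auto

lemma sin_shift_nz:
  assumes "norm x < \<phi>" "norm x < pi - \<phi>"
  shows "sin (x + complex_of_real \<phi>) \<noteq> 0"
proof
  assume "sin (x + complex_of_real \<phi>) = 0"
  then obtain n :: int where n: "x + of_real \<phi> = of_real (of_int n * pi)" by (auto simp: sin_eq_0)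
  hence "x = of_real (of_int n * pi - \<phi>)" by (simp add: algebra_simps)
  hence "norm x = \<bar>of_int n * pi - \<phi>\<bar>" by (simp only: norm_of_real)
  moreover have "\<bar>of_int n * pi - \<phi>\<bar> \<ge> min \<phi> (pi - \<phi>)"
  proof (cases "n \<le> 0")
    case True
    hence "of_int n * pi \<le> 0" by (simp add: mult_nonpos_nonneg)
    thus ?thesis by linarith
  next
    case False
    hence "of_int n * pi \<ge> 1 * pi" by (intro mult_right_mono) auto
    thus ?thesis by linarith
  qed
  ultimately show False using assms by linarith
qed

lemma contour_integral_circlepath:
  "contour_integral (circlepath 0 r) f = integral (cbox 0 1) (\<lambda>s. f (circlepath 0 r s) * (2 * of_real pi * \<i> * r * exp (2 * of_real pi * \<i> * s)))"
  unfolding contour_integral_integral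
  by (simp add: vector_derivative_circlepath cbox_interval)

definition sin_residue :: "nat \<Rightarrow> nat \<Rightarrow> nat \<Rightarrow> complex" where
  "sin_residue d i m = residue (\<lambda>x. csin_int d x ^ i / sin x ^ m) 0"

definition residue_sum :: "nat \<Rightarrow> nat \<Rightarrow> nat \<Rightarrow> real \<Rightarrow> complex" where
  "residue_sum d e N \<phi> = (\<Sum>i\<le>N. of_nat (N choose i) * of_nat (e + d * i + 1) * csin_int d \<phi> ^ (N - i) * sin (of_real \<phi>) ^ (e + d * i) * sin_residue d i (e + d * i + 2))"

lemma contour_integral_Psi_t:
  assumes r: "0 < r" "r < pi"
  shows "((\<lambda>x. Psi_t d e N x \<phi> / (sin x)\<^sup>2) has_contour_integral
     2 * of_real pi * \<i> * (\<Sum>i\<le>N. of_nat (N choose i) * of_nat (e + d * i + 1) * csin_int d \<phi> ^ (N - i) * sin \<phi> ^ (e + d * i) * sin_residue d i (e + d * i + 2))) (circlepath 0 r)"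
proof -
  have nz: "sin x \<noteq> 0" if "x \<in> ball 0 pi - {0}" for x :: complex
    using that by (intro sin_nz_ball) auto
  have 1: "((\<lambda>x. csin_int d x ^ i / sin x ^ m) has_contour_integral 2 * pi * \<i> * sin_residue d i m) (circlepath 0 r)" for i m
    unfolding sin_residue_def
  proof (rule base_residue[of "ball 0 pi"])
    show "(\<lambda>x. csin_int d x ^ i / sin x ^ m) holomorphic_on ball 0 pi - {0}"
      using nz by (intro holomorphic_intros) auto
  qed (use r in auto)
  let ?c = "\<lambda>i. of_nat (N choose i) * of_nat (e + d * i + 1) * csin_int d \<phi> ^ (N - i) * sin \<phi> ^ (e + d * i)"
  have 2: "((\<lambda>x. \<Sum>i\<le>N. ?c i * (csin_int d x ^ i / sin x ^ (e + d * i + 2))) has_contour_integral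
      (\<Sum>i\<le>N. ?c i * (2 * pi * \<i> * sin_residue d i (e + d * i + 2)))) (circlepath 0 r)"
    by (intro has_contour_integral_sum has_contour_integral_lmul 1) auto
  have "Psi_t d e N x \<phi> / (sin x)\<^sup>2 = (\<Sum>i\<le>N. ?c i * (csin_int d x ^ i / sin x ^ (e + d * i + 2)))" for x
    unfolding Psi_t_def sum_divide_distrib
    by (intro sum.cong refl) (simp add: power_divide power_add mult_ac power2_eq_square)
  moreover have "(\<Sum>i\<le>N. ?c i * (2 * pi * \<i> * sin_residue d i (e + d * i + 2))) = 2 * of_real pi * \<i> * (\<Sum>i\<le>N. ?c i * sin_residue d i (e + d * i + 2))"
    by (simp add: sum_distrib_left mult_ac)
  ultimately show ?thesis using 2 by simp
qed

text \<open>While \<phi> stays strictly between \<open>r\<close> and \<open>pi - r\<close>, the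
  poles \<open>- \<phi>\<close> and \<open>pi - \<phi>\<close> remain outside the circle, and the
  contour integral may be differentiated in \<phi>.\<close>

lemma circlepath_contour_diff:
  assumes r: "0 < r" "r < a" "a \<le> b" "b < pi - r"
  shows "((\<lambda>\<phi>. 2 * of_real pi * \<i> * residue_sum d e N \<phi>) has_integral
     (contour_integral (circlepath 0 r) (\<lambda>x. Psi_kernel d e N x (of_real b)) - contour_integral (circlepath 0 r) (\<lambda>x. Psi_kernel d e N x (of_real a)))) {a..b}"
proof (rule fundamental_theorem_of_calculus[OF r(3)])
  fix \<phi>0 assume \<phi>0: "\<phi>0 \<in> {a..b}"
  let ?g = "circlepath 0 r"
  let ?w = "\<lambda>s::real. 2 * of_real pi * \<i> * r * exp (2 * of_real pi * \<i> * s) :: complex"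
  have ng: "norm (?g s) = r" for s
    using r by (simp add: circlepath norm_mult)
  have nz1: "sin (?g s) \<noteq> 0" for s
    using ng[of s] r by (intro sin_nz_ball) auto
  have nz2: "sin (?g s + of_real \<phi>) \<noteq> 0" if "\<phi> \<in> {a..b}" for s \<phi>
    using ng[of s] r that by (intro sin_shift_nz) auto
  have gc: "continuous_on S (\<lambda>z. ?g (snd z))" for S :: "(real \<times> real) set"
    unfolding circlepath by (intro continuous_intros)
  have wc: "continuous_on S (\<lambda>z. ?w (snd z))" for S :: "(real \<times> real) set"
    by (intro continuous_intros)
  have nz3: "z \<in> {a..b} \<times> cbox 0 1 \<Longrightarrow> sin (?g (snd z) + complex_of_real (fst z)) \<noteq> 0" for z
    using nz2 by (auto simp: mem_Times_iff)
  let ?f = "\<lambda>\<phi> s. Psi_kernel d e N (?g s) (of_real \<phi>) * ?w s"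
  let ?f' = "\<lambda>\<phi> s. (Psi_kernel_x d e N (?g s) (of_real \<phi>) + Psi_t d e N (?g s) (of_real \<phi>) / (sin (?g s))\<^sup>2) * ?w s"
  have "((\<lambda>\<phi>. integral (cbox 0 1) (?f \<phi>)) has_vector_derivative integral (cbox 0 1) (?f' \<phi>0)) (at \<phi>0 within {a..b})"
  proof (rule leibniz_rule_vector_derivative[OF _ _ _ \<phi>0])
    fix \<phi> s :: real assume \<phi>: "\<phi> \<in> {a..b}" and "s \<in> cbox 0 1"
    have "((\<lambda>\<phi>. Psi_kernel d e N (?g s) (of_real \<phi>)) has_vector_derivative
       (Psi_kernel_x d e N (?g s) (of_real \<phi>) + Psi_t d e N (?g s) (of_real \<phi>) / (sin (?g s))\<^sup>2)) (at \<phi> within {a..b})"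
      by (rule has_vector_derivative_real_field[OF Psi_kernel_deriv_phi[OF nz1 nz2[OF \<phi>]]])
    thus "((\<lambda>\<phi>. ?f \<phi> s) has_vector_derivative ?f' \<phi> s) (at \<phi> within {a..b})"
      by (rule has_vector_derivative_mult_left)
  next
    fix \<phi> :: real assume \<phi>: "\<phi> \<in> {a..b}"
    have "continuous_on (cbox 0 1) (\<lambda>s. ?f \<phi> s)"
      unfolding circlepath[abs_def] using nz1 nz2[OF \<phi>] unfolding circlepath
      by (intro continuous_intros Psi_kernel_continuous) auto
    thus "?f \<phi> integrable_on cbox 0 1" by (rule integrable_continuous)
  next
    show "continuous_on ({a..b} \<times> cbox 0 1) (\<lambda>(\<phi>, s). ?f' \<phi> s)"
      unfolding case_prod_unfold
      by (intro continuous_on_mult continuous_on_add continuous_on_divide continuous_on_power wc Psi_kernel_x_continuous Psi_t_continuous gc continuous_on_of_real continuous_on_fst continuous_on_id continuous_on_sin ballI)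
         (auto simp: nz1 nz3)
  qed simp
  moreover have "integral (cbox 0 1) (?f \<phi>) = contour_integral ?g (\<lambda>x. Psi_kernel d e N x (of_real \<phi>))" for \<phi>
    by (rule contour_integral_circlepath[symmetric])
  moreover have "integral (cbox 0 1) (?f' \<phi>0) = 2 * of_real pi * \<i> * residue_sum d e N \<phi>0"
  proof -
    have "((\<lambda>x. Psi_kernel_x d e N x (of_real \<phi>0)) has_contour_integral 0) ?g"
    proof (rule Cauchy_theorem_primitive[of "sphere 0 r" "\<lambda>x. Psi_kernel d e N x (of_real \<phi>0)"])
      fix x :: complex assume "x \<in> sphere 0 r"
      hence x: "norm x = r" by simp
      have "sin x \<noteq> 0" using x r by (intro sin_nz_ball) auto
      moreover have "sin (x + of_real \<phi>0) \<noteq> 0" using x r \<phi>0 by (intro sin_shift_nz) auto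
      ultimately show "((\<lambda>x. Psi_kernel d e N x (of_real \<phi>0)) has_field_derivative Psi_kernel_x d e N x (of_real \<phi>0)) (at x within sphere 0 r)"
        by (intro has_field_derivative_at_within[OF Psi_kernel_deriv_x])
    qed (use r in auto)
    from has_contour_integral_add[OF this contour_integral_Psi_t[of r d e N "of_real \<phi>0"]]
    have "contour_integral ?g (\<lambda>x. Psi_kernel_x d e N x (of_real \<phi>0) + Psi_t d e N x (of_real \<phi>0) / (sin x)\<^sup>2) = 2 * of_real pi * \<i> * residue_sum d e N \<phi>0"
      using r unfolding residue_sum_def by (simp add: contour_integral_unique)
    thus ?thesis unfolding contour_integral_circlepath .
  qed
  ultimately show "((\<lambda>\<phi>. contour_integral ?g (\<lambda>x. Psi_kernel d e N x (of_real \<phi>))) has_vector_derivative 2 * of_real pi * \<i> * residue_sum d e N \<phi>0) (at \<phi>0 within {a..b})"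
    by simp
qed

lemma Psi_holomorphic:
  assumes "\<And>x. x \<in> S \<Longrightarrow> sin x \<noteq> 0"
  shows "(\<lambda>x. Psi d e N x \<phi>) holomorphic_on S"
  unfolding Psi_def using assms by (intro holomorphic_intros) auto

lemma winding_circle: "norm z < 1 \<Longrightarrow> winding_number (circlepath 0 1) z = 1"
  by (intro winding_number_circlepath) simp

text \<open>The small circle has to shrink with the pole \<open>p\<close>; the unit circle stays
  fixed and allows a limit, at the price of one residue.\<close>

lemma circlepath_expand:
  assumes r: "0 < r" "r < norm p" and p: "norm p < 1/2"
    and f: "f holomorphic_on ball 0 (3/2) - {0, p}"
  shows "contour_integral (circlepath 0 1) f = contour_integral (circlepath 0 r) f + 2 * of_real pi * \<i> * residue f p"
proof -
  have p0: "p \<noteq> 0" using r by auto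
  have "contour_integral (circlepath 0 1) f = 2 * pi * \<i> * (\<Sum>q\<in>{0, p}. winding_number (circlepath 0 1) q * residue f q)"
  proof (rule Residue_theorem[of "ball 0 (3/2)"])
    show "path_image (circlepath 0 1) \<subseteq> ball 0 (3/2) - {0, p}" using p by auto
    show "\<forall>z. z \<notin> ball 0 (3/2) \<longrightarrow> winding_number (circlepath 0 1) z = 0"
    proof (intro allI impI)
      fix z :: complex assume "z \<notin> ball 0 (3/2)"
      thus "winding_number (circlepath 0 1) z = 0"
        by (intro winding_number_zero_outside[of _ "cball 0 1"]) auto
    qed
  qed (use f in auto)
  also have "\<dots> = 2 * pi * \<i> * (residue f 0 + residue f p)"
    using p p0 winding_circle[of p] winding_circle[of 0] by simp
  finally have 1: "contour_integral (circlepath 0 1) f = 2 * pi * \<i> * (residue f 0 + residue f p)" .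
  have 2: "2 * pi * \<i> * residue f 0 = contour_integral (circlepath 0 r) f"
  proof (rule contour_integral_unique[symmetric])
    show "(f has_contour_integral 2 * pi * \<i> * residue f 0) (circlepath 0 r)"
    proof (rule base_residue[of "ball 0 (norm p)"])
      show "f holomorphic_on ball 0 (norm p) - {0}"
        by (rule holomorphic_on_subset[OF f]) (use p in auto)
    qed (use r p0 in auto)
  qed
  show ?thesis unfolding 1 distrib_left 2 by simp
qed

lemma Psi_kernel_holomorphic:
  assumes "\<And>x. x \<in> S \<Longrightarrow> sin x \<noteq> 0" "\<And>x. x \<in> S \<Longrightarrow> sin (x + \<phi>) \<noteq> 0"
  shows "(\<lambda>x. Psi_kernel d e N x \<phi>) holomorphic_on S"
  unfolding Psi_kernel_def using assms by (intro holomorphic_intros Psi_holomorphic) auto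

lemma Psi_kernel_expand_left:
  assumes p: "0 < p" "p < 1/2"
  shows "contour_integral (circlepath 0 (p / 2)) (\<lambda>x. Psi_kernel d e N x (of_real p))
    = contour_integral (circlepath 0 1) (\<lambda>x. Psi_kernel d e N x (of_real p)) - 2 * of_real pi * \<i> * ((-1) ^ (e + 1) * 0 ^ N)"
proof -
  let ?f = "\<lambda>x. Psi_kernel d e N x (of_real p)" and ?p = "- complex_of_real p"
  have "residue ?f ?p = Psi d e N ?p (of_real p)"
  proof -
    have "(\<lambda>x. Psi d e N x (of_real p)) holomorphic_on ball ?p p"
    proof (rule Psi_holomorphic, rule sin_nz_ball)
      fix x assume x: "x \<in> ball ?p p"
      show "x \<noteq> 0" using x p by auto
      have "norm x \<le> norm (x - ?p) + norm ?p" using norm_triangle_sub[of x ?p] by simp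
      also have "\<dots> < p + p" using x p by (simp add: dist_norm norm_minus_commute)
      also have "\<dots> < pi" using p pi_gt3 by linarith
      finally show "norm x < pi" .
    qed
    from residue_over_sin[OF open_ball _ this, of ?p] show ?thesis using p by (simp add: Psi_kernel_def)
  qed
  also have "\<dots> = (-1) ^ (e + 1) * 0 ^ N"
  proof -
    have s: "sin (complex_of_real p) \<noteq> 0" using p pi_gt3 by (intro sin_nz_ball) auto
    hence "sin (complex_of_real p) / sin ?p = -1" by simp
    moreover have "csin_int d (of_real p) + csin_int d ?p * (-1) ^ d = 0"
      unfolding csin_int_minus by (simp add: mult_ac flip: power_add power_mult_distrib)
    ultimately show ?thesis unfolding Psi_def by (simp only:)
  qed
  finally have res: "residue ?f ?p = (-1) ^ (e + 1) * 0 ^ N" .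
  have "contour_integral (circlepath 0 1) ?f = contour_integral (circlepath 0 (p / 2)) ?f + 2 * of_real pi * \<i> * residue ?f ?p"
  proof (rule circlepath_expand)
    show "?f holomorphic_on ball 0 (3/2) - {0, ?p}"
    proof (rule Psi_kernel_holomorphic)
      fix x assume x: "x \<in> ball 0 (3/2) - {0, ?p}"
      show "sin x \<noteq> 0" using x pi_gt3 by (intro sin_nz_ball) auto
      have "norm (x + of_real p) \<le> norm x + p" using norm_triangle_ineq[of x "of_real p"] p by simp
      thus "sin (x + of_real p) \<noteq> 0" using x pi_gt3 p by (intro sin_nz_ball) (auto simp: add_eq_0_iff)
    qed
  qed (use p in auto)
  thus ?thesis unfolding res by simp
qed

lemma sin_pi_shift: "sin (x + complex_of_real (pi - p)) = - sin (x - of_real p)"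
proof -
  have e: "x + complex_of_real (pi - p) = (x - of_real p) + of_real pi" by simp
  have "sin (y + of_real pi) = - sin y" for y :: complex
    unfolding sin_add by (simp flip: sin_of_real cos_of_real)
  thus ?thesis unfolding e .
qed

text \<open>Here the angle is \<open>pi - p\<close> and the pole crossed is \<open>p\<close>. The
  residue changes sign because \<open>sin (x + (pi - p)) = - sin (x - p)\<close>.\<close>

lemma Psi_kernel_expand_right:
  assumes p: "0 < p" "p < 1/2"
  shows "contour_integral (circlepath 0 (p / 2)) (\<lambda>x. Psi_kernel d e N x (of_real (pi - p)))
    = contour_integral (circlepath 0 1) (\<lambda>x. Psi_kernel d e N x (of_real (pi - p))) + 2 * of_real pi * \<i> * csin_int d (of_real pi) ^ N"
proof -
  let ?f = "\<lambda>x. Psi_kernel d e N x (of_real (pi - p))" and ?p = "complex_of_real p"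
  have "residue ?f ?p = - Psi d e N ?p (of_real (pi - p))"
  proof -
    have "(\<lambda>x. - Psi d e N x (of_real (pi - p))) holomorphic_on ball ?p p"
    proof (intro holomorphic_intros Psi_holomorphic, rule sin_nz_ball)
      fix x assume x: "x \<in> ball ?p p"
      show "x \<noteq> 0" using x p by auto
      have "norm x \<le> norm (x - ?p) + norm ?p" using norm_triangle_sub[of x ?p] by simp
      also have "\<dots> < p + p" using x p by (simp add: dist_norm norm_minus_commute)
      also have "\<dots> < pi" using p pi_gt3 by linarith
      finally show "norm x < pi" .
    qed
    from residue_over_sin[OF open_ball _ this, of ?p] show ?thesis using p unfolding Psi_kernel_def sin_pi_shift by simp
  qed
  also have "\<dots> = - (csin_int d (of_real pi) ^ N)"
  proof -
    have s: "sin (complex_of_real p) \<noteq> 0" using p pi_gt3 by (intro sin_nz_ball) auto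
    have "sin (complex_of_real (pi - p)) = sin ?p"
      by (simp only: sin_of_real sin_pi_minus)
    hence "sin (complex_of_real (pi - p)) / sin ?p = 1" using s by simp
    moreover have "csin_int d (of_real (pi - p)) + csin_int d ?p = csin_int d (of_real pi)"
      using csin_int_reflect[of d ?p] by simp
    ultimately show ?thesis unfolding Psi_def by simp
  qed
  finally have res: "residue ?f ?p = - (csin_int d (of_real pi) ^ N)" .
  have "contour_integral (circlepath 0 1) ?f = contour_integral (circlepath 0 (p / 2)) ?f + 2 * of_real pi * \<i> * residue ?f ?p"
  proof (rule circlepath_expand)
    show "?f holomorphic_on ball 0 (3/2) - {0, ?p}"
    proof (rule Psi_kernel_holomorphic)
      fix x assume x: "x \<in> ball 0 (3/2) - {0, ?p}"
      show "sin x \<noteq> 0" using x pi_gt3 by (intro sin_nz_ball) auto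
      have "norm (x - of_real p) \<le> norm x + p" using norm_triangle_ineq4[of x "of_real p"] p by simp
      hence "sin (x - of_real p) \<noteq> 0" using x pi_gt3 p by (intro sin_nz_ball) auto
      thus "sin (x + of_real (pi - p)) \<noteq> 0" unfolding sin_pi_shift by simp
    qed
  qed (use p in auto)
  thus ?thesis unfolding res by simp
qed

text \<open>On the unit circle the kernel remains regular when the angle reaches 0 or
  \<open>pi\<close>, and it vanishes there because of the factor \<open>sin \<phi>\<close>. The
  function \<open>g\<close> serves both ends.\<close>

lemma circle_HH_tendsto_0:
  fixes g :: "real \<Rightarrow> real"
  assumes g: "continuous_on {0..1/2} g" "sin (g 0) = 0"
    and nz: "\<And>x p. norm x = 1 \<Longrightarrow> p \<in> {0..1/2} \<Longrightarrow> sin (x + complex_of_real (g p)) \<noteq> 0"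
  shows "((\<lambda>p. contour_integral (circlepath 0 1) (\<lambda>x. Psi_kernel d e N x (of_real (g p)))) \<longlongrightarrow> 0) (at_right 0)"
proof -
  let ?c = "circlepath 0 1"
  let ?w = "\<lambda>s::real. 2 * of_real pi * \<i> * 1 * exp (2 * of_real pi * \<i> * s) :: complex"
  have ng: "norm (?c s) = 1" for s by (simp add: circlepath norm_mult)
  have nz1: "sin (?c s) \<noteq> 0" for s using ng[of s] pi_gt3 by (intro sin_nz_ball) auto
  have gc: "continuous_on S (\<lambda>z. ?c (snd z))" for S :: "(real \<times> real) set"
    unfolding circlepath by (intro continuous_intros)
  have wc: "continuous_on S (\<lambda>z. ?w (snd z))" for S :: "(real \<times> real) set"
    by (intro continuous_intros)
  have gg: "continuous_on ({0..1/2} \<times> cbox 0 1) (\<lambda>z. g (fst z))"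
    by (rule continuous_on_compose2[OF g(1)]) (auto intro: continuous_intros)
  have "continuous_on {0..1/2} (\<lambda>p. integral (cbox 0 1) (\<lambda>s. Psi_kernel d e N (?c s) (of_real (g p)) * ?w s))"
  proof (rule integral_continuous_on_param)
    show "continuous_on ({0..1/2} \<times> cbox 0 1) (\<lambda>(p, s). Psi_kernel d e N (?c s) (of_real (g p)) * ?w s)"
      unfolding case_prod_unfold
    proof (rule continuous_on_mult[OF _ wc], rule Psi_kernel_continuous[OF gc continuous_on_of_real[OF gg]])
      fix z :: "real \<times> real" assume "z \<in> {0..1/2} \<times> cbox 0 1"
      thus "sin (?c (snd z) + complex_of_real (g (fst z))) \<noteq> 0" by (intro nz ng) auto
    qed (rule nz1)
  qed
  hence "((\<lambda>p. integral (cbox 0 1) (\<lambda>s. Psi_kernel d e N (?c s) (of_real (g p)) * ?w s)) \<longlongrightarrow> integral (cbox 0 1) (\<lambda>s. Psi_kernel d e N (?c s) (of_real (g 0)) * ?w s)) (at 0 within {0..1/2})"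
    by (simp add: continuous_on_def)
  moreover have "Psi_kernel d e N (?c s) (of_real (g 0)) = 0" for s
    using g(2) by (simp add: Psi_kernel_def Psi_def sin_of_real)
  moreover have "at (0::real) within {0..1/2} = at_right 0"
    by (rule at_within_Icc_at_right) simp
  ultimately show ?thesis unfolding contour_integral_circlepath by simp
qed

text \<open>On the interval from \<open>p\<close> to \<open>pi - p\<close> the integral is a
  difference of contour integrals over a circle of radius \<open>p / 2\<close>. Expanding both to
  the unit circle makes them vanish as \<open>p\<close> tends to 0, so only the residues picked up
  on the way survive.\<close>

lemma residue_sum_integral: "integral {0..pi} (residue_sum d e N) = csin_int d (of_real pi) ^ N - (-1) ^ e * 0 ^ N"
proof -
  have qc: "continuous_on S (residue_sum d e N)" for S
    unfolding residue_sum_def[abs_def] by (intro continuous_intros)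
  let ?A = "\<lambda>u. integral {0..u} (residue_sum d e N)"
  have Ac: "continuous_on {0..pi} ?A"
    by (intro indefinite_integral_continuous_1 integrable_continuous_interval qc)
  have lim1: "((\<lambda>p. ?A (pi - p) - ?A p) \<longlongrightarrow> ?A pi - ?A 0) (at_right 0)"
  proof (intro tendsto_diff)
    have "(?A \<longlongrightarrow> ?A 0) (at 0 within {0..pi})"
      by (rule Ac[unfolded continuous_on_def, rule_format]) simp
    thus "(?A \<longlongrightarrow> ?A 0) (at_right 0)" by (simp add: at_within_Icc_at_right)
    have Ac': "continuous_on {0..pi} (\<lambda>p. ?A (pi - p))"
      by (rule continuous_on_compose2[OF Ac]) (auto intro: continuous_intros)
    have "((\<lambda>p. ?A (pi - p)) \<longlongrightarrow> ?A (pi - 0)) (at 0 within {0..pi})"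
      by (rule Ac'[unfolded continuous_on_def, rule_format]) simp
    thus "((\<lambda>p. ?A (pi - p)) \<longlongrightarrow> ?A pi) (at_right 0)" by (simp add: at_within_Icc_at_right)
  qed
  let ?C = "\<lambda>\<phi>. contour_integral (circlepath 0 1) (\<lambda>x. Psi_kernel d e N x (of_real \<phi>))"
  let ?L = "csin_int d (of_real pi) ^ N - (-1) ^ e * 0 ^ N"
  have eq: "?A (pi - p) - ?A p = (?C (pi - p) - ?C p) / (2 * of_real pi * \<i>) + ?L" if p: "p \<in> {0<..<1/2}" for p
  proof -
    have ppi: "p \<le> pi - p" "0 \<le> p" "p < pi - p / 2" using p pi_gt3 by auto
    have "((\<lambda>\<phi>. 2 * of_real pi * \<i> * residue_sum d e N \<phi>) has_integral
       (contour_integral (circlepath 0 (p / 2)) (\<lambda>x. Psi_kernel d e N x (of_real (pi - p))) - contour_integral (circlepath 0 (p / 2)) (\<lambda>x. Psi_kernel d e N x (of_real p)))) {p..pi - p}"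
      using p ppi by (intro circlepath_contour_diff) auto
    moreover have "((\<lambda>\<phi>. 2 * of_real pi * \<i> * residue_sum d e N \<phi>) has_integral 2 * of_real pi * \<i> * integral {p..pi - p} (residue_sum d e N)) {p..pi - p}"
      by (intro has_integral_mult_right integrable_integral integrable_continuous_interval qc)
    ultimately have "2 * of_real pi * \<i> * integral {p..pi - p} (residue_sum d e N) =
       contour_integral (circlepath 0 (p / 2)) (\<lambda>x. Psi_kernel d e N x (of_real (pi - p))) - contour_integral (circlepath 0 (p / 2)) (\<lambda>x. Psi_kernel d e N x (of_real p))"
      by (rule has_integral_unique[rotated])
    also have "\<dots> = ?C (pi - p) - ?C p + 2 * of_real pi * \<i> * ?L"
      using p Psi_kernel_expand_left[of p d e N] Psi_kernel_expand_right[of p d e N] by (simp add: algebra_simps)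
    finally have "integral {p..pi - p} (residue_sum d e N) = (?C (pi - p) - ?C p) / (2 * of_real pi * \<i>) + ?L"
      by (simp add: field_simps)
    moreover have "?A p + integral {p..pi - p} (residue_sum d e N) = ?A (pi - p)"
      using ppi by (intro Henstock_Kurzweil_Integration.integral_combine integrable_continuous_interval qc) auto
    hence "?A (pi - p) - ?A p = integral {p..pi - p} (residue_sum d e N)" by (metis add_diff_cancel_left')
    ultimately show ?thesis by (simp only:)
  qed
  have c1: "((\<lambda>p. ?C p) \<longlongrightarrow> 0) (at_right 0)"
  proof (rule circle_HH_tendsto_0[of "\<lambda>p. p"])
    fix x :: complex and p :: real assume x: "norm x = 1" and p: "p \<in> {0..1/2}"
    have "norm (x + of_real p) \<le> norm x + p" using norm_triangle_ineq[of x "of_real p"] p by simp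
    moreover have "x + of_real p \<noteq> 0"
    proof
      assume "x + of_real p = 0"
      hence "x = - of_real p" by (simp add: add_eq_0_iff2)
      thus False using x p by simp
    qed
    ultimately show "sin (x + of_real p) \<noteq> 0" using x p pi_gt3 by (intro sin_nz_ball) auto
  qed (auto intro: continuous_intros)
  have c2: "((\<lambda>p. ?C (pi - p)) \<longlongrightarrow> 0) (at_right 0)"
  proof (rule circle_HH_tendsto_0[of "\<lambda>p. pi - p"])
    fix x :: complex and p :: real assume x: "norm x = 1" and p: "p \<in> {0..1/2}"
    have "norm (x - of_real p) \<le> norm x + p" using norm_triangle_ineq4[of x "of_real p"] p by simp
    moreover have "x - of_real p \<noteq> 0" using x p by auto
    ultimately have "sin (x - of_real p) \<noteq> 0" using x p pi_gt3 by (intro sin_nz_ball) auto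
    thus "sin (x + of_real (pi - p)) \<noteq> 0" unfolding sin_pi_shift by simp
  qed (auto intro!: continuous_intros)
  have "((\<lambda>p. (?C (pi - p) - ?C p) / (2 * of_real pi * \<i>) + ?L) \<longlongrightarrow> (0 - 0) / (2 * of_real pi * \<i>) + ?L) (at_right 0)"
    by (intro tendsto_intros c1 c2) auto
  moreover have "eventually (\<lambda>p. ?A (pi - p) - ?A p = (?C (pi - p) - ?C p) / (2 * of_real pi * \<i>) + ?L) (at_right 0)"
  proof -
    have "eventually (\<lambda>p. p \<in> {0<..<1/2}) (at_right (0::real))" by (rule eventually_at_right_real) simp
    thus ?thesis by (rule eventually_mono) (rule eq)
  qed
  ultimately have "((\<lambda>p. ?A (pi - p) - ?A p) \<longlongrightarrow> ?L) (at_right 0)"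
    by (simp add: tendsto_cong)
  with lim1 have "?A pi - ?A 0 = ?L" using tendsto_unique trivial_limit_at_right_real by blast
  thus ?thesis by simp
qed

lemma csin_int_sin_int: "x \<ge> 0 \<Longrightarrow> csin_int d (of_real x) = of_real (sin_int d x)"
  unfolding sin_int_def by (rule csin_int_of_real)

lemma sin_int_continuous: "continuous_on {0..pi} (sin_int d)"
  unfolding sin_int_def by (intro indefinite_integral_continuous_1 integrable_continuous_interval continuous_intros)

definition sin_moment :: "nat \<Rightarrow> nat \<Rightarrow> nat \<Rightarrow> real" where
  "sin_moment d a n = integral {0..pi} (\<lambda>\<phi>. sin \<phi> ^ a * sin_int d \<phi> ^ n)"

text \<open>Integrating \<open>residue_sum\<close> termwise in the angle turns its coefficients into
  moments. The identity is used with \<open>e = d * K\<close> and \<open>N = n - K\<close>.\<close>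

theorem residue_identity:
  "(\<Sum>i\<le>N. of_nat (N choose i) * of_nat (e + d * i + 1) * complex_of_real (sin_moment d (e + d * i) (N - i)) * sin_residue d i (e + d * i + 2))
     = complex_of_real (sin_int d pi ^ N) - (-1) ^ e * 0 ^ N"
proof -
  let ?c = "\<lambda>i. of_nat (N choose i) * of_nat (e + d * i + 1) * sin_residue d i (e + d * i + 2)"
  have h1: "((\<lambda>\<phi>. \<Sum>i\<le>N. ?c i * of_real (sin \<phi> ^ (e + d * i) * sin_int d \<phi> ^ (N - i))) has_integral
      (\<Sum>i\<le>N. ?c i * of_real (sin_moment d (e + d * i) (N - i)))) {0..pi}"
    unfolding sin_moment_def
    by (intro has_integral_sum has_integral_mult_right has_integral_of_real integrable_integral integrable_continuous_interval continuous_intros sin_int_continuous) auto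
  have h2: "residue_sum d e N \<phi> = (\<Sum>i\<le>N. ?c i * of_real (sin \<phi> ^ (e + d * i) * sin_int d \<phi> ^ (N - i)))" if "\<phi> \<in> {0..pi}" for \<phi>
    using that unfolding residue_sum_def by (intro sum.cong refl) (simp add: csin_int_sin_int sin_of_real mult_ac)
  have "(residue_sum d e N has_integral (\<Sum>i\<le>N. ?c i * of_real (sin_moment d (e + d * i) (N - i)))) {0..pi}"
    by (rule has_integral_eq[OF h2[symmetric] h1])
  hence "integral {0..pi} (residue_sum d e N) = (\<Sum>i\<le>N. ?c i * of_real (sin_moment d (e + d * i) (N - i)))"
    by (rule integral_unique)
  thus ?thesis unfolding residue_sum_integral by (simp add: csin_int_sin_int mult_ac)
qed

text \<open>The function is even, since \<open>csin_int d\<close> has parity \<open>d + 1\<close>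
  and the sine is odd.\<close>

lemma sin_residue_even_zero:
  assumes "even ((d + 1) * i + m)"
  shows "sin_residue d i m = 0"
  unfolding sin_residue_def
proof (rule residue_even[OF pi_gt_zero])
  show "(\<lambda>x. csin_int d x ^ i / sin x ^ m) holomorphic_on ball 0 pi - {0}"
  proof (intro holomorphic_intros)
    fix x :: complex assume "x \<in> ball 0 pi - {0}"
    hence "sin x \<noteq> 0" by (intro sin_nz_ball) auto
    thus "sin x ^ m \<noteq> 0" by simp
  qed
  fix x :: complex
  have s: "((-1) ^ ((d + 1) * i) :: complex) = (-1) ^ m" using assms by (simp add: neg_one_power_add_eq_neg_one_power_diff minus_one_power_iff)
  have "csin_int d (- x) ^ i = (-1) ^ m * csin_int d x ^ i"
    unfolding csin_int_minus power_mult_distrib by (simp only: s flip: power_mult)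
  moreover have "sin (- x) ^ m = (-1) ^ m * sin x ^ m"
    by (simp add: power_minus[of "sin x"])
  ultimately show "csin_int d (- x) ^ i / sin (- x) ^ m = csin_int d x ^ i / sin x ^ m"
    by simp
qed

section \<open>Caps of the ball\<close>

lemma nn_integral_lborel_linear:
  fixes f :: "real^'n::finite \<Rightarrow> real^'n"
  assumes f: "linear f" and inj: "\<And>x. f x = 0 \<Longrightarrow> x = 0"
  shows "\<exists>\<delta>>0. \<forall>g\<in>borel_measurable borel. (\<integral>\<^sup>+x. g (f x) \<partial>lborel) = ennreal \<delta> * (\<integral>\<^sup>+x. g x \<partial>lborel)"
proof -
  let ?I = "{0 :: nat} \<times> (UNIV :: 'n set)"
  define vec where "vec = (\<lambda>y :: nat \<times> 'n \<Rightarrow> real. (\<chi> j. y (0, j)) :: real^'n)"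
  define M where "M = (\<lambda>(p :: nat \<times> 'n) (q :: nat \<times> 'n). matrix f $ snd p $ snd q)"
  have vm: "vec \<in> lebP ?I \<rightarrow>\<^sub>M borel"
    unfolding vec_def by (intro measurable_vec_lambda measurable_lebP_component) auto
  have dv: "(\<integral>\<^sup>+x. h x \<partial>lborel) = (\<integral>\<^sup>+y. h (vec y) \<partial>lebP ?I)" if "h \<in> borel_measurable borel" for h
  proof -
    have "(\<integral>\<^sup>+x. h x \<partial>distr (lebP ?I) borel vec) = (\<integral>\<^sup>+y. h (vec y) \<partial>lebP ?I)"
      using that by (intro nn_integral_distr[OF vm]) (simp only: measurable_distr_eq1)
    moreover have "distr (lebP ?I) borel vec = lborel" unfolding vec_def by (rule distr_lebP_vec)
    ultimately show ?thesis by simp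
  qed
  have fv: "f (vec y) = vec (\<lambda>p\<in>?I. \<Sum>q\<in>?I. M p q * y q)" for y
  proof -
    have "f (vec y) = matrix f *v vec y" using f by (simp add: matrix_works)
    also have "\<dots> = (\<chi> i. \<Sum>j\<in>UNIV. matrix f $ i $ j * y (0, j))"
      unfolding matrix_vector_mult_def vec_def by simp
    also have "\<dots> = vec (\<lambda>p\<in>?I. \<Sum>q\<in>?I. M p q * y q)"
    proof -
      have "(\<Sum>q\<in>?I. M (0, i) q * y q) = (\<Sum>j\<in>UNIV. matrix f $ i $ j * y (0, j))" for i
        by (rule sum.reindex_bij_witness[of _ "\<lambda>j. (0, j)" snd]) (auto simp: M_def)
      thus ?thesis unfolding vec_def by simp
    qed
    finally show ?thesis .
  qed
  have "\<exists>\<delta>>0. \<forall>h\<in>borel_measurable (lebP ?I).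
     (\<integral>\<^sup>+y. h (\<lambda>p\<in>?I. \<Sum>q\<in>?I. M p q * y q) \<partial>lebP ?I) = ennreal \<delta> * (\<integral>\<^sup>+y. h y \<partial>lebP ?I)"
  proof (rule nn_integral_lebP_linear)
    fix a assume a: "\<And>i. i \<in> ?I \<Longrightarrow> (\<Sum>j\<in>?I. M i j * a j) = 0"
    have "(\<Sum>q\<in>?I. M (0, i) q * a q) = 0" for i by (rule a) simp
    hence "vec (\<lambda>p\<in>?I. \<Sum>q\<in>?I. M p q * a q) = 0" unfolding vec_def by (simp add: vec_eq_iff)
    hence "f (vec a) = 0" unfolding fv .
    hence "vec a = 0" by (rule inj)
    thus "\<forall>j\<in>?I. a j = 0" unfolding vec_def by (auto simp: vec_eq_iff)
  qed auto
  then obtain \<delta> where \<delta>: "\<delta> > 0" "\<And>h. h \<in> borel_measurable (lebP ?I) \<Longrightarrow>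
     (\<integral>\<^sup>+y. h (\<lambda>p\<in>?I. \<Sum>q\<in>?I. M p q * y q) \<partial>lebP ?I) = ennreal \<delta> * (\<integral>\<^sup>+y. h y \<partial>lebP ?I)" by blast
  show ?thesis
  proof (intro exI[of _ \<delta>] conjI ballI \<delta>(1))
    fix g :: "real^'n \<Rightarrow> ennreal" assume g: "g \<in> borel_measurable borel"
    have "f \<in> borel_measurable borel" using f by (intro borel_measurable_continuous_onI linear_continuous_on) (simp add: linear_conv_bounded_linear)
    hence gf: "(\<lambda>x. g (f x)) \<in> borel_measurable borel" using g by (rule measurable_compose)
    have "(\<integral>\<^sup>+x. g (f x) \<partial>lborel) = (\<integral>\<^sup>+y. g (f (vec y)) \<partial>lebP ?I)"
      by (rule dv[OF gf])
    also have "\<dots> = ennreal \<delta> * (\<integral>\<^sup>+y. g (vec y) \<partial>lebP ?I)"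
      unfolding fv by (rule \<delta>(2)) (rule measurable_compose[OF vm g])
    also have "(\<integral>\<^sup>+y. g (vec y) \<partial>lebP ?I) = (\<integral>\<^sup>+x. g x \<partial>lborel)"
      by (rule dv[OF g, symmetric])
    finally show "(\<integral>\<^sup>+x. g (f x) \<partial>lborel) = ennreal \<delta> * (\<integral>\<^sup>+x. g x \<partial>lborel)" .
  qed
qed

text \<open>The scaling constant of a linear substitution is found by testing on the unit ball,
  which an orthogonal map preserves.\<close>

lemma nn_integral_lborel_orthogonal:
  fixes f :: "real^'n::finite \<Rightarrow> real^'n"
  assumes f: "orthogonal_transformation f" and g: "g \<in> borel_measurable borel"
  shows "(\<integral>\<^sup>+x. g (f x) \<partial>lborel) = (\<integral>\<^sup>+x. g x \<partial>lborel)"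
proof -
  have nf: "norm (f x) = norm x" for x using f by (simp add: orthogonal_transformation_norm)
  obtain \<delta> where \<delta>: "\<delta> > 0" "\<And>g. g \<in> borel_measurable borel \<Longrightarrow> (\<integral>\<^sup>+x. g (f x) \<partial>lborel) = ennreal \<delta> * (\<integral>\<^sup>+x. g x \<partial>lborel)"
    using nn_integral_lborel_linear[of f] f nf by (metis norm_eq_zero orthogonal_transformation_linear)
  let ?V = "emeasure lborel (ball (0::real^'n) 1)"
  have "(\<integral>\<^sup>+x. indicator (ball 0 1) (f x) \<partial>lborel) = ennreal \<delta> * (\<integral>\<^sup>+x. indicator (ball (0::real^'n) 1) x \<partial>lborel)"
    by (rule \<delta>(2)[of "indicator (ball 0 1)"]) (rule borel_measurable_indicator, simp)
  moreover have "indicator (ball 0 1) (f x) = (indicator (ball 0 1) x :: ennreal)" for x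
    using nf by (simp add: indicator_def)
  ultimately have "?V = ennreal \<delta> * ?V" by simp
  moreover have "?V = ennreal (measure lborel (ball (0::real^'n) 1))"
    using emeasure_lborel_ball_finite[of "0::real^'n" 1] by (intro emeasure_eq_ennreal_measure) auto
  ultimately have "measure lborel (ball (0::real^'n) 1) = \<delta> * measure lborel (ball (0::real^'n) 1)"
    using \<delta>(1) by (simp flip: ennreal_mult')
  hence "\<delta> = 1" using content_ball_pos[of 1 "0::real^'n"] by simp
  thus ?thesis using \<delta>(2)[OF g] by simp
qed

lemma emeasure_unif_ball_orthogonal:
  fixes f :: "real^'n::finite \<Rightarrow> real^'n"
  assumes f: "orthogonal_transformation f" and A: "A \<in> sets borel"
  shows "emeasure unif_ball {x. f x \<in> A} = emeasure unif_ball A"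
proof -
  have nf: "norm (f x) = norm x" for x using f by (simp add: orthogonal_transformation_norm)
  have fm: "f \<in> borel_measurable borel"
    using f orthogonal_transformation_linear[of f] by (intro borel_measurable_continuous_onI linear_continuous_on) (simp add: linear_conv_bounded_linear)
  let ?c = "inverse (emeasure lborel (ball (0::real^'n) 1))"
  have E: "emeasure unif_ball B = (\<integral>\<^sup>+x. (indicator (cball 0 1) x * ?c) * indicator B x \<partial>lborel)" if "B \<in> sets borel" for B :: "(real^'n) set"
    unfolding unif_ball_density using that
    by (intro emeasure_density borel_measurable_times_ennreal borel_measurable_indicator borel_measurable_const) auto
  have "{x. f x \<in> A} \<in> sets borel" using measurable_sets[OF fm A] by (simp add: vimage_def)
  hence "emeasure unif_ball {x. f x \<in> A} = (\<integral>\<^sup>+x. (indicator (cball 0 1) x * ?c) * indicator {x. f x \<in> A} x \<partial>lborel)" by (rule E)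
  also have "\<dots> = (\<integral>\<^sup>+x. (indicator (cball 0 1) (f x) * ?c) * indicator A (f x) \<partial>lborel)"
    by (intro nn_integral_cong) (simp add: indicator_def nf)
  also have "\<dots> = (\<integral>\<^sup>+x. (indicator (cball 0 1) x * ?c) * indicator A x \<partial>lborel)"
    using A by (intro nn_integral_lborel_orthogonal[OF f] borel_measurable_times_ennreal borel_measurable_indicator borel_measurable_const) auto
  also have "\<dots> = emeasure unif_ball A" using A by (rule E[symmetric])
  finally show ?thesis .
qed

text \<open>The distribution function of a coordinate of a uniform point; by rotation invariance the
  choice of the coordinate is immaterial.\<close>

definition cap_cdf :: "'n::finite itself \<Rightarrow> real \<Rightarrow> real" where
  "cap_cdf _ h = measure unif_ball {x :: real^'n. axis (SOME t. True) 1 \<bullet> x < h}"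

lemma halfspace_borel: "{x :: real^'n::finite. u \<bullet> x < h} \<in> sets borel"
  by (intro borel_open open_halfspace_lt)

lemma emeasure_unif_ball_halfspace:
  fixes u :: "real^'n::finite"
  assumes "norm u = 1"
  shows "emeasure unif_ball {x. u \<bullet> x < h} = ennreal (cap_cdf TYPE('n) h)"
proof -
  let ?e = "axis (SOME t. True) 1 :: real^'n"
  obtain f where f: "orthogonal_transformation f" "f u = ?e"
    using orthogonal_transformation_exists_1[OF assms, of ?e] by (auto simp: norm_axis_1)
  have "?e \<bullet> f x = u \<bullet> x" for x using f unfolding orthogonal_transformation_def by metis
  hence "{x. u \<bullet> x < h} = {x. f x \<in> {x. ?e \<bullet> x < h}}" by simp
  hence "emeasure unif_ball {x. u \<bullet> x < h} = emeasure unif_ball {x. ?e \<bullet> x < h}"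
    using emeasure_unif_ball_orthogonal[OF f(1) halfspace_borel] by simp
  also have "\<dots> = ennreal (cap_cdf TYPE('n) h)"
    unfolding cap_cdf_def
    by (rule finite_measure.emeasure_eq_measure[OF prob_space.finite_measure[OF prob_space_unif_ball]])
  finally show ?thesis .
qed

lemma cap_cdf_measurable [measurable]: "cap_cdf TYPE('n::finite) \<in> borel_measurable borel"
proof (rule borel_measurable_mono)
  show "mono (cap_cdf TYPE('n))"
  proof (rule monoI)
    fix g h :: real assume "g \<le> h"
    interpret prob_space "unif_ball :: (real^'n) measure" by (rule prob_space_unif_ball)
    show "cap_cdf TYPE('n) g \<le> cap_cdf TYPE('n) h"
      unfolding cap_cdf_def using \<open>g \<le> h\<close> by (intro finite_measure_mono) (auto simp: halfspace_borel)
  qed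
qed

lemma cap_cdf_nonneg: "0 \<le> cap_cdf TYPE('n::finite) h"
  unfolding cap_cdf_def by simp

lemma sin_int_pi: "sin_int d pi = wallis d"
  unfolding sin_int_def wallis_def ..

text \<open>The case of \<open>ballM_factor\<close> with one point and \<open>A = {t}\<close>. The
  graph has no slopes, so the height of the hyperplane is the coordinate \<open>t\<close> of the
  point, and the law of the height becomes the law of that coordinate.\<close>

lemma cap_cdf_cos:
  assumes \<phi>: "\<phi> \<in> {0..pi}"
  shows "cap_cdf TYPE('n::finite) (- cos \<phi>) = sin_int CARD('n) \<phi> / wallis CARD('n)"
proof -
  define t :: 'n where "t = (SOME t. True)"
  define h where "h = - cos \<phi>"
  let ?\<gamma> = "indicator {..<h} :: real \<Rightarrow> ennreal"
  let ?G = "\<lambda>X :: nat \<Rightarrow> real^'n. ?\<gamma> (X 0 $ t)"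
  let ?d = "CARD('n)"
  have ax: "axis t 1 \<bullet> x = x $ t" for x :: "real^'n" by (simp add: inner_axis inner_commute)
  have xm: "(\<lambda>x :: real^'n. x $ t) \<in> borel_measurable borel" by (intro borel_measurable_continuous_onI continuous_intros)
  have gm: "(\<lambda>x :: real^'n. ?\<gamma> (x $ t)) \<in> borel_measurable borel"
    by (rule measurable_compose[OF xm]) simp
  have fac: "(\<integral>\<^sup>+X. of_bool True * ?G X \<partial>ballM {0}) * ennreal (wallis (card {0::nat} * ?d))
     = (\<integral>\<^sup>+s. ?\<gamma> s * height_weight (card {0::nat} * ?d - 1) s \<partial>lborel) * emeasure (ballM {0}) {X \<in> space (ballM {0} :: (nat \<Rightarrow> real^'n) measure). True}"
  proof (rule ballM_factor[where A = "{t}"])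
    show "?G \<in> borel_measurable (ballM {0})"
      by (rule measurable_compose[OF ballM_component gm]) simp
    fix X :: "nat \<Rightarrow> real^'n" and v assume "v \<in> affs ({t} - {t})" and v: "\<And>i. i \<in> {0::nat} \<Longrightarrow> v \<bullet> hat (X i) = 0"
    hence "fst v = 0" by (simp add: affs_def vec_eq_iff)
    moreover from this v[of 0] have "snd v = 0" by (simp add: hat_inner)
    ultimately show "v = 0" by (simp add: prod_eq_iff)
  next
    fix X :: "nat \<Rightarrow> real^'n" and a b
    assume a: "\<And>j. j \<notin> {t} - {t} \<Longrightarrow> a $ j = 0" and b: "\<And>i. i \<in> {0::nat} \<Longrightarrow> X i $ t = a \<bullet> X i + b"
    have "a = 0" using a by (simp add: vec_eq_iff)
    thus "?G X = ?\<gamma> (b / sqrt (1 + (norm a)\<^sup>2))" using b[of 0] by simp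
  qed auto
  have 1: "(\<integral>\<^sup>+X. of_bool True * ?G X \<partial>ballM {0}) = ennreal (cap_cdf TYPE('n) h)"
  proof -
    have "(\<integral>\<^sup>+X. of_bool True * ?G X \<partial>ballM {0}) = (\<integral>\<^sup>+X. ?G X \<partial>ballM {0})" by simp
    moreover have "(\<integral>\<^sup>+X. ?G X \<partial>ballM {0}) = (\<integral>\<^sup>+x. ?\<gamma> (x $ t) \<partial>(unif_ball :: (real^'n) measure))"
      using gm by (intro ub.product_nn_integral_singleton) simp
    moreover have "(\<integral>\<^sup>+x. ?\<gamma> (x $ t) \<partial>(unif_ball :: (real^'n) measure)) = (\<integral>\<^sup>+x. indicator {x :: real^'n. axis t 1 \<bullet> x < h} x \<partial>unif_ball)"
      by (intro nn_integral_cong) (simp add: indicator_def ax)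
    moreover have "(\<integral>\<^sup>+x. indicator {x :: real^'n. axis t 1 \<bullet> x < h} x \<partial>unif_ball) = emeasure unif_ball {x :: real^'n. axis t 1 \<bullet> x < h}"
      by (rule nn_integral_indicator) (simp add: halfspace_borel)
    moreover have "emeasure unif_ball {x :: real^'n. axis t 1 \<bullet> x < h} = ennreal (cap_cdf TYPE('n) h)"
      by (rule emeasure_unif_ball_halfspace) (simp add: norm_axis_1)
    ultimately show ?thesis by (simp only:)
  qed
  have 2: "emeasure (ballM {0}) {X \<in> space (ballM {0} :: (nat \<Rightarrow> real^'n) measure). True} = 1"
    using prob_space.emeasure_space_1[OF prob_space_ballM] by simp
  have 3: "(\<integral>\<^sup>+s. ?\<gamma> s * height_weight (?d - 1) s \<partial>lborel) = ennreal (sin_int ?d \<phi>)"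
  proof -
    have "(\<integral>\<^sup>+s. ?\<gamma> s * height_weight (?d - 1) s \<partial>lborel) = (\<integral>\<^sup>+s. ennreal (indicator {..<h} s) * height_weight (?d - 1) s \<partial>lborel)"
      by (intro nn_integral_cong) (simp add: indicator_def)
    also have "\<dots> = (\<integral>\<^sup>+\<psi>. ennreal (indicator {..<h} (- cos \<psi>) * sin \<psi> ^ Suc (?d - 1) * indicator {0..pi} \<psi>) \<partial>lborel)"
      by (rule height_weight_substitution) auto
    also have "\<dots> = (\<integral>\<^sup>+\<psi>. ennreal (indicator {0..\<phi>} \<psi> *\<^sub>R sin \<psi> ^ ?d) \<partial>lborel)"
    proof (rule nn_integral_cong_AE)
      have "AE \<psi> in lborel. \<psi> \<noteq> \<phi>" by (rule AE_lborel_singleton)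
      thus "AE \<psi> in lborel. ennreal (indicator {..<h} (- cos \<psi>) * sin \<psi> ^ Suc (?d - 1) * indicator {0..pi} \<psi>) = ennreal (indicator {0..\<phi>} \<psi> *\<^sub>R sin \<psi> ^ ?d)"
      proof eventually_elim
        case (elim \<psi>)
        show ?case
        proof (cases "\<psi> \<in> {0..pi}")
          case True
          have "- cos \<psi> < h \<longleftrightarrow> \<psi> < \<phi>" unfolding h_def using True \<phi> cos_mono_less_eq[of \<phi> \<psi>] by auto
          thus ?thesis using True elim by (auto simp: indicator_def)
        next
          case False
          thus ?thesis using \<phi> by (auto simp: indicator_def)
        qed
      qed
    qed
    also have "\<dots> = ennreal (\<integral>\<psi>. indicator {0..\<phi>} \<psi> *\<^sub>R sin \<psi> ^ ?d \<partial>lborel)"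
    proof (rule nn_integral_eq_integral)
      have "set_integrable lborel {0..\<phi>} (\<lambda>\<psi>. sin \<psi> ^ ?d)" by (intro borel_integrable_atLeastAtMost' continuous_intros)
      thus "integrable lborel (\<lambda>\<psi>. indicator {0..\<phi>} \<psi> *\<^sub>R sin \<psi> ^ ?d)" unfolding set_integrable_def .
      show "AE \<psi> in lborel. 0 \<le> indicator {0..\<phi>} \<psi> *\<^sub>R sin \<psi> ^ ?d"
        using \<phi> by (intro AE_I2) (auto simp: indicator_def intro!: zero_le_power sin_ge_zero)
    qed
    also have "(\<integral>\<psi>. indicator {0..\<phi>} \<psi> *\<^sub>R sin \<psi> ^ ?d \<partial>lborel) = sin_int ?d \<phi>"
    proof -
      have "set_integrable lborel {0..\<phi>} (\<lambda>\<psi>. sin \<psi> ^ ?d)" by (intro borel_integrable_atLeastAtMost' continuous_intros)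
      from set_borel_integral_eq_integral(2)[OF this] show ?thesis
        unfolding set_lebesgue_integral_def sin_int_def .
    qed
    finally show ?thesis .
  qed
  have si: "sin_int ?d \<phi> \<ge> 0" unfolding sin_int_def using \<phi>
    by (intro integral_nonneg integrable_continuous_interval continuous_intros) (auto intro!: zero_le_power sin_ge_zero)
  have "ennreal (cap_cdf TYPE('n) h) * ennreal (wallis ?d) = ennreal (sin_int ?d \<phi>)"
    using fac unfolding 1 2 using 3 by simp
  hence "cap_cdf TYPE('n) h * wallis ?d = sin_int ?d \<phi>"
    using cap_cdf_nonneg[where 'n = 'n, of h] wallis_pos[of ?d] si
    by (metis ennreal_inj ennreal_mult' less_imp_le mult_nonneg_nonneg)
  thus ?thesis unfolding h_def using wallis_pos[of ?d] by (simp add: field_simps)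
qed

section \<open>Probability that all remaining points lie on one side\<close>

abbreviation hats :: "('i \<Rightarrow> real^'n) \<Rightarrow> 'i \<Rightarrow> (real^'n) \<times> real" where
  "hats X \<equiv> (\<lambda>i. hat (X i))"

text \<open>The functionals on \<open>A\<close> that vanish on \<open>G\<close> are the multiples of
  \<open>v\<close>: after the slope in direction \<open>t\<close> has been cancelled by a multiple
  of \<open>v\<close>, assumption \<open>gen\<close> leaves nothing. Solvability is therefore a
  choice of side.\<close>

lemma pos_sol_two_sides:
  fixes X :: "nat \<Rightarrow> real^'n::finite" and a :: "real^'n"
  assumes t: "t \<in> A" and a: "\<And>j. j \<notin> A - {t} \<Longrightarrow> a $ j = 0"
    and graph: "\<And>i. i \<in> G \<Longrightarrow> X i $ t = a \<bullet> X i + b"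
    and gen: "\<And>v. v \<in> affs (A - {t}) \<Longrightarrow> (\<And>i. i \<in> G \<Longrightarrow> v \<bullet> hat (X i) = 0) \<Longrightarrow> v = 0"
    and S: "S \<noteq> {}"
  shows "pos_sol (affs A) (hats X) G S \<longleftrightarrow> (\<forall>i\<in>S. (axis t 1 - a) \<bullet> X i < b) \<or> (\<forall>i\<in>S. (a - axis t 1) \<bullet> X i < - b)"
proof -
  define v where "v = (a - axis t 1, b)"
  have vA: "v \<in> affs A" unfolding v_def affs_def using a t by (auto simp: axis_def)
  have vh: "v \<bullet> hat x = a \<bullet> x - x $ t + b" for x
    unfolding v_def hat_inner fst_conv snd_conv inner_diff_left inner_axis' by simp
  have v0: "v \<bullet> hat (X i) = 0" if "i \<in> G" for i using graph[OF that] by (simp add: vh)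
  have "pos_sol (affs A) (hats X) G S \<longleftrightarrow> (\<forall>i\<in>S. v \<bullet> hat (X i) > 0) \<or> (\<forall>i\<in>S. v \<bullet> hat (X i) < 0)"
  proof
    assume "pos_sol (affs A) (hats X) G S"
    then obtain u where u: "u \<in> affs A" "\<And>i. i \<in> G \<Longrightarrow> u \<bullet> hat (X i) = 0" "\<And>i. i \<in> S \<Longrightarrow> u \<bullet> hat (X i) > 0"
      unfolding pos_sol_def by auto
    define c where "c = fst u $ t"
    have vt: "fst v $ t = -1" unfolding v_def using a[of t] by simp
    have "u + c *\<^sub>R v = 0"
    proof (rule gen)
      have "fst (u + c *\<^sub>R v) $ j = 0" if "j \<notin> A - {t}" for j
        using that u(1) vA vt unfolding affs_def c_def by (cases "j = t") auto
      thus "u + c *\<^sub>R v \<in> affs (A - {t})" unfolding affs_def by simp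
    qed (use u v0 in \<open>simp add: inner_add_left\<close>)
    hence uv: "u = (- c) *\<^sub>R v" by (simp add: add_eq_0_iff2)
    have pos: "- c * (v \<bullet> hat (X i)) > 0" if "i \<in> S" for i using u(3)[OF that] unfolding uv by simp
    show "(\<forall>i\<in>S. v \<bullet> hat (X i) > 0) \<or> (\<forall>i\<in>S. v \<bullet> hat (X i) < 0)"
    proof (cases "c < 0")
      case True
      have "v \<bullet> hat (X i) > 0" if "i \<in> S" for i using pos[OF that] True by (simp add: mult_less_0_iff)
      thus ?thesis by blast
    next
      case False
      have "v \<bullet> hat (X i) < 0" if "i \<in> S" for i using pos[OF that] False by (auto simp: mult_less_0_iff)
      thus ?thesis by blast
    qed
  next
    assume "(\<forall>i\<in>S. v \<bullet> hat (X i) > 0) \<or> (\<forall>i\<in>S. v \<bullet> hat (X i) < 0)"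
    thus "pos_sol (affs A) (hats X) G S"
    proof
      assume "\<forall>i\<in>S. v \<bullet> hat (X i) > 0"
      thus ?thesis unfolding pos_sol_def using vA v0 by blast
    next
      assume "\<forall>i\<in>S. v \<bullet> hat (X i) < 0"
      moreover have "- v \<in> affs A" by (rule subspace_neg[OF subspace_affs vA])
      ultimately show ?thesis unfolding pos_sol_def using v0 by (intro bexI[of _ "- v"]) auto
    qed
  qed
  also have "(\<forall>i\<in>S. v \<bullet> hat (X i) > 0) \<longleftrightarrow> (\<forall>i\<in>S. (axis t 1 - a) \<bullet> X i < b)"
    unfolding vh by (intro ball_cong refl) (auto simp: inner_diff_left inner_axis' )
  also have "(\<forall>i\<in>S. v \<bullet> hat (X i) < 0) \<longleftrightarrow> (\<forall>i\<in>S. (a - axis t 1) \<bullet> X i < - b)"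
    unfolding vh by (intro ball_cong refl) (auto simp: inner_diff_left inner_axis')
  finally show ?thesis .
qed

lemma emeasure_halfspace_scaled:
  fixes u :: "real^'n::finite"
  assumes "u \<noteq> 0"
  shows "emeasure unif_ball {x. u \<bullet> x < b} = ennreal (cap_cdf TYPE('n) (b / norm u))"
proof -
  have "u \<bullet> x < b \<longleftrightarrow> (u /\<^sub>R norm u) \<bullet> x < b / norm u" for x
    using assms by (simp add: field_simps)
  hence "{x. u \<bullet> x < b} = {x. (u /\<^sub>R norm u) \<bullet> x < b / norm u}" by simp
  thus ?thesis using emeasure_unif_ball_halfspace[of "u /\<^sub>R norm u" "b / norm u"] assms by simp
qed

lemma nn_integral_all_in:
  assumes "finite S" "B \<in> sets (borel :: (real^'n::finite) measure)"
  shows "(\<integral>\<^sup>+y. of_bool (\<forall>i\<in>S. y i \<in> B) \<partial>ballM S) = emeasure unif_ball B ^ card S"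
proof -
  have "(\<integral>\<^sup>+y. of_bool (\<forall>i\<in>S. y i \<in> B) \<partial>ballM S) = (\<integral>\<^sup>+y. (\<Prod>i\<in>S. indicator B (y i)) \<partial>ballM S)"
  proof (intro nn_integral_cong)
    fix y :: "_ \<Rightarrow> real^'n"
    show "of_bool (\<forall>i\<in>S. y i \<in> B) = (\<Prod>i\<in>S. indicator B (y i) :: ennreal)"
    proof (cases "\<forall>i\<in>S. y i \<in> B")
      case True thus ?thesis by (simp add: indicator_def)
    next
      case False
      then obtain i where "i \<in> S" "y i \<notin> B" by auto
      thus ?thesis using assms(1) False by (subst prod_zero[of S]) (auto simp: indicator_def)
    qed
  qed
  also have "\<dots> = (\<Prod>i\<in>S. \<integral>\<^sup>+x. indicator B x \<partial>unif_ball)"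
    using assms(2) by (intro ub.product_nn_integral_prod assms(1) borel_measurable_indicator) simp
  also have "\<dots> = emeasure unif_ball B ^ card S" using assms by simp
  finally show ?thesis .
qed

text \<open>Given the points of \<open>G\<close>, the remaining points lie independently on a given
  side of the hyperplane, with probability \<open>cap_cdf\<close> at plus or minus the height. The
  inner integral is thus a function of the height, and \<open>ballM_factor\<close> applies.\<close>

theorem nn_integral_count:
  fixes A :: "'n::finite set" and Ev :: "(nat \<Rightarrow> real^'n) \<Rightarrow> bool"
  assumes I: "finite I" and G: "G \<subseteq> I" "G \<noteq> {}" and t: "t \<in> A" and card: "card G = card A"
    and Evm: "Measurable.pred (ballM G) Ev"
    and dep: "\<And>X Y. (\<And>i j. i \<in> G \<Longrightarrow> j \<noteq> t \<Longrightarrow> X i $ j = Y i $ j) \<Longrightarrow> Ev X = Ev Y"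
    and inv: "\<And>X c r. r > 0 \<Longrightarrow> Ev (\<lambda>i. c + r *\<^sub>R X i) = Ev X"
    and gen: "\<And>X v. Ev X \<Longrightarrow> v \<in> affs (A - {t}) \<Longrightarrow> (\<And>i. i \<in> G \<Longrightarrow> v \<bullet> hat (X i) = 0) \<Longrightarrow> v = 0"
  shows "(\<integral>\<^sup>+X. of_bool (Ev X) * (of_bool (pos_sol (affs A) (hats X) G (I - G)) + of_bool (G = I)) \<partial>ballM I) * ennreal (wallis (card G * CARD('n)))
     = (\<integral>\<^sup>+h. ennreal (cap_cdf TYPE('n) h ^ card (I - G) + cap_cdf TYPE('n) (- h) ^ card (I - G)) * height_weight (card G * CARD('n) - 1) h \<partial>lborel)
       * emeasure (ballM G) {X \<in> space (ballM G). Ev X}"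
proof -
  define S where "S = I - G"
  have GS: "G \<inter> S = {}" "G \<union> S = I" "finite G" "finite S" using I G finite_subset unfolding S_def by auto
  define cnt :: "(nat \<Rightarrow> real^'n) \<Rightarrow> ennreal" where "cnt = (\<lambda>X. of_bool (pos_sol (affs A) (hats X) G S) + of_bool (G = I))"
  have psm: "Measurable.pred (ballM (G \<union> S)) (\<lambda>X. pos_sol (affs A) (hats X :: nat \<Rightarrow> (real^'n) \<times> real) G S)"
    using GS by (intro pos_sol_hat_measurable) auto
  have cm: "cnt \<in> borel_measurable (ballM (G \<union> S))"
    unfolding cnt_def using psm by measurable
  have restr: "(\<lambda>X. restrict X G) \<in> ballM (G \<union> S) \<rightarrow>\<^sub>M ballM G" by (rule measurable_restrict_subset) auto
  have Evr: "Ev (restrict X G) = Ev X" for X by (rule dep) simp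
  have em: "Measurable.pred (ballM (G \<union> S)) Ev"
    using measurable_compose[OF restr Evm] by (simp add: Evr)
  have fm: "(\<lambda>X. of_bool (Ev X) * cnt X) \<in> borel_measurable (ballM (G \<union> S))"
    using em cm by measurable
  define K where "K = (\<lambda>x. \<integral>\<^sup>+y. cnt (merge G S (x, y)) \<partial>ballM S)"
  have mz: "merge G S \<in> ballM G \<Otimes>\<^sub>M ballM S \<rightarrow>\<^sub>M ballM (G \<union> S)" by (rule measurable_merge)
  interpret Sf: finite_product_sigma_finite "\<lambda>_. unif_ball :: (real^'n) measure" S by standard (rule GS)
  have Km: "K \<in> borel_measurable (ballM G)"
    unfolding K_def using measurable_compose[OF mz cm] by (intro Sf.borel_measurable_nn_integral) (simp add: case_prod_unfold)
  have "(\<integral>\<^sup>+X. of_bool (Ev X) * cnt X \<partial>ballM I) = (\<integral>\<^sup>+x. (\<integral>\<^sup>+y. of_bool (Ev (merge G S (x, y))) * cnt (merge G S (x, y)) \<partial>ballM S) \<partial>ballM G)"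
    using ub.product_nn_integral_fold[OF GS(1,3,4) fm] unfolding GS(2) .
  also have "\<dots> = (\<integral>\<^sup>+x. of_bool (Ev x) * K x \<partial>ballM G)"
  proof (rule nn_integral_cong)
    fix x :: "nat \<Rightarrow> real^'n" assume x: "x \<in> space (ballM G)"
    have e: "Ev (merge G S (x, y)) = Ev x" for y by (rule dep) (simp add: merge_def)
    have "(\<lambda>y. cnt (merge G S (x, y))) \<in> borel_measurable (ballM S)"
      by (rule measurable_compose[OF measurable_Pair2[OF mz x] cm])
    thus "(\<integral>\<^sup>+y. of_bool (Ev (merge G S (x, y))) * cnt (merge G S (x, y)) \<partial>ballM S) = of_bool (Ev x) * K x"
      unfolding e K_def by (rule nn_integral_cmult)
  qed
  finally have 1: "(\<integral>\<^sup>+X. of_bool (Ev X) * cnt X \<partial>ballM I) = (\<integral>\<^sup>+x. of_bool (Ev x) * K x \<partial>ballM G)" .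
  show ?thesis
    unfolding 1[unfolded cnt_def S_def]
  proof (rule ballM_factor[OF GS(3) G(2) t card Evm dep inv gen Km])
    show "(\<lambda>h. ennreal (cap_cdf TYPE('n) h ^ card (I - G) + cap_cdf TYPE('n) (- h) ^ card (I - G))) \<in> borel_measurable borel"
      by measurable
    fix X :: "nat \<Rightarrow> real^'n" and a :: "real^'n" and b
    assume ev: "Ev X" and a: "\<And>j. j \<notin> A - {t} \<Longrightarrow> a $ j = 0" and graph: "\<And>i. i \<in> G \<Longrightarrow> X i $ t = a \<bullet> X i + b"
    let ?u = "axis t 1 - a"
    have nu: "norm ?u = sqrt (1 + (norm a)\<^sup>2)"
    proof -
      have "a \<bullet> axis t 1 = 0" using a[of t] by (simp add: inner_axis)
      hence "(norm ?u)\<^sup>2 = 1 + (norm a)\<^sup>2"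
        by (simp add: power2_norm_eq_inner inner_diff_left inner_diff_right inner_commute inner_axis_axis)
      thus ?thesis by (metis norm_ge_zero real_sqrt_abs abs_of_nonneg)
    qed
    have u0: "?u \<noteq> 0" using nu by (metis add_pos_nonneg norm_zero real_sqrt_gt_0_iff zero_le_power2 zero_less_one less_irrefl)
    let ?L = "{x. ?u \<bullet> x < b}" and ?R = "{x. (a - axis t 1) \<bullet> x < - b}"
    have eL: "emeasure unif_ball ?L = ennreal (cap_cdf TYPE('n) (b / sqrt (1 + (norm a)\<^sup>2)))"
      using emeasure_halfspace_scaled[OF u0, of b] unfolding nu .
    have eR: "emeasure unif_ball ?R = ennreal (cap_cdf TYPE('n) (- (b / sqrt (1 + (norm a)\<^sup>2))))"
    proof -
      have "a - axis t 1 \<noteq> 0" "norm (a - axis t 1) = sqrt (1 + (norm a)\<^sup>2)" using u0 nu by (auto simp: norm_minus_commute)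
      thus ?thesis using emeasure_halfspace_scaled[of "a - axis t 1" "- b"] by simp
    qed
    have cnt_eq: "cnt (merge G S (X, y)) = of_bool (\<forall>i\<in>S. y i \<in> ?L) + of_bool (\<forall>i\<in>S. y i \<in> ?R)" for y
    \<comment> \<open>Without remaining points both half-space conditions hold vacuously; the
      summand for \<open>G = I\<close> supplies the second one.\<close>
    proof (cases "S = {}")
      case True
      hence "G = I" using G unfolding S_def by auto
      moreover have "0 \<in> affs A" using subspace_affs by (rule subspace_0)
      hence "pos_sol (affs A) (hats (merge G S (X, y))) G {}" unfolding pos_sol_def by (intro bexI[of _ 0]) auto
      ultimately show ?thesis using True unfolding cnt_def by simp
    next
      case False
      let ?m = "merge G S (X, y)"
      have mG: "?m i = X i" if "i \<in> G" for i using that by (simp add: merge_def)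
      have mS: "?m i = y i" if "i \<in> S" for i using that GS(1) by (auto simp: merge_def)
      have p: "pos_sol (affs A) (hats ?m) G S \<longleftrightarrow> (\<forall>i\<in>S. ?u \<bullet> ?m i < b) \<or> (\<forall>i\<in>S. (a - axis t 1) \<bullet> ?m i < - b)"
      proof (rule pos_sol_two_sides[OF t a _ _ False])
        show "?m i $ t = a \<bullet> ?m i + b" if "i \<in> G" for i using graph[OF that] mG[OF that] by simp
        show "v = 0" if "v \<in> affs (A - {t})" "\<And>i. i \<in> G \<Longrightarrow> v \<bullet> hat (?m i) = 0" for v
          by (rule gen[OF ev that(1)]) (use that(2) mG in simp)
      qed
      have ne: "G \<noteq> I" using False unfolding S_def by auto
      obtain i where i: "i \<in> S" using False by auto
      have excl: "\<not> ((\<forall>i\<in>S. y i \<in> ?L) \<and> (\<forall>i\<in>S. y i \<in> ?R))"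
      proof
        assume "(\<forall>i\<in>S. y i \<in> ?L) \<and> (\<forall>i\<in>S. y i \<in> ?R)"
        hence "?u \<bullet> y i < b" "(a - axis t 1) \<bullet> y i < - b" using i by auto
        thus False by (simp add: inner_diff_left)
      qed
      have "pos_sol (affs A) (hats ?m) G S \<longleftrightarrow> (\<forall>i\<in>S. y i \<in> ?L) \<or> (\<forall>i\<in>S. y i \<in> ?R)"
        unfolding p using mS by simp
      thus ?thesis unfolding cnt_def using ne excl by auto
    qed
    have bL: "?L \<in> sets borel" "?R \<in> sets borel" by (rule halfspace_borel)+
    have mB: "(\<lambda>y. of_bool (\<forall>i\<in>S. y i \<in> B) :: ennreal) \<in> borel_measurable (ballM S)" if "B \<in> sets borel" for B :: "(real^'n) set"
    proof -
      have "{y \<in> space (ballM S). \<forall>i\<in>S. y i \<in> B} \<in> sets (ballM S)"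
      proof (intro sets.sets_Collect_finite_All GS(4))
        fix i assume "i \<in> S"
        from measurable_sets[OF ballM_component[OF this] that]
        show "{y \<in> space (ballM S). y i \<in> B} \<in> sets (ballM S)" by (simp add: vimage_def Int_def conj_commute)
      qed
      from borel_measurable_indicator[OF this]
      have "(\<lambda>y. indicator {y \<in> space (ballM S). \<forall>i\<in>S. y i \<in> B} y :: ennreal) \<in> borel_measurable (ballM S)" .
      thus ?thesis by (rule measurable_cong[THEN iffD1, rotated]) (simp add: indicator_def)
    qed
    have "K X = (\<integral>\<^sup>+y. of_bool (\<forall>i\<in>S. y i \<in> ?L) + of_bool (\<forall>i\<in>S. y i \<in> ?R) \<partial>ballM S)"
      unfolding K_def cnt_eq ..
    also have "\<dots> = (\<integral>\<^sup>+y. of_bool (\<forall>i\<in>S. y i \<in> ?L) \<partial>ballM S) + (\<integral>\<^sup>+y. of_bool (\<forall>i\<in>S. y i \<in> ?R) \<partial>ballM S)"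
      by (rule nn_integral_add[OF mB[OF bL(1)] mB[OF bL(2)]])
    also have "\<dots> = emeasure unif_ball ?L ^ card S + emeasure unif_ball ?R ^ card S"
      unfolding nn_integral_all_in[OF GS(4) bL(1)] nn_integral_all_in[OF GS(4) bL(2)] ..
    also have "\<dots> = ennreal (cap_cdf TYPE('n) (b / sqrt (1 + (norm a)\<^sup>2)) ^ card S + cap_cdf TYPE('n) (- (b / sqrt (1 + (norm a)\<^sup>2))) ^ card S)"
      unfolding eL eR by (simp add: ennreal_power cap_cdf_nonneg ennreal_plus)
    finally show "K X = ennreal (cap_cdf TYPE('n) (b / sqrt (1 + (norm a)\<^sup>2)) ^ card (I - G) + cap_cdf TYPE('n) (- (b / sqrt (1 + (norm a)\<^sup>2))) ^ card (I - G))"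
      unfolding S_def .
  qed
qed

section \<open>Faces of the convex hull\<close>

lemma convex_hull_Int_supporting_hyperplane:
  fixes S :: "'a::euclidean_space set"
  assumes S: "finite S" "S \<subseteq> {x. a \<bullet> x \<le> b}"
  shows "convex hull S \<inter> {x. a \<bullet> x = b} = convex hull (S \<inter> {x. a \<bullet> x = b})"
proof
  have le: "convex hull S \<subseteq> {x. a \<bullet> x \<le> b}" using S(2) by (intro hull_minimal convex_halfspace_le)
  have "convex hull S \<inter> {x. a \<bullet> x = b} face_of convex hull S"
    by (rule face_of_Int_supporting_hyperplane_le) (use le in auto)
  then obtain T where T: "T \<subseteq> S" "convex hull S \<inter> {x. a \<bullet> x = b} = convex hull T"
    using face_of_convex_hull_subset[OF finite_imp_compact[OF S(1)]] by metis
  have "T \<subseteq> S \<inter> {x. a \<bullet> x = b}" using T hull_subset[of T convex] by auto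
  thus "convex hull S \<inter> {x. a \<bullet> x = b} \<subseteq> convex hull (S \<inter> {x. a \<bullet> x = b})"
    unfolding T(2) by (rule hull_mono)
  show "convex hull (S \<inter> {x. a \<bullet> x = b}) \<subseteq> convex hull S \<inter> {x. a \<bullet> x = b}"
    by (intro Int_greatest hull_mono hull_minimal convex_hyperplane) auto
qed

lemma affs_UNIV [simp]: "affs UNIV = UNIV"
  unfolding affs_def by simp

lemma inner_hat_eq_0_iff: "v \<bullet> hat x = 0 \<longleftrightarrow> fst v \<bullet> x = - snd v"
  by (simp add: hat_inner eq_neg_iff_add_eq_0)

text \<open>Every face of a polytope, including the empty one and the polytope itself, is exposed.\<close>

lemma num_faces_eq_card_exposed:
  fixes X :: "nat \<Rightarrow> real^'n::finite"
  shows "num_faces k (convex hull (X ` {..<n}))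
    = card {F. F \<subseteq> {..<n} \<and> pos_sol (affs UNIV) (hats X) F ({..<n} - F) \<and> aff_dim (X ` F) = int k}"
proof -
  let ?P = "convex hull (X ` {..<n})"
  let ?ps = "\<lambda>F. pos_sol (affs UNIV) (hats X) F ({..<n} - F)"
  have fin: "finite (X ` {..<n})" by simp
  have exp: "?P \<inter> {x. - fst v \<bullet> x = snd v} = convex hull (X ` F) \<and> ?P \<subseteq> {x. - fst v \<bullet> x \<le> snd v}"
    if F: "F \<subseteq> {..<n}" and v0: "\<And>i. i \<in> F \<Longrightarrow> v \<bullet> hat (X i) = 0" and vp: "\<And>i. i \<in> {..<n} - F \<Longrightarrow> v \<bullet> hat (X i) > 0" for F v
  proof -
    have sub: "X ` {..<n} \<subseteq> {x. - fst v \<bullet> x \<le> snd v}"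
    proof safe
      fix i assume "i < n"
      thus "- fst v \<bullet> X i \<le> snd v" using v0[of i] vp[of i] unfolding hat_inner by (cases "i \<in> F") (auto simp: algebra_simps)
    qed
    have "X ` {..<n} \<inter> {x. - fst v \<bullet> x = snd v} = X ` F"
    proof (intro equalityI subsetI)
      fix x assume "x \<in> X ` {..<n} \<inter> {x. - fst v \<bullet> x = snd v}"
      then obtain i where i: "i < n" "x = X i" "- fst v \<bullet> X i = snd v" by auto
      hence "v \<bullet> hat (X i) = 0" unfolding hat_inner by (simp add: algebra_simps)
      hence "i \<in> F" using vp[of i] i(1) by force
      thus "x \<in> X ` F" using i by auto
    next
      fix x assume "x \<in> X ` F"
      then obtain i where i: "i \<in> F" "x = X i" by auto
      hence "- fst v \<bullet> X i = snd v" using v0[of i] unfolding hat_inner by (simp add: algebra_simps)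
      thus "x \<in> X ` {..<n} \<inter> {x. - fst v \<bullet> x = snd v}" using i F by auto
    qed
    thus ?thesis
      using convex_hull_Int_supporting_hyperplane[OF fin sub] hull_minimal[of "X ` {..<n}" "{x. - fst v \<bullet> x \<le> snd v}" convex, OF sub convex_halfspace_le]
      by simp
  qed
  have bij: "bij_betw (\<lambda>F. convex hull (X ` F)) {F. F \<subseteq> {..<n} \<and> ?ps F \<and> aff_dim (X ` F) = int k} {F. F face_of ?P \<and> aff_dim F = int k}"
  proof (rule bij_betwI')
    fix F F' assume F: "F \<in> {F. F \<subseteq> {..<n} \<and> ?ps F \<and> aff_dim (X ` F) = int k}" and F': "F' \<in> {F. F \<subseteq> {..<n} \<and> ?ps F \<and> aff_dim (X ` F) = int k}"
    \<comment> \<open>\<open>F2\<close> consists of all indices whose points lie on its supporting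
      hyperplane, so equal hulls force equal index sets even if points coincide.\<close>
    have "F1 \<subseteq> F2" if F1: "F1 \<subseteq> {..<n}" and F2: "F2 \<subseteq> {..<n}" "?ps F2" and eq: "convex hull (X ` F1) = convex hull (X ` F2)" for F1 F2
    proof
      fix i assume i: "i \<in> F1"
      obtain v where v: "\<And>i. i \<in> F2 \<Longrightarrow> v \<bullet> hat (X i) = 0" "\<And>i. i \<in> {..<n} - F2 \<Longrightarrow> v \<bullet> hat (X i) > 0"
        using F2(2) unfolding pos_sol_def by blast
      have "X i \<in> convex hull (X ` F2)" using i eq hull_inc[of "X i" "X ` F1" convex] by auto
      hence "- fst v \<bullet> X i = snd v" using exp[OF F2(1) v] by auto
      hence "v \<bullet> hat (X i) = 0" unfolding hat_inner by (simp add: algebra_simps)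
      thus "i \<in> F2" using v(2)[of i] i F1 by force
    qed
    thus "(convex hull (X ` F) = convex hull (X ` F')) = (F = F')" using F F' by (metis (mono_tags, lifting) mem_Collect_eq subset_antisym)
  next
    fix F assume F: "F \<in> {F. F \<subseteq> {..<n} \<and> ?ps F \<and> aff_dim (X ` F) = int k}"
    then obtain v where v: "\<And>i. i \<in> F \<Longrightarrow> v \<bullet> hat (X i) = 0" "\<And>i. i \<in> {..<n} - F \<Longrightarrow> v \<bullet> hat (X i) > 0"
      unfolding pos_sol_def by blast
    have Fn: "F \<subseteq> {..<n}" using F by auto
    have "?P \<inter> {x. - fst v \<bullet> x = snd v} face_of ?P"
      by (rule face_of_Int_supporting_hyperplane_le) (use exp[OF Fn v] in auto)
    hence "convex hull (X ` F) face_of ?P" using exp[OF Fn v] by simp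
    thus "convex hull (X ` F) \<in> {F. F face_of ?P \<and> aff_dim F = int k}" using F by (simp add: aff_dim_convex_hull)
  next
    fix \<Phi> assume \<Phi>: "\<Phi> \<in> {F. F face_of ?P \<and> aff_dim F = int k}"
    have "\<Phi> exposed_face_of ?P"
      using \<Phi> polytope_imp_polyhedron[OF polytope_convex_hull[OF fin]] by (simp add: exposed_face_of_polyhedron)
    then obtain a b where ab: "?P \<subseteq> {x. a \<bullet> x \<le> b}" "\<Phi> = ?P \<inter> {x. a \<bullet> x = b}"
      unfolding exposed_face_of_def by auto
    define v where "v = (- a, b)"
    define F where "F = {i. i < n \<and> a \<bullet> X i = b}"
    have inP: "X i \<in> ?P" if "i < n" for i using that by (intro hull_inc) auto
    have v0: "v \<bullet> hat (X i) = 0" if "i \<in> F" for i using that unfolding hat_inner v_def F_def by simp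
    have vp: "v \<bullet> hat (X i) > 0" if "i \<in> {..<n} - F" for i
      using that ab(1) inP[of i] unfolding hat_inner v_def F_def by (auto simp: order_less_le)
    have Fs: "F \<subseteq> {..<n}" unfolding F_def by auto
    have \<Phi>eq: "\<Phi> = convex hull (X ` F)" using exp[OF Fs v0 vp] ab(2) unfolding v_def by simp
    have "aff_dim (X ` F) = int k" using \<Phi> unfolding \<Phi>eq by (simp add: aff_dim_convex_hull)
    moreover have "?ps F" unfolding pos_sol_def affs_UNIV using v0 vp by blast
    ultimately show "\<exists>F\<in>{F. F \<subseteq> {..<n} \<and> ?ps F \<and> aff_dim (X ` F) = int k}. \<Phi> = convex hull (X ` F)"
      using \<Phi>eq Fs by (intro bexI[of _ F]) auto
  qed
  show ?thesis unfolding num_faces_def using bij_betw_same_card[OF bij] by simp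
qed

lemma aff_dim_image_separated:
  fixes X :: "'i \<Rightarrow> real^'n::finite"
  assumes fin: "finite B" and sep: "\<And>i. i \<in> B \<Longrightarrow> \<exists>v. (\<forall>j\<in>B - {i}. v \<bullet> hat (X j) = 0) \<and> v \<bullet> hat (X i) \<noteq> 0"
  shows "aff_dim (X ` B) = int (card B) - 1"
proof -
  have inj: "inj_on X B"
  proof (rule inj_onI, rule ccontr)
    fix i j assume ij: "i \<in> B" "j \<in> B" "X i = X j" "i \<noteq> j"
    obtain v where "\<forall>j\<in>B - {i}. v \<bullet> hat (X j) = 0" "v \<bullet> hat (X i) \<noteq> 0" using sep[OF ij(1)] by blast
    thus False using ij by auto
  qed
  have "\<not> affine_dependent (X ` B)"
  proof
    assume "affine_dependent (X ` B)"
    then obtain x where x: "x \<in> X ` B" "x \<in> affine hull (X ` B - {x})" unfolding affine_dependent_def by blast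
    obtain i where i: "i \<in> B" "x = X i" using x(1) by auto
    obtain v where v: "\<forall>j\<in>B - {i}. v \<bullet> hat (X j) = 0" "v \<bullet> hat (X i) \<noteq> 0" using sep[OF i(1)] by blast
    have "X ` B - {x} \<subseteq> {y. fst v \<bullet> y = - snd v}" using v(1) i unfolding inner_hat_eq_0_iff by auto
    hence "affine hull (X ` B - {x}) \<subseteq> {y. fst v \<bullet> y = - snd v}" by (intro hull_minimal) (auto simp: affine_hyperplane)
    hence "x \<in> {y. fst v \<bullet> y = - snd v}" using x(2) by auto
    thus False using v(2) i(2) unfolding inner_hat_eq_0_iff by auto
  qed
  hence "aff_dim (X ` B) = int (card (X ` B)) - 1" by (simp add: aff_dim_affine_independent)
  thus ?thesis using inj by (simp add: card_image)
qed

text \<open>Affine combinations of points are the linear combinations of their lifts with last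
  coordinate 1, so \<open>hat x\<close> lies outside the span of the lifted set. Its component
  orthogonal to that span is the functional.\<close>

lemma separating_functional:
  fixes x :: "real^'n::finite"
  assumes x: "x \<notin> affine hull S"
  shows "\<exists>v. (\<forall>y\<in>S. v \<bullet> hat y = 0) \<and> v \<bullet> hat x > 0"
proof -
  have ns: "hat x \<notin> span (hat ` S)"
  proof
    assume "hat x \<in> span (hat ` S)"
    then obtain T r where T: "finite T" "T \<subseteq> hat ` S" "(\<Sum>a\<in>T. r a *\<^sub>R a) = hat x"
      unfolding span_explicit by auto
    obtain T' where T': "T' \<subseteq> S" "finite T'" "T = hat ` T'"
      using T(1,2) by (meson finite_subset_image)
    have inj: "inj_on hat T'" by (auto simp: inj_on_def hat_def)
    have s: "(\<Sum>y\<in>T'. r (hat y) *\<^sub>R hat y) = hat x"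
      using T(3) unfolding T'(3) by (simp add: sum.reindex[OF inj])
    have "(\<Sum>y\<in>T'. r (hat y)) = 1" "(\<Sum>y\<in>T'. r (hat y) *\<^sub>R y) = x"
      using arg_cong[OF s, of snd] arg_cong[OF s, of fst] by (simp_all add: snd_sum fst_sum hat_def)
    moreover from this have "T' \<noteq> {}" by auto
    ultimately have "x \<in> affine hull S" using T'(1,2) unfolding affine_hull_explicit
      by (intro CollectI exI[of _ T'] exI[of _ "\<lambda>y. r (hat y)"]) auto
    thus False using x by simp
  qed
  obtain y z where yz: "y \<in> span (hat ` S)" "\<And>w. w \<in> span (hat ` S) \<Longrightarrow> orthogonal z w" "hat x = y + z"
    using orthogonal_subspace_decomp_exists[of "hat ` S" "hat x"] by metis
  have "z \<noteq> 0" using yz ns by auto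
  moreover have "z \<bullet> y = 0" using yz(2)[OF yz(1)] unfolding orthogonal_def .
  ultimately have "z \<bullet> hat x > 0" unfolding yz(3) by (simp add: inner_add_right)
  moreover have "\<forall>y\<in>S. z \<bullet> hat y = 0" using yz(2) unfolding orthogonal_def by (blast intro: span_base imageI)
  ultimately show ?thesis by blast
qed

text \<open>Affine independence, phrased as separability of each point from the others, is a finite
  combination of \<open>pos_sol\<close> conditions and hence measurable.\<close>

lemma aff_dim_image_ge_iff:
  fixes X :: "'i \<Rightarrow> real^'n::finite"
  assumes fin: "finite F"
  shows "int k \<le> aff_dim (X ` F) \<longleftrightarrow> (\<exists>B\<in>{B. B \<subseteq> F \<and> card B = k + 1}. \<forall>i\<in>B. pos_sol (affs UNIV) (hats X) (B - {i}) {i})"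
    (is "?L \<longleftrightarrow> ?R")
proof
  assume ?R
  then obtain B where B: "B \<subseteq> F" "card B = k + 1" "\<And>i. i \<in> B \<Longrightarrow> pos_sol (affs UNIV) (hats X) (B - {i}) {i}" by auto
  have "aff_dim (X ` B) = int (card B) - 1"
  proof (rule aff_dim_image_separated)
    show "finite B" using B(1) fin finite_subset by blast
    fix i assume "i \<in> B"
    from B(3)[OF this] show "\<exists>v. (\<forall>j\<in>B - {i}. v \<bullet> hat (X j) = 0) \<and> v \<bullet> hat (X i) \<noteq> 0"
      unfolding pos_sol_def by force
  qed
  moreover have "aff_dim (X ` B) \<le> aff_dim (X ` F)" using B(1) by (intro aff_dim_subset image_mono)
  ultimately show ?L using B(2) by simp
next
  assume L: ?L
  obtain C where C: "C \<subseteq> X ` F" "\<not> affine_dependent C" "affine hull C = affine hull (X ` F)"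
    using affine_basis_exists[of "X ` F"] by metis
  have "aff_dim C = aff_dim (X ` F)" using C(3) by (metis aff_dim_affine_hull)
  hence "k + 1 \<le> card C" using L aff_dim_affine_independent[OF C(2)] by linarith
  then obtain D where D: "D \<subseteq> C" "card D = k + 1" by (meson obtain_subset_with_card_n)
  have indD: "\<not> affine_dependent D" using C(2) D(1) affine_independent_subset by blast
  obtain B where B: "B \<subseteq> F" "D = X ` B" "inj_on X B" using D(1) C(1) by (metis subset_image_inj subset_trans)
  have "pos_sol (affs UNIV) (hats X) (B - {i}) {i}" if i: "i \<in> B" for i
  proof -
    have "X ` (B - {i}) = D - {X i}" using B i by (auto simp: inj_on_def)
    hence "X i \<notin> affine hull (X ` (B - {i}))" using indD i B(2) unfolding affine_dependent_def by auto
    from separating_functional[OF this] show ?thesis unfolding pos_sol_def affs_UNIV by auto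
  qed
  moreover have "card B = k + 1" using D(2) B by (simp add: card_image)
  ultimately show ?R using B(1) by auto
qed

lemma aff_dim_image_measurable:
  assumes "finite F" "F \<subseteq> I"
  shows "Measurable.pred (ballM I) (\<lambda>X. aff_dim (X ` F :: (real^'n::finite) set) = int k)"
proof -
  have ge: "Measurable.pred (ballM I) (\<lambda>X. int k \<le> aff_dim (X ` F :: (real^'n) set))" for k
    unfolding aff_dim_image_ge_iff[OF assms(1)]
  proof (intro pred_intros_finite pos_sol_hat_measurable)
    show "finite {B. B \<subseteq> F \<and> card B = k + 1}" using assms(1) by simp
  qed (use assms finite_subset in auto)
  have "aff_dim (X ` F) = int k \<longleftrightarrow> int k \<le> aff_dim (X ` F) \<and> \<not> int (Suc k) \<le> aff_dim (X ` F)" for X :: "_ \<Rightarrow> real^'n"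
    by auto
  thus ?thesis using ge[of k] ge[of "Suc k"] by simp
qed

text \<open>Measurability concerns all configurations, degenerate ones included, so it rests on the
  exposed-face formula and not on its almost sure simplification.\<close>

lemma num_faces_measurable:
  fixes n :: nat
  shows "(\<lambda>X. real (num_faces k (convex hull (X ` {..<n} :: (real^'n::finite) set)))) \<in> borel_measurable (ballM {..<n})"
proof -
  let ?Q = "\<lambda>(X :: nat \<Rightarrow> real^'n) F. pos_sol (affs UNIV) (hats X) F ({..<n} - F) \<and> aff_dim (X ` F) = int k"
  have e: "real (num_faces k (convex hull (X ` {..<n}))) = (\<Sum>F\<in>Pow {..<n}. of_bool (?Q X F))" for X :: "nat \<Rightarrow> real^'n"
  proof -
    have "{F. F \<subseteq> {..<n} \<and> ?Q X F} = Pow {..<n} \<inter> {F. ?Q X F}" by auto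
    thus ?thesis unfolding num_faces_eq_card_exposed by (simp add: sum_of_bool_eq)
  qed
  have "Measurable.pred (ballM {..<n}) (\<lambda>X. ?Q X F)" if "F \<in> Pow {..<n}" for F
    using that finite_subset[of F "{..<n}"] by (intro pred_intros_logic pos_sol_hat_measurable aff_dim_image_measurable) auto
  hence "(\<lambda>X. of_bool (?Q X F) :: real) \<in> borel_measurable (ballM {..<n})" if "F \<in> Pow {..<n}" for F
    using that by measurable
  thus ?thesis unfolding e by (rule borel_measurable_sum)
qed

lemma num_faces_generic:
  fixes X :: "nat \<Rightarrow> real^'n::finite"
  assumes gen: "generic (affs UNIV) (hats X) {..<n} (CARD('n) + 1)" and k: "k < CARD('n)"
  shows "num_faces k (convex hull (X ` {..<n})) = card {F. F \<subseteq> {..<n} \<and> card F = k + 1 \<and> pos_sol (affs UNIV) (hats X) F ({..<n} - F)}"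
proof -
  let ?d = "CARD('n)"
  have adim: "aff_dim (X ` F) = int (card F) - 1" if F: "F \<subseteq> {..<n}" "card F \<le> ?d + 1" for F
  proof (rule aff_dim_image_separated)
    show finF: "finite F" using F finite_subset by auto
    fix i assume i: "i \<in> F"
    have "\<exists>u\<in>kern (affs UNIV) (hats X) (F - {i}). u \<bullet> hat (X i) \<noteq> 0"
    proof (rule generic_ex_nonzero[OF gen])
      show "card (F - {i}) < ?d + 1" using F(2) finF i card_gt_0_iff[of F] by (auto simp: card_Diff_singleton)
    qed (use F i in auto)
    thus "\<exists>v. (\<forall>j\<in>F - {i}. v \<bullet> hat (X j) = 0) \<and> v \<bullet> hat (X i) \<noteq> 0" unfolding kern_def by auto
  qed
  have "card F = k + 1 \<longleftrightarrow> aff_dim (X ` F) = int k" if F: "F \<subseteq> {..<n}" for F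
  proof
    assume "card F = k + 1" thus "aff_dim (X ` F) = int k" using adim[OF F] k by simp
  next
    assume a: "aff_dim (X ` F) = int k"
    have "card F \<le> ?d"
    proof (rule ccontr)
      assume "\<not> card F \<le> ?d"
      then obtain B where B: "B \<subseteq> F" "card B = ?d + 1" by (metis Suc_eq_plus1 not_less_eq_eq obtain_subset_with_card_n)
      have "aff_dim (X ` B) = int ?d" using adim[of B] B F by auto
      moreover have "aff_dim (X ` B) \<le> aff_dim (X ` F)" using B by (intro aff_dim_subset image_mono)
      ultimately show False using a k by simp
    qed
    thus "card F = k + 1" using adim[OF F] a by simp
  qed
  hence "{F. F \<subseteq> {..<n} \<and> pos_sol (affs UNIV) (hats X) F ({..<n} - F) \<and> aff_dim (X ` F) = int k}
    = {F. F \<subseteq> {..<n} \<and> card F = k + 1 \<and> pos_sol (affs UNIV) (hats X) F ({..<n} - F)}" by blast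
  thus ?thesis unfolding num_faces_eq_card_exposed by simp
qed

section \<open>Laplace asymptotics\<close>

lemma wallis_Gamma:
  assumes "d > 0"
  shows "wallis d = sqrt pi * Gamma ((real d + 1) / 2) / Gamma ((real d + 2) / 2)"
proof -
  obtain m where m: "d = Suc m" using assms gr0_conv_Suc by blast
  have "ennreal (wallis d) = (\<integral>\<^sup>+h. height_weight m h \<partial>lborel)"
    unfolding m height_weight_total ..
  also have "\<dots> = (\<integral>\<^sup>+h. indicator {-1..1} h * sqrt (1 - h\<^sup>2) ^ m \<partial>lborel)"
  proof (rule nn_integral_cong_AE)
    have "AE h in lborel. h \<noteq> (1::real) \<and> h \<noteq> -1" using AE_lborel_singleton[of "1::real"] AE_lborel_singleton[of "-1::real"] by eventually_elim auto
    thus "AE h in lborel. height_weight m h = ennreal (indicator {-1..1} h * sqrt (1 - h\<^sup>2) ^ m)"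
      by eventually_elim (auto simp: height_weight_def indicator_def)
  qed
  also have "\<dots> = ennreal (Beta (1 / 2) (real m / 2 + 1))"
    by (rule emeasure_cball_aux_integral)
  finally have e: "ennreal (wallis d) = ennreal (Beta (1 / 2) (real m / 2 + 1))" .
  have b: "Beta (1 / 2) (real m / 2 + 1) = sqrt pi * Gamma ((real d + 1) / 2) / Gamma ((real d + 2) / 2)"
    unfolding Beta_def m Gamma_one_half_real by (simp add: field_simps)
  have "Beta (1 / 2) (real m / 2 + 1) \<ge> 0" unfolding b by (intro divide_nonneg_pos mult_nonneg_nonneg Gamma_real_nonneg Gamma_real_pos) auto
  thus ?thesis using e wallis_pos[of d] b by (simp add: ennreal_inj)
qed

text \<open>The substitution of \<open>b * u ^ p\<close> in the Gamma integral.\<close>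

lemma integral_pow_exp_pow:
  fixes a p :: nat
  assumes p: "p > 0" and b: "b > (0::real)"
  defines "\<alpha> \<equiv> (real a + 1) / real p"
  shows "((\<lambda>u. u ^ a * exp (- b * u ^ p)) has_integral (Gamma \<alpha> / real p * b powr (- \<alpha>))) {0..}"
proof -
  let ?f = "\<lambda>t. t powr (\<alpha> - 1) / exp t"
  let ?g = "\<lambda>u. b * u ^ p" and ?g' = "\<lambda>u. b * (real p * u ^ (p - 1))"
  have \<alpha>: "\<alpha> > 0" unfolding \<alpha>_def using p by simp
  have img: "?g ` {0<..} = {0<..}"
  proof (intro equalityI subsetI)
    fix y assume "y \<in> {0::real<..}"
    thus "y \<in> ?g ` {0<..}" using p b by (intro image_eqI[of _ _ "root p (y / b)"]) (auto simp: real_root_pow_pos2)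
  qed (use b in auto)
  have spike: "(f has_integral y) {0..} \<longleftrightarrow> (f has_integral y) {0<..}" for f :: "real \<Rightarrow> real" and y
    by (rule has_integral_spike_set_eq; rule negligible_subset[of "{0}"]; auto)
  have hi: "(?f has_integral Gamma \<alpha>) {0<..}" using Gamma_integral_real[OF \<alpha>] unfolding spike .
  have "?f absolutely_integrable_on {0<..}"
    using hi by (intro nonnegative_absolutely_integrable_1) (auto simp: has_integral_integrable)
  hence ai: "?f absolutely_integrable_on (?g ` {0<..}) \<and> integral (?g ` {0<..}) ?f = Gamma \<alpha>"
    unfolding img using integral_unique[OF hi] by simp
  have inj: "inj_on ?g {0<..}" using p b by (auto simp: inj_on_def dest: power_eq_imp_eq_base)
  have der: "(?g has_real_derivative ?g' x) (at x within {0<..})" for x by (auto intro!: derivative_eq_intros)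
  have ch: "(\<lambda>x. \<bar>?g' x\<bar> * ?f (?g x)) absolutely_integrable_on {0<..} \<and> integral {0<..} (\<lambda>x. \<bar>?g' x\<bar> * ?f (?g x)) = Gamma \<alpha>"
    by (rule has_absolute_integral_change_of_variables_1'[OF _ der inj, THEN iffD2]) (use ai in auto)
  hence "((\<lambda>x. \<bar>?g' x\<bar> * ?f (?g x)) has_integral Gamma \<alpha>) {0<..}"
    using set_lebesgue_integral_eq_integral(1) by (simp only: has_integral_iff) blast
  hence "((\<lambda>x. (1 / (real p * b powr \<alpha>)) * (\<bar>?g' x\<bar> * ?f (?g x))) has_integral (1 / (real p * b powr \<alpha>) * Gamma \<alpha>)) {0<..}"
    by (rule has_integral_mult_right)
  moreover have "(1 / (real p * b powr \<alpha>)) * (\<bar>?g' u\<bar> * ?f (?g u)) = u ^ a * exp (- b * u ^ p)" if "u \<in> {0<..}" for u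
  proof -
    have u: "u > 0" using that by simp
    have "?g u powr (\<alpha> - 1) = b powr (\<alpha> - 1) * u powr (real p * (\<alpha> - 1))"
      using u b by (simp add: powr_mult powr_powr flip: powr_realpow)
    moreover have "u ^ (p - 1) = u powr (real p - 1)" using u p by (simp add: of_nat_diff flip: powr_realpow)
    moreover have "u powr (real p - 1) * u powr (real p * (\<alpha> - 1)) = u ^ a"
    proof -
      have "real p - 1 + real p * (\<alpha> - 1) = real a" unfolding \<alpha>_def using p by (simp add: field_simps)
      thus ?thesis using u by (simp add: powr_realpow flip: powr_add)
    qed
    moreover have "b * b powr (\<alpha> - 1) = b powr \<alpha>" using b by (simp add: powr_mult_base)
    ultimately have "\<bar>?g' u\<bar> * ?g u powr (\<alpha> - 1) = real p * b powr \<alpha> * u ^ a"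
      using u b by (simp only: abs_mult abs_of_pos[OF b]) (simp add: abs_mult algebra_simps)
    hence "(1 / (real p * b powr \<alpha>)) * (\<bar>?g' u\<bar> * ?f (?g u)) = (1 / (real p * b powr \<alpha>)) * (real p * b powr \<alpha> * u ^ a) / exp (?g u)"
      by (simp only: times_divide_eq_right)
    thus ?thesis using p b by (simp add: exp_minus divide_simps)
  qed
  ultimately have "((\<lambda>u. u ^ a * exp (- b * u ^ p)) has_integral (1 / (real p * b powr \<alpha>) * Gamma \<alpha>)) {0<..}"
    by (rule has_integral_eq[rotated])
  moreover have "1 / (real p * b powr \<alpha>) * Gamma \<alpha> = Gamma \<alpha> / real p * b powr (- \<alpha>)"
    by (simp add: powr_minus_divide)
  ultimately show ?thesis unfolding spike by simp
qed

lemma sin_int_deriv: "x \<in> {0<..<pi} \<Longrightarrow> (sin_int d has_real_derivative sin x ^ d) (at x)"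
proof -
  assume x: "x \<in> {0<..<pi}"
  have "(sin_int d has_real_derivative sin x ^ d) (at x within {0..pi})"
    unfolding sin_int_def using x by (intro integral_has_real_derivative continuous_intros) auto
  thus ?thesis using x by (simp add: at_within_Icc_at)
qed

lemma sin_int_0 [simp]: "sin_int d 0 = 0"
  unfolding sin_int_def by simp

lemma sin_over_x_at_right: "((\<lambda>x::real. sin x / x) \<longlongrightarrow> 1) (at_right 0)"
proof -
  have "((\<lambda>h::real. (sin (0 + h) - sin 0) / h) \<longlongrightarrow> cos 0) (at 0)"
    using DERIV_sin[of "0::real"] unfolding DERIV_def .
  hence "((\<lambda>x::real. sin x / x) \<longlongrightarrow> 1) (at 0)" by simp
  thus ?thesis by (rule tendsto_mono[OF at_le, rotated]) simp
qed

lemma sin_int_asymp: "((\<lambda>x. sin_int d x / x ^ (d + 1)) \<longlongrightarrow> 1 / (real d + 1)) (at_right 0)"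
proof (rule lhopital_right_0)
  have "(sin_int d \<longlongrightarrow> sin_int d 0) (at 0 within {0..pi})"
    by (rule sin_int_continuous[of d, unfolded continuous_on_def, rule_format]) simp
  thus "(sin_int d \<longlongrightarrow> 0) (at_right 0)" unfolding at_within_Icc_at_right[OF pi_gt_zero] by simp
  show "((\<lambda>x. x ^ (d + 1)) \<longlongrightarrow> (0::real)) (at_right 0)"
    by (auto intro!: tendsto_eq_intros)
  show "eventually (\<lambda>x::real. x ^ (d + 1) \<noteq> 0) (at_right 0)"
    by (rule eventually_mono[OF eventually_at_right_less]) auto
  show "eventually (\<lambda>x::real. (real d + 1) * x ^ d \<noteq> 0) (at_right 0)"
    by (rule eventually_mono[OF eventually_at_right_less]) (auto simp: add_eq_0_iff)
  show "\<forall>\<^sub>F x in at_right 0. (sin_int d has_real_derivative sin x ^ d) (at x)"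
    by (rule eventually_at_rightI[of 0 pi]) (auto intro: sin_int_deriv)
  show "\<forall>\<^sub>F x in at_right 0. ((\<lambda>x. x ^ (d + 1)) has_real_derivative (real d + 1) * x ^ d) (at x)"
  proof (intro always_eventually allI)
    fix x :: real
    show "((\<lambda>x. x ^ (d + 1)) has_real_derivative (real d + 1) * x ^ d) (at x)"
      using DERIV_pow[of "d + 1" x] by (simp add: add.commute)
  qed
  have "((\<lambda>x::real. sin x / x) \<longlongrightarrow> 1) (at_right 0)"
    by (rule sin_over_x_at_right)
  hence "((\<lambda>x::real. (sin x / x) ^ d / (real d + 1)) \<longlongrightarrow> 1 ^ d / (real d + 1)) (at_right 0)"
    by (intro tendsto_intros) auto
  thus "((\<lambda>x. sin x ^ d / ((real d + 1) * x ^ d)) \<longlongrightarrow> 1 / (real d + 1)) (at_right 0)"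
    by (simp add: power_divide field_simps)
qed

lemma sin_pow_integrable: "a \<ge> 0 \<Longrightarrow> (\<lambda>y::real. sin y ^ d) integrable_on {a..b}"
  by (intro integrable_continuous_interval continuous_intros)

lemma sin_int_reflect: "\<psi> \<in> {0..pi} \<Longrightarrow> sin_int d (pi - \<psi>) = wallis d - sin_int d \<psi>"
proof -
  assume \<psi>: "\<psi> \<in> {0..pi}"
  have "of_real (sin_int d (pi - \<psi>) + sin_int d \<psi>) = (of_real (wallis d) :: complex)"
    using csin_int_reflect[of d "of_real \<psi>"] \<psi> csin_int_sin_int[of "pi - \<psi>" d] csin_int_sin_int[of \<psi> d] csin_int_sin_int[of pi d]
    by (simp add: sin_int_pi)
  thus ?thesis using of_real_eq_iff by (smt (verit))
qed

text \<open>Supplies the dominating function for Laplace's method. Up to \<open>pi / 3\<close> the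
  cosine is at least 1/2, hence \<open>sin y \<ge> y / 2\<close>; monotonicity of
  \<open>sin_int\<close> extends the bound to \<open>pi\<close> by comparing \<open>x\<close> with
  \<open>x / 3\<close>.\<close>

lemma sin_int_lower: "\<exists>c>0. \<forall>x\<in>{0..pi}. sin_int d x \<ge> c * x ^ (d + 1)"
proof -
  define c0 where "c0 = (1 / 2) ^ d / (real d + 1)"
  have c0: "c0 > 0" unfolding c0_def by (intro divide_pos_pos zero_less_power) auto
  have small: "sin_int d x \<ge> c0 * x ^ (d + 1)" if x: "x \<in> {0..pi / 3}" for x
  proof -
    have hi: "((\<lambda>y. (1 / 2 * y) ^ d) has_integral (c0 * x ^ (d + 1) - c0 * 0 ^ (d + 1))) {0..x}"
    proof (rule fundamental_theorem_of_calculus)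
      fix y
      have "((\<lambda>y. c0 * y ^ (d + 1)) has_real_derivative (1 / 2 * y) ^ d) (at y within {0..x})"
      proof -
        have "((\<lambda>y. y ^ (d + 1)) has_real_derivative (real d + 1) * y ^ d) (at y within {0..x})"
          using has_field_derivative_at_within[OF DERIV_pow[of "d + 1" y]] by (simp add: add.commute)
        from DERIV_cmult[OF this, of c0] show ?thesis unfolding c0_def power_mult_distrib by simp
      qed
      thus "((\<lambda>y. c0 * y ^ (d + 1)) has_vector_derivative (1 / 2 * y) ^ d) (at y within {0..x})"
        by (simp add: has_real_derivative_iff_has_vector_derivative)
    qed (use x in auto)
    have "integral {0..x} (\<lambda>y. (1 / 2 * y) ^ d) \<le> sin_int d x"
      unfolding sin_int_def
    proof (rule integral_le)
      show "(\<lambda>y. (1 / 2 * y) ^ d) integrable_on {0..x}" using hi by (rule has_integral_integrable)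
      fix y assume "y \<in> {0..x}"
      hence y: "0 \<le> y" "y \<le> pi / 3" using x by auto
      have "sin 0 - 1 / 2 * 0 \<le> sin y - 1 / 2 * y"
      proof (rule DERIV_nonneg_imp_nondecreasing[OF y(1)])
        fix t assume t: "0 \<le> t" "t \<le> y"
        have "cos t \<ge> cos (pi / 3)" using t y by (intro cos_monotone_0_pi_le) auto
        thus "\<exists>D. ((\<lambda>y. sin y - 1 / 2 * y) has_real_derivative D) (at t) \<and> D \<ge> 0"
          by (intro exI[of _ "cos t - 1 / 2"]) (auto intro!: derivative_eq_intros simp: cos_60)
      qed
      hence "1 / 2 * y \<le> sin y" "1 / 2 * y \<ge> 0" using y by auto
      thus "(1 / 2 * y) ^ d \<le> sin y ^ d" by (rule power_mono)
    qed (intro sin_pow_integrable order_refl)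
    thus ?thesis using integral_unique[OF hi] by simp
  qed
  have mono: "sin_int d x \<le> sin_int d y" if "0 \<le> x" "x \<le> y" "y \<le> pi" for x y
    unfolding sin_int_def using that
    by (intro integral_subset_le sin_pow_integrable) (auto intro: sin_pow_nonneg)
  have "sin_int d x \<ge> (c0 / 3 ^ (d + 1)) * x ^ (d + 1)" if x: "x \<in> {0..pi}" for x
  proof -
    have "(c0 / 3 ^ (d + 1)) * x ^ (d + 1) = c0 * (x / 3) ^ (d + 1)" by (simp add: power_divide)
    also have "\<dots> \<le> sin_int d (x / 3)" using x by (intro small) auto
    also have "\<dots> \<le> sin_int d x" using x by (intro mono) auto
    finally show ?thesis .
  qed
  thus ?thesis using c0 by (intro exI[of _ "c0 / 3 ^ (d + 1)"]) auto
qed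

lemma sin_int_bounds: "x \<in> {0..pi} \<Longrightarrow> 0 \<le> sin_int d x \<and> sin_int d x \<le> wallis d"
proof -
  assume x: "x \<in> {0..pi}"
  obtain c where c: "c > 0" "\<And>x. x \<in> {0..pi} \<Longrightarrow> sin_int d x \<ge> c * x ^ (d + 1)" using sin_int_lower by blast
  have "0 \<le> sin_int d y" if "y \<in> {0..pi}" for y
    using c(2)[OF that] c(1) that by (meson atLeastAtMost_iff less_imp_le mult_nonneg_nonneg order_trans zero_le_power)
  from this[OF x] this[of "pi - x"] sin_int_reflect[OF x, of d] x show ?thesis by simp
qed

text \<open>The quadratic error of the logarithm contributes \<open>N * G N * G N\<close>, which
  tends to 0 because \<open>N * G N\<close> converges and \<open>G N\<close> tends to 0.\<close>

lemma one_minus_power_exp_limit: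
  fixes G :: "nat \<Rightarrow> real"
  assumes lim: "(\<lambda>N. real N * G N) \<longlonglongrightarrow> L" and nn: "\<And>N. 0 \<le> G N"
  shows "(\<lambda>N. (1 - G N) ^ N) \<longlonglongrightarrow> exp (- L)"
proof -
  have "(\<lambda>N. (real N * G N) * (1 / real N)) \<longlonglongrightarrow> L * 0"
    by (intro tendsto_mult lim lim_1_over_n)
  moreover have "\<forall>\<^sub>F N in sequentially. (real N * G N) * (1 / real N) = G N"
    using eventually_gt_at_top[of 0] by eventually_elim simp
  ultimately have G0: "G \<longlonglongrightarrow> 0" by (simp add: tendsto_cong)
  have sm: "\<forall>\<^sub>F N in sequentially. G N \<le> 1 / 2"
    using order_tendstoD(2)[OF G0, of "1 / 2"] by (auto elim: eventually_mono)
  show ?thesis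
  proof (rule tendsto_sandwich)
    show "\<forall>\<^sub>F N in sequentially. exp (- (real N * G N) - 2 * ((real N * G N) * G N)) \<le> (1 - G N) ^ N"
      using sm
    proof eventually_elim
      case (elim N)
      have "- G N - 2 * (G N)\<^sup>2 \<le> ln (1 - G N)" using elim nn by (intro ln_one_minus_pos_lower_bound)
      hence "real N * (- G N - 2 * (G N)\<^sup>2) \<le> real N * ln (1 - G N)" by (intro mult_left_mono) auto
      also have "\<dots> = ln ((1 - G N) ^ N)" using elim by (simp add: ln_realpow)
      finally have "exp (real N * (- G N - 2 * (G N)\<^sup>2)) \<le> (1 - G N) ^ N"
        using elim by (subst (asm) ln_ge_iff) auto
      thus ?case by (simp add: algebra_simps power2_eq_square)
    qed
    show "\<forall>\<^sub>F N in sequentially. (1 - G N) ^ N \<le> exp (- (real N * G N))"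
      using sm
    proof eventually_elim
      case (elim N)
      have "(1 - G N) ^ N \<le> exp (- G N) ^ N" using elim exp_ge_add_one_self[of "- G N"] by (intro power_mono) auto
      thus ?case by (simp add: exp_of_nat_mult[symmetric])
    qed
    show "(\<lambda>N. exp (- (real N * G N))) \<longlonglongrightarrow> exp (- L)" by (intro tendsto_intros lim)
    have "(\<lambda>N. exp (- (real N * G N) - 2 * ((real N * G N) * G N))) \<longlonglongrightarrow> exp (- L - 2 * (L * 0))"
      by (intro tendsto_intros lim G0)
    thus "(\<lambda>N. exp (- (real N * G N) - 2 * ((real N * G N) * G N))) \<longlonglongrightarrow> exp (- L)" by simp
  qed
qed

text \<open>The integrand concentrates at the angle \<open>pi\<close>, where \<open>sin_int\<close>
  is maximal. Measuring the distance to \<open>pi\<close> in units of \<open>s\<close>, with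
  \<open>s ^ (d + 1) = 1 / (N + 1)\<close>, makes the large power converge to an
  exponential.\<close>

theorem laplace_sin_int:
  fixes a d :: nat
  defines "\<alpha> \<equiv> (real a + 1) / (real d + 1)"
  shows "(\<lambda>N. real N powr \<alpha> * (sin_moment d a N / wallis d ^ N)) \<longlonglongrightarrow> Gamma \<alpha> / (real d + 1) * (wallis d * (real d + 1)) powr \<alpha>"
proof -
  define w where "w = wallis d"
  have w: "w > 0" unfolding w_def by (rule wallis_pos)
  define G where "G = (\<lambda>x. sin_int d x / w)"
  \<comment> \<open>The successor keeps the scale positive for every \<open>N\<close>; the shift is
    undone at the end by \<open>LIMSEQ_imp_Suc\<close>.\<close>
  define s where "s = (\<lambda>N. real (Suc N) powr (- 1 / (real d + 1)))"
  have s: "s N > 0" for N unfolding s_def by simp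
  have sp: "real (Suc N) * s N ^ (d + 1) = 1" for N
  proof -
    have "s N ^ (d + 1) = real (Suc N) powr (real (d + 1) * (- 1 / (real d + 1)))"
      unfolding s_def by (rule powr_power) simp
    also have "real (d + 1) * (- 1 / (real d + 1)) = - 1" by (simp add: field_simps)
    finally show ?thesis by (simp add: powr_minus_divide)
  qed
  have s0: "s \<longlonglongrightarrow> 0"
  proof -
    have "filterlim (\<lambda>N. real (Suc N)) at_top sequentially"
      by (rule filterlim_compose[OF filterlim_real_sequentially filterlim_Suc])
    thus ?thesis unfolding s_def by (intro tendsto_neg_powr) auto
  qed
  define f where "f = (\<lambda>N u. if u \<in> {0..pi / s N} then (sin (s N * u) / s N) ^ a * (1 - G (s N * u)) ^ Suc N else 0)"
  have su: "s N * u \<in> {0..pi}" if "u \<in> {0..pi / s N}" for N u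
    using that s[of N] by (auto simp: field_simps)
  have Gb: "0 \<le> G x \<and> G x \<le> 1" if "x \<in> {0..pi}" for x
    using sin_int_bounds[OF that, of d] w unfolding G_def w_def by simp
  have hi: "(f N has_integral real (Suc N) powr \<alpha> * (sin_moment d a (Suc N) / w ^ Suc N)) {0..}" for N
  proof -
    let ?F = "\<lambda>\<phi>. sin \<phi> ^ a * (sin_int d \<phi> / w) ^ Suc N"
    let ?I = "sin_moment d a (Suc N) / w ^ Suc N"
    have "((\<lambda>\<phi>. sin \<phi> ^ a * sin_int d \<phi> ^ Suc N) has_integral sin_moment d a (Suc N)) {0..pi}"
      unfolding sin_moment_def by (intro integrable_integral integrable_continuous_interval continuous_intros sin_int_continuous)
    from has_integral_divide[OF this, of "w ^ Suc N"] have "(?F has_integral ?I) (cbox 0 pi)"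
      unfolding power_divide times_divide_eq_right cbox_interval .
    from has_integral_affinity[OF this, of "- s N" pi] s[of N]
    have "((\<lambda>u. ?F (- s N * u + pi)) has_integral (1 / s N) * ?I) ((\<lambda>x. (1 / - s N) *\<^sub>R x + - ((1 / - s N) *\<^sub>R pi)) ` {0..pi})"
      by simp
    also have "(\<lambda>x. (1 / - s N) *\<^sub>R x + - ((1 / - s N) *\<^sub>R pi)) ` {0..pi} = {0..pi / s N}"
    proof (intro equalityI subsetI)
      fix u assume "u \<in> {0..pi / s N}"
      thus "u \<in> (\<lambda>x. (1 / - s N) *\<^sub>R x + - ((1 / - s N) *\<^sub>R pi)) ` {0..pi}"
        using s[of N] by (intro image_eqI[of _ _ "pi - s N * u"]) (auto simp: field_simps)
    qed (use s[of N] in \<open>auto simp: field_simps\<close>)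
    finally have "((\<lambda>u. (1 / s N) ^ a * ?F (- s N * u + pi)) has_integral (1 / s N) ^ a * ((1 / s N) * ?I)) {0..pi / s N}"
      by (rule has_integral_mult_right)
    \<comment> \<open>At the reflected angle \<open>sin_int\<close> becomes
      \<open>w - sin_int\<close>, so division by \<open>w\<close> leaves a power of
      \<open>1 - G\<close>.\<close>
    moreover have "(1 / s N) ^ a * ?F (- s N * u + pi) = (sin (s N * u) / s N) ^ a * (1 - G (s N * u)) ^ Suc N" if "u \<in> {0..pi / s N}" for u
    proof -
      have "sin_int d (- s N * u + pi) = w - sin_int d (s N * u)"
        using sin_int_reflect[OF su[OF that], of d] unfolding w_def by simp
      hence "sin_int d (- s N * u + pi) / w = 1 - G (s N * u)"
        unfolding G_def using w by (simp add: diff_divide_distrib)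
      moreover have "sin (- s N * u + pi) = sin (s N * u)" using sin_pi_minus[of "s N * u"] by simp
      ultimately show ?thesis by (simp only: power_divide power_one) simp
    qed
    ultimately have "((\<lambda>u. (sin (s N * u) / s N) ^ a * (1 - G (s N * u)) ^ Suc N) has_integral (1 / s N) ^ a * ((1 / s N) * ?I)) {0..pi / s N}"
      by (rule has_integral_eq[rotated])
    hence "(f N has_integral (1 / s N) ^ a * ((1 / s N) * ?I)) {0..}"
      unfolding f_def by (subst has_integral_restrict) auto
    moreover have "(1 / s N) ^ a * (1 / s N) = real (Suc N) powr \<alpha>"
    proof -
      have "1 / s N = real (Suc N) powr (1 / (real d + 1))" unfolding s_def by (simp add: powr_minus_divide)
      hence "(1 / s N) ^ Suc a = real (Suc N) powr \<alpha>"
        by (simp only: powr_power \<alpha>_def) (simp add: add.commute)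
      thus ?thesis by (simp add: mult.commute)
    qed
    ultimately show ?thesis by (simp only: mult.assoc[symmetric])
  qed
  obtain c where c: "c > 0" "\<And>x. x \<in> {0..pi} \<Longrightarrow> sin_int d x \<ge> c * x ^ (d + 1)" using sin_int_lower by blast
  have bound: "norm (f N u) \<le> u ^ a * exp (- (c / w) * u ^ (d + 1))" if "u \<in> {0..}" for N u
  proof (cases "u \<in> {0..pi / s N}")
    case True
    note su = su[OF True]
    have "\<bar>sin (s N * u) / s N\<bar> \<le> u"
      using s[of N] that abs_sin_x_le_abs_x[of "s N * u"] by (simp add: abs_mult field_simps)
    hence 1: "\<bar>sin (s N * u) / s N\<bar> ^ a \<le> u ^ a" by (intro power_mono) auto
    have "\<bar>1 - G (s N * u)\<bar> \<le> exp (- G (s N * u))" using Gb[OF su] exp_ge_add_one_self[of "- G (s N * u)"] by auto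
    hence "\<bar>1 - G (s N * u)\<bar> ^ Suc N \<le> exp (- G (s N * u)) ^ Suc N" by (intro power_mono) auto
    also have "\<dots> = exp (- (real (Suc N) * G (s N * u)))" by (simp only: exp_of_nat_mult[symmetric]) simp
    also have "\<dots> \<le> exp (- (c / w) * u ^ (d + 1))"
    proof -
      have "(c / w) * u ^ (d + 1) = real (Suc N) * (c * (s N * u) ^ (d + 1) / w)"
      proof -
        have "real (Suc N) * (c * (s N * u) ^ (d + 1) / w) = (real (Suc N) * s N ^ (d + 1)) * (c / w * u ^ (d + 1))"
          by (simp only: power_mult_distrib times_divide_eq_right times_divide_eq_left mult_ac)
        thus ?thesis unfolding sp by (simp only: mult_1)
      qed
      also have "\<dots> \<le> real (Suc N) * G (s N * u)"
        unfolding G_def using c(2)[OF su] w by (intro mult_left_mono divide_right_mono) auto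
      finally show ?thesis by simp
    qed
    finally have 2: "\<bar>1 - G (s N * u)\<bar> ^ Suc N \<le> exp (- (c / w) * u ^ (d + 1))" .
    have "norm (f N u) = \<bar>sin (s N * u) / s N\<bar> ^ a * \<bar>1 - G (s N * u)\<bar> ^ Suc N"
      using True unfolding f_def by (simp only: if_True real_norm_def abs_mult power_abs)
    also have "\<dots> \<le> u ^ a * exp (- (c / w) * u ^ (d + 1))" using that by (intro mult_mono 1 2) auto
    finally show ?thesis .
  next
    case False
    thus ?thesis using that unfolding f_def by simp
  qed
  \<comment> \<open>Near 0 the function \<open>sin_int d\<close> behaves like
    \<open>x ^ (d + 1) / (d + 1)\<close>; division by \<open>w\<close> gives the rate
    \<open>b\<close>.\<close>
  define b where "b = 1 / (w * (real d + 1))"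
  have b: "b > 0" unfolding b_def using w by simp
  have lim: "(\<lambda>N. f N u) \<longlonglongrightarrow> u ^ a * exp (- b * u ^ (d + 1))" if "u \<in> {0..}" for u
  proof (cases "u = 0")
    case True
    thus ?thesis using s unfolding f_def G_def by (simp add: order_less_imp_le)
  next
    case False
    hence u: "u > 0" using that by simp
    have su0: "(\<lambda>N. s N * u) \<longlonglongrightarrow> 0" using tendsto_mult_right[OF s0, of u] by simp
    have fl: "filterlim (\<lambda>N. s N * u) (at_right 0) sequentially"
      using su0 s u by (intro tendsto_imp_filterlim_at_right) auto
    have ev: "\<forall>\<^sub>F N in sequentially. u \<in> {0..pi / s N}"
    proof -
      have "\<forall>\<^sub>F N in sequentially. s N * u < pi" by (rule order_tendstoD(2)[OF su0]) simp
      thus ?thesis by eventually_elim (use s u in \<open>auto simp: field_simps\<close>)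
    qed
    have "((\<lambda>x::real. sin x / x) \<longlongrightarrow> 1) (at_right 0)"
      by (rule sin_over_x_at_right)
    from filterlim_compose[OF this fl] have "(\<lambda>N. sin (s N * u) / (s N * u) * u) \<longlonglongrightarrow> 1 * u"
      by (intro tendsto_intros)
    moreover have "sin (s N * u) / (s N * u) * u = sin (s N * u) / s N" for N using u by simp
    ultimately have l1: "(\<lambda>N. sin (s N * u) / s N) \<longlonglongrightarrow> u" by simp
    \<comment> \<open>The index is shifted back so that exponent and index agree in
      \<open>one_minus_power_exp_limit\<close>; the value 0 outside the range keeps all terms
      nonnegative.\<close>
    define g where "g = (\<lambda>N. if u \<in> {0..pi / s (N - 1)} then G (s (N - 1) * u) else 0)"
    have l2: "(\<lambda>N. (1 - g N) ^ N) \<longlonglongrightarrow> exp (- (b * u ^ (d + 1)))"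
    proof (rule one_minus_power_exp_limit)
      show "0 \<le> g N" for N unfolding g_def using Gb[OF su] by auto
      have "(\<lambda>N. sin_int d (s N * u) / (s N * u) ^ (d + 1) * (u ^ (d + 1) / w)) \<longlonglongrightarrow> 1 / (real d + 1) * (u ^ (d + 1) / w)"
        by (intro tendsto_intros filterlim_compose[OF sin_int_asymp fl])
      moreover have "1 / (real d + 1) * (u ^ (d + 1) / w) = b * u ^ (d + 1)" unfolding b_def by simp
      moreover have "\<forall>\<^sub>F N in sequentially. sin_int d (s N * u) / (s N * u) ^ (d + 1) * (u ^ (d + 1) / w) = real (Suc N) * g (Suc N)"
        using ev
      proof eventually_elim
        case (elim N)
        have N: "real (Suc N) = 1 / s N ^ (d + 1)" using sp[of N] s[of N] by (simp add: field_simps)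
        have g: "g (Suc N) = sin_int d (s N * u) / w" using elim unfolding g_def G_def by simp
        show ?case unfolding N g power_mult_distrib using u s[of N] by simp
      qed
      ultimately have "(\<lambda>N. real (Suc N) * g (Suc N)) \<longlonglongrightarrow> b * u ^ (d + 1)" by (simp only: tendsto_cong)
      thus "(\<lambda>N. real N * g N) \<longlonglongrightarrow> b * u ^ (d + 1)" by (rule LIMSEQ_imp_Suc)
    qed
    have "(\<lambda>N. (sin (s N * u) / s N) ^ a * (1 - g (Suc N)) ^ Suc N) \<longlonglongrightarrow> u ^ a * exp (- (b * u ^ (d + 1)))"
      by (intro tendsto_mult tendsto_power l1 LIMSEQ_Suc[OF l2])
    moreover have "\<forall>\<^sub>F N in sequentially. (sin (s N * u) / s N) ^ a * (1 - g (Suc N)) ^ Suc N = f N u"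
      using ev by eventually_elim (simp add: f_def g_def)
    ultimately show ?thesis by (simp add: tendsto_cong)
  qed
  have ai: "(\<lambda>u. u ^ a * exp (- (c / w) * u ^ (d + 1))) integrable_on {0..}"
    using integral_pow_exp_pow[of "d + 1" "c / w" a] c(1) w by (auto intro: has_integral_integrable)
  have "(\<lambda>N. integral {0..} (f N)) \<longlonglongrightarrow> integral {0..} (\<lambda>u. u ^ a * exp (- b * u ^ (d + 1)))"
    by (rule dominated_convergence(2)[OF has_integral_integrable[OF hi] ai bound lim])
  hence "(\<lambda>N. real (Suc N) powr \<alpha> * (sin_moment d a (Suc N) / w ^ Suc N)) \<longlonglongrightarrow> Gamma \<alpha> / real (d + 1) * b powr (- \<alpha>)"
    unfolding integral_unique[OF hi] using integral_unique[OF integral_pow_exp_pow[of "d + 1" b a]] b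
    by (simp add: \<alpha>_def add.commute)
  hence "(\<lambda>N. real N powr \<alpha> * (sin_moment d a N / w ^ N)) \<longlonglongrightarrow> Gamma \<alpha> / real (d + 1) * b powr (- \<alpha>)"
    by (rule LIMSEQ_imp_Suc)
  moreover have "b powr (- \<alpha>) = (w * (real d + 1)) powr \<alpha>"
    unfolding b_def using w by (simp add: powr_minus_divide powr_divide)
  ultimately show ?thesis unfolding w_def by (simp add: add.commute)
qed

section \<open>Face probabilities\<close>

lemma inner_hat_affs_cong: "v \<in> affs A \<Longrightarrow> (\<And>j. j \<in> A \<Longrightarrow> x $ j = y $ j) \<Longrightarrow> v \<bullet> hat x = v \<bullet> hat y"
proof -
  assume v: "v \<in> affs A" and xy: "\<And>j. j \<in> A \<Longrightarrow> x $ j = y $ j"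
  have "fst v $ j \<bullet> x $ j = fst v $ j \<bullet> y $ j" for j
    using v xy[of j] unfolding affs_def by (cases "j \<in> A") auto
  hence "fst v \<bullet> x = fst v \<bullet> y" unfolding inner_vec_def by (intro sum.cong refl)
  thus ?thesis unfolding hat_inner by simp
qed

lemma pos_sol_affs_cong:
  fixes X Y :: "'i \<Rightarrow> real^'n::finite"
  assumes "\<And>i j. i \<in> F \<union> S \<Longrightarrow> j \<in> A \<Longrightarrow> X i $ j = Y i $ j"
  shows "pos_sol (affs A) (hats X) F S = pos_sol (affs A) (hats Y) F S"
proof -
  have "v \<bullet> hat (X i) = v \<bullet> hat (Y i)" if "v \<in> affs A" "i \<in> F \<union> S" for v i
    using that assms by (intro inner_hat_affs_cong) auto
  thus ?thesis unfolding pos_sol_def by simp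
qed

lemma kern_affs_cong:
  fixes X Y :: "'i \<Rightarrow> real^'n::finite"
  assumes "\<And>i j. i \<in> G \<Longrightarrow> j \<in> A \<Longrightarrow> X i $ j = Y i $ j"
  shows "kern (affs A) (hats X) G = kern (affs A) (hats Y) G"
proof -
  have "v \<bullet> hat (X i) = v \<bullet> hat (Y i)" if "v \<in> affs A" "i \<in> G" for v i
    using that assms by (intro inner_hat_affs_cong) auto
  thus ?thesis unfolding kern_def by auto
qed

text \<open>Composing an affine functional with the inverse homothety does not change the set of
  coordinates that it reads.\<close>

lemma affs_homothety:
  fixes c :: "real^'n::finite"
  assumes "r \<noteq> 0" "u \<in> affs A"
  obtains u' where "u' \<in> affs A" "\<And>x. u' \<bullet> hat (c + r *\<^sub>R x) = u \<bullet> hat x" "u' = 0 \<Longrightarrow> u = 0"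
proof
  let ?u = "((1 / r) *\<^sub>R fst u, snd u - (1 / r) * (fst u \<bullet> c))"
  show "?u \<in> affs A" using assms(2) unfolding affs_def by simp
  show "?u \<bullet> hat (c + r *\<^sub>R x) = u \<bullet> hat x" for x
    using assms(1) unfolding hat_inner by (simp add: inner_add_right)
  show "?u = 0 \<Longrightarrow> u = 0" using assms(1) by (simp add: prod_eq_iff)
qed

lemma homothety_inverse: "r \<noteq> 0 \<Longrightarrow> X i = - (1 / r) *\<^sub>R c + (1 / r) *\<^sub>R (c + r *\<^sub>R (X i :: 'v::real_vector))"
  by (simp add: scaleR_add_right)

lemma pos_sol_affs_homothety:
  fixes X :: "'i \<Rightarrow> real^'n::finite"
  assumes r: "r \<noteq> 0"
  shows "pos_sol (affs A) (hats (\<lambda>i. c + r *\<^sub>R X i)) F S = pos_sol (affs A) (hats X) F S"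
proof
  assume "pos_sol (affs A) (hats X) F S"
  then obtain u where u: "u \<in> affs A" "\<forall>i\<in>F. u \<bullet> hat (X i) = 0" "\<forall>i\<in>S. u \<bullet> hat (X i) > 0" unfolding pos_sol_def by blast
  obtain u' where "u' \<in> affs A" "\<And>x. u' \<bullet> hat (c + r *\<^sub>R x) = u \<bullet> hat x" using affs_homothety[OF r u(1)] by metis
  thus "pos_sol (affs A) (hats (\<lambda>i. c + r *\<^sub>R X i)) F S" unfolding pos_sol_def using u by (intro bexI[of _ u']) auto
next
  let ?Y = "\<lambda>i. c + r *\<^sub>R X i"
  assume "pos_sol (affs A) (hats ?Y) F S"
  then obtain u where u: "u \<in> affs A" "\<forall>i\<in>F. u \<bullet> hat (?Y i) = 0" "\<forall>i\<in>S. u \<bullet> hat (?Y i) > 0" unfolding pos_sol_def by blast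
  have r': "1 / r \<noteq> 0" using r by simp
  obtain u' where u': "u' \<in> affs A" "\<And>x. u' \<bullet> hat (- (1 / r) *\<^sub>R c + (1 / r) *\<^sub>R x) = u \<bullet> hat x"
    using affs_homothety[OF r' u(1), of "- (1 / r) *\<^sub>R c"] by metis
  have "u' \<bullet> hat (X i) = u \<bullet> hat (?Y i)" for i using u'(2)[of "?Y i"] homothety_inverse[OF r, of X i c] by simp
  thus "pos_sol (affs A) (hats X) F S" unfolding pos_sol_def using u u'(1) by (intro bexI[of _ u']) auto
qed

lemma kern_affs_homothety:
  fixes X :: "'i \<Rightarrow> real^'n::finite"
  assumes r: "r \<noteq> 0"
  shows "kern (affs A) (hats (\<lambda>i. c + r *\<^sub>R X i)) G = {0} \<longleftrightarrow> kern (affs A) (hats X) G = {0}"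
proof -
  have triv: "kern (affs A) (hats X) G = {0} \<longleftrightarrow> (\<forall>u\<in>affs A. (\<forall>i\<in>G. u \<bullet> hat (X i) = 0) \<longrightarrow> u = 0)" for X :: "'i \<Rightarrow> real^'n"
    using subspace_0[OF subspace_affs[of A]] unfolding kern_def by auto
  let ?Y = "\<lambda>i. c + r *\<^sub>R X i"
  have r': "1 / r \<noteq> 0" using r by simp
  show ?thesis
    unfolding triv
  proof (intro iffI ballI impI)
    fix u assume a: "\<forall>u\<in>affs A. (\<forall>i\<in>G. u \<bullet> hat (?Y i) = 0) \<longrightarrow> u = 0" and u: "u \<in> affs A" "\<forall>i\<in>G. u \<bullet> hat (X i) = 0"
    obtain u' where u': "u' \<in> affs A" "\<And>x. u' \<bullet> hat (c + r *\<^sub>R x) = u \<bullet> hat x" "u' = 0 \<Longrightarrow> u = 0" using affs_homothety[OF r u(1)] by metis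
    show "u = 0" using a u u' by simp
  next
    fix u assume a: "\<forall>u\<in>affs A. (\<forall>i\<in>G. u \<bullet> hat (X i) = 0) \<longrightarrow> u = 0" and u: "u \<in> affs A" "\<forall>i\<in>G. u \<bullet> hat (?Y i) = 0"
    obtain u' where u': "u' \<in> affs A" "\<And>x. u' \<bullet> hat (- (1 / r) *\<^sub>R c + (1 / r) *\<^sub>R x) = u \<bullet> hat x" "u' = 0 \<Longrightarrow> u = 0"
      using affs_homothety[OF r' u(1), of "- (1 / r) *\<^sub>R c"] by metis
    have "u' \<bullet> hat (X i) = u \<bullet> hat (?Y i)" for i using u'(2)[of "?Y i"] homothety_inverse[OF r, of X i c] by simp
    thus "u = 0" using a u u' by simp
  qed
qed

text \<open>Adding a basis vector as an extra point reduces measurability of this event to that of \<^const>\<open>pos_sol\<close>.\<close>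

lemma kern_trivial_iff:
  assumes "subspace U"
  shows "kern U z G = {0} \<longleftrightarrow> (\<forall>b\<in>Basis. \<not> pos_sol U (case_option b z) (Some ` G) {None})"
proof
  assume k: "kern U z G = {0}"
  show "\<forall>b\<in>Basis. \<not> pos_sol U (case_option b z) (Some ` G) {None}"
  proof (intro ballI notI)
    fix b assume "pos_sol U (case_option b z) (Some ` G) {None}"
    then obtain u where u: "u \<in> U" "\<forall>i\<in>G. u \<bullet> z i = 0" "u \<bullet> b > 0" unfolding pos_sol_def by auto
    hence "u \<in> kern U z G" unfolding kern_def by simp
    thus False using k u(3) by simp
  qed
next
  assume a: "\<forall>b\<in>Basis. \<not> pos_sol U (case_option b z) (Some ` G) {None}"
  have "u = 0" if u: "u \<in> U" "\<forall>i\<in>G. u \<bullet> z i = 0" for u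
  proof (rule euclidean_eqI)
    fix b :: 'a assume b: "b \<in> Basis"
    have "- u \<in> U" using subspace_neg[OF assms u(1)] .
    hence "\<not> u \<bullet> b > 0" "\<not> (- u) \<bullet> b > 0" using a[rule_format, OF b] u unfolding pos_sol_def by auto
    thus "u \<bullet> b = 0 \<bullet> b" by simp
  qed
  thus "kern U z G = {0}" using subspace_0[OF assms] unfolding kern_def by auto
qed

lemma kern_trivial_measurable:
  assumes "finite G" "G \<subseteq> I"
  shows "Measurable.pred (ballM I) (\<lambda>X. kern (affs A) (hats X :: 'i \<Rightarrow> (real^'n::finite) \<times> real) G = {0})"
  unfolding kern_trivial_iff[OF subspace_affs]
proof (intro pred_intros_finite pred_intros_logic finite_Basis pos_sol_measurable closed_affs)
  fix b :: "(real^'n) \<times> real" and i assume i: "i \<in> Some ` G \<union> {None}"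
  show "(\<lambda>X. case_option b (hats X) i) \<in> borel_measurable (ballM I)"
  proof (cases i)
    case (Some j)
    have "j \<in> I" using i Some assms(2) by auto
    hence "(\<lambda>X. hat (X j)) \<in> borel_measurable (ballM I)"
      by (rule measurable_compose[OF ballM_component hat_measurable])
    thus ?thesis unfolding Some option.case .
  qed simp
qed (use assms in auto)

lemma AE_kern_trivial:
  fixes A :: "'n::finite set"
  assumes "finite I" "G \<subseteq> I" "card G = card A + 1"
  shows "AE X in ballM I. kern (affs A) (hats X) G = {0}"
proof -
  have "AE X in ballM I. dim (kern (affs A) (hats X) G) = 0"
    using AE_dim_kern[of I G A] assms by simp
  thus ?thesis
  proof eventually_elim
    case (elim X)
    hence "kern (affs A) (hats X) G \<subseteq> {0}" by (simp only: dim_eq_0)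
    thus "kern (affs A) (hats X) G = {0}" using subspace_0[OF subspace_kern[OF subspace_affs]] by blast
  qed
qed

text \<open>The expected number of open sides, of the hyperplane determined by \<open>m\<close>
  points in \<open>m\<close> coordinates, that contain all of \<open>N\<close> further points;
  \<open>wallis (d * m)\<close> normalises the law of the height. With \<open>N = 0\<close> both
  sides count.\<close>

definition facet_mass :: "nat \<Rightarrow> nat \<Rightarrow> nat \<Rightarrow> real" where
  "facet_mass d m N = 2 * sin_moment d (d * m) N / (wallis d ^ N * wallis (d * m))"

lemma sin_moment_nonneg: "sin_moment d a N \<ge> 0"
  unfolding sin_moment_def
proof (rule integral_nonneg)
  show "(\<lambda>\<phi>. sin \<phi> ^ a * sin_int d \<phi> ^ N) integrable_on {0..pi}"
    by (intro integrable_continuous_interval continuous_intros sin_int_continuous)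
  fix x :: real assume x: "x \<in> {0..pi}"
  have "sin_int d x \<ge> 0" unfolding sin_int_def
    using x by (intro integral_nonneg integrable_continuous_interval continuous_intros) (auto intro!: zero_le_power sin_ge_zero)
  thus "0 \<le> sin x ^ a * sin_int d x ^ N" using sin_pow_nonneg[OF x] by simp
qed

lemma facet_mass_nonneg: "facet_mass d m N \<ge> 0"
  unfolding facet_mass_def by (intro divide_nonneg_nonneg mult_nonneg_nonneg sin_moment_nonneg zero_le_power less_imp_le[OF wallis_pos]) simp

text \<open>The two sides of the hyperplane contribute equally, by the reflection of the angle in
  \<open>pi / 2\<close>; hence the factor 2.\<close>

lemma cap_integral:
  assumes "m > 0"
  shows "(\<integral>\<^sup>+h. ennreal (cap_cdf TYPE('n::finite) h ^ N + cap_cdf TYPE('n) (- h) ^ N) * height_weight (m * CARD('n) - 1) h \<partial>lborel)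
     = ennreal (2 * sin_moment CARD('n) (CARD('n) * m) N / wallis CARD('n) ^ N)"
proof -
  let ?d = "CARD('n)"
  define w where "w = wallis ?d"
  define f where "f = (\<lambda>\<phi>. (sin_int ?d \<phi> / w) ^ N * sin \<phi> ^ (?d * m))"
  have s: "Suc (m * ?d - 1) = ?d * m" using assms by (simp add: mult.commute)
  have fi: "(f has_integral sin_moment ?d (?d * m) N / w ^ N) {0..pi}"
  proof -
    have "((\<lambda>\<phi>. sin \<phi> ^ (?d * m) * sin_int ?d \<phi> ^ N) has_integral sin_moment ?d (?d * m) N) {0..pi}"
      unfolding sin_moment_def by (intro integrable_integral integrable_continuous_interval continuous_intros sin_int_continuous)
    from has_integral_divide[OF this, of "w ^ N"] show ?thesis unfolding f_def by (simp add: power_divide mult.commute)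
  qed
  have "((\<lambda>x. f ((-1) *\<^sub>R x + pi)) has_integral (1 / (\<bar>- 1\<bar> ^ DIM(real))) *\<^sub>R (sin_moment ?d (?d * m) N / w ^ N)) ((\<lambda>x. (1 / (-1)) *\<^sub>R x + - ((1 / (-1)) *\<^sub>R pi)) ` cbox 0 pi)"
    using fi by (intro has_integral_affinity) (auto simp: cbox_interval)
  moreover have "(\<lambda>x. (1 / (-1)) *\<^sub>R x + - ((1 / (-1)) *\<^sub>R pi)) ` cbox 0 pi = {0..pi}"
  proof (intro equalityI subsetI)
    fix x assume "x \<in> {0..pi}"
    thus "x \<in> (\<lambda>x. (1 / (-1)) *\<^sub>R x + - ((1 / (-1)) *\<^sub>R pi)) ` cbox 0 pi"
      by (intro image_eqI[of _ _ "pi - x"]) auto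
  qed auto
  ultimately have fr: "((\<lambda>x. f (pi - x)) has_integral sin_moment ?d (?d * m) N / w ^ N) {0..pi}"
    by (simp add: algebra_simps)
  have cont: "continuous_on {0..pi} f" unfolding f_def w_def
    using wallis_pos[of ?d] by (intro continuous_intros sin_int_continuous) auto
  have contr: "continuous_on {0..pi} (\<lambda>x. f (pi - x))"
    by (rule continuous_on_compose2[OF cont]) (auto intro!: continuous_intros)
  have f0: "f x \<ge> 0" if "x \<in> {0..pi}" for x
    using cap_cdf_cos[OF that, where 'n = 'n] cap_cdf_nonneg[where 'n = 'n, of "- cos x"] sin_pow_nonneg[OF that] unfolding f_def w_def
    by (metis mult_nonneg_nonneg zero_le_power)
  have "(\<integral>\<^sup>+h. ennreal (cap_cdf TYPE('n::finite) h ^ N + cap_cdf TYPE('n) (- h) ^ N) * height_weight (m * CARD('n) - 1) h \<partial>lborel)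
    = (\<integral>\<^sup>+\<phi>. ennreal ((cap_cdf TYPE('n) (- cos \<phi>) ^ N + cap_cdf TYPE('n) (- (- cos \<phi>)) ^ N) * sin \<phi> ^ Suc (m * ?d - 1) * indicator {0..pi} \<phi>) \<partial>lborel)"
    by (intro height_weight_substitution) (auto intro!: add_nonneg_nonneg zero_le_power cap_cdf_nonneg)
  also have "\<dots> = (\<integral>\<^sup>+\<phi>. ennreal ((f \<phi> + f (pi - \<phi>)) * indicator {0..pi} \<phi>) \<partial>lborel)"
  proof (intro nn_integral_cong arg_cong[where f = ennreal])
    fix \<phi> :: real
    show "(cap_cdf TYPE('n) (- cos \<phi>) ^ N + cap_cdf TYPE('n) (- (- cos \<phi>)) ^ N) * sin \<phi> ^ Suc (m * ?d - 1) * indicator {0..pi} \<phi> = (f \<phi> + f (pi - \<phi>)) * indicator {0..pi} \<phi>"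
    proof (cases "\<phi> \<in> {0..pi}")
      case True
      have "cap_cdf TYPE('n) (- cos (pi - \<phi>)) = sin_int ?d (pi - \<phi>) / w"
        unfolding w_def using True by (intro cap_cdf_cos) auto
      thus ?thesis using True cap_cdf_cos[OF True, where 'n = 'n] unfolding f_def s by (simp add: w_def algebra_simps)
    qed simp
  qed
  also have "\<dots> = ennreal (integral {0..pi} (\<lambda>\<phi>. f \<phi> + f (pi - \<phi>)))"
    by (intro nn_integral_cont_pi continuous_intros cont contr add_nonneg_nonneg f0) auto
  also have "integral {0..pi} (\<lambda>\<phi>. f \<phi> + f (pi - \<phi>)) = 2 * sin_moment ?d (?d * m) N / w ^ N"
    using integral_unique[OF has_integral_add[OF fi fr]] by simp
  finally show ?thesis unfolding w_def .
qed

text \<open>The nondegeneracy demanded by \<open>nn_integral_count\<close> holds almost surely,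
  ignores coordinate \<open>t\<close> and is homothety invariant, so it can be conjoined with
  \<open>Q\<close> without changing either side.\<close>

theorem nn_integral_facet:
  fixes A :: "'n::finite set" and Q :: "(nat \<Rightarrow> real^'n) \<Rightarrow> bool"
  assumes I: "finite I" and G: "G \<subseteq> I" "G \<noteq> {}" and t: "t \<in> A" and card: "card G = card A"
    and Qm: "Measurable.pred (ballM G) Q"
    and dep: "\<And>X Y. (\<And>i j. i \<in> G \<Longrightarrow> j \<noteq> t \<Longrightarrow> X i $ j = Y i $ j) \<Longrightarrow> Q X = Q Y"
    and inv: "\<And>X c r. r > 0 \<Longrightarrow> Q (\<lambda>i. c + r *\<^sub>R X i) = Q X"
  shows "(\<integral>\<^sup>+X. of_bool (Q X) * (of_bool (pos_sol (affs A) (hats X) G (I - G)) + of_bool (G = I)) \<partial>ballM I)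
     = ennreal (facet_mass CARD('n) (card A) (card I - card A)) * emeasure (ballM G) {X \<in> space (ballM G). Q X}"
proof -
  let ?d = "CARD('n)" and ?m = "card A"
  have finG: "finite G" using G(1) I finite_subset by auto
  have At: "card (A - {t}) + 1 = ?m" using t by (metis Suc_eq_plus1 card_Suc_Diff1 finite)
  have m0: "?m > 0" using At by simp
  have N: "card (I - G) = card I - ?m" using card_Diff_subset[OF finG G(1)] card by simp
  define Ev where "Ev = (\<lambda>X. kern (affs (A - {t})) (hats X) G = {0} \<and> Q X)"
  let ?c = "\<lambda>X. of_bool (pos_sol (affs A) (hats X) G (I - G)) + of_bool (G = I) :: ennreal"
  define L where "L = (\<integral>\<^sup>+X. of_bool (Q X) * ?c X \<partial>ballM I)"
  have "(\<integral>\<^sup>+X. of_bool (Ev X) * ?c X \<partial>ballM I) = L"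
    unfolding L_def
  proof (rule nn_integral_cong_AE)
    have "AE X in ballM I. kern (affs (A - {t})) (hats X) G = {0}"
      by (rule AE_kern_trivial[OF I G(1)]) (simp only: card At)
    thus "AE X in ballM I. of_bool (Ev X) * ?c X = of_bool (Q X) * ?c X"
      by eventually_elim (simp add: Ev_def)
  qed
  moreover have Evm: "Measurable.pred (ballM G) Ev"
    unfolding Ev_def by (intro pred_intros_logic kern_trivial_measurable finG Qm) simp
  moreover have "emeasure (ballM G) {X \<in> space (ballM G). Ev X} = emeasure (ballM G) {X \<in> space (ballM G). Q X}"
  proof (rule emeasure_eq_AE)
    have "AE X in ballM G. kern (affs (A - {t})) (hats X) G = {0}"
      by (rule AE_kern_trivial[OF finG order_refl]) (simp only: card At)
    thus "AE X in ballM G. X \<in> {X \<in> space (ballM G). Ev X} \<longleftrightarrow> X \<in> {X \<in> space (ballM G). Q X}"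
      by eventually_elim (simp add: Ev_def)
  qed (use Evm Qm in \<open>simp_all add: pred_def\<close>)
  moreover have "(\<integral>\<^sup>+X. of_bool (Ev X) * ?c X \<partial>ballM I) * ennreal (wallis (card G * ?d))
     = (\<integral>\<^sup>+h. ennreal (cap_cdf TYPE('n) h ^ card (I - G) + cap_cdf TYPE('n) (- h) ^ card (I - G)) * height_weight (card G * ?d - 1) h \<partial>lborel)
       * emeasure (ballM G) {X \<in> space (ballM G). Ev X}"
  proof (rule nn_integral_count[OF I G t card Evm])
    fix X Y :: "nat \<Rightarrow> real^'n" assume XY: "\<And>i j. i \<in> G \<Longrightarrow> j \<noteq> t \<Longrightarrow> X i $ j = Y i $ j"
    have "kern (affs (A - {t})) (hats X) G = kern (affs (A - {t})) (hats Y) G"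
      by (rule kern_affs_cong) (use XY in auto)
    moreover have "Q X = Q Y" by (rule dep) (use XY in auto)
    ultimately show "Ev X = Ev Y" unfolding Ev_def by simp
  next
    fix X :: "nat \<Rightarrow> real^'n" and c r assume r: "r > (0::real)"
    show "Ev (\<lambda>i. c + r *\<^sub>R X i) = Ev X"
      unfolding Ev_def using r inv[OF r] kern_affs_homothety[of r "A - {t}" c X G] by simp
  next
    fix X :: "nat \<Rightarrow> real^'n" and v
    assume "Ev X" "v \<in> affs (A - {t})" "\<And>i. i \<in> G \<Longrightarrow> v \<bullet> hat (X i) = 0"
    thus "v = 0" unfolding Ev_def kern_def by blast
  qed
  ultimately have eq: "L * ennreal (wallis (?d * ?m)) = ennreal (2 * sin_moment ?d (?d * ?m) (card I - ?m) / wallis ?d ^ (card I - ?m)) * emeasure (ballM G) {X \<in> space (ballM G). Q X}"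
    unfolding cap_integral[OF m0[folded card]] by (simp add: N card mult.commute)
  define e where "e = emeasure (ballM G) {X \<in> space (ballM G). Q X}"
  have "L = L * ennreal (wallis (?d * ?m)) * ennreal (1 / wallis (?d * ?m))"
    using wallis_pos[of "?d * ?m"] by (simp add: mult.assoc ennreal_mult''[symmetric])
  also have "\<dots> = ennreal (2 * sin_moment ?d (?d * ?m) (card I - ?m) / wallis ?d ^ (card I - ?m)) * ennreal (1 / wallis (?d * ?m)) * e"
    unfolding eq e_def by (simp only: mult_ac)
  also have "ennreal (2 * sin_moment ?d (?d * ?m) (card I - ?m) / wallis ?d ^ (card I - ?m)) * ennreal (1 / wallis (?d * ?m)) = ennreal (facet_mass ?d ?m (card I - ?m))"
    using wallis_pos[of "?d * ?m"] unfolding facet_mass_def by (subst ennreal_mult''[symmetric]) auto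
  finally show ?thesis unfolding L_def e_def .
qed

lemma emeasure_ballM_reindex:
  fixes f :: "nat \<Rightarrow> nat"
  assumes f: "bij_betw f J G" and E: "E \<in> sets (ballM J :: (nat \<Rightarrow> real^'n::finite) measure)"
  shows "emeasure (ballM J) E = emeasure (ballM G) {X \<in> space (ballM G). (\<lambda>n\<in>J. X (f n)) \<in> E}"
proof -
  have "distr (ballM G) (ballM J) (\<lambda>\<omega>. \<lambda>n\<in>J. \<omega> (f n)) = (ballM J :: (nat \<Rightarrow> real^'n) measure)"
    using f by (intro distr_PiM_reindex prob_space_unif_ball) (auto simp: bij_betw_def)
  hence "emeasure (ballM J) E = emeasure (distr (ballM G) (ballM J) (\<lambda>\<omega>. \<lambda>n\<in>J. \<omega> (f n))) E" by simp
  also have "\<dots> = emeasure (ballM G) ((\<lambda>\<omega>. \<lambda>n\<in>J. \<omega> (f n)) -` E \<inter> space (ballM G))"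
  proof (rule emeasure_distr[OF _ E])
    show "(\<lambda>\<omega>. \<lambda>n\<in>J. \<omega> (f n)) \<in> ballM G \<rightarrow>\<^sub>M (ballM J :: (nat \<Rightarrow> real^'n) measure)"
      using f by (intro measurable_restrict measurable_component_singleton) (auto simp: bij_betw_def)
  qed
  also have "(\<lambda>\<omega>. \<lambda>n\<in>J. \<omega> (f n)) -` E \<inter> space (ballM G) = {X \<in> space (ballM G). (\<lambda>n\<in>J. X (f n)) \<in> E}" by auto
  finally show ?thesis .
qed

text \<open>The unknowns of the linear system: they involve \<open>m\<close> points only, whatever
  the sample size. The indices below \<open>K\<close> stand for the prescribed face.\<close>

definition cone_miss :: "'n::finite set \<Rightarrow> nat \<Rightarrow> nat \<Rightarrow> real" where
  "cone_miss A K m = measure (ballM {..<m}) {X \<in> space (ballM {..<m}). \<not> pos_sol (affs A) (hats X) {..<K} {K..<m}}"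

text \<open>Exchangeability of the sample: only the sizes of \<open>F\<close> and \<open>G\<close>
  matter.\<close>

lemma emeasure_cone_miss:
  fixes A :: "'n::finite set" and G :: "nat set"
  assumes G: "finite G" and F: "F \<subseteq> G"
  shows "emeasure (ballM G) {X \<in> space (ballM G). \<not> pos_sol (affs A) (hats X) F (G - F)} = ennreal (cone_miss A (card F) (card G))"
proof -
  define K m where "K = card F" and "m = card G"
  have Km: "K \<le> m" unfolding K_def m_def by (rule card_mono[OF G F])
  have finF: "finite F" using G F finite_subset by auto
  obtain g1 where g1: "bij_betw g1 {..<K} F"
    unfolding K_def using finF by (metis card_lessThan finite_lessThan finite_same_card_bij)
  have "card (G - F) = card {K..<m}" unfolding K_def m_def using card_Diff_subset[OF finF F] by simp
  then obtain g2 where g2: "bij_betw g2 {K..<m} (G - F)"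
    using G by (metis finite_Diff finite_atLeastLessThan finite_same_card_bij)
  \<comment> \<open>Gluing a bijection onto \<open>F\<close> with one onto \<open>G - F\<close>
    keeps the indices of the face in front.\<close>
  define f where "f = (\<lambda>i. if i \<in> {..<K} then g1 i else g2 i)"
  have "bij_betw f ({..<K} \<union> {K..<m}) (F \<union> (G - F))"
    unfolding f_def by (intro bij_betw_disjoint_Un g1 g2) auto
  moreover have "{..<K} \<union> {K..<m} = {..<m}" "F \<union> (G - F) = G" using Km F by auto
  ultimately have f: "bij_betw f {..<m} G" by simp
  have f1: "F = f ` {..<K}" using g1 unfolding f_def bij_betw_def by auto
  have f2: "G - F = f ` {K..<m}" using g2 unfolding f_def bij_betw_def by auto
  let ?E = "{X \<in> space (ballM {..<m}). \<not> pos_sol (affs A) (hats X) {..<K} {K..<m}}"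
  have Em: "?E \<in> sets (ballM {..<m})"
  proof -
    have "Measurable.pred (ballM {..<m}) (\<lambda>X :: nat \<Rightarrow> real^'n. \<not> pos_sol (affs A) (hats X) {..<K} {K..<m})"
      using Km by (intro pred_intros_logic pos_sol_hat_measurable) auto
    thus ?thesis by (simp add: pred_def)
  qed
  have "pos_sol (affs A) (hats (\<lambda>n\<in>{..<m}. X (f n))) {..<K} {K..<m} = pos_sol (affs A) (hats X) F (G - F)" for X
  proof -
    have e1: "(\<forall>i\<in>{..<K}. P ((\<lambda>n\<in>{..<m}. X (f n)) i)) = (\<forall>i\<in>F. P (X i))" for P
      unfolding f1 using Km by auto
    have e2: "(\<forall>i\<in>{K..<m}. P ((\<lambda>n\<in>{..<m}. X (f n)) i)) = (\<forall>i\<in>G - F. P (X i))" for P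
      unfolding f2 by auto
    show ?thesis
      unfolding pos_sol_def e1[of "\<lambda>x. u \<bullet> hat x = 0" for u] e2[of "\<lambda>x. u \<bullet> hat x > 0" for u] ..
  qed
  moreover have "(\<lambda>n\<in>{..<m}. X (f n)) \<in> space (ballM {..<m})" for X :: "nat \<Rightarrow> real^'n"
    by (auto simp: space_PiM)
  ultimately have "{X \<in> space (ballM G). (\<lambda>n\<in>{..<m}. X (f n)) \<in> ?E} = {X \<in> space (ballM G). \<not> pos_sol (affs A) (hats X) F (G - F)}"
    by simp
  hence "emeasure (ballM G) {X \<in> space (ballM G). \<not> pos_sol (affs A) (hats X) F (G - F)} = emeasure (ballM {..<m}) ?E"
    using emeasure_ballM_reindex[OF f Em] by simp
  also have "\<dots> = ennreal (cone_miss A K m)"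
    unfolding cone_miss_def by (rule finite_measure.emeasure_eq_measure[OF prob_space.finite_measure[OF prob_space_ballM]])
  finally show ?thesis unfolding K_def m_def .
qed

lemma cone_miss_nonneg: "cone_miss A K m \<ge> 0"
  unfolding cone_miss_def by simp

definition face_prob :: "'n::finite set \<Rightarrow> nat set \<Rightarrow> nat set \<Rightarrow> real" where
  "face_prob A F I = measure (ballM I) {X \<in> space (ballM I). pos_sol (affs A) (hats X) F (I - F)}"

lemma face_prob_nonneg: "face_prob A F I \<ge> 0"
  unfolding face_prob_def by simp

lemma nn_integral_face_prob:
  fixes A :: "'n::finite set"
  assumes "finite I" "F \<subseteq> I"
  shows "(\<integral>\<^sup>+X. of_bool (pos_sol (affs A) (hats X) F (I - F)) \<partial>ballM I) = ennreal (face_prob A F I)"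
proof -
  let ?E = "{X \<in> space (ballM I). pos_sol (affs A) (hats X) F (I - F)}"
  have "Measurable.pred (ballM I) (\<lambda>X. pos_sol (affs A) (hats X) F (I - F))"
    using assms finite_subset[of F I] by (intro pos_sol_hat_measurable) auto
  hence E: "?E \<in> sets (ballM I)" by (simp add: pred_def)
  have "(\<integral>\<^sup>+X. of_bool (pos_sol (affs A) (hats X) F (I - F)) \<partial>ballM I) = (\<integral>\<^sup>+X. indicator ?E X \<partial>ballM I)"
    by (intro nn_integral_cong) (simp add: indicator_def)
  also have "\<dots> = emeasure (ballM I) ?E" by (rule nn_integral_indicator[OF E])
  also have "\<dots> = ennreal (face_prob A F I)"
    unfolding face_prob_def by (rule finite_measure.emeasure_eq_measure[OF prob_space.finite_measure[OF prob_space_ballM]])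
  finally show ?thesis .
qed

lemma pred_of_bool_measurable:
  "Measurable.pred M P \<Longrightarrow> (\<lambda>x. of_bool (P x) :: ennreal) \<in> borel_measurable M"
  by measurable

text \<open>The expectation of \<open>defect_zero\<close>, applied to the functionals that vanish on
  \<open>F\<close>. All sets \<open>B\<close> contribute equally by exchangeability, and in each
  contribution the test in \<open>A'\<close> splits off as a factor, because it ignores a coordinate
  \<open>t\<close> of \<open>A\<close>.\<close>

lemma face_prob_step:
  fixes A A' :: "'n::finite set"
  assumes I: "finite I" and F: "F \<subseteq> I" "F \<noteq> {}" and A: "A' \<subseteq> A" "card A = card A' + 2" and K: "card F < card A"
  shows "2 * face_prob A F I = 2 * face_prob A' F I
     + real ((card I - card F) choose (card A - card F)) * facet_mass CARD('n) (card A) (card I - card A) * cone_miss A' (card F) (card A)"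
proof -
  let ?m = "card A" and ?S = "I - F"
  let ?q = "facet_mass CARD('n) ?m (card I - ?m)" and ?j = "cone_miss A' (card F) ?m"
  have finF: "finite F" using F I finite_subset by auto
  obtain t where t: "t \<in> A" "t \<notin> A'" using A by (metis add_2_eq_Suc' nat_neq_iff card_mono finite leD le_refl less_Suc_eq psubsetI subsetI subset_antisym)
  define Bs where "Bs = {B. B \<subseteq> ?S \<and> card B = ?m - card F}"
  have Bs: "B \<subseteq> ?S" "finite B" "card (F \<union> B) = ?m" "F \<union> B \<subseteq> I" "F \<union> B - F = B" "I - (F \<union> B) = ?S - B" "F \<union> B = I \<longleftrightarrow> B = ?S"
    if "B \<in> Bs" for B
  proof -
    show 1: "B \<subseteq> ?S" and 2: "finite B" using that I finite_subset unfolding Bs_def by auto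
    have "F \<inter> B = {}" using 1 by auto
    thus "card (F \<union> B) = ?m" using card_Un_disjoint[OF finF 2] that K unfolding Bs_def by simp
    show "F \<union> B \<subseteq> I" "F \<union> B - F = B" "I - (F \<union> B) = ?S - B" "F \<union> B = I \<longleftrightarrow> B = ?S" using 1 F by auto
  qed
  have finBs: "finite Bs" unfolding Bs_def using I by simp
  let ?p = "\<lambda>X. pos_sol (affs A) (hats X) F ?S" and ?p' = "\<lambda>X. pos_sol (affs A') (hats X) F ?S"
  let ?c = "\<lambda>X B. of_bool (pos_sol (affs A) (hats X) (F \<union> B) (I - (F \<union> B))) + of_bool (F \<union> B = I) :: ennreal"
  let ?n = "\<lambda>X B. \<not> pos_sol (affs A') (hats X) F B"
  have "AE X in ballM I. 2 * of_bool (?p X) = 2 * of_bool (?p' X) + (\<Sum>B\<in>Bs. of_bool (?n X B) * ?c X B)"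
    using AE_generic[OF I]
  proof eventually_elim
    case (elim X)
    define r where "r = ?m - 1 - card F"
    have r: "?m + 1 - card F = r + 2" "card A' + 1 - card F = r" "?m - card F = r + 1" unfolding r_def using K A(2) by auto
    have SF: "?S \<union> F = I" "?S \<inter> F = {}" using F by auto
    have g: "generic (affs A) (hats X) (?S \<union> F) (?m + 1)" "generic (affs A') (hats X) (?S \<union> F) (card A' + 1)"
      unfolding SF using elim by auto
    have fS: "finite ?S" using I by simp
    have "defect (kern (affs A) (hats X) F) (kern (affs A') (hats X) F) (hats X) ?S (r + 1) = 0"
    proof (rule defect_zero[OF fS subspace_kern[OF subspace_affs] subspace_kern[OF subspace_affs] kern_mono[OF affs_mono[OF A(1)]]])
      show "generic (kern (affs A) (hats X) F) (hats X) ?S (r + 2)"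
        using generic_kern[OF g(1) finF fS SF(2)] K r(1) by simp
      show "generic (kern (affs A') (hats X) F) (hats X) ?S r"
        using generic_kern[OF g(2) finF fS SF(2)] K A(2) r(2) by simp
    qed
    hence "2 * of_bool (?p X) = 2 * of_bool (?p' X) + facet_count (kern (affs A) (hats X) F) (kern (affs A') (hats X) F) (hats X) ?S (r + 1)"
      unfolding defect_def pos_sol_kern' by simp
    also have "facet_count (kern (affs A) (hats X) F) (kern (affs A') (hats X) F) (hats X) ?S (r + 1)
      = (\<Sum>B\<in>Bs. of_bool (?n X B) * (of_bool (pos_sol (affs A) (hats X) (F \<union> B) (I - (F \<union> B))) + of_bool (F \<union> B = I)))"
      unfolding facet_count_def pos_sol_kern' pos_sol_kern r(3)[symmetric] Bs_def[symmetric]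
      by (intro sum.cong refl) (simp add: Bs)
    \<comment> \<open>Written without subtraction, the identity is one between natural numbers, and
      as such it can be transported from the integers to \<open>ennreal\<close>.\<close>
    finally have "int (2 * of_bool (?p X)) = int (2 * of_bool (?p' X) + (\<Sum>B\<in>Bs. of_bool (?n X B) * (of_bool (pos_sol (affs A) (hats X) (F \<union> B) (I - (F \<union> B))) + of_bool (F \<union> B = I))))"
      by (simp add: of_nat_sum)
    hence "(of_nat (2 * of_bool (?p X)) :: ennreal) = of_nat (2 * of_bool (?p' X) + (\<Sum>B\<in>Bs. of_bool (?n X B) * (of_bool (pos_sol (affs A) (hats X) (F \<union> B) (I - (F \<union> B))) + of_bool (F \<union> B = I))))"
      by (simp only: of_nat_eq_iff)
    thus ?case by (simp only: of_nat_add of_nat_mult of_nat_sum of_nat_of_bool of_nat_numeral)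
  qed
  hence eqn: "(\<integral>\<^sup>+X. 2 * of_bool (?p X) \<partial>ballM I) = (\<integral>\<^sup>+X. 2 * of_bool (?p' X) + (\<Sum>B\<in>Bs. of_bool (?n X B) * ?c X B) \<partial>ballM I)"
    by (rule nn_integral_cong_AE)
  have pm: "Measurable.pred (ballM I) (\<lambda>X. pos_sol (affs C) (hats X :: nat \<Rightarrow> (real^'n) \<times> real) F' S')" if "F' \<subseteq> I" "S' \<subseteq> I" for C F' S'
    using that I finite_subset by (intro pos_sol_hat_measurable) auto
  have pm1: "(\<lambda>X. of_bool (pos_sol (affs C) (hats X :: nat \<Rightarrow> (real^'n) \<times> real) F' S') :: ennreal) \<in> borel_measurable (ballM I)" if "F' \<subseteq> I" "S' \<subseteq> I" for C F' S'
    by (rule pred_of_bool_measurable[OF pm[OF that]])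
  have cm: "(\<lambda>X. of_bool (?n X B) * ?c X B) \<in> borel_measurable (ballM I)" if B: "B \<in> Bs" for B
  proof (intro borel_measurable_times_ennreal borel_measurable_add pm1 borel_measurable_const)
    show "(\<lambda>X. of_bool (?n X B) :: ennreal) \<in> borel_measurable (ballM I)"
      using Bs(1)[OF B] F(1) by (intro pred_of_bool_measurable pred_intros_logic pm) auto
  qed (use Bs(4)[OF B] in auto)
  have lhs: "(\<integral>\<^sup>+X. 2 * of_bool (?p X) \<partial>ballM I) = ennreal (2 * face_prob A F I)"
    using nn_integral_cmult[OF pm1[of F ?S A], of 2] F nn_integral_face_prob[OF I F(1), of A] face_prob_nonneg[of A F I]
    by (simp add: ennreal_mult')
  have fct: "(\<integral>\<^sup>+X. of_bool (?n X B) * ?c X B \<partial>ballM I) = ennreal (?q * ?j)" if B: "B \<in> Bs" for B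
  proof -
    have "(\<integral>\<^sup>+X. of_bool (?n X B) * ?c X B \<partial>ballM I)
      = ennreal ?q * emeasure (ballM (F \<union> B)) {X \<in> space (ballM (F \<union> B)). ?n X B}"
    proof (rule nn_integral_facet[OF I Bs(4)[OF B] _ t(1) Bs(3)[OF B]])
      show "F \<union> B \<noteq> {}" using F by auto
      show "Measurable.pred (ballM (F \<union> B)) (\<lambda>X. ?n X B)"
        using finF Bs(2)[OF B] by (intro pred_intros_logic pos_sol_hat_measurable) auto
      fix X Y :: "nat \<Rightarrow> real^'n" assume XY: "\<And>i j. i \<in> F \<union> B \<Longrightarrow> j \<noteq> t \<Longrightarrow> X i $ j = Y i $ j"
      have "pos_sol (affs A') (hats X) F B = pos_sol (affs A') (hats Y) F B"
      proof (rule pos_sol_affs_cong)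
        fix i j assume ij: "i \<in> F \<union> B" "j \<in> A'"
        show "X i $ j = Y i $ j" using t(2) ij(2) by (intro XY[OF ij(1)]) auto
      qed
      thus "?n X B = ?n Y B" by simp
    next
      fix X :: "nat \<Rightarrow> real^'n" and c r assume "r > (0::real)"
      thus "?n (\<lambda>i. c + r *\<^sub>R X i) B = ?n X B" using pos_sol_affs_homothety[of r A' c X F B] by simp
    qed
    also have "emeasure (ballM (F \<union> B)) {X \<in> space (ballM (F \<union> B)). ?n X B} = ennreal ?j"
      using emeasure_cone_miss[of "F \<union> B" F A'] finF Bs[OF B] by simp
    also have "ennreal ?q * ennreal ?j = ennreal (?q * ?j)" by (rule ennreal_mult[symmetric, OF facet_mass_nonneg cone_miss_nonneg])
    finally show ?thesis .
  qed
  have "(\<integral>\<^sup>+X. 2 * of_bool (?p' X) + (\<Sum>B\<in>Bs. of_bool (?n X B) * ?c X B) \<partial>ballM I)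
    = (\<integral>\<^sup>+X. 2 * of_bool (?p' X) \<partial>ballM I) + (\<integral>\<^sup>+X. (\<Sum>B\<in>Bs. of_bool (?n X B) * ?c X B) \<partial>ballM I)"
    using F by (intro nn_integral_add borel_measurable_times_ennreal borel_measurable_const pm1 borel_measurable_sum cm) auto
  also have "(\<integral>\<^sup>+X. 2 * of_bool (?p' X) \<partial>ballM I) = ennreal (2 * face_prob A' F I)"
    using nn_integral_cmult[OF pm1[of F ?S A'], of 2] F nn_integral_face_prob[OF I F(1), of A'] face_prob_nonneg[of A' F I]
    by (simp add: ennreal_mult')
  also have "(\<integral>\<^sup>+X. (\<Sum>B\<in>Bs. of_bool (?n X B) * ?c X B) \<partial>ballM I) = (\<Sum>B\<in>Bs. ennreal (?q * ?j))"
    by (subst nn_integral_sum) (auto simp: cm fct intro!: sum.cong)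
  also have "\<dots> = ennreal (real (card Bs) * (?q * ?j))"
    by (simp add: ennreal_mult' ennreal_of_nat_eq_real_of_nat)
  also have "card Bs = ((card I - card F) choose (?m - card F))"
    unfolding Bs_def using n_subsets[of ?S] I card_Diff_subset[OF finF F(1)] by simp
  also have "ennreal (2 * face_prob A' F I) + ennreal (real ((card I - card F) choose (?m - card F)) * (?q * ?j))
    = ennreal (2 * face_prob A' F I + real ((card I - card F) choose (?m - card F)) * (?q * ?j))"
    by (rule ennreal_plus[symmetric]; intro mult_nonneg_nonneg face_prob_nonneg facet_mass_nonneg cone_miss_nonneg; simp)
  finally have rhs: "(\<integral>\<^sup>+X. 2 * of_bool (?p' X) + (\<Sum>B\<in>Bs. of_bool (?n X B) * ?c X B) \<partial>ballM I)
    = ennreal (2 * face_prob A' F I + real ((card I - card F) choose (?m - card F)) * (?q * ?j))" .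
  have "2 * face_prob A F I = 2 * face_prob A' F I + real ((card I - card F) choose (?m - card F)) * (?q * ?j)"
    using eqn[unfolded lhs rhs] face_prob_nonneg[of A F I] face_prob_nonneg[of A' F I]
      facet_mass_nonneg[of "CARD('n)" ?m "card I - ?m"] cone_miss_nonneg[of A' "card F" ?m]
    by (subst (asm) ennreal_inj) auto
  thus ?thesis by (simp only: mult.assoc)
qed

text \<open>In general position \<open>card A + 1\<close> points leave only the zero functional,
  which is not positive at any further point.\<close>

lemma face_prob_bottom_empty:
  fixes A :: "'n::finite set"
  assumes I: "finite I" and F: "F \<subseteq> I" "F \<noteq> I" and K: "card F = card A + 1"
  shows "face_prob A F I = 0"
proof -
  have "AE X in ballM I. of_bool (pos_sol (affs A) (hats X) F (I - F)) = (0 :: ennreal)"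
    using AE_kern_trivial[OF I F(1) K]
  proof eventually_elim
    case (elim X)
    have "\<not> pos_sol (affs A) (hats X) F (I - F)"
    proof
      assume "pos_sol (affs A) (hats X) F (I - F)"
      then obtain u where u: "u \<in> affs A" "\<forall>i\<in>F. u \<bullet> hat (X i) = 0" "\<forall>i\<in>I - F. u \<bullet> hat (X i) > 0" unfolding pos_sol_def by blast
      hence "u = 0" using elim unfolding kern_def by blast
      thus False using u(3) F by auto
    qed
    thus ?case by simp
  qed
  from nn_integral_cong_AE[OF this] have "ennreal (face_prob A F I) = 0"
    unfolding nn_integral_face_prob[OF I F(1)] by simp
  thus ?thesis using face_prob_nonneg[of A F I] by (simp add: ennreal_eq_0_iff)
qed

text \<open>\<open>F\<close> itself determines the hyperplane, so no test remains and
  \<open>Q\<close> is trivial.\<close>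

lemma face_prob_bottom:
  fixes A :: "'n::finite set"
  assumes I: "finite I" and F: "F \<subseteq> I" "F \<noteq> I" "F \<noteq> {}" and K: "card F = card A"
  shows "face_prob A F I = facet_mass CARD('n) (card A) (card I - card A)"
proof -
  have finF: "finite F" using F I finite_subset by auto
  obtain t where t: "t \<in> A" using K F(3) finF by fastforce
  have "(\<integral>\<^sup>+X. of_bool True * (of_bool (pos_sol (affs A) (hats X) F (I - F)) + of_bool (F = I)) \<partial>ballM I)
     = ennreal (facet_mass CARD('n) (card A) (card I - card A)) * emeasure (ballM F) {X \<in> space (ballM F :: (nat \<Rightarrow> real^'n) measure). True}"
    by (rule nn_integral_facet[OF I F(1,3) t K]) auto
  moreover have "emeasure (ballM F :: (nat \<Rightarrow> real^'n) measure) (space (ballM F)) = 1"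
    by (rule prob_space.emeasure_space_1[OF prob_space_ballM])
  ultimately have "ennreal (face_prob A F I) = ennreal (facet_mass CARD('n) (card A) (card I - card A))"
    using F(2) nn_integral_face_prob[OF I F(1), of A] by simp
  thus ?thesis using face_prob_nonneg[of A F I] facet_mass_nonneg by (simp add: ennreal_inj)
qed

text \<open>At most \<open>CARD('n) + 1\<close> points in general position are the vertices of a
  simplex, whose vertex sets all span faces.\<close>

lemma face_prob_few_points:
  fixes F I :: "nat set"
  assumes I: "finite I" and F: "F \<subseteq> I" and n: "card I \<le> CARD('n::finite) + 1"
  shows "face_prob (UNIV :: 'n set) F I = 1"
proof -
  have finF: "finite F" using F I finite_subset by auto
  have "AE X in ballM I. of_bool (pos_sol (affs (UNIV :: 'n set)) (hats X) F (I - F)) = (1 :: ennreal)"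
    using AE_generic[OF I]
  proof eventually_elim
    case (elim X)
    have SF: "(I - F) \<union> F = I" "(I - F) \<inter> F = {}" using F by auto
    have g: "generic (affs UNIV) (hats X) ((I - F) \<union> F) (CARD('n) + 1)" unfolding SF by (rule elim[rule_format, of UNIV])
    have cF: "card F \<le> card I" by (rule card_mono[OF I F])
    have "pos_sol (kern (affs UNIV) (hats X) F) (hats X) {} (I - F)"
    proof (rule generic_pos_sol[OF subspace_kern[OF subspace_affs]])
      show "generic (kern (affs UNIV) (hats X) F) (hats X) (I - F) (CARD('n) + 1 - card F)"
        using generic_kern[OF g finF _ SF(2)] I cF n by simp
      show "card (I - F) \<le> CARD('n) + 1 - card F" using card_Diff_subset[OF finF F] n by simp
    qed (use I in simp)
    thus ?case unfolding pos_sol_kern' by simp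
  qed
  moreover have "emeasure (ballM I :: (nat \<Rightarrow> real^'n) measure) (space (ballM I)) = 1"
    by (rule prob_space.emeasure_space_1[OF prob_space_ballM])
  ultimately have "ennreal (face_prob (UNIV :: 'n set) F I) = 1"
    using nn_integral_cong_AE nn_integral_face_prob[OF I F, of "UNIV :: 'n set"] by fastforce
  thus ?thesis by (simp add: ennreal_eq_1)
qed

section \<open>The triangular system\<close>

text \<open>A flag of coordinate sets, along which the recursion of \<open>face_prob_step\<close>
  descends.\<close>

lemma ex_subset_chain:
  obtains A :: "nat \<Rightarrow> 'n::finite set" where "\<And>m. m \<le> CARD('n) \<Longrightarrow> card (A m) = m" "\<And>l m. l \<le> m \<Longrightarrow> A l \<subseteq> A m" "A CARD('n) = UNIV"
proof -
  obtain h where h: "bij_betw h {0..<CARD('n)} (UNIV :: 'n set)" using ex_bij_betw_nat_finite[of "UNIV :: 'n set"] by auto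
  show thesis
  proof (rule that[of "\<lambda>m. h ` {0..<m}"])
    fix m assume "m \<le> CARD('n)"
    hence "inj_on h {0..<m}" using h by (auto simp: bij_betw_def intro: inj_on_subset)
    thus "card (h ` {0..<m}) = m" by (simp add: card_image)
  qed (use h in \<open>auto simp: bij_betw_def\<close>)
qed

text \<open>The value \<open>2\<close> at \<open>l = K\<close> accounts for the end of the chain, where \<open>F\<close> itself spans the hyperplane
  and the facet term is not halved.\<close>

definition chain_miss :: "(nat \<Rightarrow> 'n::finite set) \<Rightarrow> nat \<Rightarrow> nat \<Rightarrow> real" where
  "chain_miss A K l = (if l = K then 2 else cone_miss (A (l - 2)) K l)"

text \<open>Descending in steps of two, the recursion ends either at \<open>m = card F\<close>,
  where \<open>F\<close> alone determines the hyperplane, or at \<open>m + 1 = card F\<close>, where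
  the probability is 0.\<close>

lemma face_prob_chain:
  fixes A :: "nat \<Rightarrow> 'n::finite set"
  assumes A: "\<And>m. m \<le> CARD('n) \<Longrightarrow> card (A m) = m" "\<And>l m. l \<le> m \<Longrightarrow> A l \<subseteq> A m"
    and I: "finite I" and F: "F \<subseteq> I" "F \<noteq> I" "F \<noteq> {}" and m: "m \<le> CARD('n)" "card F \<le> m + 1"
  shows "2 * face_prob (A m) F I = (\<Sum>l | l \<in> {card F..m} \<and> even (l + m).
    real ((card I - card F) choose (l - card F)) * facet_mass CARD('n) l (card I - l) * chain_miss A (card F) l)"
  using m
proof (induction m rule: less_induct)
  case (less m)
  let ?K = "card F"
  have K0: "?K > 0" using F I finite_subset[of F I] by (simp add: card_gt_0_iff)
  consider "?K = m + 1" | "?K = m" | "?K < m" using less.prems(2) by linarith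
  thus ?case
  proof cases
    case 1
    hence "{l. l \<in> {?K..m} \<and> even (l + m)} = {}" by auto
    thus ?thesis using face_prob_bottom_empty[OF I F(1,2), of "A m"] 1 A(1)[OF less.prems(1)] by simp
  next
    case 2
    hence "{l. l \<in> {?K..m} \<and> even (l + m)} = {m}" by auto
    thus ?thesis using face_prob_bottom[OF I F, of "A m"] 2 A(1)[OF less.prems(1)] by (simp add: chain_miss_def)
  next
    case 3
    hence m2: "m \<ge> 2" "?K \<le> m - 2 + 1" "m - 2 < m" using K0 by auto
    have "2 * face_prob (A m) F I = 2 * face_prob (A (m - 2)) F I
      + real ((card I - ?K) choose (m - ?K)) * facet_mass CARD('n) m (card I - m) * cone_miss (A (m - 2)) ?K m"
      using face_prob_step[OF I F(1,3) A(2)[of "m - 2" m]] A(1)[of m] A(1)[of "m - 2"] less.prems(1) m2 3 by simp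
    also have "2 * face_prob (A (m - 2)) F I = (\<Sum>l | l \<in> {?K..m - 2} \<and> even (l + (m - 2)).
      real ((card I - ?K) choose (l - ?K)) * facet_mass CARD('n) l (card I - l) * chain_miss A ?K l)"
      using less.prems(1) m2 by (intro less.IH) auto
    also have "cone_miss (A (m - 2)) ?K m = chain_miss A ?K m" using 3 by (simp add: chain_miss_def)
    finally have "2 * face_prob (A m) F I = (\<Sum>l\<in>insert m {l. l \<in> {?K..m - 2} \<and> even (l + (m - 2))}.
      real ((card I - ?K) choose (l - ?K)) * facet_mass CARD('n) l (card I - l) * chain_miss A ?K l)"
      using m2 by (subst sum.insert) auto
    moreover have "{l. l \<in> {?K..m} \<and> even (l + m)} = insert m {l. l \<in> {?K..m - 2} \<and> even (l + (m - 2))}"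
    proof (intro equalityI subsetI)
      fix l assume l: "l \<in> {l. l \<in> {?K..m} \<and> even (l + m)}"
      hence "l \<noteq> m - 1" using m2 by (auto simp: even_diff_nat)
      thus "l \<in> insert m {l. l \<in> {?K..m - 2} \<and> even (l + (m - 2))}" using l m2(1) by (auto simp: even_diff_nat)
    qed (use m2 3 in \<open>auto simp: even_diff_nat\<close>)
    ultimately show ?thesis by simp
  qed
qed

lemma sin_moment_0: "sin_moment d a 0 = wallis a"
  unfolding sin_moment_def wallis_def by simp

lemma facet_mass_0: "facet_mass d m 0 = 2"
  unfolding facet_mass_def sin_moment_0 using wallis_pos[of "d * m"] by simp

text \<open>Read off from \<open>residue_identity\<close> with \<open>e = d * K\<close>,
  \<open>N = n - K\<close> and \<open>i = l - K\<close>: the factor left after the binomial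
  coefficient and \<open>facet_mass d l (n - l)\<close> have been split off. It is free of
  \<open>n\<close> because the powers of \<open>wallis d\<close> divide as
  \<open>n - K = (n - l) + (l - K)\<close>.\<close>

definition res_coeff :: "nat \<Rightarrow> nat \<Rightarrow> nat \<Rightarrow> complex" where
  "res_coeff d K l = of_real ((real d * real l + 1) * wallis (d * l) / wallis d ^ (l - K)) * sin_residue d (l - K) (d * l + 2)"

text \<open>The residue identity sums over all \<open>l\<close>; under the parity assumption the
  summands with \<open>l + d\<close> odd contain an even function and vanish, which leaves exactly
  the indices of the chain. For \<open>n > K\<close> the right-hand side is 2.\<close>

lemma res_coeff_sum:
  assumes par: "odd d \<or> odd K" and n: "K \<le> n"
  shows "(\<Sum>l | l \<in> {K..n} \<and> even (l + d). of_real (real ((n - K) choose (l - K)) * facet_mass d l (n - l)) * res_coeff d K l)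
     = 2 * (1 - (-1) ^ (d * K) * 0 ^ (n - K))"
proof -
  let ?w = "wallis d"
  have w: "complex_of_real ?w \<noteq> 0" using wallis_pos[of d] by simp
  let ?t = "\<lambda>l. of_real (real ((n - K) choose (l - K)) * facet_mass d l (n - l)) * res_coeff d K l"
  let ?u = "\<lambda>i. of_nat ((n - K) choose i) * of_nat (d * K + d * i + 1) * complex_of_real (sin_moment d (d * K + d * i) (n - K - i)) * sin_residue d i (d * K + d * i + 2)"
  have z: "?t l = 0" if l: "l \<in> {K..n}" "odd (l + d)" for l
  proof -
    have "even ((d + 1) * (l - K) + (d * l + 2))" using par l by (auto simp: even_diff_nat)
    thus ?thesis unfolding res_coeff_def using sin_residue_even_zero by simp
  qed
  have "(\<Sum>l | l \<in> {K..n} \<and> even (l + d). ?t l) = (\<Sum>l\<in>{K..n}. ?t l)"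
    by (rule sum.mono_neutral_left) (use z in auto)
  also have "\<dots> = (\<Sum>i\<le>n - K. ?t (K + i))"
    by (rule sum.reindex_bij_witness[of _ "\<lambda>i. K + i" "\<lambda>l. l - K"]) (use n in auto)
  also have "\<dots> = (\<Sum>i\<le>n - K. 2 / of_real ?w ^ (n - K) * ?u i)"
  proof (rule sum.cong[OF refl])
    fix i assume i: "i \<in> {..n - K}"
    have e: "d * (K + i) = d * K + d * i" "K + i - K = i" "n - (K + i) = n - K - i" by (simp_all add: distrib_left)
    have pw: "of_real ?w ^ (n - K) = of_real ?w ^ (n - K - i) * complex_of_real ?w ^ i"
    proof -
      have "n - K = (n - K - i) + i" using i by simp
      thus ?thesis by (metis power_add)
    qed
    have W: "complex_of_real (wallis (d * K + d * i)) \<noteq> 0" using wallis_pos[of "d * K + d * i"] by simp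
    have "real d * real (K + i) + 1 = real (d * K + d * i + 1)" by (simp add: distrib_left)
    thus "?t (K + i) = 2 / of_real ?w ^ (n - K) * ?u i"
      unfolding res_coeff_def facet_mass_def e pw using w W by (simp add: field_simps)
  qed
  also have "\<dots> = 2 / of_real ?w ^ (n - K) * (complex_of_real (sin_int d pi ^ (n - K)) - (-1) ^ (d * K) * 0 ^ (n - K))"
    unfolding sum_distrib_left[symmetric] residue_identity ..
  also have "\<dots> = 2 * (1 - (-1) ^ (d * K) * 0 ^ (n - K))"
    using w by (cases "n - K = 0") (simp_all add: sin_int_pi power_0_left field_simps)
  finally show ?thesis .
qed

text \<open>The linear system is triangular in the unknowns \<open>j l\<close>, so it has only one solution.\<close>

lemma res_coeff_unique:
  fixes j :: "nat \<Rightarrow> real"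
  assumes par: "odd d \<or> (even d \<and> odd K)"
    and sys: "\<And>n. K < n \<Longrightarrow> n \<le> d \<Longrightarrow> even (n + d) \<Longrightarrow>
      (\<Sum>l | l \<in> {K..d} \<and> even (l + d). real ((n - K) choose (l - K)) * facet_mass d l (n - l) * j l) = 2"
    and jK: "j K = 2"
    and l: "K \<le> l" "l \<le> d" "even (l + d)"
  shows "complex_of_real (j l) = res_coeff d K l"
  using l
proof (induction l rule: less_induct)
  case (less n)
  have par': "odd d \<or> odd K" using par by auto
  let ?c = "\<lambda>l. real ((n - K) choose (l - K)) * facet_mass d l (n - l)"
  let ?L = "{l. l \<in> {K..<n} \<and> even (l + d)}"
  have split: "{l. l \<in> {K..n} \<and> even (l + d)} = insert n ?L" using less.prems by auto
  have R: "(\<Sum>l\<in>insert n ?L. of_real (?c l) * res_coeff d K l) = 2 * (1 - (-1) ^ (d * K) * 0 ^ (n - K))"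
    using res_coeff_sum[OF par' less.prems(1)] unfolding split .
  show ?case
  proof (cases "n = K")
    case True
    \<comment> \<open>Then the right-hand side is 4 and the diagonal coefficient is 2, in accordance
      with \<open>j K = 2\<close>. For even \<open>d\<close> this case cannot occur, since
      \<open>K\<close> would be odd while \<open>n + d\<close> is even.\<close>
    hence "odd (d * K)" using par less.prems by auto
    moreover have "?L = {}" using True by auto
    ultimately show ?thesis using R True jK by (simp add: facet_mass_0)
  next
    case False
    hence Kn: "K < n" using less.prems by simp
    have "(\<Sum>l\<in>insert n ?L. ?c l * j l) = (\<Sum>l | l \<in> {K..d} \<and> even (l + d). ?c l * j l)"
    proof (rule sum.mono_neutral_left)
      show "insert n ?L \<subseteq> {l. l \<in> {K..d} \<and> even (l + d)}" using less.prems by auto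
      show "\<forall>l\<in>{l. l \<in> {K..d} \<and> even (l + d)} - insert n ?L. ?c l * j l = 0"
      proof
        fix l assume "l \<in> {l. l \<in> {K..d} \<and> even (l + d)} - insert n ?L"
        \<comment> \<open>Beyond \<open>n\<close> the difference \<open>n - l\<close> is truncated
          to 0, but the binomial coefficient vanishes; this makes the system triangular.\<close>
        hence "n - K < l - K" using Kn by (auto simp: diff_less_mono)
        thus "?c l * j l = 0" by (simp add: binomial_eq_0)
      qed
    qed simp
    also have "\<dots> = 2" by (rule sys[OF Kn less.prems(2,3)])
    finally have "complex_of_real (\<Sum>l\<in>insert n ?L. ?c l * j l) = (\<Sum>l\<in>insert n ?L. of_real (?c l) * res_coeff d K l)"
      unfolding R using Kn by simp
    hence "of_real (?c n * j n) + (\<Sum>l\<in>?L. of_real (?c l * j l)) = of_real (?c n) * res_coeff d K n + (\<Sum>l\<in>?L. of_real (?c l) * res_coeff d K l)"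
      by simp
    moreover have "(\<Sum>l\<in>?L. of_real (?c l * j l)) = (\<Sum>l\<in>?L. of_real (?c l) * res_coeff d K l)"
    proof (rule sum.cong[OF refl])
      fix l assume "l \<in> ?L"
      hence "complex_of_real (j l) = res_coeff d K l" using less.prems by (intro less.IH) auto
      thus "of_real (?c l * j l) = of_real (?c l) * res_coeff d K l" by simp
    qed
    ultimately have "complex_of_real (?c n) * of_real (j n) = of_real (?c n) * res_coeff d K n" by simp
    \<comment> \<open>The diagonal coefficient is \<open>facet_mass d n 0 = 2\<close>.\<close>
    moreover have "complex_of_real (?c n) \<noteq> 0" by (simp add: facet_mass_0)
    ultimately show ?thesis by (simp only: mult_cancel_left) simp
  qed
qed

section \<open>Expected face numbers as sums of face probabilities\<close>

lemma expected_faces_eq_sum: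
  assumes k: "k < CARD('n::finite)"
  shows "expected_faces TYPE(real^'n) k n = (\<Sum>F | F \<subseteq> {..<n} \<and> card F = k + 1. face_prob (UNIV :: 'n set) F {..<n})"
proof -
  let ?M = "ballM {..<n} :: (nat \<Rightarrow> real^'n) measure"
  let ?Fs = "{F. F \<subseteq> {..<n} \<and> card F = k + 1}"
  let ?ps = "\<lambda>(X :: nat \<Rightarrow> real^'n) F. pos_sol (affs UNIV) (hats X) F ({..<n} - F)"
  have fin: "finite ?Fs" by simp
  have pm: "Measurable.pred ?M (\<lambda>X. ?ps X F)" if "F \<in> ?Fs" for F
    using that finite_subset[of F "{..<n}"] by (intro pos_sol_hat_measurable) auto
  have ind: "(\<lambda>X. of_bool (?ps X F) :: real) \<in> borel_measurable ?M" if "F \<in> ?Fs" for F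
    using pm[OF that] by measurable
  have int: "integrable ?M (\<lambda>X. of_bool (?ps X F) :: real)" if "F \<in> ?Fs" for F
    by (rule finite_measure.integrable_const_bound[OF prob_space.finite_measure[OF prob_space_ballM], where B = 1])
       (use ind[OF that] in auto)
  have val: "(\<integral>X. of_bool (?ps X F) \<partial>?M) = face_prob (UNIV :: 'n set) F {..<n}" if F: "F \<in> ?Fs" for F
  proof -
    have "ennreal (\<integral>X. of_bool (?ps X F) \<partial>?M) = (\<integral>\<^sup>+X. ennreal (of_bool (?ps X F)) \<partial>?M)"
      by (rule nn_integral_eq_integral[symmetric, OF int[OF F]]) auto
    also have "\<dots> = (\<integral>\<^sup>+X. of_bool (?ps X F) \<partial>?M)" by (intro nn_integral_cong) simp
    also have "\<dots> = ennreal (face_prob (UNIV :: 'n set) F {..<n})" using F by (intro nn_integral_face_prob) auto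
    finally show ?thesis by (subst (asm) ennreal_inj) (auto intro!: integral_nonneg_AE face_prob_nonneg)
  qed
  have "expected_faces TYPE(real^'n) k n = (\<integral>X. (\<Sum>F\<in>?Fs. of_bool (?ps X F)) \<partial>?M)"
    unfolding expected_faces_def
  proof (rule integral_cong_AE)
    show "(\<lambda>X. real (num_faces k (convex hull (X ` {..<n})))) \<in> borel_measurable ?M" by (rule num_faces_measurable)
    show "(\<lambda>X. \<Sum>F\<in>?Fs. of_bool (?ps X F) :: real) \<in> borel_measurable ?M" by (rule borel_measurable_sum[OF ind])
    show "AE X in ?M. real (num_faces k (convex hull (X ` {..<n}))) = (\<Sum>F\<in>?Fs. of_bool (?ps X F))"
      using AE_generic[OF finite_lessThan]
    proof eventually_elim
      case (elim X)
      have "?Fs \<inter> {F. ?ps X F} = {F. F \<subseteq> {..<n} \<and> card F = k + 1 \<and> ?ps X F}" by auto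
      thus ?case using num_faces_generic[OF elim[rule_format, of UNIV] k] fin by (simp add: sum_of_bool_eq)
    qed
  qed
  also have "\<dots> = (\<Sum>F\<in>?Fs. \<integral>X. of_bool (?ps X F) \<partial>?M)" by (rule Bochner_Integration.integral_sum[OF int])
  also have "\<dots> = (\<Sum>F\<in>?Fs. face_prob (UNIV :: 'n set) F {..<n})" by (rule sum.cong[OF refl val])
  finally show ?thesis .
qed

section \<open>Asymptotics of the expected number of faces\<close>

lemma binomial_over_power_limit: "(\<lambda>n. real (n choose l) / real n ^ l) \<longlonglongrightarrow> 1 / fact l"
proof -
  have "(\<lambda>n. (\<Prod>i = 0..<l. 1 - real i * (1 / real n)) / fact l) \<longlonglongrightarrow> (\<Prod>i = 0..<l. 1 - real i * 0) / fact l"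
    by (intro tendsto_intros lim_1_over_n) simp
  moreover have "\<forall>\<^sub>F n in sequentially. (\<Prod>i = 0..<l. 1 - real i * (1 / real n)) / fact l = real (n choose l) / real n ^ l"
    using eventually_gt_at_top[of 0]
  proof eventually_elim
    case (elim n)
    have "real (n choose l) = (\<Prod>i = 0..<l. real n - real i) / fact l"
      unfolding binomial_gbinomial gbinomial_prod_rev ..
    also have "(\<Prod>i = 0..<l. real n - real i) = (\<Prod>i = 0..<l. real n * (1 - real i * (1 / real n)))"
      using elim by (intro prod.cong refl) (simp add: field_simps)
    also have "\<dots> = real n ^ l * (\<Prod>i = 0..<l. 1 - real i * (1 / real n))"
      by (simp add: prod.distrib)
    finally show ?case using elim by simp
  qed
  ultimately show ?thesis by (simp add: tendsto_cong)
qed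

text \<open>The binomial coefficient grows like \<open>n ^ l\<close> and Laplace's method gives the
  decay \<open>n powr (- \<alpha>)\<close>; the exponent that remains is
  \<open>l - \<alpha> = (l - 1) / (d + 1)\<close>.\<close>

lemma facet_number_limit:
  fixes d l :: nat
  defines "\<alpha> \<equiv> (real d * real l + 1) / (real d + 1)"
  shows "(\<lambda>n. real (n choose l) * (sin_moment d (d * l) (n - l) / wallis d ^ (n - l)) / real n powr ((real l - 1) / (real d + 1)))
    \<longlonglongrightarrow> 1 / fact l * (Gamma \<alpha> / (real d + 1) * (wallis d * (real d + 1)) powr \<alpha>)"
proof -
  let ?W = "\<lambda>N. sin_moment d (d * l) N / wallis d ^ N"
  let ?G = "Gamma \<alpha> / (real d + 1) * (wallis d * (real d + 1)) powr \<alpha>"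
  have "(\<lambda>N. real N powr \<alpha> * ?W N) \<longlonglongrightarrow> ?G"
    using laplace_sin_int[of "d * l" d] unfolding \<alpha>_def by simp
  moreover have "filterlim (\<lambda>n. n - l) at_top sequentially" by (rule filterlim_minus_const_nat_at_top)
  ultimately have 1: "(\<lambda>n. real (n - l) powr \<alpha> * ?W (n - l)) \<longlonglongrightarrow> ?G"
    by (rule filterlim_compose)
  \<comment> \<open>Compensates for the power of \<open>n - l\<close> that stands in place of a
    power of \<open>n\<close>.\<close>
  have 2: "(\<lambda>n. (1 - real l * (1 / real n)) powr (- \<alpha>)) \<longlonglongrightarrow> 1"
  proof -
    have "(\<lambda>n. (1 - real l * (1 / real n)) powr (- \<alpha>)) \<longlonglongrightarrow> (1 - real l * 0) powr (- \<alpha>)"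
      by (intro tendsto_intros lim_1_over_n) auto
    thus ?thesis by simp
  qed
  have "(\<lambda>n. real (n choose l) / real n ^ l * ((1 - real l * (1 / real n)) powr (- \<alpha>) * (real (n - l) powr \<alpha> * ?W (n - l)))) \<longlonglongrightarrow> 1 / fact l * (1 * ?G)"
    by (intro tendsto_mult binomial_over_power_limit 1 2)
  moreover have "\<forall>\<^sub>F n in sequentially. real (n choose l) / real n ^ l * ((1 - real l * (1 / real n)) powr (- \<alpha>) * (real (n - l) powr \<alpha> * ?W (n - l)))
     = real (n choose l) * ?W (n - l) / real n powr ((real l - 1) / (real d + 1))"
    using eventually_gt_at_top[of l]
  proof eventually_elim
    case (elim n)
    have n: "real n > 0" using elim by simp
    have "1 - real l * (1 / real n) = real (n - l) / real n" using elim by (simp add: field_simps of_nat_diff)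
    hence e1: "(1 - real l * (1 / real n)) powr (- \<alpha>) * real (n - l) powr \<alpha> = real n powr \<alpha>"
      using elim n by (simp add: powr_divide powr_minus field_simps)
    have e2: "real n powr \<alpha> / real n ^ l = 1 / real n powr ((real l - 1) / (real d + 1))"
    proof -
      have "real n powr \<alpha> * real n powr ((real l - 1) / (real d + 1)) = real n powr (\<alpha> + (real l - 1) / (real d + 1))"
        by (rule powr_add[symmetric])
      also have "\<alpha> + (real l - 1) / (real d + 1) = real l * (real d + 1) / (real d + 1)"
        unfolding \<alpha>_def add_divide_distrib[symmetric] by (simp add: algebra_simps)
      also have "\<dots> = real l" by simp
      also have "real n powr real l = real n ^ l" using n by (rule powr_realpow)
      finally show ?thesis using n by (simp add: field_simps)
    qed
    have gen: "c / N * (x * (y * V)) = c * V * (x * y / N)" for c N x y V :: real by simp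
    show ?case unfolding gen e1 e2 by simp
  qed
  ultimately show ?thesis by (simp add: tendsto_cong)
qed

lemma facet_number_limit_lower:
  fixes d l :: nat
  assumes "l < d"
  shows "(\<lambda>n. real (n choose l) * (sin_moment d (d * l) (n - l) / wallis d ^ (n - l)) / real n powr ((real d - 1) / (real d + 1))) \<longlonglongrightarrow> 0"
proof -
  let ?f = "\<lambda>n. real (n choose l) * (sin_moment d (d * l) (n - l) / wallis d ^ (n - l))"
  have "(\<lambda>n. real n powr (- ((real d - real l) / (real d + 1)))) \<longlonglongrightarrow> 0"
    using assms by (intro tendsto_neg_powr filterlim_real_sequentially) auto
  from tendsto_mult[OF facet_number_limit[of l d] this]
  have "(\<lambda>n. ?f n / real n powr ((real l - 1) / (real d + 1)) * real n powr (- ((real d - real l) / (real d + 1)))) \<longlonglongrightarrow> 0" by simp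
  moreover have "?f n / real n powr ((real l - 1) / (real d + 1)) * real n powr (- ((real d - real l) / (real d + 1))) = ?f n / real n powr ((real d - 1) / (real d + 1))" for n
  proof -
    have "(real d - 1) / (real d + 1) = (real l - 1) / (real d + 1) + (real d - real l) / (real d + 1)"
      by (simp add: add_divide_distrib[symmetric])
    hence "real n powr ((real d - 1) / (real d + 1)) = real n powr ((real l - 1) / (real d + 1)) * real n powr ((real d - real l) / (real d + 1))"
      by (simp only: powr_add)
    thus ?thesis by (simp add: powr_minus divide_inverse)
  qed
  ultimately show ?thesis by simp
qed

text \<open>The witness \<open>j\<close> is real by construction, while its value is a residue;
  hence the limit is stated over the reals and the value of \<open>j\<close> as a separate complex
  equation.\<close>

lemma expected_faces_limit:
  fixes k :: nat
  defines "d \<equiv> CARD('n::finite)"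
  assumes k: "k < d" and par: "(even d \<and> even (d - k)) \<or> odd d"
  obtains j where "complex_of_real j = res_coeff d (k + 1) d"
    and "(\<lambda>n. expected_faces TYPE(real^'n) k n / real n powr ((real d - 1) / (real d + 1)))
      \<longlonglongrightarrow> real (d choose (k + 1)) * (1 / fact d * (Gamma ((real d * real d + 1) / (real d + 1)) / (real d + 1) * (wallis d * (real d + 1)) powr ((real d * real d + 1) / (real d + 1)))) / wallis (d * d) * j"
proof -
  let ?K = "k + 1"
  obtain A :: "nat \<Rightarrow> 'n set" where A: "\<And>m. m \<le> d \<Longrightarrow> card (A m) = m" "\<And>l m. l \<le> m \<Longrightarrow> A l \<subseteq> A m" "A d = UNIV"
    unfolding d_def using ex_subset_chain by metis
  define j where "j = chain_miss A ?K"
  define L where "L = {l. l \<in> {?K..d} \<and> even (l + d)}"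
  have finL: "finite L" unfolding L_def by simp
  have dL: "d \<in> L" unfolding L_def using k by simp
  have prob: "2 * face_prob (UNIV :: 'n set) F {..<n} = (\<Sum>l\<in>L. real ((n - ?K) choose (l - ?K)) * facet_mass d l (n - l) * j l)"
    if F: "F \<subseteq> {..<n}" "card F = ?K" and n: "?K < n" for F n
  proof -
    have "F \<noteq> {..<n}" using F n by auto
    moreover have "F \<noteq> {}" using F by auto
    ultimately show ?thesis
      using face_prob_chain[of A "{..<n}" F d] A F k unfolding L_def j_def d_def by simp
  qed
  have jres: "complex_of_real (j d) = res_coeff d ?K d"
  proof (rule res_coeff_unique)
    show "odd d \<or> even d \<and> odd ?K" using par k by auto
    show "j ?K = 2" by (simp add: j_def chain_miss_def)
    fix n assume n: "?K < n" "n \<le> d" "even (n + d)"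
    have F: "{..<?K} \<subseteq> {..<n}" using n by auto
    have "face_prob (UNIV :: 'n set) {..<?K} {..<n} = 1"
      using n F unfolding d_def by (intro face_prob_few_points) auto
    with prob[OF F _ n(1)] show "(\<Sum>l | l \<in> {?K..d} \<and> even (l + d). real ((n - ?K) choose (l - ?K)) * facet_mass d l (n - l) * j l) = 2"
      unfolding L_def by simp
  qed (use k in auto)
  let ?f = "\<lambda>l n. real (n choose l) * (sin_moment d (d * l) (n - l) / wallis d ^ (n - l))"
  let ?p = "\<lambda>n. real n powr ((real d - 1) / (real d + 1))"
  let ?c = "\<lambda>l. real (l choose ?K) / wallis (d * l) * j l"
  have gen: "a * (b * (2 * W / (P * V)) * J) = 2 * (e / V * J * (c * (W / P)))" if "a * b = c * e" for a b W P V J e c :: real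
  proof -
    have "a * (b * (2 * W / (P * V)) * J) = a * b * (2 * W / (P * V) * J)" by simp
    also have "\<dots> = c * e * (2 * W / (P * V) * J)" unfolding that ..
    also have "\<dots> = 2 * (e / V * J * (c * (W / P)))" by (simp add: mult_ac)
    finally show ?thesis .
  qed
  have ef: "expected_faces TYPE(real^'n) k n = (\<Sum>l\<in>L. ?c l * ?f l n)" if n: "n > d" for n
  proof -
    have nK: "?K < n" using n k by simp
    have "2 * expected_faces TYPE(real^'n) k n = (\<Sum>F | F \<subseteq> {..<n} \<and> card F = ?K. 2 * face_prob (UNIV :: 'n set) F {..<n})"
      using k unfolding d_def by (simp add: expected_faces_eq_sum sum_distrib_left)
    also have "\<dots> = (\<Sum>F | F \<subseteq> {..<n} \<and> card F = ?K. \<Sum>l\<in>L. real ((n - ?K) choose (l - ?K)) * facet_mass d l (n - l) * j l)"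
      by (rule sum.cong[OF refl]) (use prob nK in auto)
    also have "\<dots> = real (n choose ?K) * (\<Sum>l\<in>L. real ((n - ?K) choose (l - ?K)) * facet_mass d l (n - l) * j l)"
      using n_subsets[of "{..<n}" ?K] by simp
    also have "\<dots> = (\<Sum>l\<in>L. 2 * (?c l * ?f l n))"
      unfolding sum_distrib_left
    proof (rule sum.cong[OF refl])
      fix l assume "l \<in> L"
      hence l: "?K \<le> l" "l \<le> n" using n unfolding L_def by auto
      \<comment> \<open>Choosing a face and then a hyperplane through it amounts to choosing the
        hyperplane and then a face in it.\<close>
      have "real (n choose ?K) * real ((n - ?K) choose (l - ?K)) = real (n choose l) * real (l choose ?K)"
        using choose_mult[OF l] by (metis of_nat_mult)
      thus "real (n choose ?K) * (real ((n - ?K) choose (l - ?K)) * facet_mass d l (n - l) * j l) = 2 * (?c l * ?f l n)"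
        unfolding facet_mass_def by (rule gen)
    qed
    also have "\<dots> = 2 * (\<Sum>l\<in>L. ?c l * ?f l n)" by (rule sum_distrib_left[symmetric])
    finally show ?thesis by (simp only: mult_cancel_left) simp
  qed
  let ?g = "1 / fact d * (Gamma ((real d * real d + 1) / (real d + 1)) / (real d + 1) * (wallis d * (real d + 1)) powr ((real d * real d + 1) / (real d + 1)))"
  have "(\<lambda>n. \<Sum>l\<in>L. ?c l * (?f l n / ?p n)) \<longlonglongrightarrow> (\<Sum>l\<in>L. ?c l * (if l = d then ?g else 0))"
  proof (intro tendsto_sum tendsto_mult tendsto_const)
    fix l assume "l \<in> L"
    hence "l = d \<or> l < d" unfolding L_def by auto
    thus "(\<lambda>n. ?f l n / ?p n) \<longlonglongrightarrow> (if l = d then ?g else 0)"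
      using facet_number_limit[of d d] facet_number_limit_lower[of l d] by auto
  qed
  also have "(\<Sum>l\<in>L. ?c l * (if l = d then ?g else 0)) = ?c d * ?g"
    using finL dL by (simp add: if_distrib[of "\<lambda>x. _ * x"] cong: if_cong)
  finally have "(\<lambda>n. \<Sum>l\<in>L. ?c l * (?f l n / ?p n)) \<longlonglongrightarrow> ?c d * ?g" .
  moreover have "\<forall>\<^sub>F n in sequentially. (\<Sum>l\<in>L. ?c l * (?f l n / ?p n)) = expected_faces TYPE(real^'n) k n / ?p n"
    using eventually_gt_at_top[of d]
  proof eventually_elim
    case (elim n)
    show ?case unfolding ef[OF elim] sum_divide_distrib by (rule sum.cong[OF refl times_divide_eq_right])
  qed
  ultimately have "(\<lambda>n. expected_faces TYPE(real^'n) k n / ?p n) \<longlonglongrightarrow> ?c d * ?g"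
    by (simp only: tendsto_cong)
  moreover have "?c d * ?g = real (d choose ?K) * ?g / wallis (d * d) * j d"
  proof -
    have "x / z * y * v = x * v / z * y" for x y z v :: real by simp
    thus ?thesis .
  qed
  ultimately show thesis using that[OF jres] by (simp only:)
qed

theorem theorem2p8:
  fixes k :: nat
  defines "d \<equiv> CARD('n::finite)"
  assumes "k < d"
    and "(even d \<and> even (d - k)) \<or> odd d"
  shows "\<exists>C. ((\<lambda>n. expected_faces TYPE(real^'n) k n / real n powr ((real d - 1) / (real d + 1)))
                \<longlonglongrightarrow> C)
           \<and> complex_of_real C =
             complex_of_real ((real d ^ 2 + 1) / fact d
               * (real d + 1) powr ((real d ^ 2 - real d) / (real d + 1))
               * real (d choose (k + 1))
               * Gamma ((real d ^ 2 + 1) / (real d + 1))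
               * (sqrt pi * Gamma ((real d + 1) / 2) / Gamma ((real d + 2) / 2))
                   powr (real k + 2 / (real d + 1)))
             * residue (res_fun d k) 0"
proof -
  define w where "w = wallis d"
  have w: "w > 0" unfolding w_def by (rule wallis_pos)
  have wG: "sqrt pi * Gamma ((real d + 1) / 2) / Gamma ((real d + 2) / 2) = w"
    unfolding w_def using assms(2) by (intro wallis_Gamma[symmetric]) simp
  define \<alpha> where "\<alpha> = (real d * real d + 1) / (real d + 1)"
  obtain j where j0: "complex_of_real j = res_coeff CARD('n) (k + 1) CARD('n)"
    and lim0: "(\<lambda>n. expected_faces TYPE(real^'n) k n / real n powr ((real CARD('n) - 1) / (real CARD('n) + 1)))
      \<longlonglongrightarrow> real (CARD('n) choose (k + 1)) * (1 / fact CARD('n) * (Gamma ((real CARD('n) * real CARD('n) + 1) / (real CARD('n) + 1)) / (real CARD('n) + 1)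
        * (wallis CARD('n) * (real CARD('n) + 1)) powr ((real CARD('n) * real CARD('n) + 1) / (real CARD('n) + 1)))) / wallis (CARD('n) * CARD('n)) * j"
    by (rule expected_faces_limit[where 'n = 'n, OF assms(2,3)[unfolded d_def]])
  note j = j0[folded d_def] and lim = lim0[folded d_def, folded w_def \<alpha>_def]
  have res: "sin_residue d (d - (k + 1)) (d * d + 2) = residue (res_fun d k) 0"
    unfolding sin_residue_def res_fun_def[abs_def] csin_int_def by (simp add: power2_eq_square)
  \<comment> \<open>The factor \<open>wallis (d * d)\<close> will cancel the normalisation of the
    height contained in \<open>facet_mass\<close>.\<close>
  define r where "r = (real d * real d + 1) * wallis (d * d) / w ^ (d - (k + 1))"
  have jr: "complex_of_real j = of_real r * residue (res_fun d k) 0"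
    unfolding j res_coeff_def res r_def w_def ..
  have "real (d choose (k + 1)) * (1 / fact d * (Gamma \<alpha> / (real d + 1) * (w * (real d + 1)) powr \<alpha>)) / wallis (d * d) * r
    = (real d ^ 2 + 1) / fact d * (real d + 1) powr ((real d ^ 2 - real d) / (real d + 1)) * real (d choose (k + 1))
      * Gamma \<alpha> * w powr (real k + 2 / (real d + 1))"
  proof -
    have e1: "(w * (real d + 1)) powr \<alpha> = w powr \<alpha> * (real d + 1) powr \<alpha>" using w by (simp add: powr_mult)
    have e2: "(real d + 1) powr \<alpha> / (real d + 1) = (real d + 1) powr ((real d ^ 2 - real d) / (real d + 1))"
    proof -
      have "(real d ^ 2 - real d) / (real d + 1) = \<alpha> - 1" unfolding \<alpha>_def by (simp add: field_simps power2_eq_square)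
      thus ?thesis by (simp add: powr_diff)
    qed
    \<comment> \<open>Laplace's method contributes \<open>w powr \<alpha>\<close> and
      \<open>res_coeff\<close> divides by \<open>w ^ (d - (k + 1))\<close>; since
      \<open>\<alpha> = d - 1 + 2 / (d + 1)\<close>, the stated exponent remains.\<close>
    have e3: "w powr \<alpha> / w ^ (d - (k + 1)) = w powr (real k + 2 / (real d + 1))"
    proof -
      have "real k + 2 / (real d + 1) = \<alpha> - real (d - (k + 1))"
        unfolding \<alpha>_def using assms(2) by (simp add: field_simps of_nat_diff)
      thus ?thesis using w by (simp add: powr_diff powr_realpow)
    qed
    have v: "wallis (d * d) \<noteq> 0" using wallis_pos[of "d * d"] by simp
    have gen: "b * (1 / f * (G / D * (P * Q))) / v * (E * v / W) = E / f * (Q / D) * b * G * (P / W)" if "v \<noteq> 0" for b f G D P Q v E W :: real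
      using that by simp
    show ?thesis unfolding r_def power2_eq_square e1 gen[OF v] e2[unfolded power2_eq_square] e3 ..
  qed
  note const = this
  let ?c = "real (d choose (k + 1)) * (1 / fact d * (Gamma \<alpha> / (real d + 1) * (w * (real d + 1)) powr \<alpha>)) / wallis (d * d)"
  have "complex_of_real (?c * j) = complex_of_real (?c * r) * residue (res_fun d k) 0"
    unfolding of_real_mult[of ?c] jr by (simp only: mult.assoc)
  hence "complex_of_real (?c * j) = complex_of_real ((real d ^ 2 + 1) / fact d * (real d + 1) powr ((real d ^ 2 - real d) / (real d + 1)) * real (d choose (k + 1))
      * Gamma ((real d ^ 2 + 1) / (real d + 1)) * (sqrt pi * Gamma ((real d + 1) / 2) / Gamma ((real d + 2) / 2)) powr (real k + 2 / (real d + 1))) * residue (res_fun d k) 0"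
    unfolding const wG by (simp only: \<alpha>_def power2_eq_square)
  thus ?thesis using lim by blast
qed

end
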